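(* Let $K$ be the extended sine operator associated with finite unions of intervals $X_1,\dots,X_m$, and let $r,q,\tilde q,p,\tilde p,r_x,r_y$ be the associated matrix functions of the end-points $\xi_{kw}$ (all defined in the context). Then $$\frac{\partial}{\partial\xi_{kw}}\log\det(I-K)=(-1)^{w+1}R_{kk}(\xi_{kw},\xi_{kw})=(-1)^{w+1}r_{kw,kw},$$ and the following system of partial differential equations holds: \begin{align*} dr&=-r\,d\xi\,r+\widehat d\xi\,r_x+r_y\,\widehat d\xi,\\ dq&=\widehat d\xi\,(p+r\,s\,q)-r\,d\xi\,q,\\ d\tilde q&=(\tilde p+\tilde q\,s\,r)\,\widehat d\xi-\tilde q\,d\xi\,r,\\ dp&=\widehat d\xi\,(-q+r\,s\,p)-r\,d\xi\,p,\\ d\tilde p&=(-\tilde q+\tilde p\,s\,r)\,\widehat d\xi-\tilde p\,d\xi\,r . \end{align*} Moreover the right-hand sides involve $r_x$ and $r_y$ only through the diagonal entries of $r_x+r_y$ and the off-diagonal entries of $r_x$ and of $r_y$, and all of these are expressible algebraically in terms of the entries of $r,q,\tilde q,p,\tilde p$ and the end-points $\xi_{kw}$. Thus the system is a closed system of PDEs in the unknowns $r,q,\tilde q,p,\tilde p$ whose solution determines $\det(I-K)$.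
   Context: Fix $m\ge1$ and $\tau_1<\dots<\tau_m$. The extended sine kernel is the $m\times m$ matrix kernel $L=(L_{ij})$ with $$L_{ij}(x,y)=\int_0^1 e^{z^2(\tau_i-\tau_j)}\cos z(x-y)\,dz\ (i\ge j),\qquad L_{ij}(x,y)=-\int_1^\infty e^{z^2(\tau_i-\tau_j)}\cos z(x-y)\,dz\ (i<j).$$ Each $X_k$ is a finite union of disjoint bounded intervals $X_k=(\xi_{k1},\xi_{k2})\cup(\xi_{k3},\xi_{k4})\cup\cdots$ with $\xi_{k1}<\xi_{k2}<\cdots$; the end-points $\xi_{kw}$ are the independent variables. $K$ is the operator with matrix kernel $K_{ij}(x,y)=L_{ij}(x,y)\chi_{X_j}(y)$, $I-K$ is assumed invertible, $\rho=(I-K)^{-1}$, and $R=K(I-K)^{-1}$ has matrix kernel $(R_{ij}(x,y))$; $R_x,R_y$ are the (classical) partial derivatives. Operators are identified with their kernels. Let $\varphi(x)=\sin x$, $\psi(x)=\cos x$, and $$Q_{ij}=\rho_{ij}\varphi,\quad P_{ij}=\rho_{ij}\psi,\quad \tilde Q_{ij}(x)=\int\varphi(y)\chi_{X_i}(y)\rho_{ij}(y,x)\,dy,\quad \tilde P_{ij}(x)=\int\psi(y)\chi_{X_i}(y)\rho_{ij}(y,x)\,dy.$$ Indices $iu$, $jv$, $kw$ run over the end-points. Define (at points of discontinuity always taking limits from inside the $X_k$) $$r_{iu,jv}=R_{ij}(\xi_{iu},\xi_{jv}),\quad r_{x,iu,jv}=R_{x,ij}(\xi_{iu},\xi_{jv}),\quad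 r_{y,iu,jv}=R_{y,ij}(\xi_{iu},\xi_{jv}),$$ $$q_{iu,j}=Q_{ij}(\xi_{iu}),\quad \tilde q_{i,jv}=\tilde Q_{ij}(\xi_{jv}),\quad p_{iu,j}=P_{ij}(\xi_{iu}),\quad \tilde p_{i,jv}=\tilde P_{ij}(\xi_{jv}).$$ Further, $s=\mathrm{diag}((-1)^{w+1})$, $\widehat d\xi=\mathrm{diag}(d\xi_{kw})$ and $d\xi=\mathrm{diag}((-1)^{w+1}d\xi_{kw})=s\,\widehat d\xi$, all indexed by end-points. On the left sides $d$ is the total differential with respect to all the $\xi_{kw}$. "Expressible algebraically in terms of" given quantities means equal to a rational function of them, with denominator not identically zero and coefficients depending only on the $\tau_k$. *)

theory Defs
  imports "HOL-Analysis.Analysis"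
begin

text \<open>
  Blocks \<open>i, j, k\<close> range over a finite linearly ordered type \<open>'m\<close> (so \<open>m = CARD('m) \<ge> 1\<close>).
  End-points are indexed by a finite type \<open>'e\<close>, and \<open>ix e = (k, w)\<close> says that \<open>e\<close> is the
  \<open>w\<close>-th end-point (counted from 1) of block \<open>k\<close>. A configuration is a vector \<open>\<xi> :: real^'e\<close>,
  the end-point \<open>\<xi>\<^sub>k\<^sub>w\<close> being \<open>\<xi> $ e\<close>.
\<close>

definition endpoint_indexing :: "('m::finite \<Rightarrow> nat) \<Rightarrow> ('e::finite \<Rightarrow> 'm \<times> nat) \<Rightarrow> bool" where
  "endpoint_indexing n ix \<longleftrightarrow> bij_betw ix UNIV (SIGMA k:UNIV. {1..2 * n k})"

definition ordered_endpoints :: "('e::finite \<Rightarrow> 'm::finite \<times> nat) \<Rightarrow> real^'e \<Rightarrow> bool" where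
  "ordered_endpoints ix \<xi> \<longleftrightarrow>
     (\<forall>e e'. fst (ix e) = fst (ix e') \<and> snd (ix e) < snd (ix e') \<longrightarrow> \<xi> $ e < \<xi> $ e')"

definition intervals :: "('e::finite \<Rightarrow> 'm::finite \<times> nat) \<Rightarrow> real^'e \<Rightarrow> 'm \<Rightarrow> real set" where
  "intervals ix \<xi> k =
     \<Union> {{\<xi> $ e <..< \<xi> $ e'} | e e' w. odd w \<and> ix e = (k, w) \<and> ix e' = (k, w + 1)}"

definition sine_L :: "('m::{finite,linorder} \<Rightarrow> real) \<Rightarrow> 'm \<Rightarrow> 'm \<Rightarrow> real \<Rightarrow> real \<Rightarrow> real" where
  "sine_L \<tau> i j x y =
     (if i \<ge> j then (LBINT z:{0..1}. exp (z\<^sup>2 * (\<tau> i - \<tau> j)) * cos (z * (x - y)))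
      else - (LBINT z:{1..}. exp (z\<^sup>2 * (\<tau> i - \<tau> j)) * cos (z * (x - y))))"

definition sine_K ::
  "('m::{finite,linorder} \<Rightarrow> real) \<Rightarrow> ('m \<Rightarrow> real set) \<Rightarrow> 'm \<Rightarrow> 'm \<Rightarrow> real \<Rightarrow> real \<Rightarrow> real" where
  "sine_K \<tau> X i j x y = sine_L \<tau> i j x y * indicator (X j) y"

text \<open>
  Operators act on the Banach space of bounded continuous functions from \<open>\<real>\<close> to \<open>\<real>\<^sup>m\<close>, which
  contains \<open>sin\<close> and \<open>cos\<close>; the operator with matrix kernel \<open>k\<close> sends \<open>f\<close> to
  \<open>(\<Sum>\<^sub>j \<integral> k\<^sub>i\<^sub>j(x,y) f\<^sub>j(y) dy)\<^sub>i\<close>.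
\<close>

type_synonym 'm bc_space = "real \<Rightarrow>\<^sub>C (real^'m)"

definition kernel_operator ::
  "('m::finite \<Rightarrow> 'm \<Rightarrow> real \<Rightarrow> real \<Rightarrow> real) \<Rightarrow> 'm bc_space \<Rightarrow>\<^sub>L 'm bc_space" where
  "kernel_operator k =
     Blinfun (\<lambda>f. Bcontfun (\<lambda>x. \<chi> i. \<Sum>j\<in>UNIV. LBINT y. k i j x y * apply_bcontfun f y $ j))"

definition is_inverse_operator ::
  "('a::real_normed_vector \<Rightarrow>\<^sub>L 'a) \<Rightarrow> ('a \<Rightarrow>\<^sub>L 'a) \<Rightarrow> bool" where
  "is_inverse_operator T S \<longleftrightarrow> T o\<^sub>L S = id_blinfun \<and> S o\<^sub>L T = id_blinfun"

definition invertible_operator :: "('a::real_normed_vector \<Rightarrow>\<^sub>L 'a) \<Rightarrow> bool" where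
  "invertible_operator T \<longleftrightarrow> (\<exists>S. is_inverse_operator T S)"

definition inverse_operator :: "('a::real_normed_vector \<Rightarrow>\<^sub>L 'a) \<Rightarrow> ('a \<Rightarrow>\<^sub>L 'a)" where
  "inverse_operator T = (THE S. is_inverse_operator T S)"

definition operator_entry ::
  "('m::finite bc_space \<Rightarrow>\<^sub>L 'm bc_space) \<Rightarrow> 'm \<Rightarrow> 'm \<Rightarrow> (real \<Rightarrow> real) \<Rightarrow> real \<Rightarrow> real" where
  "operator_entry T i j f x =
     apply_bcontfun (blinfun_apply T (Bcontfun (\<lambda>y. axis j (f y)))) x $ i"

definition has_matrix_kernel ::
  "('m::finite bc_space \<Rightarrow>\<^sub>L 'm bc_space) \<Rightarrow> ('m \<Rightarrow> 'm \<Rightarrow> real \<Rightarrow> real \<Rightarrow> real) \<Rightarrow> bool" where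
  "has_matrix_kernel T k \<longleftrightarrow>
     (\<forall>i j x. integrable lborel (k i j x)) \<and>
     (\<forall>f i x. apply_bcontfun (blinfun_apply T f) x $ i =
        (\<Sum>j\<in>UNIV. LBINT y. k i j x y * apply_bcontfun f y $ j))"

definition sine_op ::
  "('m::{finite,linorder} \<Rightarrow> real) \<Rightarrow> ('m \<Rightarrow> real set) \<Rightarrow> 'm bc_space \<Rightarrow>\<^sub>L 'm bc_space" where
  "sine_op \<tau> X = kernel_operator (sine_K \<tau> X)"

definition sine_rho ::
  "('m::{finite,linorder} \<Rightarrow> real) \<Rightarrow> ('m \<Rightarrow> real set) \<Rightarrow> 'm bc_space \<Rightarrow>\<^sub>L 'm bc_space" where
  "sine_rho \<tau> X = inverse_operator (id_blinfun - sine_op \<tau> X)"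

text \<open>
  The kernel of \<open>K (I - K)\<^sup>-\<^sup>1\<close> is determined only up to null sets in \<open>y\<close>; the continuity condition
  on the open sets \<open>X\<^sub>j\<close>, together with vanishing outside them, singles out one kernel.
\<close>

definition sine_R ::
  "('m::{finite,linorder} \<Rightarrow> real) \<Rightarrow> ('m \<Rightarrow> real set) \<Rightarrow> 'm \<Rightarrow> 'm \<Rightarrow> real \<Rightarrow> real \<Rightarrow> real" where
  "sine_R \<tau> X = (THE R. has_matrix_kernel (sine_op \<tau> X o\<^sub>L sine_rho \<tau> X) R \<and>
     (\<forall>i j x. continuous_on (X j) (R i j x) \<and> (\<forall>y. y \<notin> X j \<longrightarrow> R i j x y = 0)))"

text \<open>
  \<open>\<integral> f(y) \<chi>\<^sub>X\<^sub>i(y) \<rho>\<^sub>i\<^sub>j(y,x) dy\<close>, where \<open>\<rho> = I + R\<close>, so that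
  \<open>\<rho>\<^sub>i\<^sub>j(y,x) = \<delta>\<^sub>i\<^sub>j \<delta>(y - x) + R\<^sub>i\<^sub>j(y,x)\<close> as a distributional kernel.
\<close>

definition rho_left ::
  "('m::{finite,linorder} \<Rightarrow> real) \<Rightarrow> ('m \<Rightarrow> real set) \<Rightarrow> (real \<Rightarrow> real) \<Rightarrow> 'm \<Rightarrow> 'm \<Rightarrow> real \<Rightarrow> real" where
  "rho_left \<tau> X f i j x =
     (if i = j then f x * indicator (X i) x else 0) +
     (LBINT y. f y * indicator (X i) y * sine_R \<tau> X i j y x)"

text \<open>
  The Fredholm determinant of \<open>I - k\<close> by Fredholm's series, a matrix kernel being regarded as a
  scalar kernel on \<open>'m \<times> \<real>\<close> with counting measure times Lebesgue measure. The sum over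
  permutations is the determinant of the \<open>N \<times> N\<close> matrix \<open>k(z\<^sub>a, z\<^sub>b)\<close>.
\<close>

definition fredholm_det :: "('m::finite \<Rightarrow> 'm \<Rightarrow> real \<Rightarrow> real \<Rightarrow> real) \<Rightarrow> real" where
  "fredholm_det k =
     (\<Sum>N. (-1) ^ N / fact N *
        (LINT z|(\<Pi>\<^sub>M a\<in>{..<N}. count_space UNIV \<Otimes>\<^sub>M lborel).
           (\<Sum>p | p permutes {..<N}. of_int (sign p) *
             (\<Prod>a<N. k (fst (z a)) (fst (z (p a))) (snd (z a)) (snd (z (p a)))))))"

definition admissible ::
  "('m::{finite,linorder} \<Rightarrow> real) \<Rightarrow> ('e::finite \<Rightarrow> 'm \<times> nat) \<Rightarrow> (real^'e) set" where
  "admissible \<tau> ix = {\<xi>. ordered_endpoints ix \<xi> \<and>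
     invertible_operator (id_blinfun - sine_op \<tau> (intervals ix \<xi>))}"

definition sine_det ::
  "('m::{finite,linorder} \<Rightarrow> real) \<Rightarrow> ('e::finite \<Rightarrow> 'm \<times> nat) \<Rightarrow> real^'e \<Rightarrow> real" where
  "sine_det \<tau> ix \<xi> = fredholm_det (sine_K \<tau> (intervals ix \<xi>))"

text \<open>Value at \<open>(\<xi>\<^sub>i\<^sub>u, \<xi>\<^sub>j\<^sub>v)\<close> of a matrix of functions of \<open>(x,y)\<close>, as the limit from inside \<open>X\<^sub>i \<times> X\<^sub>j\<close>.\<close>

definition endpoint_matrix ::
  "('e::finite \<Rightarrow> 'm::finite \<times> nat) \<Rightarrow> real^'e \<Rightarrow> ('m \<Rightarrow> 'm \<Rightarrow> real \<Rightarrow> real \<Rightarrow> real) \<Rightarrow> real^'e^'e" where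
  "endpoint_matrix ix \<xi> F = (\<chi> e e'.
     Lim (at (\<xi> $ e, \<xi> $ e') within intervals ix \<xi> (fst (ix e)) \<times> intervals ix \<xi> (fst (ix e')))
       (\<lambda>(x, y). F (fst (ix e)) (fst (ix e')) x y))"

definition mat_r ::
  "('m::{finite,linorder} \<Rightarrow> real) \<Rightarrow> ('e::finite \<Rightarrow> 'm \<times> nat) \<Rightarrow> real^'e \<Rightarrow> real^'e^'e" where
  "mat_r \<tau> ix \<xi> = endpoint_matrix ix \<xi> (sine_R \<tau> (intervals ix \<xi>))"

definition mat_rx ::
  "('m::{finite,linorder} \<Rightarrow> real) \<Rightarrow> ('e::finite \<Rightarrow> 'm \<times> nat) \<Rightarrow> real^'e \<Rightarrow> real^'e^'e" where
  "mat_rx \<tau> ix \<xi> = endpoint_matrix ix \<xi>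
     (\<lambda>i j x y. deriv (\<lambda>t. sine_R \<tau> (intervals ix \<xi>) i j t y) x)"

definition mat_ry ::
  "('m::{finite,linorder} \<Rightarrow> real) \<Rightarrow> ('e::finite \<Rightarrow> 'm \<times> nat) \<Rightarrow> real^'e \<Rightarrow> real^'e^'e" where
  "mat_ry \<tau> ix \<xi> = endpoint_matrix ix \<xi>
     (\<lambda>i j x y. deriv (\<lambda>t. sine_R \<tau> (intervals ix \<xi>) i j x t) y)"

text \<open>
  With \<open>f = sin\<close> these two matrices are \<open>q\<close> and \<open>q\<close>-tilde, with \<open>f = cos\<close> they are \<open>p\<close> and
  \<open>p\<close>-tilde. The functions \<open>\<rho>\<^sub>i\<^sub>j f\<close> are continuous on \<open>\<real>\<close>, so no limit is needed in the first.
\<close>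

definition mat_right ::
  "(real \<Rightarrow> real) \<Rightarrow> ('m::{finite,linorder} \<Rightarrow> real) \<Rightarrow> ('e::finite \<Rightarrow> 'm \<times> nat) \<Rightarrow> real^'e \<Rightarrow> real^'m::{finite,linorder}^'e"
  where
  "mat_right f \<tau> ix \<xi> =
     (\<chi> e j. operator_entry (sine_rho \<tau> (intervals ix \<xi>)) (fst (ix e)) j f (\<xi> $ e))"

definition mat_left ::
  "(real \<Rightarrow> real) \<Rightarrow> ('m::{finite,linorder} \<Rightarrow> real) \<Rightarrow> ('e::finite \<Rightarrow> 'm \<times> nat) \<Rightarrow> real^'e \<Rightarrow> real^'e^'m::{finite,linorder}"
  where
  "mat_left f \<tau> ix \<xi> =
     (\<chi> i e. Lim (at (\<xi> $ e) within intervals ix \<xi> (fst (ix e)))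
               (rho_left \<tau> (intervals ix \<xi>) f i (fst (ix e))))"

abbreviation "mat_q \<equiv> mat_right sin"
abbreviation "mat_p \<equiv> mat_right cos"
abbreviation "mat_qt \<equiv> mat_left sin"
abbreviation "mat_pt \<equiv> mat_left cos"

definition diag_mat :: "real^'e \<Rightarrow> real^'e^'e" where
  "diag_mat v = (\<chi> a b. if a = b then v $ a else 0)"

definition endpoint_sign :: "('e::finite \<Rightarrow> 'm::finite \<times> nat) \<Rightarrow> 'e \<Rightarrow> real" where
  "endpoint_sign ix e = (-1) ^ (snd (ix e) + 1)"

definition sign_mat :: "('e::finite \<Rightarrow> 'm::finite \<times> nat) \<Rightarrow> real^'e^'e" where
  "sign_mat ix = diag_mat (\<chi> e. endpoint_sign ix e)"

text \<open>
  Differentials are linear functions of the increment \<open>h\<close> of \<open>\<xi>\<close>: \<open>d\<xi>\<close>-hat is \<open>diag_mat h\<close> and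
  \<open>d\<xi>\<close> is \<open>signed_diff ix h\<close>.
\<close>

definition signed_diff :: "('e::finite \<Rightarrow> 'm::finite \<times> nat) \<Rightarrow> real^'e \<Rightarrow> real^'e^'e" where
  "signed_diff ix h = sign_mat ix ** diag_mat h"

definition dr_rhs ::
  "('e::finite \<Rightarrow> 'm::finite \<times> nat) \<Rightarrow> real^'e^'e \<Rightarrow> real^'e^'e \<Rightarrow> real^'e^'e \<Rightarrow> real^'e \<Rightarrow> real^'e^'e" where
  "dr_rhs ix r rx ry h =
     - (r ** signed_diff ix h ** r) + diag_mat h ** rx + ry ** diag_mat h"

type_synonym ('m, 'e) sine_vars =
  "(real^'e^'e) \<times> (real^'m^'e) \<times> (real^'e^'m) \<times> (real^'m^'e) \<times> (real^'e^'m) \<times> (real^'e)"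

definition sine_data ::
  "('m::{finite,linorder} \<Rightarrow> real) \<Rightarrow> ('e::finite \<Rightarrow> 'm \<times> nat) \<Rightarrow> real^'e \<Rightarrow> ('m, 'e) sine_vars" where
  "sine_data \<tau> ix \<xi> =
     (mat_r \<tau> ix \<xi>, mat_q \<tau> ix \<xi>, mat_qt \<tau> ix \<xi>, mat_p \<tau> ix \<xi>, mat_pt \<tau> ix \<xi>, \<xi>)"

text \<open>
  A rational function whose denominator vanishes nowhere on \<open>V\<close>. Requiring only a nonzero
  polynomial as denominator would be vacuous when the points of \<open>V\<close> satisfy algebraic relations.
\<close>

definition rational_on :: "'v::real_normed_vector set \<Rightarrow> ('v \<Rightarrow> real) \<Rightarrow> bool" where
  "rational_on V F \<longleftrightarrow> (\<exists>N D. real_polynomial_function N \<and> real_polynomial_function D \<and>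
     (\<exists>v. D v \<noteq> 0) \<and> (\<forall>v\<in>V. D v \<noteq> 0 \<and> F v = N v / D v))"

definition algebraic_in ::
  "('a \<Rightarrow> 'v::real_normed_vector) \<Rightarrow> 'a set \<Rightarrow> ('a \<Rightarrow> real) \<Rightarrow> bool" where
  "algebraic_in vars S g \<longleftrightarrow> (\<exists>F. rational_on (vars ` S) F \<and> (\<forall>\<xi>\<in>S. g \<xi> = F (vars \<xi>)))"

end

theory Submission
  imports Defs "HOL-Complex_Analysis.Complex_Analysis" "Jordan_Normal_Form.Determinant"
begin

text \<open>
  On bounded continuous functions the integrals over the \<open>X\<^sub>k\<close> are alternating sums of antiderivatives
  at the end-points. Hence \<open>K\<close> depends smoothly on \<open>\<xi>\<close>, also for unordered end-points, with rank one
  partial derivatives whose ranges are spanned by the columns of the kernel, and the formula for the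
  derivative of \<open>(I - K)\<^sup>-\<^sup>1\<close> gives the differential equations. Integration by parts shows that the commutator of \<open>R\<close>
  with differentiation is a sum of products of values of \<open>R\<close>; this is \<open>R\<^sub>x + R\<^sub>y\<close>. The functions
  \<open>L\<^sub>i\<^sub>j(x,y) = l\<^sub>i\<^sub>j(x - y)\<close> satisfy \<open>2 (\<tau>\<^sub>i - \<tau>\<^sub>j) l' = x l - exp (\<tau>\<^sub>i - \<tau>\<^sub>j) sin x\<close>, so the commutator of \<open>R\<close> with
  \<open>x - 2 \<tau> d/dx\<close> is also of finite rank. This yields a second linear relation between \<open>R\<^sub>x\<close> and \<open>R\<^sub>y\<close>,
  independent of the first one off the diagonal blocks; inside a diagonal block it gives
  \<open>(x - y) R\<close>, which can be differentiated.

  The determinant is treated through Fredholm's series. Hadamard's inequality makes it analytic in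
  the weight, its first variation is Fredholm's first minor, and the latter is the determinant times
  the resolvent kernel.
\<close>

text \<open>On bounded continuous functions the partial derivatives of \<open>K\<close> contain the
  evaluation f(xi_e), and no difference quotient approximates an evaluation uniformly on the unit
  ball. So \<open>K\<close> is norm continuous in xi but differentiable only on each fixed function.
  The derivative of the resolvent is therefore taken from the identity rho(eta) G(eta) - f =
  rho(eta) (Psi(eta) - Psi(xi)), where f = rho(xi) G(xi) and Psi(eta) = K(eta) f + G(eta): only K on
  the fixed f is differentiated, and continuity of rho suffices. The determinant meets the same
  obstacle: the indicator of X is Lipschitz but not differentiable in xi as an element of L1. Its
  first-order effect is computed exactly, as a difference of antiderivatives, and the remainder is
  quadratic in the L1 distance. Multiplication by x leads out of the space; it is replaced by a
  truncation that agrees with it on X, the only place where \<open>K\<close> looks at its argument.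
  The resolvent kernel is handled without the factor chi_X(y), as rho applied to the columns of the
  kernel. This version is continuous on the whole plane, so limits from inside X become plain
  values.\<close>

no_notation vec_index (infixl "$" 100)
no_notation fps_nth (infixl "$" 75)

hide_const (open) Matrix.diag_mat
hide_fact (open) Matrix.diag_mat_def

instance bcontfun :: (metric_space, banach) banach ..

section \<open>Hadamard's inequality and the summability that it yields\<close>

lemma det_mat_eq_sum_permutations:
  "Determinant.det (Matrix.mat n n (\<lambda>(i, j). a i j)) =
     (\<Sum>p | p permutes {..<n}. of_int (sign p) * (\<Prod>i<n. a i (p i)))"
  for a :: "nat \<Rightarrow> nat \<Rightarrow> real"
proof -
  have "Determinant.det (Matrix.mat n n (\<lambda>(i, j). a i j)) =
     (\<Sum>p | p permutes {0..<n}. of_int (sign p) * (\<Prod>i=0..<n. (Matrix.mat n n (\<lambda>(i, j). a i j)) $$ (i, p i)))"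
    by (subst Determinant.det_def'[where n=n]) (auto)
  also have "\<dots> = (\<Sum>p | p permutes {0..<n}. of_int (sign p) * (\<Prod>i=0..<n. a i (p i)))"
    by (intro sum.cong refl arg_cong2[where f="(*)"] prod.cong) (auto dest: permutes_in_image)
  finally show ?thesis by (simp add: atLeast0LessThan)
qed

text \<open>
  A Householder reflection turns the first row into a multiple of the first basis vector without
  changing the row norms; Laplace expansion along that row then reduces the size.
\<close>

lemma hadamard_inequality_rows:
  fixes a :: "nat \<Rightarrow> nat \<Rightarrow> real"
  shows "(Determinant.det (Matrix.mat n n (\<lambda>(i, j). a i j)))\<^sup>2 \<le> (\<Prod>i<n. \<Sum>j<n. (a i j)\<^sup>2)"
proof (induction n arbitrary: a)
  case 0
  then show ?case by (simp add: Determinant.det_def)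
next
  case (Suc n)
  let ?m = "\<lambda>b. Matrix.mat (Suc n) (Suc n) (\<lambda>(i, j). b i j :: real)"
  let ?I = "{..<Suc n}"
  have expand: "Determinant.det (?m b) = b 0 0 * Determinant.det (Matrix.mat n n (\<lambda>(i, j). b (Suc i) (Suc j)))"
    if "\<And>j. 0 < j \<Longrightarrow> j < Suc n \<Longrightarrow> b 0 j = 0" for b
  proof -
    have "Determinant.det (?m b) = (\<Sum>j<Suc n. ?m b $$ (0, j) * cofactor (?m b) 0 j)"
      by (rule laplace_expansion_row) auto
    also have "\<dots> = (\<Sum>j\<in>{0}. ?m b $$ (0, j) * cofactor (?m b) 0 j)"
      by (intro sum.mono_neutral_right) (auto simp: that)
    also have "\<dots> = b 0 0 * Determinant.det (mat_delete (?m b) 0 0)"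
      by (simp add: cofactor_def)
    also have "mat_delete (?m b) 0 0 = Matrix.mat n n (\<lambda>(i, j). b (Suc i) (Suc j))"
      by (rule eq_matI) (auto simp: mat_delete_def)
    finally show ?thesis .
  qed
  have step: "(Determinant.det (?m b))\<^sup>2 \<le> (\<Prod>i<Suc n. \<Sum>j<Suc n. (b i j)\<^sup>2)"
    if "\<And>j. 0 < j \<Longrightarrow> j < Suc n \<Longrightarrow> b 0 j = 0" for b
  proof -
    have "(Determinant.det (?m b))\<^sup>2 = (b 0 0)\<^sup>2 * (Determinant.det (Matrix.mat n n (\<lambda>(i, j). b (Suc i) (Suc j))))\<^sup>2"
      by (simp add: expand[of b, OF that] power_mult_distrib)
    also have "\<dots> \<le> (\<Sum>j<Suc n. (b 0 j)\<^sup>2) * (\<Prod>i<n. \<Sum>j<Suc n. (b (Suc i) j)\<^sup>2)"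
    proof (rule mult_mono)
      show "(b 0 0)\<^sup>2 \<le> (\<Sum>j<Suc n. (b 0 j)\<^sup>2)"
        by (rule member_le_sum) auto
      have "(Determinant.det (Matrix.mat n n (\<lambda>(i, j). b (Suc i) (Suc j))))\<^sup>2 \<le> (\<Prod>i<n. \<Sum>j<n. (b (Suc i) (Suc j))\<^sup>2)"
        by (rule Suc.IH)
      also have "\<dots> \<le> (\<Prod>i<n. \<Sum>j<Suc n. (b (Suc i) j)\<^sup>2)"
        by (intro prod_mono conjI sum_nonneg) (auto simp only: sum.lessThan_Suc_shift, auto)
      finally show "(Determinant.det (Matrix.mat n n (\<lambda>(i, j). b (Suc i) (Suc j))))\<^sup>2 \<le> \<dots>" .
    qed (auto intro: sum_nonneg prod_nonneg simp del: sum.lessThan_Suc)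
    also have "\<dots> = (\<Prod>i<Suc n. \<Sum>j<Suc n. (b i j)\<^sup>2)"
      by (simp only: prod.lessThan_Suc_shift)
    finally show ?thesis .
  qed
  define \<alpha> where "\<alpha> = (\<Sum>j<Suc n. (a 0 j)\<^sup>2)"
  have \<alpha>_nonneg: "\<alpha> \<ge> 0" unfolding \<alpha>_def by (intro sum_nonneg) auto
  show ?case
  proof (cases "\<alpha> = 0")
    case True
    then have "a 0 j = 0" if "j < Suc n" for j
      unfolding \<alpha>_def using that by (subst (asm) sum_nonneg_eq_0_iff) auto
    then show ?thesis by (intro step) auto
  next
    case False
    with \<alpha>_nonneg have \<alpha>: "\<alpha> > 0" by simp
    \<comment> \<open>The sign of \<beta> is that of \<open>a 0 0\<close>, so that |u|^2 = 2
      (\<alpha> + \<beta> a_00) is at least 2 \<alpha> > 0 and the division by \<open>s\<close> is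
      safe.\<close>
    define \<beta> where "\<beta> = (if a 0 0 \<ge> 0 then sqrt \<alpha> else - sqrt \<alpha>)"
    have \<beta>2: "\<beta> * \<beta> = \<alpha>" using \<alpha> by (simp add: \<beta>_def)
    define u where "u j = a 0 j + (if j = 0 then \<beta> else 0)" for j :: nat
    define s where "s = (\<Sum>j<Suc n. u j * u j)"
    have au: "(\<Sum>j<Suc n. a 0 j * u j) = \<alpha> + \<beta> * a 0 0"
      by (simp add: u_def \<alpha>_def distrib_left sum.distrib power2_eq_square if_distrib[where f="\<lambda>x. _ * x"] 
          sum.delta cong: if_cong del: sum.lessThan_Suc)
    have s: "s = 2 * (\<alpha> + \<beta> * a 0 0)"
    proof -
      have "s = (\<Sum>j<Suc n. a 0 j * u j) + (\<Sum>j<Suc n. (if j = 0 then \<beta> * u j else 0))"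
        unfolding s_def sum.distrib[symmetric] by (intro sum.cong) (auto simp: u_def algebra_simps)
      also have "(\<Sum>j<Suc n. (if j = 0 then \<beta> * u j else 0)) = \<beta> * u 0"
        by (subst sum.delta) auto
      finally show ?thesis using au by (simp add: u_def algebra_simps \<beta>2)
    qed
    have "\<beta> * a 0 0 \<ge> 0" unfolding \<beta>_def using \<alpha> by (auto intro: mult_nonneg_nonpos)
    then have spos: "s > 0" using s \<alpha> by simp
    \<comment> \<open>The Householder reflection I - 2 u u^T / |u|^2; the rows of \<open>b\<close>
      are the rows of \<open>a\<close> after this reflection.\<close>
    define H where "H i j = (if i = j then 1 else 0) - 2 * u i * u j / s" for i j :: nat
    define b where "b i j = a i j - (2 * (\<Sum>k<Suc n. a i k * u k) / s) * u j" for i j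
    have mult: "?m c * ?m H = ?m (\<lambda>i j. c i j - (2 * (\<Sum>k<Suc n. c i k * u k) / s) * u j)" for c
    proof (rule eq_matI, simp_all add: scalar_prod_def del: sum.op_ivl_Suc sum.lessThan_Suc)
      fix i j assume "i < Suc n" "j < Suc n"
      have "(\<Sum>k = 0..<Suc n. c i k * H k j) = (\<Sum>k<Suc n. (if k = j then c i k else 0) - c i k * u k * (2 * u j / s))"
        unfolding H_def atLeast0LessThan by (intro sum.cong) (auto simp: algebra_simps)
      also have "\<dots> = c i j - (\<Sum>k<Suc n. c i k * u k) * (2 * u j / s)"
        unfolding sum_subtractf sum_distrib_right[symmetric] using \<open>j < Suc n\<close> by (subst sum.delta) auto
      finally show "(\<Sum>k = 0..<Suc n. c i k * H k j) = c i j - 2 * (\<Sum>k<Suc n. c i k * u k) * u j / s"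
        by (simp add: field_simps)
    qed
    have norm: "(\<Sum>j<Suc n. (b i j)\<^sup>2) = (\<Sum>j<Suc n. (a i j)\<^sup>2)" for i
    proof -
      define c where "c = (\<Sum>k<Suc n. a i k * u k)"
      have "(\<Sum>j<Suc n. (b i j)\<^sup>2) = (\<Sum>j<Suc n. (a i j)\<^sup>2 - (4 * c / s) * (a i j * u j) + (4 * c\<^sup>2 / s\<^sup>2) * (u j * u j))"
        unfolding b_def c_def[symmetric] 
        by (intro sum.cong refl, simp add: power2_diff power_mult_distrib power_divide)
          (simp add: power2_eq_square mult_ac)
      also have "\<dots> = (\<Sum>j<Suc n. (a i j)\<^sup>2) - (4 * c / s) * c + (4 * c\<^sup>2 / s\<^sup>2) * s"
        unfolding sum.distrib sum_subtractf sum_distrib_left[symmetric] c_def[symmetric] s_def[symmetric] by simp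
      also have "\<dots> = (\<Sum>j<Suc n. (a i j)\<^sup>2)" using spos by (simp add: power2_eq_square field_simps)
      finally show ?thesis .
    qed
    \<comment> \<open>Since 2 <a_0, u> = |u|^2, the reflection takes the first row a_0 to a_0 - u,
      and this is -\<beta> times the first basis vector.\<close>
    have b0: "b 0 j = 0" if "0 < j" "j < Suc n" for j
    proof -
      have "2 * (\<Sum>k<Suc n. a 0 k * u k) / s = 1" using spos unfolding au s by simp
      then show ?thesis using that unfolding b_def by (simp add: u_def del: sum.lessThan_Suc)
    qed
    have "H i j - (2 * (\<Sum>k<Suc n. H i k * u k) / s) * u j = (if i = j then 1 else 0)"
      if ij: "i < Suc n" "j < Suc n" for i j
    proof -
      have "(\<Sum>k<Suc n. H i k * u k) = (\<Sum>k<Suc n. (if k = i then u k else 0) - (u k * u k) * (2 * u i / s))"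
        unfolding H_def by (intro sum.cong) (auto simp: algebra_simps)
      also have "\<dots> = u i - s * (2 * u i / s)"
        unfolding sum_subtractf sum_distrib_right[symmetric] s_def using ij by (subst sum.delta) auto
      finally have "(\<Sum>k<Suc n. H i k * u k) = - u i" using spos by (simp add: field_simps)
      then show ?thesis by (simp add: H_def del: sum.lessThan_Suc)
    qed
    then have "?m H * ?m H = 1\<^sub>m (Suc n)"
      unfolding mult by (intro eq_matI) (auto simp del: sum.lessThan_Suc)
    then have "Determinant.det (?m H) * Determinant.det (?m H) = 1"
      by (subst Determinant.det_mult[symmetric, where n = "Suc n"]) (auto)
    moreover have "?m b = ?m a * ?m H" unfolding mult b_def ..
    then have "Determinant.det (?m b) = Determinant.det (?m a) * Determinant.det (?m H)"
      by (subst Determinant.det_mult[symmetric, where n = "Suc n"]) auto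
    ultimately have "(Determinant.det (?m a))\<^sup>2 = (Determinant.det (?m b))\<^sup>2"
      by (simp add: power2_eq_square)
    also have "\<dots> \<le> (\<Prod>i<Suc n. \<Sum>j<Suc n. (b i j)\<^sup>2)"
      by (rule step) (use b0 in auto)
    finally show ?thesis unfolding norm .
  qed
qed

text \<open>n^(n/2), the Hadamard bound for a real n by n determinant with entries in [-1, 1]. Up to
  a geometric factor it grows at most like the square root of n!, so the factor 1/n! of Fredholm's
  series beats it.\<close>

definition hadamard_const :: "nat \<Rightarrow> real" where "hadamard_const n = sqrt (real n) ^ n"

lemma hadamard_const_nonneg: "0 \<le> hadamard_const n"
  by (simp add: hadamard_const_def)

lemma abs_det_le_hadamard:
  fixes a :: "nat \<Rightarrow> nat \<Rightarrow> real"
  assumes "\<And>i j. \<bar>a i j\<bar> \<le> B"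
  shows "\<bar>\<Sum>p | p permutes {..<n}. of_int (sign p) * (\<Prod>i<n. a i (p i))\<bar> \<le> B ^ n * hadamard_const n"
proof (rule power2_le_imp_le)
  have B: "B \<ge> 0" using assms[of 0 0] by linarith
  have "(Determinant.det (Matrix.mat n n (\<lambda>(i, j). a i j)))\<^sup>2 \<le> (\<Prod>i<n. \<Sum>j<n. (a i j)\<^sup>2)"
    by (rule hadamard_inequality_rows)
  also have "\<dots> \<le> (\<Prod>i<n. \<Sum>j<n. B\<^sup>2)"
    by (intro prod_mono conjI sum_nonneg sum_mono) (use assms B in \<open>auto simp: abs_le_square_iff[symmetric] abs_of_nonneg\<close>)
  also have "\<dots> = (B ^ n * hadamard_const n)\<^sup>2"
    unfolding hadamard_const_def power_mult_distrib power_mult[symmetric]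
    by (simp add: power_mult_distrib mult.commute[of n 2] power_mult)
  finally show "\<bar>\<Sum>p | p permutes {..<n}. of_int (sign p) * (\<Prod>i<n. a i (p i))\<bar>\<^sup>2 \<le> (B ^ n * hadamard_const n)\<^sup>2"
    by (simp add: det_mat_eq_sum_permutations)
  show "0 \<le> B ^ n * hadamard_const n" using B by (simp add: hadamard_const_nonneg)
qed

text \<open>n^n / n! is a single term of the exponential series at n; square roots give the
  geometric factor.\<close>

lemma hadamard_const_le: "hadamard_const n \<le> sqrt (exp 1) ^ n * sqrt (fact n)"
proof -
  have "(\<Sum>k\<in>{n}. inverse (fact k) * real n ^ k) \<le> exp (real n)"
    unfolding exp_def by (simp only: real_scaleR_def, rule sum_le_suminf) (use summable_exp[of "real n"] in auto)
  then have "real n ^ n \<le> exp 1 ^ n * fact n"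
    by (simp add: field_simps exp_of_nat_mult[symmetric])
  then have "sqrt (real n ^ n) \<le> sqrt (exp 1 ^ n * fact n)" by (rule real_sqrt_le_mono)
  then show ?thesis by (simp add: hadamard_const_def real_sqrt_power real_sqrt_mult)
qed

lemma summable_power_over_sqrt_fact: "summable (\<lambda>n. E ^ n / sqrt (fact n))" for E :: real
proof -
  obtain N :: nat where N: "4 * E\<^sup>2 \<le> real N" using real_arch_simple by blast
  show ?thesis
  proof (rule summable_ratio_test[where c = "1/2" and N = N])
    fix n assume "N \<le> n"
    then have "(2 * \<bar>E\<bar>)\<^sup>2 \<le> real (Suc n)" using N by (simp add: power_mult_distrib)
    then have "2 * \<bar>E\<bar> \<le> sqrt (real (Suc n))" by (intro real_le_rsqrt) 
    then have "\<bar>E\<bar> / sqrt (real (Suc n)) \<le> 1/2" by (simp add: field_simps)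
    then have "(\<bar>E\<bar> / sqrt (real (Suc n))) * (\<bar>E\<bar> ^ n / sqrt (fact n)) \<le> 1/2 * (\<bar>E\<bar> ^ n / sqrt (fact n))"
      by (intro mult_right_mono) auto
    then show "norm (E ^ Suc n / sqrt (fact (Suc n))) \<le> 1 / 2 * norm (E ^ n / sqrt (fact n))"
      by (simp add: real_sqrt_mult abs_mult power_abs)
  qed simp
qed

text \<open>A common majorant for the series below: the square leaves room for the quadratic
  remainder in the weight, and the mismatch between n + 1 and n! is that of the minors, whose
  matrices have one row more than there are integrations.\<close>

lemma summable_hadamard_const:
  fixes C :: real
  shows "summable (\<lambda>n. (real (Suc n))\<^sup>2 * (C ^ Suc n * hadamard_const (Suc n)) / fact n)"
proof (rule summable_comparison_test)
  \<comment> \<open>The number 8 absorbs (n + 1)^3 <= (2^(n + 1))^3, that is, the square in the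
    statement and one factor from n! = (n + 1)! / (n + 1). The root of e comes from
    \<open>hadamard_const_le\<close>.\<close>
  let ?E = "8 * \<bar>C\<bar> * sqrt (exp 1)"
  show "summable (\<lambda>n. ?E ^ Suc n / sqrt (fact (Suc n)))"
    using summable_power_over_sqrt_fact[of ?E] by (subst summable_Suc_iff)
  show "\<exists>N. \<forall>n\<ge>N. norm ((real (Suc n))\<^sup>2 * (C ^ Suc n * hadamard_const (Suc n)) / fact n) \<le> ?E ^ Suc n / sqrt (fact (Suc n))"
  proof (intro exI allI impI)
    fix n
    let ?m = "Suc n"
    have "((2::real) ^ ?m) ^ 3 = (2 ^ 3) ^ ?m" by (metis power_mult mult.commute)
    then have pow: "((2::real) ^ ?m) ^ 3 = 8 ^ ?m" by simp
    have "real ?m \<le> 2 ^ ?m" using of_nat_less_two_power[of ?m] by (metis less_imp_le)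
    then have m3: "real ?m ^ 3 \<le> 8 ^ ?m"
      using power_mono[of "real ?m" "2 ^ ?m" 3] by (simp add: pow del: power_Suc of_nat_Suc)
    have "norm ((real ?m)\<^sup>2 * (C ^ ?m * hadamard_const ?m) / fact n) = real ?m ^ 3 * (\<bar>C\<bar> ^ ?m * hadamard_const ?m) / fact ?m"
      by (simp add: abs_mult power_abs hadamard_const_nonneg power2_eq_square power3_eq_cube field_simps del: power_Suc of_nat_Suc)
    also have "\<dots> \<le> 8 ^ ?m * (\<bar>C\<bar> ^ ?m * (sqrt (exp 1) ^ ?m * sqrt (fact ?m))) / fact ?m"
      by (intro divide_right_mono mult_mono m3 hadamard_const_le mult_nonneg_nonneg hadamard_const_nonneg) auto
    also have "\<dots> = ?E ^ ?m / sqrt (fact ?m)"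
      using real_sqrt_mult_self[of "fact ?m"]
      by (simp add: power_mult_distrib field_simps del: power_Suc fact_Suc real_sqrt_mult_self)
    finally show "norm ((real ?m)\<^sup>2 * (C ^ ?m * hadamard_const ?m) / fact n) \<le> ?E ^ ?m / sqrt (fact ?m)" .
  qed
qed

section \<open>Determinants over an arbitrary finite index set\<close>

text \<open>Index sets are arbitrary so that an index can be removed or added without renumbering
  the others.\<close>

definition perm_det :: "'i set \<Rightarrow> ('i \<Rightarrow> 'i \<Rightarrow> real) \<Rightarrow> real" where
  "perm_det I a = (\<Sum>p | p permutes I. of_int (sign p) * (\<Prod>i\<in>I. a i (p i)))"

lemma perm_det_cong:
  assumes "\<And>i j. i \<in> I \<Longrightarrow> j \<in> I \<Longrightarrow> a i j = b i j"
  shows "perm_det I a = perm_det I b"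
  unfolding perm_det_def
  by (intro sum.cong refl arg_cong2[where f="(*)"] prod.cong) (auto simp: assms permutes_in_image)

lemma perm_det_empty [simp]: "perm_det {} a = 1"
  by (simp add: perm_det_def)

text \<open>Expansion along the row of \<open>c\<close>. A permutation that sends \<open>c\<close>
  to \<open>b\<close> in \<open>I\<close> is the transposition of \<open>c\<close> and
  \<open>b\<close> after a permutation of \<open>I\<close>. It reads column \<open>c\<close>
  wherever the latter reads column \<open>b\<close>, which accounts for the replaced column, and its
  sign is opposite.\<close>

lemma perm_det_insert:
  assumes fin: "finite I" and c: "c \<notin> I"
  shows "perm_det (insert c I) a =
    a c c * perm_det I a - (\<Sum>b\<in>I. a c b * perm_det I (\<lambda>i j. if j = b then a i c else a i j))"
proof -
  let ?g = "\<lambda>p. of_int (sign p) * (\<Prod>i\<in>insert c I. a i (p i))"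
  have q: "q permutes I \<Longrightarrow> q c = c" for q using c by (auto simp: permutes_def)
  have "perm_det (insert c I) a = (\<Sum>b\<in>insert c I. \<Sum>q | q permutes I. ?g (Transposition.transpose c b \<circ> q))"
    unfolding perm_det_def by (rule sum_over_permutations_insert[OF fin c])
  also have "\<dots> = (\<Sum>q | q permutes I. ?g (Transposition.transpose c c \<circ> q))
       + (\<Sum>b\<in>I. \<Sum>q | q permutes I. ?g (Transposition.transpose c b \<circ> q))"
    using fin c by simp
  also have "(\<Sum>q | q permutes I. ?g (Transposition.transpose c c \<circ> q)) = a c c * perm_det I a"
    unfolding perm_det_def sum_distrib_left using fin c by (intro sum.cong) (auto simp: q)
  also have "(\<Sum>b\<in>I. \<Sum>q | q permutes I. ?g (Transposition.transpose c b \<circ> q)) =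
      (\<Sum>b\<in>I. - (a c b * perm_det I (\<lambda>i j. if j = b then a i c else a i j)))"
  proof (rule sum.cong[OF refl])
    fix b assume b: "b \<in> I"
    have "?g (Transposition.transpose c b \<circ> p) =
        - (a c b * (of_int (sign p) * (\<Prod>i\<in>I. if p i = b then a i c else a i (p i))))"
      if p: "p permutes I" for p
    proof -
      have "sign (Transposition.transpose c b \<circ> p) = - sign p"
        using b c fin permutes_imp_permutation[OF fin p]
        by (subst sign_compose) (auto simp: sign_swap_id permutation_swap_id)
      moreover have "Transposition.transpose c b (p i) = (if p i = b then c else p i)" if "i \<in> I" for i
        using that p c by (auto simp: Transposition.transpose_def permutes_in_image)
      then have "(\<Prod>i\<in>I. a i (Transposition.transpose c b (p i))) = (\<Prod>i\<in>I. if p i = b then a i c else a i (p i))"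
        by (intro prod.cong) auto
      ultimately show ?thesis using fin c b q[OF p] by simp
    qed
    then show "(\<Sum>q | q permutes I. ?g (Transposition.transpose c b \<circ> q)) =
        - (a c b * perm_det I (\<lambda>i j. if j = b then a i c else a i j))"
      unfolding perm_det_def sum_distrib_left sum_negf[symmetric] by (intro sum.cong) auto
  qed
  finally show ?thesis by (simp add: sum_negf)
qed

text \<open>Crude bound that serves integrability; the convergence of the series rests on Hadamard's
  inequality.\<close>

lemma abs_perm_det_le:
  assumes fin: "finite I" and "\<And>i j. \<bar>a i j\<bar> \<le> B"
  shows "\<bar>perm_det I a\<bar> \<le> fact (card I) * B ^ card I"
proof -
  have "\<bar>perm_det I a\<bar> \<le> (\<Sum>p | p permutes I. \<bar>of_int (sign p) * (\<Prod>i\<in>I. a i (p i))\<bar>)"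
    unfolding perm_det_def by (rule sum_abs)
  also have "\<dots> \<le> (\<Sum>p | p permutes I. B ^ card I)"
  proof (rule sum_mono)
    fix p
    have "(\<Prod>i\<in>I. \<bar>a i (p i)\<bar>) \<le> (\<Prod>i\<in>I. B)" using assms by (intro prod_mono) auto
    then show "\<bar>of_int (sign p) * (\<Prod>i\<in>I. a i (p i))\<bar> \<le> B ^ card I"
      by (simp add: abs_mult abs_prod sign_def)
  qed
  also have "\<dots> = fact (card I) * B ^ card I" by (simp add: card_permutations[OF refl fin])
  finally show ?thesis .
qed

text \<open>Fubini's theorem with the added coordinate outermost, so that the inner integral over
  the remaining coordinates is a minor at a fixed point.\<close>

lemma (in product_sigma_finite) product_integral_insert_rev:
  fixes f :: "_ \<Rightarrow> real"
  assumes I: "finite I" "i \<notin> I" and f: "integrable (Pi\<^sub>M (insert i I) M) f"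
  shows "integral\<^sup>L (Pi\<^sub>M (insert i I) M) f = (\<integral>y. (\<integral>x. f (x(i:=y)) \<partial>Pi\<^sub>M I M) \<partial>M i)"
proof -
  interpret I: finite_product_sigma_finite M I by standard fact
  interpret P: pair_sigma_finite "Pi\<^sub>M I M" "M i" ..
  have meas[measurable]: "f \<in> borel_measurable (Pi\<^sub>M (insert i I) M)" using f by auto
  have "integrable (Pi\<^sub>M I M \<Otimes>\<^sub>M M i) (\<lambda>(x, y). f (x(i:=y)))"
  proof (rule integrableI_bounded)
    have "(\<integral>\<^sup>+ z. ennreal (norm (case z of (x, y) \<Rightarrow> f (x(i := y)))) \<partial>(Pi\<^sub>M I M \<Otimes>\<^sub>M M i)) =
       (\<integral>\<^sup>+ x. \<integral>\<^sup>+ y. ennreal (norm (f (x(i := y)))) \<partial>M i \<partial>Pi\<^sub>M I M)"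
      by (subst sigma_finite_measure.nn_integral_fst[OF sigma_finite_measures, symmetric]) (auto simp: split_beta)
    also have "\<dots> = (\<integral>\<^sup>+ x. ennreal (norm (f x)) \<partial>Pi\<^sub>M (insert i I) M)"
      by (rule product_nn_integral_insert[symmetric]) (use I in auto)
    also have "\<dots> < \<infinity>" using f by (simp add: integrable_iff_bounded)
    finally show "(\<integral>\<^sup>+ z. ennreal (norm (case z of (x, y) \<Rightarrow> f (x(i := y)))) \<partial>(Pi\<^sub>M I M \<Otimes>\<^sub>M M i)) < \<infinity>" .
  qed simp
  then show ?thesis
    unfolding product_integral_insert[OF I f] by (rule P.Fubini_integral[symmetric])
qed

section \<open>Fredholm's coefficients and minors for a bounded kernel and an integrable
  weight\<close>

text \<open>The set X is carried by a weight and not by the kernel: \<open>k\<close> is bounded and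
  fixed, and moving the end-points changes only an integrable weight. The condition on the space
  lets every fixed point serve as a measurable constant.\<close>

locale bounded_kernel = sigma_finite_measure M
  for M :: "'a measure" +
  fixes k :: "'a \<Rightarrow> 'a \<Rightarrow> real" and B :: real
  assumes space_UNIV: "space M = UNIV"
    and kernel_measurable: "case_prod k \<in> borel_measurable (M \<Otimes>\<^sub>M M)"
    and kernel_bound: "\<bar>k x y\<bar> \<le> B"
begin

sublocale product_sigma_finite "\<lambda>_::nat. M" ..

lemma B_nonneg: "B \<ge> 0" using kernel_bound[of undefined undefined] by linarith

lemma measurable_kernel [measurable (raw)]:
  assumes [measurable]: "f \<in> N \<rightarrow>\<^sub>M M" "g \<in> N \<rightarrow>\<^sub>M M"
  shows "(\<lambda>z. k (f z) (g z)) \<in> borel_measurable N"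
proof -
  have "(\<lambda>z. case_prod k (f z, g z)) \<in> borel_measurable N"
    by (rule measurable_compose[OF _ kernel_measurable]) measurable
  then show ?thesis by simp
qed

lemma measurable_perm_det:
  assumes "\<And>i j. i \<in> I \<Longrightarrow> j \<in> I \<Longrightarrow> (\<lambda>z. a z i j) \<in> borel_measurable N"
  shows "(\<lambda>z. perm_det I (a z)) \<in> borel_measurable N"
  unfolding perm_det_def
  by (intro borel_measurable_sum borel_measurable_times borel_measurable_const borel_measurable_prod)
    (auto intro: assms simp: permutes_in_image)

lemma integrable_bounded_times_prod:
  assumes "finite I" and f: "f \<in> borel_measurable (Pi\<^sub>M I (\<lambda>_. M))" and C: "\<And>z. \<bar>f z\<bar> \<le> C"
    and w: "\<And>i. i \<in> I \<Longrightarrow> integrable M (w i)"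
  shows "integrable (Pi\<^sub>M I (\<lambda>_::nat. M)) (\<lambda>z. f z * (\<Prod>i\<in>I. w i (z i)) :: real)"
proof (rule Bochner_Integration.integrable_bound)
  show "integrable (Pi\<^sub>M I (\<lambda>_. M)) (\<lambda>z. C * (\<Prod>i\<in>I. w i (z i)))"
    by (intro integrable_mult_right product_integrable_prod assms)
  have "(\<lambda>z. \<Prod>i\<in>I. w i (z i)) \<in> borel_measurable (Pi\<^sub>M I (\<lambda>_. M))"
    using product_integrable_prod[OF assms(1) w] by auto
  with f show "(\<lambda>z. f z * (\<Prod>i\<in>I. w i (z i))) \<in> borel_measurable (Pi\<^sub>M I (\<lambda>_. M))" by measurable
  show "AE z in Pi\<^sub>M I (\<lambda>_. M). norm (f z * (\<Prod>i\<in>I. w i (z i))) \<le> norm (C * (\<Prod>i\<in>I. w i (z i)))"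
  proof (rule AE_I2)
    fix z
    have "\<bar>f z\<bar> \<le> \<bar>C\<bar>" using C[of z] by linarith
    then show "norm (f z * (\<Prod>i\<in>I. w i (z i))) \<le> norm (C * (\<Prod>i\<in>I. w i (z i)))"
      by (simp add: abs_mult mult_right_mono)
  qed
qed

definition weighted_det :: "('a \<Rightarrow> real) \<Rightarrow> nat set \<Rightarrow> real" where
  "weighted_det w I = (\<integral>z. perm_det I (\<lambda>i j. k (z i) (z j)) * (\<Prod>i\<in>I. w (z i)) \<partial>Pi\<^sub>M I (\<lambda>_. M))"

text \<open>Fredholm's minor: row \<open>c\<close> is evaluated at x and column \<open>c\<close> at
  y, all other rows and columns at the integration variables.\<close>

definition weighted_minor :: "('a \<Rightarrow> real) \<Rightarrow> nat set \<Rightarrow> nat \<Rightarrow> 'a \<Rightarrow> 'a \<Rightarrow> real" where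
  "weighted_minor w I c x y =
    (\<integral>z. perm_det (insert c I) (\<lambda>i j. k ((z(c:=x)) i) ((z(c:=y)) j)) * (\<Prod>i\<in>I. w (z i)) \<partial>Pi\<^sub>M I (\<lambda>_. M))"

text \<open>The recursion that expansion along the row of x produces. Summed over all orders it
  becomes an integral equation; \<open>weighted_minor_eq\<close> shows that it agrees with the
  integrals of determinants, which are the form that can be estimated.\<close>

primrec fredholm_minor :: "('a \<Rightarrow> real) \<Rightarrow> nat \<Rightarrow> 'a \<Rightarrow> 'a \<Rightarrow> real" where
  "fredholm_minor w 0 = k"
| "fredholm_minor w (Suc n) = (\<lambda>x y. (\<integral>z. w z * fredholm_minor w n z z \<partial>M) * k x y
      - real (Suc n) * (\<integral>z. k x z * w z * fredholm_minor w n z y \<partial>M))"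

primrec fredholm_coeff :: "('a \<Rightarrow> real) \<Rightarrow> nat \<Rightarrow> real" where
  "fredholm_coeff w 0 = 1"
| "fredholm_coeff w (Suc n) = (\<integral>z. w z * fredholm_minor w n z z \<partial>M)"

lemma measurable_component_upd [measurable]:
  assumes "i \<in> insert c I"
  shows "(\<lambda>z. (z(c := x)) i) \<in> Pi\<^sub>M I (\<lambda>_::nat. M) \<rightarrow>\<^sub>M M"
proof (cases "i = c")
  case False
  then have "i \<in> I" using assms by auto
  with False show ?thesis by simp
qed (simp add: space_UNIV)

lemma measurable_det_integrand:
  "(\<lambda>z. perm_det I (\<lambda>i j. k (z i) (z j))) \<in> borel_measurable (Pi\<^sub>M I (\<lambda>_::nat. M))"
  by (intro measurable_perm_det measurable_kernel measurable_component_singleton)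

lemma integrable_det_integrand:
  assumes "finite I" "\<And>i. i \<in> I \<Longrightarrow> integrable M (w i)"
  shows "integrable (Pi\<^sub>M I (\<lambda>_::nat. M)) (\<lambda>z. perm_det I (\<lambda>i j. k (z i) (z j)) * (\<Prod>i\<in>I. w i (z i)))"
  by (rule integrable_bounded_times_prod[OF assms(1) measurable_det_integrand _ assms(2)])
    (use abs_perm_det_le[OF _ kernel_bound] assms(1) in auto)

text \<open>One factor of the weight product is set apart: v = w gives the recursion, and an
  increment v of the weight gives the first variation.\<close>

lemma det_integral_insert:
  assumes J: "finite J" "b \<notin> J" and w: "integrable M w" and v: "integrable M v"
  shows "(\<integral>z. perm_det (insert b J) (\<lambda>i j. k (z i) (z j)) * (v (z b) * (\<Prod>i\<in>J. w (z i))) \<partial>Pi\<^sub>M (insert b J) (\<lambda>_. M))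
    = (\<integral>t. v t * weighted_minor w J b t t \<partial>M)"
proof -
  have *: "v (z b) * (\<Prod>i\<in>J. w (z i)) = (\<Prod>i\<in>insert b J. (if i = b then v else w) (z i))" for z
    using J by (auto intro!: prod.cong)
  have "(\<integral>z. perm_det (insert b J) (\<lambda>i j. k (z i) (z j)) * (v (z b) * (\<Prod>i\<in>J. w (z i))) \<partial>Pi\<^sub>M (insert b J) (\<lambda>_. M))
    = (\<integral>t. (\<integral>z. perm_det (insert b J) (\<lambda>i j. k ((z(b:=t)) i) ((z(b:=t)) j)) * (v ((z(b:=t)) b) * (\<Prod>i\<in>J. w ((z(b:=t)) i))) \<partial>Pi\<^sub>M J (\<lambda>_. M)) \<partial>M)"
    by (rule product_integral_insert_rev[OF J])
      (unfold *, rule integrable_det_integrand, use J w v in auto)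
  also have "(\<Prod>i\<in>J. w ((z(b:=t)) i)) = (\<Prod>i\<in>J. w (z i))" for z t
    using J by (intro prod.cong) auto
  then have "(\<integral>t. (\<integral>z. perm_det (insert b J) (\<lambda>i j. k ((z(b:=t)) i) ((z(b:=t)) j)) * (v ((z(b:=t)) b) * (\<Prod>i\<in>J. w ((z(b:=t)) i))) \<partial>Pi\<^sub>M J (\<lambda>_. M)) \<partial>M)
      = (\<integral>t. (\<integral>z. v t * (perm_det (insert b J) (\<lambda>i j. k ((z(b:=t)) i) ((z(b:=t)) j)) * (\<Prod>i\<in>J. w (z i))) \<partial>Pi\<^sub>M J (\<lambda>_. M)) \<partial>M)"
    by (simp add: mult_ac)
  finally show ?thesis unfolding weighted_minor_def by simp
qed

text \<open>Column \<open>b\<close> is already taken at y, so z_b occurs only as a row variable and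
  in the factors in front; integrating over it last leaves a minor with one variable less.\<close>

lemma minor_integral_insert:
  assumes J: "finite J" "b \<notin> J" and w: "integrable M w"
  shows "(\<integral>z. k x (z b) * perm_det (insert b J) (\<lambda>i j. k (z i) ((z(b:=y)) j)) * (\<Prod>i\<in>insert b J. w (z i)) \<partial>Pi\<^sub>M (insert b J) (\<lambda>_. M))
    = (\<integral>t. k x t * w t * weighted_minor w J b t y \<partial>M)"
proof -
  have meas: "(\<lambda>z. k x (z b) * perm_det (insert b J) (\<lambda>i j. k (z i) ((z(b:=y)) j)))
      \<in> borel_measurable (Pi\<^sub>M (insert b J) (\<lambda>_. M))"
    by (intro borel_measurable_times measurable_perm_det measurable_kernel measurable_component_upd measurable_component_singleton)
      (auto simp: space_UNIV)
  have bound: "\<bar>k x (z b) * perm_det (insert b J) (\<lambda>i j. k (z i) ((z(b:=y)) j))\<bar> \<le> 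
      B * (fact (card (insert b J)) * B ^ card (insert b J))" for z
    unfolding abs_mult using J B_nonneg
    by (intro mult_mono kernel_bound abs_perm_det_le) auto
  have "(\<integral>z. k x (z b) * perm_det (insert b J) (\<lambda>i j. k (z i) ((z(b:=y)) j)) * (\<Prod>i\<in>insert b J. w (z i)) \<partial>Pi\<^sub>M (insert b J) (\<lambda>_. M))
    = (\<integral>t. (\<integral>z. k x ((z(b:=t)) b) * perm_det (insert b J) (\<lambda>i j. k ((z(b:=t)) i) ((z(b:=t,b:=y)) j)) * (\<Prod>i\<in>insert b J. w ((z(b:=t)) i)) \<partial>Pi\<^sub>M J (\<lambda>_. M)) \<partial>M)"
    by (rule product_integral_insert_rev[OF J], rule integrable_bounded_times_prod[OF _ meas bound])
      (use J w in auto)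
  also have "(\<Prod>i\<in>insert b J. w ((z(b:=t)) i)) = w t * (\<Prod>i\<in>J. w (z i))" for z t
    using J by (auto intro!: prod.cong)
  then have "(\<integral>t. (\<integral>z. k x ((z(b:=t)) b) * perm_det (insert b J) (\<lambda>i j. k ((z(b:=t)) i) ((z(b:=t,b:=y)) j)) * (\<Prod>i\<in>insert b J. w ((z(b:=t)) i)) \<partial>Pi\<^sub>M J (\<lambda>_. M)) \<partial>M)
      = (\<integral>t. (\<integral>z. (k x t * w t) * (perm_det (insert b J) (\<lambda>i j. k ((z(b:=t)) i) ((z(b:=y)) j)) * (\<Prod>i\<in>J. w (z i))) \<partial>Pi\<^sub>M J (\<lambda>_. M)) \<partial>M)"
    by (simp add: mult_ac)
  finally show ?thesis unfolding weighted_minor_def by simp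
qed

lemma perm_det_minor_expand:
  assumes I: "finite I" "c \<notin> I"
  shows "perm_det (insert c I) (\<lambda>i j. k ((z(c:=x)) i) ((z(c:=y)) j)) =
    k x y * perm_det I (\<lambda>i j. k (z i) (z j)) - (\<Sum>b\<in>I. k x (z b) * perm_det I (\<lambda>i j. k (z i) ((z(b:=y)) j)))"
proof -
  have "perm_det I (\<lambda>i j. k ((z(c:=x)) i) ((z(c:=y)) j)) = perm_det I (\<lambda>i j. k (z i) (z j))"
    by (rule perm_det_cong) (use I in auto)
  moreover have "perm_det I (\<lambda>i j. if j = b then k ((z(c:=x)) i) ((z(c:=y)) c) else k ((z(c:=x)) i) ((z(c:=y)) j))
      = perm_det I (\<lambda>i j. k (z i) ((z(b:=y)) j))" for b
    by (rule perm_det_cong) (use I in auto)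
  moreover have "(\<Sum>b\<in>I. k x ((z(c:=y)) b) * f b) = (\<Sum>b\<in>I. k x (z b) * f b)" for f
    by (rule sum.cong) (use I in auto)
  ultimately show ?thesis by (subst perm_det_insert[OF I]) simp
qed

text \<open>In the expansion along the row of x all columns b in \<open>I\<close> contribute the
  same integral by symmetry, which is the factor \<open>Suc n\<close> of the recursion. The
  induction is over the size of arbitrary sets \<open>I\<close>, since an initial segment without b
  need not be an initial segment.\<close>

lemma weighted_minor_eq:
  assumes "finite I" "c \<notin> I" and w: "integrable M w"
  shows "weighted_det w I = fredholm_coeff w (card I)"
    and "weighted_minor w I c x y = fredholm_minor w (card I) x y"
  using assms(1,2)
proof (induction "card I" arbitrary: I c x y)
  case 0
  interpret P: finite_measure "Pi\<^sub>M {} (\<lambda>_::nat. M)" by rule (simp add: space_PiM)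
  {
    case 1
    with 0 show ?case by (simp add: weighted_det_def space_PiM measure_def)
  next
    case 2
    with 0 show ?case by (simp add: weighted_minor_def space_PiM measure_def perm_det_def)
  }
next
  case (Suc n)
  have IH: "weighted_minor w J b t y = fredholm_minor w n t y" if "finite J" "b \<notin> J" "card J = n" for J b t y
    using Suc.hyps that by auto
  have det: "weighted_det w I = fredholm_coeff w (Suc n)" if I: "Suc n = card I" "finite I" for I
  proof -
    obtain b J where bJ: "I = insert b J" "b \<notin> J" "card J = n" "finite J"
      using I by (metis card_Suc_eq finite_insert)
    have "weighted_det w I = (\<integral>t. w t * weighted_minor w J b t t \<partial>M)"
      unfolding weighted_det_def bJ(1) using bJ
      by (subst det_integral_insert[symmetric]) (auto simp: w)
    also have "\<dots> = (\<integral>t. w t * fredholm_minor w n t t \<partial>M)"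
      by (subst IH) (use bJ in auto)
    finally show ?thesis by simp
  qed
  {
    case 1
    then show ?case using det[OF Suc.hyps(3)] Suc.hyps(3) by simp
  next
    case 2
    let ?W = "\<lambda>z. \<Prod>i\<in>I. w (z i)"
    have b: "(\<integral>z. k x (z b) * perm_det I (\<lambda>i j. k (z i) ((z(b:=y)) j)) * ?W z \<partial>Pi\<^sub>M I (\<lambda>_. M))
      = (\<integral>t. k x t * w t * fredholm_minor w n t y \<partial>M)" if "b \<in> I" for b
    proof -
      have I: "I = insert b (I - {b})" using that by auto
      have J: "finite (I - {b})" "b \<notin> I - {b}" "card (I - {b}) = n"
        using that 2 Suc.hyps(3) by auto
      show ?thesis
        by (subst (1 2 3) I, subst minor_integral_insert[OF J(1,2) w], subst IH) (use J in auto)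
    qed
    have int1: "integrable (Pi\<^sub>M I (\<lambda>_. M)) (\<lambda>z. k x y * (perm_det I (\<lambda>i j. k (z i) (z j)) * ?W z))"
      by (intro integrable_mult_right integrable_det_integrand) (use 2 w in auto)
    have int2: "integrable (Pi\<^sub>M I (\<lambda>_. M)) (\<lambda>z. k x (z b) * perm_det I (\<lambda>i j. k (z i) ((z(b:=y)) j)) * ?W z)"
      if "b \<in> I" for b
    proof (rule integrable_bounded_times_prod)
      have [simp]: "insert b I = I" using that by auto
      show "(\<lambda>z. k x (z b) * perm_det I (\<lambda>i j. k (z i) ((z(b:=y)) j))) \<in> borel_measurable (Pi\<^sub>M I (\<lambda>_. M))"
        using that by (intro borel_measurable_times measurable_perm_det measurable_kernel measurable_component_upd measurable_component_singleton)
          (auto simp: space_UNIV)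
      show "\<bar>k x (z b) * perm_det I (\<lambda>i j. k (z i) ((z(b:=y)) j))\<bar> \<le> B * (fact (card I) * B ^ card I)" for z
        unfolding abs_mult using 2 B_nonneg by (intro mult_mono kernel_bound abs_perm_det_le) auto
    qed (use 2 w in auto)
    have "weighted_minor w I c x y = (\<integral>z. k x y * (perm_det I (\<lambda>i j. k (z i) (z j)) * ?W z)
        - (\<Sum>b\<in>I. k x (z b) * perm_det I (\<lambda>i j. k (z i) ((z(b:=y)) j)) * ?W z) \<partial>Pi\<^sub>M I (\<lambda>_. M))"
      unfolding weighted_minor_def using 2
      by (subst perm_det_minor_expand) (simp_all add: left_diff_distrib sum_distrib_right mult.assoc)
    also have "\<dots> = k x y * weighted_det w I
        - (\<Sum>b\<in>I. \<integral>z. k x (z b) * perm_det I (\<lambda>i j. k (z i) ((z(b:=y)) j)) * ?W z \<partial>Pi\<^sub>M I (\<lambda>_. M))"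
      using int1 int2 by (subst Bochner_Integration.integral_diff)
        (auto simp: weighted_det_def Bochner_Integration.integral_sum)
    also have "\<dots> = k x y * fredholm_coeff w (Suc n) - (\<Sum>b\<in>I. \<integral>t. k x t * w t * fredholm_minor w n t y \<partial>M)"
      using det[OF Suc.hyps(3)] 2 b by simp
    finally show ?case using Suc.hyps(3)[symmetric] by simp
  }
qed

end

section \<open>Estimates for a change of the weight\<close>

lemma abs_integral_le:
  fixes f g :: "'a \<Rightarrow> real"
  assumes "integrable M g" "\<And>x. \<bar>f x\<bar> \<le> g x"
  shows "\<bar>\<integral>x. f x \<partial>M\<bar> \<le> (\<integral>x. g x \<partial>M)"
proof -
  have "\<bar>\<integral>x. f x \<partial>M\<bar> \<le> (\<integral>x. \<bar>f x\<bar> \<partial>M)" by (rule integral_abs_bound)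
  also have "\<dots> \<le> (\<integral>x. g x \<partial>M)"
    by (rule integral_mono') (use assms in \<open>auto intro: order_trans[OF abs_ge_zero]\<close>)
  finally show ?thesis .
qed

text \<open>The difference is a sum of monomials with coefficient one, so the triangle inequality
  bounds it by the same expression in absolute values, and the integral of the latter
  factorises.\<close>

lemma abs_prod_add_diff_le:
  fixes w v :: "'i \<Rightarrow> real"
  assumes "finite I"
  shows "\<bar>(\<Prod>i\<in>I. w i + v i) - (\<Prod>i\<in>I. w i)\<bar> \<le> (\<Prod>i\<in>I. \<bar>w i\<bar> + \<bar>v i\<bar>) - (\<Prod>i\<in>I. \<bar>w i\<bar>)"
  using assms
proof induction
  case (insert c I)
  let ?P = "\<Prod>i\<in>I. w i + v i" and ?Q = "\<Prod>i\<in>I. w i"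
  let ?P' = "\<Prod>i\<in>I. \<bar>w i\<bar> + \<bar>v i\<bar>" and ?Q' = "\<Prod>i\<in>I. \<bar>w i\<bar>"
  have P: "\<bar>?P\<bar> \<le> ?P'" unfolding abs_prod by (intro prod_mono) auto
  have "\<bar>(w c + v c) * ?P - w c * ?Q\<bar> = \<bar>w c * (?P - ?Q) + v c * ?P\<bar>" by (simp add: algebra_simps)
  also have "\<dots> \<le> \<bar>w c\<bar> * \<bar>?P - ?Q\<bar> + \<bar>v c\<bar> * \<bar>?P\<bar>"
    by (rule order_trans[OF abs_triangle_ineq]) (simp add: abs_mult)
  also have "\<dots> \<le> \<bar>w c\<bar> * (?P' - ?Q') + \<bar>v c\<bar> * ?P'"
    by (intro add_mono mult_left_mono insert.IH P) auto
  finally show ?case using insert.hyps by (simp add: algebra_simps)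
qed simp

text \<open>The same principle for the monomials with at least two factors from
  \<open>v\<close>.\<close>

lemma abs_prod_add_diff2_le:
  fixes w v :: "'i \<Rightarrow> real"
  assumes "finite I"
  shows "\<bar>(\<Prod>i\<in>I. w i + v i) - (\<Prod>i\<in>I. w i) - (\<Sum>a\<in>I. v a * (\<Prod>i\<in>I - {a}. w i))\<bar>
    \<le> (\<Prod>i\<in>I. \<bar>w i\<bar> + \<bar>v i\<bar>) - (\<Prod>i\<in>I. \<bar>w i\<bar>) - (\<Sum>a\<in>I. \<bar>v a\<bar> * (\<Prod>i\<in>I - {a}. \<bar>w i\<bar>))"
  using assms
proof induction
  case (insert c I)
  have S: "(\<Sum>a\<in>insert c I. v a * (\<Prod>i\<in>insert c I - {a}. w i)) =
      v c * (\<Prod>i\<in>I. w i) + w c * (\<Sum>a\<in>I. v a * (\<Prod>i\<in>I - {a}. w i))" for w v :: "'i \<Rightarrow> real"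
  proof -
    have "v a * (\<Prod>i\<in>insert c I - {a}. w i) = w c * (v a * (\<Prod>i\<in>I - {a}. w i))" if "a \<in> I" for a
    proof -
      have "insert c I - {a} = insert c (I - {a})" using insert.hyps that by auto
      then show ?thesis using insert.hyps by simp
    qed
    then have "(\<Sum>a\<in>I. v a * (\<Prod>i\<in>insert c I - {a}. w i)) = w c * (\<Sum>a\<in>I. v a * (\<Prod>i\<in>I - {a}. w i))"
      unfolding sum_distrib_left by (intro sum.cong) auto
    moreover have "insert c I - {c} = I" using insert.hyps by auto
    ultimately show ?thesis using insert.hyps by simp
  qed
  let ?P = "\<Prod>i\<in>I. w i + v i" and ?Q = "\<Prod>i\<in>I. w i" and ?R = "\<Sum>a\<in>I. v a * (\<Prod>i\<in>I - {a}. w i)"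
  let ?P' = "\<Prod>i\<in>I. \<bar>w i\<bar> + \<bar>v i\<bar>" and ?Q' = "\<Prod>i\<in>I. \<bar>w i\<bar>" and ?R' = "\<Sum>a\<in>I. \<bar>v a\<bar> * (\<Prod>i\<in>I - {a}. \<bar>w i\<bar>)"
  have "\<bar>(w c + v c) * ?P - w c * ?Q - (v c * ?Q + w c * ?R)\<bar> = \<bar>w c * (?P - ?Q - ?R) + v c * (?P - ?Q)\<bar>"
    by (simp add: algebra_simps)
  also have "\<dots> \<le> \<bar>w c\<bar> * \<bar>?P - ?Q - ?R\<bar> + \<bar>v c\<bar> * \<bar>?P - ?Q\<bar>"
    by (rule order_trans[OF abs_triangle_ineq]) (simp add: abs_mult)
  also have "\<dots> \<le> \<bar>w c\<bar> * (?P' - ?Q' - ?R') + \<bar>v c\<bar> * (?P' - ?Q')"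
    by (intro add_mono mult_left_mono insert.IH abs_prod_add_diff_le insert.hyps) auto
  finally show ?case unfolding S using insert.hyps by (simp add: algebra_simps)
qed simp

lemma power_add_diff_le:
  fixes W V C :: real
  assumes "0 \<le> W" "0 \<le> V" "W + V \<le> C" "1 \<le> C"
  shows "(W + V) ^ n - W ^ n \<le> real n * V * C ^ n"
proof (induction n)
  case (Suc n)
  have "(W + V) ^ Suc n - W ^ Suc n = W * ((W + V) ^ n - W ^ n) + V * (W + V) ^ n" by (simp add: algebra_simps)
  also have "\<dots> \<le> C * (real n * V * C ^ n) + V * C ^ Suc n"
  proof (intro add_mono mult_mono Suc.IH)
    have "(W + V) ^ n \<le> C ^ n" using assms by (intro power_mono) auto
    also have "\<dots> \<le> C ^ Suc n" using assms by (intro power_increasing) auto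
    finally show "(W + V) ^ n \<le> C ^ Suc n" .
    show "0 \<le> (W + V) ^ n - W ^ n" using assms by (simp add: power_mono)
  qed (use assms in auto)
  finally show ?case by (simp add: algebra_simps)
qed simp

text \<open>With W and V the L1 norms of weight and increment, this is the integrated remainder of
  second order. Since C >= 1, lower powers of C can be raised to C^n, which leaves a bound that
  depends on W only through C.\<close>

lemma power_add_diff2_le:
  fixes W V C :: real
  assumes "0 \<le> W" "0 \<le> V" "W + V \<le> C" "1 \<le> C"
  shows "(W + V) ^ n - W ^ n - real n * V * W ^ (n - 1) \<le> (real n)\<^sup>2 * V\<^sup>2 * C ^ n"
proof (induction n)
  case (Suc n)
  have *: "real n * W * W ^ (n - 1) = real n * W ^ n" by (cases n) auto
  have C: "C ^ n \<le> C ^ Suc n" using assms by (intro power_increasing) auto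
  have "(W + V) ^ Suc n - W ^ Suc n - real (Suc n) * V * W ^ (Suc n - 1) =
      W * ((W + V) ^ n - W ^ n - real n * V * W ^ (n - 1)) + V * ((W + V) ^ n - W ^ n)"
    using * by (simp add: algebra_simps)
  also have "\<dots> \<le> W * ((real n)\<^sup>2 * V\<^sup>2 * C ^ n) + V * (real n * V * C ^ n)"
    by (intro add_mono mult_left_mono Suc.IH power_add_diff_le assms)
  also have "\<dots> \<le> C * ((real n)\<^sup>2 * V\<^sup>2 * C ^ n) + V * (real n * V * C ^ Suc n)"
    using assms C by (intro add_mono mult_right_mono mult_left_mono) auto
  also have "\<dots> = ((real n)\<^sup>2 + real n) * V\<^sup>2 * C ^ Suc n"
    by (simp add: algebra_simps power2_eq_square)
  also have "\<dots> \<le> (real (Suc n))\<^sup>2 * V\<^sup>2 * C ^ Suc n"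
    using assms by (intro mult_right_mono) (auto simp: power2_eq_square algebra_simps)
  finally show ?case .
qed simp

context bounded_kernel
begin

text \<open>The size m of the matrix and the number n of integrations are kept apart because a minor
  has one row more than variables.\<close>

lemma abs_det_integral_le:
  assumes I: "I = {..<n}" and w: "integrable (Pi\<^sub>M I (\<lambda>_::nat. M)) w" and w': "integrable (Pi\<^sub>M I (\<lambda>_::nat. M)) w'"
    and le: "\<And>z. \<bar>w z\<bar> \<le> w' z" and a: "\<And>z i j. \<bar>a z i j\<bar> \<le> B"
  shows "\<bar>\<integral>z. perm_det {..<m} (a z) * w z \<partial>Pi\<^sub>M I (\<lambda>_. M)\<bar> \<le> B ^ m * hadamard_const m * (\<integral>z. w' z \<partial>Pi\<^sub>M I (\<lambda>_. M))"
proof -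
  have "\<bar>\<integral>z. perm_det {..<m} (a z) * w z \<partial>Pi\<^sub>M I (\<lambda>_. M)\<bar> \<le> (\<integral>z. B ^ m * hadamard_const m * w' z \<partial>Pi\<^sub>M I (\<lambda>_. M))"
  proof (rule abs_integral_le)
    fix z
    show "\<bar>perm_det {..<m} (a z) * w z\<bar> \<le> B ^ m * hadamard_const m * w' z"
      using abs_det_le_hadamard[of "a z" B m, OF a] le[of z] B_nonneg hadamard_const_nonneg
      by (simp add: abs_mult perm_det_def mult_mono)
  qed (use w' in auto)
  then show ?thesis by simp
qed

lemma weighted_prod_integral:
  fixes w v :: "'a \<Rightarrow> real"
  assumes "finite I" "a \<in> I" "integrable M w" "integrable M v"
  shows "(\<integral>z. v (z a) * (\<Prod>i\<in>I - {a}. w (z i)) \<partial>Pi\<^sub>M I (\<lambda>_::nat. M)) =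
      (\<integral>z. v z \<partial>M) * (\<integral>z. w z \<partial>M) ^ (card I - 1)"
    and "integrable (Pi\<^sub>M I (\<lambda>_::nat. M)) (\<lambda>z. v (z a) * (\<Prod>i\<in>I - {a}. w (z i)))"
proof -
  have split: "(\<Prod>i\<in>I. (f i :: real)) = f a * (\<Prod>i\<in>I - {a}. f i)" for f
    using assms by (subst prod.remove[of I a]) auto
  have *: "v (z a) * (\<Prod>i\<in>I - {a}. w (z i)) = (\<Prod>i\<in>I. (if i = a then v else w) (z i))" for z
    unfolding split by simp
  show "integrable (Pi\<^sub>M I (\<lambda>_::nat. M)) (\<lambda>z. v (z a) * (\<Prod>i\<in>I - {a}. w (z i)))"
    unfolding * using assms by (intro product_integrable_prod) auto
  have "(\<integral>z. (\<Prod>i\<in>I. (if i = a then v else w) (z i)) \<partial>Pi\<^sub>M I (\<lambda>_::nat. M)) =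
      (\<Prod>i\<in>I. \<integral>z. (if i = a then v else w) z \<partial>M)"
    using assms by (intro product_integral_prod) auto
  also have "\<dots> = (\<integral>z. v z \<partial>M) * (\<integral>z. w z \<partial>M) ^ (card I - 1)"
    unfolding split using assms by simp
  finally show "(\<integral>z. v (z a) * (\<Prod>i\<in>I - {a}. w (z i)) \<partial>Pi\<^sub>M I (\<lambda>_::nat. M)) =
      (\<integral>z. v z \<partial>M) * (\<integral>z. w z \<partial>M) ^ (card I - 1)" unfolding * .
qed

lemma abs_fredholm_minor_le:
  assumes w: "integrable M w"
  shows "\<bar>fredholm_minor w n x y\<bar> \<le> B ^ Suc n * hadamard_const (Suc n) * (\<integral>z. \<bar>w z\<bar> \<partial>M) ^ n"
proof -
  have "fredholm_minor w n x y = weighted_minor w {..<n} n x y"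
    using weighted_minor_eq(2)[of "{..<n}" n w x y] w by simp
  also have "\<bar>\<dots>\<bar> \<le> B ^ Suc n * hadamard_const (Suc n) * (\<integral>z. (\<Prod>i\<in>{..<n}. \<bar>w (z i)\<bar>) \<partial>Pi\<^sub>M {..<n} (\<lambda>_. M))"
    unfolding weighted_minor_def lessThan_Suc[symmetric]
    by (rule abs_det_integral_le[OF refl]) (use w in \<open>auto simp: abs_prod kernel_bound intro!: product_integrable_prod\<close>)
  also have "(\<integral>z. (\<Prod>i\<in>{..<n}. \<bar>w (z i)\<bar>) \<partial>Pi\<^sub>M {..<n} (\<lambda>_. M)) = (\<integral>z. \<bar>w z\<bar> \<partial>M) ^ n"
    by (subst product_integral_prod) (use w in auto)
  finally show ?thesis .
qed

lemma abs_fredholm_coeff_le: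
  assumes w: "integrable M w"
  shows "\<bar>fredholm_coeff w n\<bar> \<le> B ^ n * hadamard_const n * (\<integral>z. \<bar>w z\<bar> \<partial>M) ^ n"
proof -
  have "fredholm_coeff w n = weighted_det w {..<n}"
    using weighted_minor_eq(1)[of "{..<n}" n w] w by simp
  also have "\<bar>\<dots>\<bar> \<le> B ^ n * hadamard_const n * (\<integral>z. (\<Prod>i\<in>{..<n}. \<bar>w (z i)\<bar>) \<partial>Pi\<^sub>M {..<n} (\<lambda>_. M))"
    unfolding weighted_det_def
    by (rule abs_det_integral_le[OF refl]) (use w in \<open>auto simp: abs_prod kernel_bound intro!: product_integrable_prod\<close>)
  also have "(\<integral>z. (\<Prod>i\<in>{..<n}. \<bar>w (z i)\<bar>) \<partial>Pi\<^sub>M {..<n} (\<lambda>_. M)) = (\<integral>z. \<bar>w z\<bar> \<partial>M) ^ n"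
    by (subst product_integral_prod) (use w in auto)
  finally show ?thesis .
qed

text \<open>Multilinearity of the weight product. The n terms of first order agree by symmetry, and
  each is an integral over the diagonal of the minor of order n - 1; at n = 0 the factor n makes the
  truncated subtraction harmless.\<close>

lemma fredholm_coeff_add:
  assumes w: "integrable M w" and v: "integrable M v"
    and C: "(\<integral>z. \<bar>w z\<bar> \<partial>M) + (\<integral>z. \<bar>v z\<bar> \<partial>M) \<le> C" "1 \<le> C"
  shows "\<bar>fredholm_coeff (\<lambda>z. w z + v z) n - fredholm_coeff w n - real n * (\<integral>t. v t * fredholm_minor w (n - 1) t t \<partial>M)\<bar>
    \<le> (B ^ n * hadamard_const n) * ((real n)\<^sup>2 * (\<integral>z. \<bar>v z\<bar> \<partial>M)\<^sup>2 * C ^ n)"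
proof -
  define I where "I = {..<n}"
  have fin: "finite I" and card: "card I = n" and nI: "n \<notin> I" by (auto simp: I_def)
  let ?det = "\<lambda>z. perm_det I (\<lambda>i j. k (z i) (z j))"
  let ?P = "Pi\<^sub>M I (\<lambda>_::nat. M)"
  define W V where "W = (\<integral>z. \<bar>w z\<bar> \<partial>M)" and "V = (\<integral>z. \<bar>v z\<bar> \<partial>M)"
  have one: "(\<integral>z. ?det z * (v (z a) * (\<Prod>i\<in>I - {a}. w (z i))) \<partial>?P) = (\<integral>t. v t * fredholm_minor w (n - 1) t t \<partial>M)"
    and one_int: "integrable ?P (\<lambda>z. ?det z * (v (z a) * (\<Prod>i\<in>I - {a}. w (z i))))" if "a \<in> I" for a
  proof -
    have I: "I = insert a (I - {a})" using that by auto
    have "card (I - {a}) = n - 1" using that card fin by simp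
    then have wm: "weighted_minor w (I - {a}) a t t = fredholm_minor w (n - 1) t t" for t
      using weighted_minor_eq(2)[of "I - {a}" a w t t] fin w by simp
    show "(\<integral>z. ?det z * (v (z a) * (\<Prod>i\<in>I - {a}. w (z i))) \<partial>?P) = (\<integral>t. v t * fredholm_minor w (n - 1) t t \<partial>M)"
      using det_integral_insert[of "I - {a}" a w v] fin w v I[symmetric] wm by simp
    have *: "v (z a) * (\<Prod>i\<in>I - {a}. w (z i)) = (\<Prod>i\<in>I. (if i = a then v else w) (z i))" for z
      using that fin by (subst prod.remove[of I a]) auto
    show "integrable ?P (\<lambda>z. ?det z * (v (z a) * (\<Prod>i\<in>I - {a}. w (z i))))"
      unfolding * using fin w v by (intro integrable_det_integrand) auto
  qed
  have wv: "integrable M (\<lambda>z. w z + v z)" using w v by simp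
  have int1: "integrable ?P (\<lambda>z. ?det z * (\<Prod>i\<in>I. w (z i) + v (z i)))"
    by (rule integrable_det_integrand[of I "\<lambda>_ z. w z + v z"]) (use fin wv in auto)
  have int2: "integrable ?P (\<lambda>z. ?det z * (\<Prod>i\<in>I. w (z i)))"
    by (rule integrable_det_integrand[of I "\<lambda>_. w"]) (use fin w in auto)
  have "fredholm_coeff (\<lambda>z. w z + v z) n - fredholm_coeff w n - real n * (\<integral>t. v t * fredholm_minor w (n - 1) t t \<partial>M)
     = weighted_det (\<lambda>z. w z + v z) I - weighted_det w I - (\<Sum>a\<in>I. (\<integral>z. ?det z * (v (z a) * (\<Prod>i\<in>I - {a}. w (z i))) \<partial>?P))"
    using weighted_minor_eq(1)[OF fin nI wv] weighted_minor_eq(1)[OF fin nI w] one card by simp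
  also have "\<dots> = (\<integral>z. ?det z * (\<Prod>i\<in>I. w (z i) + v (z i)) - ?det z * (\<Prod>i\<in>I. w (z i))
      - (\<Sum>a\<in>I. ?det z * (v (z a) * (\<Prod>i\<in>I - {a}. w (z i)))) \<partial>?P)"
    unfolding weighted_det_def using int1 int2 one_int
    by (simp add: Bochner_Integration.integral_diff Bochner_Integration.integral_sum)
  also have "\<dots> = (\<integral>z. ?det z * ((\<Prod>i\<in>I. w (z i) + v (z i)) - (\<Prod>i\<in>I. w (z i))
      - (\<Sum>a\<in>I. v (z a) * (\<Prod>i\<in>I - {a}. w (z i)))) \<partial>?P)"
    by (simp add: right_diff_distrib sum_distrib_left)
  finally have eq: "fredholm_coeff (\<lambda>z. w z + v z) n - fredholm_coeff w n - real n * (\<integral>t. v t * fredholm_minor w (n - 1) t t \<partial>M)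
     = \<dots>" .
  let ?h = "\<lambda>z. (\<Prod>i\<in>I. \<bar>w (z i)\<bar> + \<bar>v (z i)\<bar>) - (\<Prod>i\<in>I. \<bar>w (z i)\<bar>)
      - (\<Sum>a\<in>I. \<bar>v (z a)\<bar> * (\<Prod>i\<in>I - {a}. \<bar>w (z i)\<bar>))"
  let ?g = "\<lambda>z. (\<Prod>i\<in>I. w (z i) + v (z i)) - (\<Prod>i\<in>I. w (z i))
      - (\<Sum>a\<in>I. v (z a) * (\<Prod>i\<in>I - {a}. w (z i)))"
  have prods: "integrable ?P (\<lambda>z. \<Prod>i\<in>I. \<bar>w (z i)\<bar> + \<bar>v (z i)\<bar>)" "integrable ?P (\<lambda>z. \<Prod>i\<in>I. \<bar>w (z i)\<bar>)"
    "integrable ?P (\<lambda>z. \<Prod>i\<in>I. w (z i) + v (z i))" "integrable ?P (\<lambda>z. \<Prod>i\<in>I. w (z i))"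
    using product_integrable_prod[of I "\<lambda>_ z. \<bar>w z\<bar> + \<bar>v z\<bar>"] product_integrable_prod[of I "\<lambda>_ z. \<bar>w z\<bar>"]
      product_integrable_prod[of I "\<lambda>_ z. w z + v z"] product_integrable_prod[of I "\<lambda>_. w"] fin w v by auto
  have single: "integrable ?P (\<lambda>z. \<bar>v (z a)\<bar> * (\<Prod>i\<in>I - {a}. \<bar>w (z i)\<bar>))" "integrable ?P (\<lambda>z. v (z a) * (\<Prod>i\<in>I - {a}. w (z i)))"
    "(\<integral>z. \<bar>v (z a)\<bar> * (\<Prod>i\<in>I - {a}. \<bar>w (z i)\<bar>) \<partial>?P) = V * W ^ (n - 1)" if "a \<in> I" for a
    using weighted_prod_integral[OF fin that, of "\<lambda>z. \<bar>w z\<bar>" "\<lambda>z. \<bar>v z\<bar>"] weighted_prod_integral[OF fin that, of w v] w v card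
    by (auto simp: V_def W_def)
  have sums: "integrable ?P (\<lambda>z. \<Sum>a\<in>I. \<bar>v (z a)\<bar> * (\<Prod>i\<in>I - {a}. \<bar>w (z i)\<bar>))"
    "integrable ?P (\<lambda>z. \<Sum>a\<in>I. v (z a) * (\<Prod>i\<in>I - {a}. w (z i)))"
    by (rule Bochner_Integration.integrable_sum, rule single, assumption)+
  note int_g = Bochner_Integration.integrable_diff[OF Bochner_Integration.integrable_diff[OF prods(3,4)] sums(2)]
  note int_h = Bochner_Integration.integrable_diff[OF Bochner_Integration.integrable_diff[OF prods(1,2)] sums(1)]
  have "\<bar>\<integral>z. perm_det {..<n} (\<lambda>i j. k (z i) (z j)) * ?g z \<partial>?P\<bar> \<le> B ^ n * hadamard_const n * (\<integral>z. ?h z \<partial>?P)"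
    by (rule abs_det_integral_le[OF I_def int_g int_h abs_prod_add_diff2_le[OF fin] kernel_bound])
  then have le: "\<bar>\<integral>z. ?det z * ?g z \<partial>?P\<bar> \<le> B ^ n * hadamard_const n * (\<integral>z. ?h z \<partial>?P)"
    unfolding I_def[symmetric] .
  have h: "(\<integral>z. ?h z \<partial>?P) = (W + V) ^ n - W ^ n - real n * V * W ^ (n - 1)"
  proof -
    have 1: "(\<integral>z. (\<Prod>i\<in>I. \<bar>w (z i)\<bar> + \<bar>v (z i)\<bar>) \<partial>?P) = (W + V) ^ n"
      using product_integral_prod[of I "\<lambda>_ z. \<bar>w z\<bar> + \<bar>v z\<bar>"] fin w v by (simp add: W_def V_def card)
    have 2: "(\<integral>z. (\<Prod>i\<in>I. \<bar>w (z i)\<bar>) \<partial>?P) = W ^ n"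
      using product_integral_prod[of I "\<lambda>_ z. \<bar>w z\<bar>"] fin w by (simp add: W_def card)
    have 3: "(\<integral>z. (\<Sum>a\<in>I. \<bar>v (z a)\<bar> * (\<Prod>i\<in>I - {a}. \<bar>w (z i)\<bar>)) \<partial>?P) = real n * V * W ^ (n - 1)"
      by (subst Bochner_Integration.integral_sum) (simp_all add: single card)
    show ?thesis
      unfolding Bochner_Integration.integral_diff[OF Bochner_Integration.integrable_diff[OF prods(1,2)] sums(1)]
        Bochner_Integration.integral_diff[OF prods(1,2)] 1 2 3 ..
  qed
  have p: "(W + V) ^ n - W ^ n - real n * V * W ^ (n - 1) \<le> (real n)\<^sup>2 * V\<^sup>2 * C ^ n"
    using C by (intro power_add_diff2_le) (auto simp: W_def V_def)
  have "B ^ n * hadamard_const n * (\<integral>z. ?h z \<partial>?P) \<le> B ^ n * hadamard_const n * ((real n)\<^sup>2 * V\<^sup>2 * C ^ n)"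
    unfolding h by (rule mult_left_mono[OF p]) (use B_nonneg hadamard_const_nonneg in auto)
  with le show ?thesis unfolding eq V_def by (rule order_trans)
qed

section \<open>Summation of Fredholm's series and of the first minor\<close>

definition fredholm_series :: "('a \<Rightarrow> real) \<Rightarrow> real" where
  "fredholm_series w = (\<Sum>n. (-1) ^ n / fact n * fredholm_coeff w n)"

definition fredholm_first_minor :: "('a \<Rightarrow> real) \<Rightarrow> 'a \<Rightarrow> 'a \<Rightarrow> real" where
  "fredholm_first_minor w x y = (\<Sum>n. (-1) ^ n / fact n * fredholm_minor w n x y)"

lemma summable_majorant:
  fixes C :: real
  assumes "0 \<le> C"
  shows "summable (\<lambda>n. (real n)\<^sup>2 * (C ^ n * hadamard_const n) / fact n)"
proof (subst summable_Suc_iff[symmetric], rule summable_comparison_test[OF _ summable_hadamard_const[of C]], intro exI allI impI)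
  fix n
  have "(real (Suc n))\<^sup>2 * (C ^ Suc n * hadamard_const (Suc n)) / fact (Suc n) \<le> (real (Suc n))\<^sup>2 * (C ^ Suc n * hadamard_const (Suc n)) / fact n"
    using assms by (intro divide_left_mono mult_nonneg_nonneg hadamard_const_nonneg fact_mono) auto
  then show "norm ((real (Suc n))\<^sup>2 * (C ^ Suc n * hadamard_const (Suc n)) / fact (Suc n)) \<le> (real (Suc n))\<^sup>2 * (C ^ Suc n * hadamard_const (Suc n)) / fact n"
    using assms hadamard_const_nonneg[of "Suc n"] by (simp add: abs_mult)
qed

lemma fredholm_coeff_term_le:
  assumes w: "integrable M w" and C: "(\<integral>z. \<bar>w z\<bar> \<partial>M) \<le> C"
  shows "\<bar>(-1) ^ n / fact n * fredholm_coeff w n\<bar> \<le> ((B * C) ^ n * hadamard_const n) / fact n"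
proof -
  have "\<bar>fredholm_coeff w n\<bar> \<le> B ^ n * hadamard_const n * (\<integral>z. \<bar>w z\<bar> \<partial>M) ^ n"
    by (rule abs_fredholm_coeff_le[OF w])
  also have "\<dots> \<le> B ^ n * hadamard_const n * C ^ n"
    using C B_nonneg hadamard_const_nonneg by (intro mult_left_mono power_mono) auto
  finally show ?thesis by (simp add: abs_mult power_abs power_mult_distrib divide_right_mono mult_ac)
qed

text \<open>The bound is padded by one power of C and by (n + 1)^2 to fit the majorant of
  \<open>summable_hadamard_const\<close>.\<close>

lemma fredholm_minor_term_le:
  assumes w: "integrable M w" and C: "(\<integral>z. \<bar>w z\<bar> \<partial>M) \<le> C" "1 \<le> C"
  shows "\<bar>(-1) ^ n / fact n * fredholm_minor w n x y\<bar> \<le> (real (Suc n))\<^sup>2 * ((B * C) ^ Suc n * hadamard_const (Suc n)) / fact n"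
proof -
  have C0: "0 \<le> (\<integral>z. \<bar>w z\<bar> \<partial>M)" by simp
  have "\<bar>fredholm_minor w n x y\<bar> \<le> B ^ Suc n * hadamard_const (Suc n) * (\<integral>z. \<bar>w z\<bar> \<partial>M) ^ n"
    by (rule abs_fredholm_minor_le[OF w])
  also have "\<dots> \<le> B ^ Suc n * hadamard_const (Suc n) * C ^ Suc n"
  proof (rule mult_left_mono)
    have "(\<integral>z. \<bar>w z\<bar> \<partial>M) ^ n \<le> C ^ n" using C C0 by (intro power_mono) auto
    also have "\<dots> \<le> C ^ Suc n" using C by (intro power_increasing) auto
    finally show "(\<integral>z. \<bar>w z\<bar> \<partial>M) ^ n \<le> C ^ Suc n" .
  qed (use B_nonneg hadamard_const_nonneg in auto)
  also have "\<dots> = 1 * ((B * C) ^ Suc n * hadamard_const (Suc n))" by (simp add: power_mult_distrib mult_ac)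
  also have "\<dots> \<le> (real (Suc n))\<^sup>2 * ((B * C) ^ Suc n * hadamard_const (Suc n))"
    using B_nonneg C hadamard_const_nonneg by (intro mult_right_mono) auto
  finally show ?thesis by (simp add: abs_mult power_abs divide_right_mono del: power_Suc of_nat_Suc)
qed

end

text \<open>The factor n + 1 cancels against (n + 1)! and one sign remains: terms that carry this
  factor, in the recursion and in the first variation, become terms of the first minor.\<close>

lemma neg_one_power_div_fact_Suc: "(-1) ^ Suc n / fact (Suc n) * (real (Suc n) * x) = - ((-1) ^ n / fact n * x)"
  by (simp del: of_nat_Suc)

context bounded_kernel
begin

lemma measurable_fredholm_minor [measurable (raw)]:
  assumes w: "w \<in> borel_measurable M" and [measurable]: "f \<in> N \<rightarrow>\<^sub>M M" "g \<in> N \<rightarrow>\<^sub>M M"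
  shows "(\<lambda>z. fredholm_minor w n (f z) (g z)) \<in> borel_measurable N"
proof -
  note w[measurable]
  have "(\<lambda>p. fredholm_minor w n (fst p) (snd p)) \<in> borel_measurable (M \<Otimes>\<^sub>M M)"
  proof (induction n)
    case (Suc n)
    have [measurable]: "(\<lambda>z. fredholm_minor w n (f z) (g z)) \<in> borel_measurable N'" 
      if [measurable]: "f \<in> N' \<rightarrow>\<^sub>M M" "g \<in> N' \<rightarrow>\<^sub>M M" for f g and N' :: "(('a \<times> 'a) \<times> 'a) measure"
    proof -
      have "(\<lambda>z. (\<lambda>p. fredholm_minor w n (fst p) (snd p)) (f z, g z)) \<in> borel_measurable N'"
        by (rule measurable_compose[OF _ Suc.IH]) measurable
      then show ?thesis by simp
    qed
    have [measurable]: "(\<lambda>p. \<integral>z. k (fst p) z * w z * fredholm_minor w n z (snd p) \<partial>M) \<in> borel_measurable (M \<Otimes>\<^sub>M M)"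
    proof -
      have "case_prod (\<lambda>p z. k (fst p) z * w z * fredholm_minor w n z (snd p)) \<in> borel_measurable ((M \<Otimes>\<^sub>M M) \<Otimes>\<^sub>M M)"
        unfolding split_beta' by measurable
      then show ?thesis
        by (rule borel_measurable_lebesgue_integral)
    qed
    show ?case
      unfolding fredholm_minor.simps by measurable
  qed simp
  then have "(\<lambda>z. (\<lambda>p. fredholm_minor w n (fst p) (snd p)) (f z, g z)) \<in> borel_measurable N"
    by (rule measurable_compose[rotated]) measurable
  then show ?thesis by simp
qed

lemma measurable_fredholm_first_minor [measurable (raw)]:
  assumes [measurable]: "w \<in> borel_measurable M" "f \<in> N \<rightarrow>\<^sub>M M" "g \<in> N \<rightarrow>\<^sub>M M"
  shows "(\<lambda>z. fredholm_first_minor w (f z) (g z)) \<in> borel_measurable N"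
  unfolding fredholm_first_minor_def by measurable

lemma summable_fredholm_minor:
  assumes w: "integrable M w"
  shows "summable (\<lambda>n. \<bar>(-1) ^ n / fact n * fredholm_minor w n x y\<bar>)"
  by (rule summable_comparison_test[OF _ summable_hadamard_const[of "B * max 1 (\<integral>z. \<bar>w z\<bar> \<partial>M)"]])
    (use fredholm_minor_term_le[OF w, of "max 1 (\<integral>z. \<bar>w z\<bar> \<partial>M)"] in auto)

lemma fredholm_first_minor_bounded:
  assumes w: "integrable M w"
  obtains C where "\<And>x y. \<bar>fredholm_first_minor w x y\<bar> \<le> C"
proof
  fix x y
  let ?C = "max 1 (\<integral>z. \<bar>w z\<bar> \<partial>M)"
  have "\<bar>fredholm_first_minor w x y\<bar> \<le> (\<Sum>n. \<bar>(-1) ^ n / fact n * fredholm_minor w n x y\<bar>)"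
    unfolding fredholm_first_minor_def by (rule summable_rabs[OF summable_fredholm_minor[OF w]])
  also have "\<dots> \<le> (\<Sum>n. (real (Suc n))\<^sup>2 * ((B * ?C) ^ Suc n * hadamard_const (Suc n)) / fact n)"
    by (rule suminf_le[OF fredholm_minor_term_le[OF w] summable_fredholm_minor[OF w] summable_hadamard_const]) auto
  finally show "\<bar>fredholm_first_minor w x y\<bar> \<le> (\<Sum>n. (real (Suc n))\<^sup>2 * ((B * ?C) ^ Suc n * hadamard_const (Suc n)) / fact n)" .
qed

text \<open>Termwise integration. The maps \<open>f\<close> and \<open>g\<close> cover the diagonal,
  for the first variation, and a fixed second argument, for
  \<open>fredholm_identity\<close>.\<close>

lemma integral_fredholm_minor_sums:
  assumes w: "integrable M w" and v: "integrable M v"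
    and [measurable]: "f \<in> M \<rightarrow>\<^sub>M M" "g \<in> M \<rightarrow>\<^sub>M M"
  shows "(\<lambda>n. (-1) ^ n / fact n * (\<integral>z. v z * fredholm_minor w n (f z) (g z) \<partial>M)) sums
      (\<integral>z. v z * fredholm_first_minor w (f z) (g z) \<partial>M)"
proof -
  have [measurable]: "w \<in> borel_measurable M" "v \<in> borel_measurable M" using w v by auto
  let ?C = "max 1 (\<integral>z. \<bar>w z\<bar> \<partial>M)"
  let ?h = "\<lambda>n. (real (Suc n))\<^sup>2 * ((B * ?C) ^ Suc n * hadamard_const (Suc n)) / fact n"
  let ?t = "\<lambda>n z. (-1) ^ n / fact n * fredholm_minor w n (f z) (g z)"
  have le: "\<bar>?t n z\<bar> \<le> ?h n" for n z by (rule fredholm_minor_term_le[OF w]) auto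
  have bd: "\<bar>v z * ?t n z\<bar> \<le> ?h n * \<bar>v z\<bar>" for n z
    using mult_right_mono[OF le[of n z] abs_ge_zero[of "v z"]] by (simp only: abs_mult mult.commute)
  have int: "integrable M (\<lambda>z. v z * ?t n z)" for n
  proof (rule Bochner_Integration.integrable_bound)
    show "integrable M (\<lambda>z. ?h n * \<bar>v z\<bar>)" using v by (intro integrable_mult_right integrable_abs)
    show "AE z in M. norm (v z * ?t n z) \<le> norm (?h n * \<bar>v z\<bar>)"
      using bd[of _ n] by (intro AE_I2) (simp only: real_norm_def, meson abs_ge_self order_trans)
  qed measurable
  have hv: "(\<integral>z. \<bar>v z * ?t n z\<bar> \<partial>M) \<le> ?h n * (\<integral>z. \<bar>v z\<bar> \<partial>M)" for n
  proof -
    have "(\<integral>z. \<bar>v z * ?t n z\<bar> \<partial>M) \<le> (\<integral>z. ?h n * \<bar>v z\<bar> \<partial>M)"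
      by (rule integral_mono[OF integrable_abs[OF int] integrable_mult_right[OF integrable_abs[OF v]] bd])
    then show ?thesis by simp
  qed
  have "(\<lambda>n. \<integral>z. v z * ?t n z \<partial>M) sums (\<integral>z. (\<Sum>n. v z * ?t n z) \<partial>M)"
  proof (rule sums_integral[OF int])
    show "AE z in M. summable (\<lambda>n. norm (v z * ?t n z))"
      using summable_mult[OF summable_fredholm_minor[OF w]] by (intro AE_I2) (simp add: abs_mult mult.assoc)
    show "summable (\<lambda>n. \<integral>z. norm (v z * ?t n z) \<partial>M)"
      by (rule summable_comparison_test[OF _ summable_mult2[OF summable_hadamard_const[of "B * ?C"], of "\<integral>z. \<bar>v z\<bar> \<partial>M"]])
        (use hv in \<open>auto simp: times_divide_eq_left\<close>)
  qed
  also have "(\<integral>z. (\<Sum>n. v z * ?t n z) \<partial>M) = (\<integral>z. v z * fredholm_first_minor w (f z) (g z) \<partial>M)"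
    unfolding fredholm_first_minor_def
    by (intro Bochner_Integration.integral_cong refl suminf_mult summable_rabs_cancel[OF summable_fredholm_minor[OF w]])
  also have "(\<lambda>n. \<integral>z. v z * ?t n z \<partial>M) = (\<lambda>n. (-1) ^ n / fact n * (\<integral>z. v z * fredholm_minor w n (f z) (g z) \<partial>M))"
    by (simp add: mult.left_commute[of "v _"])
  finally show ?thesis .
qed

lemma summable_fredholm_coeff:
  assumes w: "integrable M w"
  shows "summable (\<lambda>n. (-1) ^ n / fact n * fredholm_coeff w n)"
proof (rule summable_comparison_test)
  let ?C = "B * (\<integral>z. \<bar>w z\<bar> \<partial>M)"
  have C: "0 \<le> ?C" using B_nonneg by simp
  show "summable (\<lambda>n. (real n)\<^sup>2 * (?C ^ n * hadamard_const n) / fact n)"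
    by (rule summable_majorant[OF C])
  show "\<exists>N. \<forall>n\<ge>N. norm ((-1) ^ n / fact n * fredholm_coeff w n) \<le> (real n)\<^sup>2 * (?C ^ n * hadamard_const n) / fact n"
  proof (intro exI[of _ 1] allI impI)
    fix n :: nat assume n: "1 \<le> n"
    have "norm ((-1) ^ n / fact n * fredholm_coeff w n) \<le> 1 * (?C ^ n * hadamard_const n) / fact n"
      using fredholm_coeff_term_le[OF w order_refl, of n] by simp
    also have "\<dots> \<le> (real n)\<^sup>2 * (?C ^ n * hadamard_const n) / fact n"
      using n C hadamard_const_nonneg by (intro divide_right_mono mult_right_mono) auto
    finally show "norm ((-1) ^ n / fact n * fredholm_coeff w n) \<le> (real n)\<^sup>2 * (?C ^ n * hadamard_const n) / fact n" .
  qed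
qed

lemma fredholm_series_sums: "integrable M w \<Longrightarrow> (\<lambda>n. (-1) ^ n / fact n * fredholm_coeff w n) sums fredholm_series w"
  unfolding fredholm_series_def by (intro summable_sums summable_fredholm_coeff)

text \<open>Fredholm's first fundamental relation, the recursion summed over all orders: in its
  first argument the first minor solves the integral equation whose right-hand side is the
  determinant times a column of the kernel.\<close>

lemma fredholm_identity:
  assumes w: "integrable M w"
  shows "fredholm_first_minor w x y =
    fredholm_series w * k x y + (\<integral>z. k x z * w z * fredholm_first_minor w z y \<partial>M)"
proof -
  have w': "w \<in> borel_measurable M" using w by auto
  let ?J = "\<lambda>n. \<integral>z. (k x z * w z) * fredholm_minor w n z y \<partial>M"
  have kx: "(\<lambda>z. k x z) \<in> borel_measurable M" by (intro measurable_kernel) (auto simp: space_UNIV)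
  have "integrable M (\<lambda>z. k x z * w z)"
  proof (rule Bochner_Integration.integrable_bound)
    show "integrable M (\<lambda>z. B * w z)" using w by simp
    show "(\<lambda>z. k x z * w z) \<in> borel_measurable M" using kx w' by measurable
    show "AE z in M. norm (k x z * w z) \<le> norm (B * w z)"
      using kernel_bound[of x] B_nonneg by (intro AE_I2) (simp add: abs_mult mult_right_mono)
  qed
  from integral_fredholm_minor_sums[OF w this, of "\<lambda>z. z" "\<lambda>_. y"]
  have J: "(\<lambda>n. (-1) ^ n / fact n * ?J n) sums (\<integral>z. (k x z * w z) * fredholm_first_minor w z y \<partial>M)"
    by (simp add: space_UNIV)
  have S: "(\<lambda>n. (-1) ^ n / fact n * fredholm_coeff w n * k x y) sums (fredholm_series w * k x y)"
    by (rule sums_mult2[OF fredholm_series_sums[OF w]])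
  have "(\<lambda>n. (-1) ^ Suc n / fact (Suc n) * fredholm_minor w (Suc n) x y) =
      (\<lambda>n. (-1) ^ Suc n / fact (Suc n) * fredholm_coeff w (Suc n) * k x y + (-1) ^ n / fact n * ?J n)"
    by (simp only: fredholm_minor.simps fredholm_coeff.simps right_diff_distrib neg_one_power_div_fact_Suc fun_eq_iff) simp
  \<comment> \<open>Both terms of order 0 are \<open>k x y\<close>: the shift of the coefficients
    removes one of them, and the shift of the minors below restores the other.\<close>
  moreover have "(\<lambda>n. (-1) ^ Suc n / fact (Suc n) * fredholm_coeff w (Suc n) * k x y + (-1) ^ n / fact n * ?J n)
      sums (fredholm_series w * k x y - k x y + (\<integral>z. (k x z * w z) * fredholm_first_minor w z y \<partial>M))"
    using S by (intro sums_add J) (subst sums_Suc_iff, simp)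
  ultimately have "(\<lambda>n. (-1) ^ Suc n / fact (Suc n) * fredholm_minor w (Suc n) x y)
      sums (fredholm_series w * k x y - k x y + (\<integral>z. (k x z * w z) * fredholm_first_minor w z y \<partial>M))"
    by simp
  then have "(\<lambda>n. (-1) ^ n / fact n * fredholm_minor w n x y)
      sums (fredholm_series w * k x y + (\<integral>z. (k x z * w z) * fredholm_first_minor w z y \<partial>M))"
    by (subst (asm) sums_Suc_iff) (simp add: algebra_simps)
  then show ?thesis unfolding fredholm_first_minor_def by (rule sums_unique[symmetric])
qed

text \<open>The constant depends only on the bound for the L1 norms. So the determinant is
  differentiable in the weight with a quadratic remainder, uniformly on bounded sets of
  weights.\<close>

lemma fredholm_series_add:
  assumes C: "1 \<le> C"
  obtains A where "0 \<le> A"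
    "\<And>w v. integrable M w \<Longrightarrow> integrable M v \<Longrightarrow> (\<integral>z. \<bar>w z\<bar> \<partial>M) + (\<integral>z. \<bar>v z\<bar> \<partial>M) \<le> C \<Longrightarrow>
      \<bar>fredholm_series (\<lambda>z. w z + v z) - fredholm_series w + (\<integral>t. v t * fredholm_first_minor w t t \<partial>M)\<bar>
        \<le> A * (\<integral>z. \<bar>v z\<bar> \<partial>M)\<^sup>2"
proof
  let ?h = "\<lambda>n. (real n)\<^sup>2 * ((B * C) ^ n * hadamard_const n) / fact n"
  have BC: "0 \<le> B * C" using B_nonneg C by simp
  have sm: "summable ?h" by (rule summable_majorant[OF BC])
  show "0 \<le> (\<Sum>n. ?h n)" using sm BC hadamard_const_nonneg by (intro suminf_nonneg) auto
  fix w v :: "'a \<Rightarrow> real"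
  assume w: "integrable M w" and v: "integrable M v" and le: "(\<integral>z. \<bar>w z\<bar> \<partial>M) + (\<integral>z. \<bar>v z\<bar> \<partial>M) \<le> C"
  let ?V = "\<integral>z. \<bar>v z\<bar> \<partial>M"
  let ?J = "\<lambda>n. \<integral>z. v z * fredholm_minor w n z z \<partial>M"
  let ?f = "\<lambda>n. (-1) ^ n / fact n * (real n * ?J (n - 1))"
  let ?e = "\<lambda>n. (-1) ^ n / fact n * (fredholm_coeff (\<lambda>z. w z + v z) n - fredholm_coeff w n - real n * ?J (n - 1))"
  have "(\<lambda>n. - ((-1) ^ n / fact n * ?J n)) sums (- (\<integral>z. v z * fredholm_first_minor w z z \<partial>M))"
    using integral_fredholm_minor_sums[OF w v, of "\<lambda>z. z" "\<lambda>z. z"] by (intro sums_minus) simp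
  also have "(\<lambda>n. - ((-1) ^ n / fact n * ?J n)) = (\<lambda>n. ?f (Suc n))"
    by (simp only: fun_eq_iff neg_one_power_div_fact_Suc diff_Suc_1) simp
  finally have "?f sums (- (\<integral>z. v z * fredholm_first_minor w z z \<partial>M))"
    by (subst (asm) sums_Suc_iff) simp
  moreover have "integrable M (\<lambda>z. w z + v z)" using w v by simp
  ultimately have "(\<lambda>n. (-1) ^ n / fact n * fredholm_coeff (\<lambda>z. w z + v z) n - (-1) ^ n / fact n * fredholm_coeff w n - ?f n)
      sums (fredholm_series (\<lambda>z. w z + v z) - fredholm_series w - (- (\<integral>z. v z * fredholm_first_minor w z z \<partial>M)))"
    by (intro sums_diff fredholm_series_sums w)
  then have e: "?e sums (fredholm_series (\<lambda>z. w z + v z) - fredholm_series w + (\<integral>z. v z * fredholm_first_minor w z z \<partial>M))"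
    by (simp add: right_diff_distrib)
  have bd: "norm (?e n) \<le> ?h n * ?V\<^sup>2" for n
  proof -
    have "\<bar>fredholm_coeff (\<lambda>z. w z + v z) n - fredholm_coeff w n - real n * ?J (n - 1)\<bar>
      \<le> (B ^ n * hadamard_const n) * ((real n)\<^sup>2 * ?V\<^sup>2 * C ^ n)"
      by (rule fredholm_coeff_add[OF w v le C])
    also have "\<dots> = ((real n)\<^sup>2 * ((B * C) ^ n * hadamard_const n)) * ?V\<^sup>2"
      by (simp add: power_mult_distrib mult_ac)
    finally show ?thesis by (simp add: abs_mult divide_right_mono)
  qed
  have "norm (\<Sum>n. ?e n) \<le> (\<Sum>n. ?h n * ?V\<^sup>2)"
    by (rule norm_suminf_le[OF bd summable_mult2[OF sm]])
  then show "\<bar>fredholm_series (\<lambda>z. w z + v z) - fredholm_series w + (\<integral>t. v t * fredholm_first_minor w t t \<partial>M)\<bar> \<le> (\<Sum>n. ?h n) * ?V\<^sup>2"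
    using sums_unique[OF e] suminf_mult2[OF sm, of "?V\<^sup>2"] by simp
qed

lemma fredholm_coeff_scale:
  assumes w: "integrable M w"
  shows "fredholm_coeff (\<lambda>z. c * w z) n = c ^ n * fredholm_coeff w n"
proof -
  have cw: "integrable M (\<lambda>z. c * w z)" using w by simp
  have "weighted_det (\<lambda>z. c * w z) {..<n} = c ^ n * weighted_det w {..<n}"
    unfolding weighted_det_def by (simp add: prod.distrib mult.left_commute)
  then show ?thesis
    using weighted_minor_eq(1)[of "{..<n}" n w] weighted_minor_eq(1)[of "{..<n}" n "\<lambda>z. c * w z"] w cw by simp
qed

lemma fredholm_series_eq_det:
  assumes w: "integrable M w"
  shows "fredholm_series w = (\<Sum>N. (-1) ^ N / fact N * (\<integral>z. (\<Sum>p | p permutes {..<N}. of_int (sign p) *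
      (\<Prod>a<N. k (z a) (z (p a)) * w (z (p a)))) \<partial>Pi\<^sub>M {..<N} (\<lambda>_. M)))"
proof -
  have "(\<Sum>p | p permutes {..<N}. of_int (sign p) * (\<Prod>a<N. k (z a) (z (p a)) * w (z (p a)))) =
      perm_det {..<N} (\<lambda>i j. k (z i) (z j)) * (\<Prod>i<N. w (z i))" for z :: "nat \<Rightarrow> 'a" and N
    unfolding perm_det_def sum_distrib_right
  proof (rule sum.cong[OF refl])
    fix p assume "p \<in> {p. p permutes {..<N}}"
    then have "p permutes {..<N}" by simp
    then have "(\<Prod>a<N. w (z (p a))) = (\<Prod>a<N. w (z a))"
      using prod.permute[of p "{..<N}" "\<lambda>a. w (z a)"] by (simp add: o_def)
    then show "of_int (sign p) * (\<Prod>a<N. k (z a) (z (p a)) * w (z (p a))) =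
        of_int (sign p) * (\<Prod>i<N. k (z i) (z (p i))) * (\<Prod>i<N. w (z i))"
      by (simp add: prod.distrib)
  qed
  moreover have "fredholm_coeff w N = weighted_det w {..<N}" for N
    using weighted_minor_eq(1)[of "{..<N}" N w] w by simp
  ultimately show ?thesis unfolding fredholm_series_def weighted_det_def by simp
qed

text \<open>
  A nonconstant entire function has no interval of zeros, and \<open>fredholm_series (\<lambda>z. c * w z)\<close> is
  entire in \<open>c\<close> with value \<open>1\<close> at \<open>c = 0\<close>.
\<close>

lemma fredholm_series_not_zero_on_interval:
  assumes w: "integrable M w" and "a < b"
  obtains c where "a < c" "c < b" "fredholm_series (\<lambda>z. c * w z) \<noteq> 0"
proof (rule ccontr)
  assume "\<not> thesis"
  with that have zero: "fredholm_series (\<lambda>z. c * w z) = 0" if "a < c" "c < b" for c using that by blast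
  define h where "h n = complex_of_real ((-1) ^ n / fact n * fredholm_coeff w n)" for n
  have real_sums: "(\<lambda>n. h n * of_real c ^ n) sums of_real (fredholm_series (\<lambda>z. c * w z))" for c
  proof -
    have "(\<lambda>n. (-1) ^ n / fact n * fredholm_coeff (\<lambda>z. c * w z) n) sums fredholm_series (\<lambda>z. c * w z)"
      using w by (intro fredholm_series_sums) simp
    then have "(\<lambda>n. complex_of_real ((-1) ^ n / fact n * fredholm_coeff (\<lambda>z. c * w z) n)) sums of_real (fredholm_series (\<lambda>z. c * w z))"
      by (rule sums_of_real)
    then show ?thesis by (simp add: h_def fredholm_coeff_scale[OF w] mult_ac)
  qed
  have summ: "summable (\<lambda>n. h n * z ^ n)" for z
  proof (rule powser_inside)
    show "summable (\<lambda>n. h n * (of_real (norm z + 1)) ^ n)" using real_sums by (rule sums_summable)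
    show "norm z < norm (complex_of_real (norm z + 1))" by simp
  qed
  define H where "H z = (\<Sum>n. h n * z ^ n)" for z
  have "(\<lambda>n. h n * (z - 0) ^ n) sums H z" for z
    unfolding H_def using summable_sums[OF summ] by simp
  then have hol: "H holomorphic_on ball 0 R" for R
    by (rule power_series_holomorphic)
  have Hreal: "H (of_real c) = of_real (fredholm_series (\<lambda>z. c * w z))" for c
    using sums_unique[OF real_sums[of c]] unfolding H_def by simp
  have "H field_differentiable at z" for z
    using holomorphic_on_imp_differentiable_at[OF hol open_ball, of z "norm z + 1"] by simp
  then have "H holomorphic_on UNIV" by (simp add: holomorphic_on_def)
  have "H 0 = 0"
  proof (rule analytic_continuation[of H UNIV "of_real ` {a<..<b}" "of_real ((a + b) / 2)"])
    show "complex_of_real ((a + b) / 2) islimpt complex_of_real ` {a<..<b}"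
    proof (rule islimpt_isCont_image)
      have "((a + b) / 2) \<in> {a<..<b}" using \<open>a < b\<close> by simp
      then show "(a + b) / 2 islimpt {a<..<b}" by (simp add: interior_limit_point)
      show "\<forall>\<^sub>F y in at ((a + b) / 2). complex_of_real y \<noteq> complex_of_real ((a + b) / 2)"
        unfolding of_real_eq_iff by (simp add: eventually_at_filter)
    qed auto
  qed (use \<open>H holomorphic_on UNIV\<close> zero Hreal in auto)
  moreover have "fredholm_series (\<lambda>z. 0 * w z) = 1"
  proof -
    have "(\<lambda>n. h n * of_real 0 ^ n) sums h 0" by (simp add: powser_sums_zero)
    from sums_unique2[OF this real_sums[of 0]] show ?thesis by (simp add: h_def)
  qed
  ultimately show False using Hreal[of 0] by simp
qed

end

section \<open>Antiderivatives and alternating sums over end-points\<close>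

text \<open>At each x one of the two integrals is over an empty or one-point set, so this is the
  antiderivative that vanishes at 0, for x of either sign.\<close>

definition antideriv :: "(real \<Rightarrow> 'b::banach) \<Rightarrow> real \<Rightarrow> 'b" where
  "antideriv g x = integral {0..x} g - integral {x..0} g"

lemma antideriv_has_vector_derivative:
  fixes g :: "real \<Rightarrow> 'b::banach"
  assumes g: "continuous_on UNIV g"
  shows "(antideriv g has_vector_derivative g x) (at x)"
proof -
  define R where "R = \<bar>x\<bar> + 1"
  have int: "g integrable_on {a..b}" for a b
    by (rule integrable_continuous_real[OF continuous_on_subset[OF g]]) simp
  have eq: "integral {-R..y} g - integral {-R..0} g = antideriv g y" if "y \<in> {-R<..<R}" for y
  proof (cases "0 \<le> y")
    case True
    then have "integral {-R..0} g + integral {0..y} g = integral {-R..y} g"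
      using that by (intro Henstock_Kurzweil_Integration.integral_combine int) (auto simp: R_def)
    moreover have "integral {y..0} g = 0" using True by (cases "y = 0") auto
    ultimately show ?thesis by (simp add: antideriv_def algebra_simps)
  next
    case False
    then have "integral {-R..y} g + integral {y..0} g = integral {-R..0} g"
      using that by (intro Henstock_Kurzweil_Integration.integral_combine int) (auto simp: R_def)
    moreover have "integral {0..y} g = 0" using False by auto
    ultimately show ?thesis by (simp add: antideriv_def algebra_simps)
  qed
  have "((\<lambda>y. integral {-R..y} g) has_vector_derivative g x) (at x within {-R..R})"
    by (rule integral_has_vector_derivative[OF continuous_on_subset[OF g]]) (auto simp: R_def)
  then have "((\<lambda>y. integral {-R..y} g) has_vector_derivative g x) (at x)"
    by (subst (asm) at_within_Icc_at) (auto simp: R_def)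
  then have "((\<lambda>y. integral {-R..y} g - integral {-R..0} g) has_vector_derivative g x) (at x)"
    by (auto intro!: derivative_eq_intros)
  then show ?thesis
    by (rule has_vector_derivative_transform_within_open[where S="{-R<..<R}"]) (use eq in \<open>auto simp: R_def\<close>)
qed

lemma antideriv_0 [simp]: "antideriv g 0 = 0"
  by (simp add: antideriv_def)

lemma vector_derivative_zero_diff:
  fixes G :: "real \<Rightarrow> 'b::real_normed_vector"
  assumes "\<And>x. (G has_vector_derivative 0) (at x)"
  shows "G x = G y"
proof -
  have "\<exists>c. \<forall>x\<in>UNIV. G x = c"
    by (rule has_derivative_zero_constant) (use assms in \<open>auto simp: has_vector_derivative_def\<close>)
  then show ?thesis by auto
qed

lemma antideriv_eq:
  fixes G :: "real \<Rightarrow> 'b::banach"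
  assumes g: "continuous_on UNIV g" and G: "\<And>x. (G has_vector_derivative g x) (at x)"
  shows "antideriv g x = G x - G 0"
proof -
  have "antideriv g x - G x = antideriv g 0 - G 0"
    by (rule vector_derivative_zero_diff)
      (use has_vector_derivative_diff[OF antideriv_has_vector_derivative[OF g] G] in auto)
  then show ?thesis by (simp add: algebra_simps)
qed

lemma antideriv_lipschitz:
  fixes g :: "real \<Rightarrow> 'b::banach"
  assumes g: "continuous_on UNIV g" and C: "\<And>x. norm (g x) \<le> C"
  shows "norm (antideriv g a - antideriv g b) \<le> C * \<bar>a - b\<bar>"
proof -
  have "norm (antideriv g a - antideriv g b) \<le> C * norm (a - b)"
  proof (rule differentiable_bound[where S = UNIV and f' = "\<lambda>x t. t *\<^sub>R g x"])
    fix x :: real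
    show "(antideriv g has_derivative (\<lambda>t. t *\<^sub>R g x)) (at x within UNIV)"
      using antideriv_has_vector_derivative[OF g, of x] by (simp add: has_vector_derivative_def)
    show "onorm (\<lambda>t. t *\<^sub>R g x) \<le> C"
      by (rule onorm_le) (auto simp: mult.commute[of C] intro!: mult_left_mono C)
  qed auto
  then show ?thesis by simp
qed

lemma antideriv_add:
  fixes f g :: "real \<Rightarrow> 'b::banach"
  assumes "continuous_on UNIV f" "continuous_on UNIV g"
  shows "antideriv (\<lambda>x. f x + g x) x = antideriv f x + antideriv g x"
  by (subst antideriv_eq[where G = "\<lambda>x. antideriv f x + antideriv g x"])
    (auto intro!: continuous_on_add assms has_vector_derivative_add antideriv_has_vector_derivative)

lemma antideriv_bounded_linear:
  fixes g :: "real \<Rightarrow> 'b::banach" and T :: "'b \<Rightarrow> 'c::banach"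
  assumes T: "bounded_linear T" and g: "continuous_on UNIV g"
  shows "antideriv (\<lambda>x. T (g x)) x = T (antideriv g x)"
  using bounded_linear.linear[OF T]
  by (subst antideriv_eq[where G = "\<lambda>x. T (antideriv g x)"])
    (auto intro!: bounded_linear.continuous_on[OF T] g bounded_linear.has_vector_derivative[OF T]
      antideriv_has_vector_derivative simp: linear_0)

text \<open>
  For ordered \<open>\<xi>\<close> this is \<open>\<Sum>\<^sub>k\<close> of the integral of \<open>f\<^sub>k v\<^sub>k\<close> over \<open>X\<^sub>k\<close>, with values in a Banach space; the form chosen
  makes sense and is differentiable for all \<open>\<xi>\<close>.
\<close>

definition vec_op ::
  "('e::finite \<Rightarrow> 'm::finite \<times> nat) \<Rightarrow> ('m \<Rightarrow> real \<Rightarrow> 'b::banach) \<Rightarrow> real^'e \<Rightarrow> 'm bc_space \<Rightarrow> 'b" where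
  "vec_op ix v \<xi> f = - (\<Sum>e\<in>UNIV. endpoint_sign ix e *\<^sub>R
      antideriv (\<lambda>y. (apply_bcontfun f y $ fst (ix e)) *\<^sub>R v (fst (ix e)) y) (\<xi> $ e))"

lemma abs_endpoint_sign [simp]: "\<bar>endpoint_sign ix e\<bar> = 1"
  by (simp add: endpoint_sign_def power_abs)

lemma abs_bcontfun_nth_le: "\<bar>apply_bcontfun f y $ k\<bar> \<le> norm f" for f :: "'m::finite bc_space"
  using component_le_norm_cart[of "apply_bcontfun f y" k] norm_bounded[of f y] by linarith

lemma continuous_on_bcontfun_nth [continuous_intros]:
  "continuous_on S (\<lambda>y. apply_bcontfun f y $ k)" for f :: "'m::finite bc_space"
  by (intro bounded_linear.continuous_on[OF bounded_linear_vec_nth] continuous_on_apply_bcontfun)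

lemma bounded_linear_eval: "bounded_linear (\<lambda>f :: 'm::finite bc_space. apply_bcontfun f x $ i)"
proof
  have "norm (apply_bcontfun f x $ i) \<le> norm f * 1" for f :: "'m bc_space"
    using abs_bcontfun_nth_le[of f x i] by simp
  then show "\<exists>K. \<forall>f :: 'm bc_space. norm (apply_bcontfun f x $ i) \<le> norm f * K" by blast
qed auto

text \<open>One function for each block. Values in the function space yield the operator
  \<open>K\<close>; real values yield its components and linear functionals.\<close>

locale cont_family =
  fixes v :: "'m::finite \<Rightarrow> real \<Rightarrow> 'b::banach" and C :: real
  assumes cont: "continuous_on UNIV (v k)" and bound: "norm (v k y) \<le> C"
begin

lemma C_nonneg: "0 \<le> C" using bound[of undefined 0] norm_ge_zero order_trans by blast

lemma cont_integrand: "continuous_on UNIV (\<lambda>y. (apply_bcontfun f y $ k) *\<^sub>R v k y)"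
  by (intro continuous_intros cont)

lemma bound_integrand: "norm ((apply_bcontfun f y $ k) *\<^sub>R v k y) \<le> C * norm f"
  using abs_bcontfun_nth_le[of f y k] bound[of k y] C_nonneg
  by (simp add: mult.commute[of C] mult_mono)

lemma vec_op_lipschitz:
  "norm (vec_op ix v \<xi> f - vec_op ix v \<eta> f) \<le> C * norm f * (\<Sum>e\<in>UNIV. \<bar>\<xi> $ e - \<eta> $ e\<bar>)"
proof -
  let ?A = "\<lambda>e. antideriv (\<lambda>y. (apply_bcontfun f y $ fst (ix e)) *\<^sub>R v (fst (ix e)) y)"
  have "vec_op ix v \<xi> f - vec_op ix v \<eta> f = - (\<Sum>e\<in>UNIV. endpoint_sign ix e *\<^sub>R (?A e (\<xi> $ e) - ?A e (\<eta> $ e)))"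
    by (simp add: vec_op_def scaleR_diff_right sum_subtractf)
  also have "norm \<dots> \<le> (\<Sum>e\<in>UNIV. norm (endpoint_sign ix e *\<^sub>R (?A e (\<xi> $ e) - ?A e (\<eta> $ e))))"
    unfolding norm_minus_cancel by (rule norm_sum)
  also have "\<dots> \<le> (\<Sum>e\<in>UNIV. C * norm f * \<bar>\<xi> $ e - \<eta> $ e\<bar>)"
    by (rule sum_mono) (simp add: antideriv_lipschitz[OF cont_integrand bound_integrand])
  finally show ?thesis by (simp add: sum_distrib_left)
qed

lemma bounded_linear_vec_op: "bounded_linear (vec_op ix v \<xi>)"
proof
  show "vec_op ix v \<xi> (f + g) = vec_op ix v \<xi> f + vec_op ix v \<xi> g" for f g
    by (simp add: vec_op_def scaleR_left_distrib scaleR_right_distrib antideriv_add cont_integrand sum.distrib)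
  show "vec_op ix v \<xi> (c *\<^sub>R f) = c *\<^sub>R vec_op ix v \<xi> f" for c f
  proof -
    have "antideriv (\<lambda>y. (c * apply_bcontfun f y $ k) *\<^sub>R v k y) x = c *\<^sub>R antideriv (\<lambda>y. (apply_bcontfun f y $ k) *\<^sub>R v k y) x" for k x
      using antideriv_bounded_linear[OF bounded_linear_scaleR_right[of c] cont_integrand[of f k]] by simp
    then show ?thesis by (simp add: vec_op_def scaleR_sum_right mult.commute)
  qed
  have "vec_op ix v 0 f = 0" for f by (simp add: vec_op_def)
  then show "\<exists>K. \<forall>f. norm (vec_op ix v \<xi> f) \<le> norm f * K"
    using vec_op_lipschitz[of ix \<xi> _ 0] by (intro exI[of _ "C * (\<Sum>e\<in>UNIV. \<bar>\<xi> $ e\<bar>)"]) (auto simp: mult_ac)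
qed

lemma Blinfun_vec_op: "blinfun_apply (Blinfun (vec_op ix v \<xi>)) = vec_op ix v \<xi>"
  by (rule bounded_linear_Blinfun_apply[OF bounded_linear_vec_op])

lemma Blinfun_vec_op_tendsto: "((\<lambda>\<eta>. Blinfun (vec_op ix v \<eta>)) \<longlongrightarrow> Blinfun (vec_op ix v \<xi>)) (at \<xi>)"
proof -
  have "norm (Blinfun (vec_op ix v \<eta>) - Blinfun (vec_op ix v \<xi>)) \<le> C * (\<Sum>e\<in>UNIV. \<bar>\<eta> $ e - \<xi> $ e\<bar>)" for \<eta>
    by (rule norm_blinfun_bound)
      (use vec_op_lipschitz[of ix \<eta> _ \<xi>] C_nonneg in \<open>auto simp: blinfun.diff_left Blinfun_vec_op mult_ac intro!: mult_nonneg_nonneg sum_nonneg\<close>)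
  then have ev: "\<forall>\<^sub>F \<eta> in at \<xi>. norm (Blinfun (vec_op ix v \<eta>) - Blinfun (vec_op ix v \<xi>)) \<le> C * (\<Sum>e\<in>UNIV. \<bar>\<eta> $ e - \<xi> $ e\<bar>)"
    by (intro always_eventually allI)
  have "((\<lambda>\<eta>. C * (\<Sum>e\<in>UNIV. \<bar>\<eta> $ e - \<xi> $ e\<bar>)) \<longlongrightarrow> C * (\<Sum>e\<in>UNIV. \<bar>\<xi> $ e - \<xi> $ e\<bar>)) (at \<xi>)"
    by (intro tendsto_intros)
  then have lim: "((\<lambda>\<eta>. C * (\<Sum>e\<in>UNIV. \<bar>\<eta> $ e - \<xi> $ e\<bar>)) \<longlongrightarrow> 0) (at \<xi>)" by simp
  show ?thesis by (rule LIM_zero_cancel[OF Lim_null_comparison[OF ev lim]])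
qed

lemma vec_op_has_derivative:
  "((\<lambda>\<xi>. vec_op ix v \<xi> f) has_derivative
     (\<lambda>h. - (\<Sum>e\<in>UNIV. (endpoint_sign ix e * h $ e * apply_bcontfun f (\<xi> $ e) $ fst (ix e)) *\<^sub>R v (fst (ix e)) (\<xi> $ e)))) (at \<xi>)"
proof -
  let ?A = "\<lambda>e. antideriv (\<lambda>y. (apply_bcontfun f y $ fst (ix e)) *\<^sub>R v (fst (ix e)) y)"
  have "((\<lambda>\<xi>. ?A e (\<xi> $ e)) has_derivative (\<lambda>h. (h $ e) *\<^sub>R ((apply_bcontfun f (\<xi> $ e) $ fst (ix e)) *\<^sub>R v (fst (ix e)) (\<xi> $ e)))) (at \<xi>)" for e
    by (rule has_derivative_compose[OF bounded_linear.has_derivative[OF bounded_linear_vec_nth has_derivative_ident]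
          antideriv_has_vector_derivative[OF cont_integrand, unfolded has_vector_derivative_def]])
  then have "((\<lambda>\<xi>. - (\<Sum>e\<in>UNIV. endpoint_sign ix e *\<^sub>R ?A e (\<xi> $ e))) has_derivative
      (\<lambda>h. - (\<Sum>e\<in>UNIV. endpoint_sign ix e *\<^sub>R (h $ e) *\<^sub>R ((apply_bcontfun f (\<xi> $ e) $ fst (ix e)) *\<^sub>R v (fst (ix e)) (\<xi> $ e))))) (at \<xi>)"
    by (intro has_derivative_minus has_derivative_sum has_derivative_scaleR_right)
  then show ?thesis by (simp add: vec_op_def mult.assoc)
qed

text \<open>Bounded operators pass under the integral. An evaluation as \<open>T\<close> gives the
  components of K f; an evaluation after the resolvent gives the kernel of \<rho> K.\<close>

lemma vec_op_compose:
  assumes T: "bounded_linear T"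
  shows "T (vec_op ix v \<xi> f) = vec_op ix (\<lambda>k y. T (v k y)) \<xi> f"
proof -
  have "T (vec_op ix v \<xi> f) = - (\<Sum>e\<in>UNIV. endpoint_sign ix e *\<^sub>R
      T (antideriv (\<lambda>y. (apply_bcontfun f y $ fst (ix e)) *\<^sub>R v (fst (ix e)) y) (\<xi> $ e)))"
    unfolding vec_op_def using bounded_linear.linear[OF T]
    by (simp add: linear_neg linear_sum linear_cmul)
  also have "\<dots> = vec_op ix (\<lambda>k y. T (v k y)) \<xi> f"
    unfolding vec_op_def antideriv_bounded_linear[OF T cont_integrand, symmetric]
    using bounded_linear.linear[OF T] by (simp add: linear_cmul)
  finally show ?thesis .
qed

end

text \<open>End-points alternate in sign, so sums over a block pair up into its intervals.\<close>

lemma sum_block: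
  fixes F :: "'e::finite \<Rightarrow> 'b::real_normed_vector"
  assumes ix: "endpoint_indexing n ix"
  shows "(\<Sum>e | fst (ix e) = k. endpoint_sign ix e *\<^sub>R F e) =
    (\<Sum>t<n k. F (the_inv ix (k, 2 * t + 1)) - F (the_inv ix (k, 2 * t + 2)))"
proof -
  have bij: "bij_betw ix UNIV (SIGMA k:UNIV. {1..2 * n k})" using ix by (simp add: endpoint_indexing_def)
  have inj: "inj ix" using bij by (simp add: bij_betw_def)
  have ix_inv: "ix (the_inv ix (k, w)) = (k, w)" if "w \<in> {1..2 * n k}" for w
    by (rule f_the_inv_into_f[OF inj]) (use bij that in \<open>auto simp: bij_betw_def\<close>)
  have "(\<Sum>e | fst (ix e) = k. endpoint_sign ix e *\<^sub>R F e) =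
      (\<Sum>w\<in>{1..2 * n k}. (-1) ^ (w + 1) *\<^sub>R F (the_inv ix (k, w)))"
  proof (rule sum.reindex_bij_witness[where i = "\<lambda>w. the_inv ix (k, w)" and j = "\<lambda>e. snd (ix e)"])
    fix e assume e: "e \<in> {e. fst (ix e) = k}"
    have "ix e \<in> (SIGMA k:UNIV. {1..2 * n k})" using bij by (auto simp: bij_betw_def)
    with e show "snd (ix e) \<in> {1..2 * n k}" by (auto simp: mem_Sigma_iff split: prod.splits)
    have "(k, snd (ix e)) = ix e" using e by (cases "ix e") auto
    then show *: "the_inv ix (k, snd (ix e)) = e" using the_inv_f_f[OF inj] by simp
    show "(-1) ^ (snd (ix e) + 1) *\<^sub>R F (the_inv ix (k, snd (ix e))) = endpoint_sign ix e *\<^sub>R F e"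
      by (simp only: * endpoint_sign_def)
  qed (auto simp: ix_inv)
  also have "\<dots> = (\<Sum>t<n k. F (the_inv ix (k, 2 * t + 1)) - F (the_inv ix (k, 2 * t + 2)))"
  proof -
    have "(\<Sum>w\<in>{1..2 * N}. (-1) ^ (w + 1) *\<^sub>R F (the_inv ix (k, w))) =
      (\<Sum>t<N. F (the_inv ix (k, 2 * t + 1)) - F (the_inv ix (k, 2 * t + 2)))" for N :: nat
    proof (induction N)
      case (Suc N)
      have "{1..2 * Suc N} = insert (2 * N + 2) (insert (2 * N + 1) {1..2 * N})" by auto
      then show ?case using Suc.IH by simp
    qed simp
    then show ?thesis .
  qed
  finally show ?thesis .
qed

lemma sum_by_blocks:
  fixes ix :: "'e::finite \<Rightarrow> 'm::finite \<times> nat"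
  shows "(\<Sum>e\<in>UNIV. F e) = (\<Sum>k\<in>UNIV. \<Sum>e | fst (ix e) = k. F e)"
  using sum.group[of "UNIV :: 'e set" "UNIV :: 'm set" "\<lambda>e. fst (ix e)" F] by simp

text \<open>Integration by parts in each block. The antiderivatives are normalised at 0 and not at
  an end-point, but these constants cancel because the signs of a block sum to zero.\<close>

lemma vec_op_by_parts:
  fixes v v' :: "'m::finite \<Rightarrow> real \<Rightarrow> 'b::banach"
  assumes ix: "endpoint_indexing n ix"
    and v: "cont_family v C" and v': "cont_family v' C'"
    and dv: "\<And>k y. (v k has_vector_derivative v' k y) (at y)"
    and df: "\<And>k y. ((\<lambda>y. apply_bcontfun f y $ k) has_real_derivative apply_bcontfun f' y $ k) (at y)"
  shows "vec_op ix v' \<xi> f + vec_op ix v \<xi> f' =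
    - (\<Sum>e\<in>UNIV. (endpoint_sign ix e * apply_bcontfun f (\<xi> $ e) $ fst (ix e)) *\<^sub>R v (fst (ix e)) (\<xi> $ e))"
proof -
  interpret v: cont_family v C by (rule v)
  interpret v': cont_family v' C' by (rule v')
  define G where "G k y = (apply_bcontfun f y $ k) *\<^sub>R v k y" for k y
  have "(G k has_vector_derivative (apply_bcontfun f y $ k) *\<^sub>R v' k y + (apply_bcontfun f' y $ k) *\<^sub>R v k y) (at y)" for k y
    unfolding G_def by (rule has_vector_derivative_scaleR[OF df dv])
  then have "antideriv (\<lambda>y. (apply_bcontfun f y $ k) *\<^sub>R v' k y + (apply_bcontfun f' y $ k) *\<^sub>R v k y) x = G k x - G k 0" for k x
    by (intro antideriv_eq continuous_on_add v.cont_integrand v'.cont_integrand)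
  then have a: "antideriv (\<lambda>y. (apply_bcontfun f y $ k) *\<^sub>R v' k y) x + antideriv (\<lambda>y. (apply_bcontfun f' y $ k) *\<^sub>R v k y) x = G k x - G k 0" for k x
    by (simp add: antideriv_add v.cont_integrand v'.cont_integrand)
  have "(\<Sum>e\<in>UNIV. endpoint_sign ix e *\<^sub>R G (fst (ix e)) 0) = (\<Sum>k\<in>UNIV. \<Sum>e | fst (ix e) = k. endpoint_sign ix e *\<^sub>R G k 0)"
    by (subst sum_by_blocks[of _ ix]) (auto intro!: sum.cong)
  also have "\<dots> = 0" by (simp add: sum_block[OF ix])
  finally have z: "(\<Sum>e\<in>UNIV. endpoint_sign ix e *\<^sub>R G (fst (ix e)) 0) = 0" .
  have "vec_op ix v' \<xi> f + vec_op ix v \<xi> f' = - (\<Sum>e\<in>UNIV. endpoint_sign ix e *\<^sub>R (G (fst (ix e)) (\<xi> $ e) - G (fst (ix e)) 0))"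
    unfolding vec_op_def a[symmetric] by (simp add: scaleR_right_distrib sum.distrib)
  also have "\<dots> = - (\<Sum>e\<in>UNIV. endpoint_sign ix e *\<^sub>R G (fst (ix e)) (\<xi> $ e))"
    using z by (simp add: scaleR_diff_right sum_subtractf)
  finally show ?thesis by (simp add: G_def)
qed

section \<open>The intervals and integrals over them\<close>

lemma intervals_eq:
  assumes ix: "endpoint_indexing n ix"
  shows "intervals ix \<xi> k = (\<Union>t<n k. {\<xi> $ the_inv ix (k, 2 * t + 1) <..< \<xi> $ the_inv ix (k, 2 * t + 2)})"
proof -
  have bij: "bij_betw ix UNIV (SIGMA k:UNIV. {1..2 * n k})" using ix by (simp add: endpoint_indexing_def)
  have inj: "inj ix" using bij by (simp add: bij_betw_def)
  have ix_inv: "ix (the_inv ix (k, w)) = (k, w)" if "w \<in> {1..2 * n k}" for w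
    by (rule f_the_inv_into_f[OF inj]) (use bij that in \<open>auto simp: bij_betw_def\<close>)
  show ?thesis
  proof (intro equalityI subsetI)
    fix x assume "x \<in> intervals ix \<xi> k"
    then obtain e e' w where e: "x \<in> {\<xi> $ e <..< \<xi> $ e'}" "odd w" "ix e = (k, w)" "ix e' = (k, w + 1)"
      unfolding intervals_def by auto
    then obtain t where t: "w = 2 * t + 1" by (auto elim: oddE)
    have "ix e' \<in> (SIGMA k:UNIV. {1..2 * n k})" using bij by (auto simp: bij_betw_def)
    then have "t < n k" using e t by auto
    moreover have "e = the_inv ix (k, 2 * t + 1)" "e' = the_inv ix (k, 2 * t + 2)"
      using e t the_inv_f_f[OF inj, of e] the_inv_f_f[OF inj, of e'] by auto
    ultimately show "x \<in> (\<Union>t<n k. {\<xi> $ the_inv ix (k, 2 * t + 1) <..< \<xi> $ the_inv ix (k, 2 * t + 2)})"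
      using e by auto
  next
    fix x assume "x \<in> (\<Union>t<n k. {\<xi> $ the_inv ix (k, 2 * t + 1) <..< \<xi> $ the_inv ix (k, 2 * t + 2)})"
    then obtain t where t: "t < n k" "x \<in> {\<xi> $ the_inv ix (k, 2 * t + 1) <..< \<xi> $ the_inv ix (k, 2 * t + 2)}" by auto
    have "ix (the_inv ix (k, 2 * t + 1)) = (k, 2 * t + 1)" "ix (the_inv ix (k, 2 * t + 2)) = (k, 2 * t + 1 + 1)"
      using ix_inv[of "2 * t + 1"] ix_inv[of "2 * t + 2"] t by auto
    then show "x \<in> intervals ix \<xi> k"
      unfolding intervals_def
      by (intro UnionI[OF _ t(2)] CollectI exI[of _ "the_inv ix (k, 2 * t + 1)"] exI[of _ "the_inv ix (k, 2 * t + 2)"]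
          exI[of _ "2 * t + 1"] conjI refl) simp_all
  qed
qed

lemma open_intervals: "open (intervals ix \<xi> k)"
  unfolding intervals_def by (intro open_Union) auto

text \<open>The order of the end-points makes the intervals disjoint and positively oriented; for
  other configurations the end-point sum is still defined, but as a signed integral.\<close>

lemma integral_intervals:
  fixes g :: "real \<Rightarrow> real"
  assumes ix: "endpoint_indexing n ix" and ord: "ordered_endpoints ix \<xi>" and g: "continuous_on UNIV g"
  shows "integrable lborel (\<lambda>y. g y * indicator (intervals ix \<xi> k) y)"
    and "(LBINT y. g y * indicator (intervals ix \<xi> k) y) = - (\<Sum>e | fst (ix e) = k. endpoint_sign ix e * antideriv g (\<xi> $ e))"
proof -
  have bij: "bij_betw ix UNIV (SIGMA k:UNIV. {1..2 * n k})" using ix by (simp add: endpoint_indexing_def)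
  have inj: "inj ix" using bij by (simp add: bij_betw_def)
  have ix_inv: "ix (the_inv ix (k, w)) = (k, w)" if "w \<in> {1..2 * n k}" for w
    by (rule f_the_inv_into_f[OF inj]) (use bij that in \<open>auto simp: bij_betw_def\<close>)
  define a where "a w = \<xi> $ the_inv ix (k, w)" for w
  have less: "a w < a w'" if "w < w'" "1 \<le> w" "w' \<le> 2 * n k" for w w'
    using ord that ix_inv[of w] ix_inv[of w'] unfolding ordered_endpoints_def a_def by auto
  define I where "I t = {a (2 * t + 1) <..< a (2 * t + 2)}" for t
  have disj: "disjoint_family_on I {..<n k}"
  proof (unfold disjoint_family_on_def, intro ballI impI)
    have "I s \<inter> I t = {}" if "s < t" "t < n k" for s t
    proof -
      have "a (2 * s + 2) \<le> a (2 * t + 1)"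
        using less[of "2 * s + 2" "2 * t + 1"] that by (cases "2 * s + 2 = 2 * t + 1") auto
      then show ?thesis by (auto simp: I_def)
    qed
    then show "I s \<inter> I t = {}" if "s \<in> {..<n k}" "t \<in> {..<n k}" "s \<noteq> t" for s t
      using that by (metis Int_commute lessThan_iff linorder_neqE_nat)
  qed
  have eq: "intervals ix \<xi> k = (\<Union>t<n k. I t)"
    unfolding intervals_eq[OF ix] I_def a_def ..
  have ind: "g y * indicator (intervals ix \<xi> k) y = (\<Sum>t<n k. indicator (I t) y *\<^sub>R g y)" for y
    unfolding eq using disj by (subst indicator_UN_disjoint) (auto simp: sum_distrib_left mult.commute)
  have int: "set_integrable lborel (I t) g" for t
    by (rule set_integrable_subset[OF borel_integrable_atLeastAtMost'[OF continuous_on_subset[OF g]],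
          of "a (2 * t + 1)" "a (2 * t + 2)"]) (auto simp: I_def)
  show "integrable lborel (\<lambda>y. g y * indicator (intervals ix \<xi> k) y)"
    unfolding ind by (intro Bochner_Integration.integrable_sum) (use int in \<open>simp add: set_integrable_def\<close>)
  have FTC: "(LBINT y:I t. g y) = antideriv g (a (2 * t + 2)) - antideriv g (a (2 * t + 1))" if "t < n k" for t
  proof -
    have le: "a (2 * t + 1) \<le> a (2 * t + 2)" using less[of "2 * t + 1" "2 * t + 2"] that by auto
    have "(LBINT y=a (2 * t + 1)..a (2 * t + 2). g y) = antideriv g (a (2 * t + 2)) - antideriv g (a (2 * t + 1))"
      by (rule interval_integral_FTC_finite)
        (auto intro: continuous_on_subset[OF g] has_vector_derivative_at_within antideriv_has_vector_derivative[OF g])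
    then show ?thesis using le by (simp add: interval_lebesgue_integral_def I_def einterval_eq)
  qed
  have "(LBINT y. g y * indicator (intervals ix \<xi> k) y) = (\<Sum>t<n k. (LBINT y:I t. g y))"
    unfolding ind set_lebesgue_integral_def using int
    by (intro Bochner_Integration.integral_sum) (auto simp: set_integrable_def)
  also have "\<dots> = - (\<Sum>t<n k. antideriv g (a (2 * t + 1)) - antideriv g (a (2 * t + 2)))"
    unfolding sum_negf[symmetric] by (intro sum.cong) (auto simp: FTC)
  also have "(\<Sum>t<n k. antideriv g (a (2 * t + 1)) - antideriv g (a (2 * t + 2))) =
      (\<Sum>e | fst (ix e) = k. endpoint_sign ix e * antideriv g (\<xi> $ e))"
    using sum_block[OF ix, where k = k and F = "\<lambda>e. antideriv g (\<xi> $ e)"] by (simp add: a_def)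
  finally show "(LBINT y. g y * indicator (intervals ix \<xi> k) y) = - (\<Sum>e | fst (ix e) = k. endpoint_sign ix e * antideriv g (\<xi> $ e))" .
qed

lemma vec_op_real:
  fixes v :: "'m::finite \<Rightarrow> real \<Rightarrow> real"
  assumes ix: "endpoint_indexing n ix" and ord: "ordered_endpoints ix \<xi>" and v: "\<And>k. continuous_on UNIV (v k)"
  shows "vec_op ix v \<xi> f = (\<Sum>k\<in>UNIV. LBINT y. apply_bcontfun f y $ k * v k y * indicator (intervals ix \<xi> k) y)"
proof -
  have "(LBINT y. apply_bcontfun f y $ k * v k y * indicator (intervals ix \<xi> k) y) =
      - (\<Sum>e | fst (ix e) = k. endpoint_sign ix e * antideriv (\<lambda>y. apply_bcontfun f y $ k * v k y) (\<xi> $ e))" for k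
    by (rule integral_intervals(2)[OF ix ord]) (intro continuous_intros v)
  moreover have "vec_op ix v \<xi> f = (\<Sum>k\<in>UNIV. - (\<Sum>e | fst (ix e) = k. endpoint_sign ix e * antideriv (\<lambda>y. apply_bcontfun f y $ k * v k y) (\<xi> $ e)))"
    unfolding vec_op_def sum_negf by (subst sum_by_blocks[of _ ix]) (auto intro!: sum.cong)
  ultimately show ?thesis by simp
qed

section \<open>Inverses of bounded operators\<close>

lemma blinfun_compose_assoc: "(A o\<^sub>L B) o\<^sub>L C = A o\<^sub>L (B o\<^sub>L C)"
  by (rule blinfun_eqI) simp

lemma blinfun_compose_id [simp]: "A o\<^sub>L id_blinfun = A" "id_blinfun o\<^sub>L A = A"
  by (rule blinfun_eqI, simp)+

lemma is_inverse_operator_unique: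
  assumes "is_inverse_operator T S" "is_inverse_operator T S'"
  shows "S = S'"
proof -
  have "S = S o\<^sub>L (T o\<^sub>L S')" using assms by (simp add: is_inverse_operator_def)
  also have "\<dots> = (S o\<^sub>L T) o\<^sub>L S'" by (simp add: blinfun_compose_assoc)
  finally show ?thesis using assms by (simp add: is_inverse_operator_def)
qed

lemma inverse_operator_eqI:
  assumes "is_inverse_operator T S"
  shows "inverse_operator T = S"
  unfolding inverse_operator_def using assms is_inverse_operator_unique by blast

lemma is_inverse_inverse_operator:
  assumes "invertible_operator T"
  shows "is_inverse_operator T (inverse_operator T)"
  using assms inverse_operator_eqI unfolding invertible_operator_def by metis

lemma neumann_series:
  fixes A :: "'a::banach \<Rightarrow>\<^sub>L 'a"
  assumes A: "norm A < 1"
  obtains S where "is_inverse_operator (id_blinfun - A) S" "norm S \<le> 1 / (1 - norm A)"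
proof
  \<comment> \<open>The powers of \<open>A\<close>. Recursions from the left and from the right are
    both needed for a two-sided inverse.\<close>
  define P where "P n = ((o\<^sub>L) A ^^ n) id_blinfun" for n
  have P_Suc: "P (Suc n) = A o\<^sub>L P n" for n by (simp add: P_def)
  have P_Suc': "P (Suc n) = P n o\<^sub>L A" for n
  proof (induction n)
    case (Suc n)
    then show ?case unfolding P_Suc[of "Suc n"] by (metis P_Suc blinfun_compose_assoc)
  qed (simp add: P_def)
  have norm_P: "norm (P n) \<le> norm A ^ n" for n
  proof (induction n)
    case (Suc n)
    have "norm (A o\<^sub>L P n) \<le> norm A * norm (P n)" by (rule norm_blinfun_compose)
    also have "\<dots> \<le> norm A * norm A ^ n" by (intro mult_left_mono Suc.IH norm_ge_zero)
    finally show ?case by (simp add: P_Suc)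
  qed (simp add: P_def norm_blinfun_id_le)
  have geo: "summable (\<lambda>n. norm A ^ n)" using A by (simp add: summable_geometric)
  have summ: "summable P"
    by (rule summable_comparison_test[OF _ geo]) (use norm_P in auto)
  define S where "S = (\<Sum>n. P n)"
  have tail: "(\<Sum>n. P (Suc n)) = S - id_blinfun"
    unfolding S_def using suminf_split_head[OF summ] by (simp add: P_def)
  have "A o\<^sub>L S = (\<Sum>n. A o\<^sub>L P n)"
    unfolding S_def by (rule bounded_linear.suminf[OF bounded_bilinear.bounded_linear_right[OF bounded_bilinear_blinfun_compose] summ])
  moreover have "S o\<^sub>L A = (\<Sum>n. P n o\<^sub>L A)"
    unfolding S_def by (rule bounded_linear.suminf[OF bounded_bilinear.bounded_linear_left[OF bounded_bilinear_blinfun_compose] summ])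
  ultimately have "A o\<^sub>L S = S - id_blinfun" "S o\<^sub>L A = S - id_blinfun"
    using tail by (simp_all add: P_Suc[symmetric] P_Suc'[symmetric])
  then show "is_inverse_operator (id_blinfun - A) S"
    unfolding is_inverse_operator_def
    by (simp add: bounded_bilinear.diff_left[OF bounded_bilinear_blinfun_compose] bounded_bilinear.diff_right[OF bounded_bilinear_blinfun_compose])
  have "norm S \<le> (\<Sum>n. norm A ^ n)" unfolding S_def by (rule norm_suminf_le[OF norm_P geo])
  then show "norm S \<le> 1 / (1 - norm A)" using A by (simp add: suminf_geometric)
qed

text \<open>T' = T (I - S (T - T')), and the Neumann series inverts the second factor with an
  inverse of norm at most 2.\<close>

lemma inverse_operator_perturb:
  fixes T :: "'a::banach \<Rightarrow>\<^sub>L 'a"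
  assumes T: "is_inverse_operator T S" and E: "norm S * norm (T - T') \<le> 1 / 2"
  shows "invertible_operator T'" "norm (inverse_operator T' - S) \<le> 2 * (norm S)\<^sup>2 * norm (T - T')"
proof -
  note bil = bounded_bilinear.diff_left[OF bounded_bilinear_blinfun_compose] bounded_bilinear.diff_right[OF bounded_bilinear_blinfun_compose]
  have TS: "T o\<^sub>L S = id_blinfun" "S o\<^sub>L T = id_blinfun" using T by (auto simp: is_inverse_operator_def)
  let ?A = "S o\<^sub>L (T - T')"
  have A: "norm ?A \<le> 1 / 2" using norm_blinfun_compose[of S "T - T'"] E by linarith
  obtain B where B: "is_inverse_operator (id_blinfun - ?A) B" "norm B \<le> 1 / (1 - norm ?A)"
    by (rule neumann_series[of ?A]) (use A in auto)
  have T'1: "id_blinfun - ?A = S o\<^sub>L T'" using TS by (simp add: bil)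
  then have T'2: "T' = T o\<^sub>L (id_blinfun - ?A)" by (simp add: blinfun_compose_assoc[symmetric] TS)
  have inv: "is_inverse_operator T' (B o\<^sub>L S)"
    unfolding is_inverse_operator_def
  proof
    have "T' o\<^sub>L (B o\<^sub>L S) = T o\<^sub>L ((id_blinfun - ?A) o\<^sub>L B) o\<^sub>L S"
      by (subst T'2) (simp only: blinfun_compose_assoc)
    then show "T' o\<^sub>L (B o\<^sub>L S) = id_blinfun" using B TS by (simp add: is_inverse_operator_def)
    have "(B o\<^sub>L S) o\<^sub>L T' = B o\<^sub>L (id_blinfun - ?A)" by (simp only: T'1 blinfun_compose_assoc)
    then show "(B o\<^sub>L S) o\<^sub>L T' = id_blinfun" using B by (simp add: is_inverse_operator_def)
  qed
  then show "invertible_operator T'" by (auto simp: invertible_operator_def)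
  have eq: "inverse_operator T' = B o\<^sub>L S" by (rule inverse_operator_eqI[OF inv])
  have "1 / (1 - norm ?A) \<le> 2" using A by (simp add: field_simps)
  then have nB: "norm B \<le> 2" using B by linarith
  have "(B o\<^sub>L S) - S = (B o\<^sub>L ?A) o\<^sub>L S"
  proof -
    have "B - (B o\<^sub>L ?A) = id_blinfun" using B(1) by (simp add: is_inverse_operator_def bil)
    then have eq: "B o\<^sub>L ?A = B - id_blinfun" by (simp add: algebra_simps)
    have "(B - id_blinfun) o\<^sub>L S = (B o\<^sub>L S) - (id_blinfun o\<^sub>L S)"
      by (rule bounded_bilinear.diff_left[OF bounded_bilinear_blinfun_compose])
    then show ?thesis unfolding eq by simp
  qed
  also have "norm \<dots> \<le> (norm B * norm ?A) * norm S"
    by (intro order_trans[OF norm_blinfun_compose] mult_right_mono norm_blinfun_compose norm_ge_zero)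
  also have "\<dots> \<le> (2 * (norm S * norm (T - T'))) * norm S"
    by (intro mult_right_mono mult_mono nB norm_blinfun_compose) auto
  finally show "norm (inverse_operator T' - S) \<le> 2 * (norm S)\<^sup>2 * norm (T - T')"
    unfolding eq by (simp add: power2_eq_square mult_ac)
qed

lemma inverse_operator_tendsto:
  fixes T0 :: "'a::banach \<Rightarrow>\<^sub>L 'a"
  assumes T: "(T \<longlongrightarrow> T0) F" and inv: "invertible_operator T0"
  shows "eventually (\<lambda>x. invertible_operator (T x)) F"
    and "((\<lambda>x. inverse_operator (T x)) \<longlongrightarrow> inverse_operator T0) F"
proof -
  let ?S = "inverse_operator T0"
  have S: "is_inverse_operator T0 ?S" by (rule is_inverse_inverse_operator[OF inv])
  have "((\<lambda>x. norm ?S * norm (T0 - T x)) \<longlongrightarrow> norm ?S * norm (T0 - T0)) F"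
    by (intro tendsto_intros T)
  then have ev: "eventually (\<lambda>x. norm ?S * norm (T0 - T x) < 1 / 2) F"
    by (rule order_tendstoD(2)) simp
  then show "eventually (\<lambda>x. invertible_operator (T x)) F"
    by eventually_elim (rule inverse_operator_perturb(1)[OF S], simp)
  have "((\<lambda>x. 2 * (norm ?S)\<^sup>2 * norm (T0 - T x)) \<longlongrightarrow> 2 * (norm ?S)\<^sup>2 * norm (T0 - T0)) F"
    by (intro tendsto_intros T)
  then have "((\<lambda>x. 2 * (norm ?S)\<^sup>2 * norm (T0 - T x)) \<longlongrightarrow> 0) F" by simp
  moreover have "eventually (\<lambda>x. norm (inverse_operator (T x) - ?S) \<le> 2 * (norm ?S)\<^sup>2 * norm (T0 - T x)) F"
    using ev by eventually_elim (rule inverse_operator_perturb(2)[OF S], simp)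
  ultimately have "((\<lambda>x. inverse_operator (T x) - ?S) \<longlongrightarrow> 0) F"
    by (rule Lim_null_comparison[rotated])
  then show "((\<lambda>x. inverse_operator (T x)) \<longlongrightarrow> ?S) F"
    by (rule LIM_zero_cancel)
qed

section \<open>Tools for differentiation and for the function space\<close>

text \<open>A product rule in which only \<open>G\<close> is differentiated: the difference of
  \<open>G\<close> vanishes at \<xi> to first order, so the variation of \<open>A\<close>
  contributes a remainder as soon as \<open>A\<close> is continuous there.\<close>

lemma has_derivative_blinfun_diff:
  fixes A :: "'x::real_normed_vector \<Rightarrow> 'a::real_normed_vector \<Rightarrow>\<^sub>L 'b::real_normed_vector"
  assumes A: "(A \<longlongrightarrow> A \<xi>) (at \<xi>)" and G: "(G has_derivative G') (at \<xi>)"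
  shows "((\<lambda>\<eta>. blinfun_apply (A \<eta>) (G \<eta> - G \<xi>)) has_derivative (\<lambda>h. blinfun_apply (A \<xi>) (G' h))) (at \<xi>)"
proof -
  have 1: "((\<lambda>\<eta>. blinfun_apply (A \<xi>) (G \<eta> - G \<xi>)) has_derivative (\<lambda>h. blinfun_apply (A \<xi>) (G' h))) (at \<xi>)"
    by (rule bounded_linear.has_derivative[OF blinfun.bounded_linear_right has_derivative_diff[OF G has_derivative_const, simplified]])
  have 2: "((\<lambda>\<eta>. blinfun_apply (A \<eta> - A \<xi>) (G \<eta> - G \<xi>)) has_derivative (\<lambda>h. 0)) (at \<xi>)"
    unfolding has_derivative_iff_norm
  proof (intro conjI)
    obtain e where e: "\<And>\<eta>. \<eta> \<noteq> \<xi> \<Longrightarrow> norm (G \<eta> - G \<xi> - G' (\<eta> - \<xi>)) \<le> norm (\<eta> - \<xi>) * e \<eta>" "(e \<longlongrightarrow> 0) (at \<xi>)"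
    proof
      show "((\<lambda>y. norm (G y - G \<xi> - G' (y - \<xi>)) / norm (y - \<xi>)) \<longlongrightarrow> 0) (at \<xi>)"
        using G by (simp add: has_derivative_iff_norm)
    qed auto
    obtain K where K: "\<And>h. norm (G' h) \<le> norm h * K"
      using bounded_linear.bounded[OF has_derivative_bounded_linear[OF G]] by blast
    have "norm (blinfun_apply (A \<eta> - A \<xi>) (G \<eta> - G \<xi>)) / norm (\<eta> - \<xi>) \<le> norm (A \<eta> - A \<xi>) * (e \<eta> + K)" if "\<eta> \<noteq> \<xi>" for \<eta>
    proof -
      have "norm (G \<eta> - G \<xi>) \<le> norm (G \<eta> - G \<xi> - G' (\<eta> - \<xi>)) + norm (G' (\<eta> - \<xi>))"
        using norm_triangle_ineq[of "G \<eta> - G \<xi> - G' (\<eta> - \<xi>)" "G' (\<eta> - \<xi>)"] by simp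
      also have "\<dots> \<le> norm (\<eta> - \<xi>) * (e \<eta> + K)" using e(1)[OF that] K[of "\<eta> - \<xi>"] by (simp add: distrib_left)
      finally have "norm (G \<eta> - G \<xi>) \<le> norm (\<eta> - \<xi>) * (e \<eta> + K)" .
      then have "norm (blinfun_apply (A \<eta> - A \<xi>) (G \<eta> - G \<xi>)) \<le> norm (A \<eta> - A \<xi>) * (norm (\<eta> - \<xi>) * (e \<eta> + K))"
        by (intro order_trans[OF norm_blinfun] mult_left_mono) auto
      then show ?thesis using that by (simp add: field_simps)
    qed
    then have ev: "eventually (\<lambda>\<eta>. norm (norm (blinfun_apply (A \<eta> - A \<xi>) (G \<eta> - G \<xi>)) / norm (\<eta> - \<xi>)) \<le> norm (A \<eta> - A \<xi>) * (e \<eta> + K)) (at \<xi>)"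
      by (auto simp: eventually_at_filter)
    have "((\<lambda>\<eta>. norm (A \<eta> - A \<xi>) * (e \<eta> + K)) \<longlongrightarrow> norm (A \<xi> - A \<xi>) * (0 + K)) (at \<xi>)"
      by (intro tendsto_intros A e(2))
    then have "((\<lambda>\<eta>. norm (A \<eta> - A \<xi>) * (e \<eta> + K)) \<longlongrightarrow> 0) (at \<xi>)" by simp
    from Lim_null_comparison[OF ev this]
    show "((\<lambda>y. norm (blinfun_apply (A y - A \<xi>) (G y - G \<xi>) - blinfun_apply (A \<xi> - A \<xi>) (G \<xi> - G \<xi>) - 0) / norm (y - \<xi>)) \<longlongrightarrow> 0) (at \<xi>)"
      by simp
  qed simp
  have "((\<lambda>\<eta>. blinfun_apply (A \<xi>) (G \<eta> - G \<xi>) + blinfun_apply (A \<eta> - A \<xi>) (G \<eta> - G \<xi>)) has_derivative (\<lambda>h. blinfun_apply (A \<xi>) (G' h) + 0)) (at \<xi>)"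
    by (rule has_derivative_add[OF 1 2])
  then show ?thesis by (simp add: blinfun.diff_left)
qed

text \<open>Quadratic remainders that hold for all increments survive integration and suprema, which
  is why the kernels are described by such bounds and not by derivatives.\<close>

lemma has_vector_derivative_quadratic:
  fixes F :: "real \<Rightarrow> 'b::real_normed_vector"
  assumes "\<And>h. norm (F (y + h) - F y - h *\<^sub>R D) \<le> B * h\<^sup>2"
  shows "(F has_vector_derivative D) (at y)"
  unfolding has_vector_derivative_def has_derivative_at
proof
  have "norm (norm (F (y + h) - F y - h *\<^sub>R D) / norm h) \<le> B * \<bar>h\<bar>" for h
  proof (cases "h = 0")
    case False
    then have "h\<^sup>2 / \<bar>h\<bar> = \<bar>h\<bar>" by (metis nonzero_mult_div_cancel_left power2_abs power2_eq_square abs_zero abs_eq_0)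
    then show ?thesis using divide_right_mono[OF assms[of h] abs_ge_zero[of h]] by (simp add: times_divide_eq_right[symmetric] del: times_divide_eq_right)
  qed simp
  then have 1: "\<forall>\<^sub>F h in at 0. norm (norm (F (y + h) - F y - h *\<^sub>R D) / norm h) \<le> B * \<bar>h\<bar>"
    by (simp add: always_eventually)
  have "((\<lambda>h. B * \<bar>h\<bar>) \<longlongrightarrow> B * \<bar>0\<bar>) (at 0)" by (intro tendsto_intros)
  then have 2: "((\<lambda>h. B * \<bar>h\<bar>) \<longlongrightarrow> 0) (at 0)" by simp
  show "(\<lambda>h. norm (F (y + h) - F y - h *\<^sub>R D) / norm h) \<midarrow>0\<rightarrow> 0"
    by (rule Lim_null_comparison[OF 1 2])
qed (rule bounded_linear_scaleR_left)

lemma norm_bcontfun_le: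
  fixes f :: "'m::finite bc_space"
  assumes "\<And>x i. \<bar>apply_bcontfun f x $ i\<bar> \<le> B"
  shows "norm f \<le> real CARD('m) * B"
proof (rule norm_bound)
  fix x
  have "norm (apply_bcontfun f x) \<le> (\<Sum>i\<in>UNIV. \<bar>apply_bcontfun f x $ i\<bar>)" by (rule norm_le_l1_cart)
  also have "\<dots> \<le> (\<Sum>i\<in>(UNIV :: 'm set). B)" by (intro sum_mono assms)
  finally show "norm (apply_bcontfun f x) \<le> real CARD('m) * B" by simp
qed

lemma apply_Bcontfun_cart:
  fixes g :: "real \<Rightarrow> real^'m::finite"
  assumes c: "\<And>i. continuous_on UNIV (\<lambda>x. g x $ i)" and b: "\<And>x i. \<bar>g x $ i\<bar> \<le> B"
  shows "apply_bcontfun (Bcontfun g) = g"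
proof (rule Bcontfun_inverse, rule bcontfun_normI)
  have "continuous_on UNIV (\<lambda>x. \<chi> i. g x $ i)" by (intro continuous_on_vec_lambda c)
  then show "continuous_on UNIV g" by simp
  show "norm (g x) \<le> real CARD('m) * B" for x
  proof -
    have "norm (g x) \<le> (\<Sum>i\<in>UNIV. \<bar>g x $ i\<bar>)" by (rule norm_le_l1_cart)
    also have "\<dots> \<le> (\<Sum>i\<in>(UNIV :: 'm set). B)" by (intro sum_mono b)
    finally show ?thesis by simp
  qed
qed

lemma cont_family_add:
  assumes "cont_family v B" "cont_family v' B'"
  shows "cont_family (\<lambda>k y. v k y + v' k y) (B + B')"
  using assms by (simp add: cont_family_def continuous_on_add norm_triangle_mono)

lemma vec_op_family_add:
  fixes v v' :: "'m::finite \<Rightarrow> real \<Rightarrow> 'b::banach"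
  assumes "\<And>k. continuous_on UNIV (v k)" "\<And>k. continuous_on UNIV (v' k)"
  shows "vec_op ix (\<lambda>k y. v k y + v' k y) \<xi> f = vec_op ix v \<xi> f + vec_op ix v' \<xi> f"
proof -
  have "continuous_on UNIV (\<lambda>y. (apply_bcontfun f y $ k) *\<^sub>R v k y)"
    "continuous_on UNIV (\<lambda>y. (apply_bcontfun f y $ k) *\<^sub>R v' k y)" for k
    by (intro continuous_intros assms)+
  then show ?thesis
    by (simp add: vec_op_def scaleR_right_distrib antideriv_add sum.distrib)
qed

section \<open>Operators with a difference kernel and their resolvents\<close>

definition column :: "('m::finite \<Rightarrow> 'm \<Rightarrow> real \<Rightarrow> real) \<Rightarrow> 'm \<Rightarrow> real \<Rightarrow> 'm bc_space" where
  "column g j y = Bcontfun (\<lambda>x. \<chi> i. g i j (x - y))"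

text \<open>All bounds are uniform in the argument, so that the columns of the kernel are
  differentiable in their parameter with respect to the supremum norm and not only
  pointwise.\<close>

locale conv_kernel =
  fixes l l1 :: "'m::{finite,linorder} \<Rightarrow> 'm \<Rightarrow> real \<Rightarrow> real" and C :: real
    and n :: "'m \<Rightarrow> nat" and ix :: "'e::finite \<Rightarrow> 'm \<times> nat"
  assumes ix: "endpoint_indexing n ix"
    and l_bound: "\<bar>l i j x\<bar> \<le> C" and l1_bound: "\<bar>l1 i j x\<bar> \<le> C"
    and l1_lipschitz: "\<bar>l1 i j x - l1 i j y\<bar> \<le> C * \<bar>x - y\<bar>"
    and l_taylor: "\<bar>l i j (x + h) - l i j x - h * l1 i j x\<bar> \<le> C * h\<^sup>2"
begin

lemma C_nonneg: "0 \<le> C" using l_bound[of undefined undefined 0] by linarith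

lemma DERIV_l: "(l i j has_real_derivative l1 i j x) (at x)"
  unfolding has_real_derivative_iff_has_vector_derivative
  by (rule has_vector_derivative_quadratic[where B = C]) (use l_taylor in simp)

lemma continuous_l: "continuous_on S (l i j)"
  by (rule DERIV_continuous_on[where D = "l1 i j"]) (rule has_field_derivative_at_within[OF DERIV_l])

lemma continuous_l1: "continuous_on S (l1 i j)"
proof (rule lipschitz_on_continuous_on)
  show "C-lipschitz_on S (l1 i j)"
    by (rule lipschitz_onI) (use l1_lipschitz C_nonneg in \<open>auto simp: dist_real_def\<close>)
qed

lemma l_lipschitz: "\<bar>l i j x - l i j y\<bar> \<le> C * \<bar>x - y\<bar>"
proof -
  have "norm (l i j x - l i j y) \<le> C * norm (x - y)"
  proof (rule differentiable_bound[where S = UNIV and f' = "\<lambda>x t. t * l1 i j x"])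
    show "(l i j has_derivative (\<lambda>t. t * l1 i j x)) (at x within UNIV)" for x
      using DERIV_l[of i j x] by (simp add: has_field_derivative_def mult_commute_abs)
    show "onorm (\<lambda>t. t * l1 i j x) \<le> C" for x
      by (rule onorm_le) (auto simp: abs_mult mult.commute[of C] intro!: mult_left_mono l1_bound)
  qed auto
  then show ?thesis by simp
qed

lemma cont_shift: "continuous_on UNIV (\<lambda>x. l i j (x - y))" "continuous_on UNIV (\<lambda>x. l1 i j (x - y))"
  "continuous_on UNIV (\<lambda>y. l i j (x - y))" "continuous_on UNIV (\<lambda>y. l1 i j (x - y))"
  for x y :: real
proof -
  have c: "continuous_on UNIV (\<lambda>t. t - y)" "continuous_on UNIV (\<lambda>t. x - t)" by (intro continuous_intros)+
  show "continuous_on UNIV (\<lambda>x. l i j (x - y))" "continuous_on UNIV (\<lambda>x. l1 i j (x - y))"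
    "continuous_on UNIV (\<lambda>y. l i j (x - y))" "continuous_on UNIV (\<lambda>y. l1 i j (x - y))"
    by (rule continuous_on_compose2[OF continuous_l[of UNIV] c(1)] continuous_on_compose2[OF continuous_l1[of UNIV] c(1)]
      continuous_on_compose2[OF continuous_l[of UNIV] c(2)] continuous_on_compose2[OF continuous_l1[of UNIV] c(2)], simp)+
qed

abbreviation u where "u \<equiv> column l"
abbreviation u1 where "u1 \<equiv> column l1"

lemma apply_u [simp]: "apply_bcontfun (u j y) x $ i = l i j (x - y)"
  unfolding column_def by (subst apply_Bcontfun_cart[where B = C]) (auto simp: cont_shift l_bound)

lemma apply_u1 [simp]: "apply_bcontfun (u1 j y) x $ i = l1 i j (x - y)"
  unfolding column_def by (subst apply_Bcontfun_cart[where B = C]) (auto simp: cont_shift l1_bound)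

definition D :: real where "D = real CARD('m) * C"

lemma D_nonneg: "0 \<le> D" using C_nonneg by (simp add: D_def)

lemma u_lipschitz: "norm (u j y - u j y') \<le> D * \<bar>y - y'\<bar>"
proof -
  have "\<bar>apply_bcontfun (u j y - u j y') x $ i\<bar> \<le> C * \<bar>y - y'\<bar>" for x i
    using l_lipschitz[of i j "x - y" "x - y'"] by (simp add: abs_minus_commute)
  then have "norm (u j y - u j y') \<le> real CARD('m) * (C * \<bar>y - y'\<bar>)" by (rule norm_bcontfun_le)
  then show ?thesis by (simp add: D_def)
qed

lemma u1_lipschitz: "norm (u1 j y - u1 j y') \<le> D * \<bar>y - y'\<bar>"
proof -
  have "\<bar>apply_bcontfun (u1 j y - u1 j y') x $ i\<bar> \<le> C * \<bar>y - y'\<bar>" for x i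
    using l1_lipschitz[of i j "x - y" "x - y'"] by (simp add: abs_minus_commute)
  then have "norm (u1 j y - u1 j y') \<le> real CARD('m) * (C * \<bar>y - y'\<bar>)" by (rule norm_bcontfun_le)
  then show ?thesis by (simp add: D_def)
qed

lemma continuous_u: "continuous_on S (u j)"
  by (rule lipschitz_on_continuous_on[of D], rule lipschitz_onI) (use u_lipschitz D_nonneg in \<open>auto simp: dist_norm\<close>)

lemma continuous_u1: "continuous_on S (u1 j)"
  by (rule lipschitz_on_continuous_on[of D], rule lipschitz_onI) (use u1_lipschitz D_nonneg in \<open>auto simp: dist_norm\<close>)

sublocale u: cont_family u D
  by standard (auto simp: continuous_u D_def l_bound intro!: norm_bcontfun_le)

sublocale u1: cont_family u1 D
  by standard (auto simp: continuous_u1 D_def l1_bound intro!: norm_bcontfun_le)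

lemma u_has_vector_derivative: "(u j has_vector_derivative - u1 j y) (at y)"
proof (rule has_vector_derivative_quadratic)
  fix h
  have "\<bar>apply_bcontfun (u j (y + h) - u j y - h *\<^sub>R (- u1 j y)) x $ i\<bar> \<le> C * h\<^sup>2" for x i
    using l_taylor[of i j "x - y" "- h"] by (simp add: diff_diff_eq)
  from norm_bcontfun_le[OF this]
  show "norm (u j (y + h) - u j y - h *\<^sub>R (- u1 j y)) \<le> real CARD('m) * C * h\<^sup>2"
    by (simp add: mult.assoc)
qed

text \<open>Given by end-point sums for every \<xi>, ordered or not;
  \<open>K_eq_kernel_operator\<close> identifies it with the integral operator when the end-points
  are ordered.\<close>

definition K :: "real^'e \<Rightarrow> 'm bc_space \<Rightarrow>\<^sub>L 'm bc_space" where "K \<xi> = Blinfun (vec_op ix u \<xi>)"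
definition K1 :: "real^'e \<Rightarrow> 'm bc_space \<Rightarrow>\<^sub>L 'm bc_space" where "K1 \<xi> = Blinfun (vec_op ix u1 \<xi>)"

lemma apply_K: "blinfun_apply (K \<xi>) f = vec_op ix u \<xi> f"
  by (simp add: K_def u.Blinfun_vec_op)

lemma apply_K1: "blinfun_apply (K1 \<xi>) f = vec_op ix u1 \<xi> f"
  by (simp add: K1_def u1.Blinfun_vec_op)

lemma K_nth: "apply_bcontfun (blinfun_apply (K \<xi>) f) x $ i = vec_op ix (\<lambda>k y. l i k (x - y)) \<xi> f"
  unfolding apply_K by (subst u.vec_op_compose[OF bounded_linear_eval]) simp

lemma K1_nth: "apply_bcontfun (blinfun_apply (K1 \<xi>) f) x $ i = vec_op ix (\<lambda>k y. l1 i k (x - y)) \<xi> f"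
  unfolding apply_K1 by (subst u1.vec_op_compose[OF bounded_linear_eval]) simp

lemma K_deriv: "((\<lambda>x. apply_bcontfun (blinfun_apply (K \<xi>) f) x $ i) has_real_derivative
    apply_bcontfun (blinfun_apply (K1 \<xi>) f) x $ i) (at x)"
  unfolding has_real_derivative_iff_has_vector_derivative
proof (rule has_vector_derivative_quadratic)
  fix h
  let ?a = "\<lambda>k y. l i k (x + h - y)" and ?b = "\<lambda>k y. - l i k (x - y)" and ?c = "\<lambda>k y. - h * l1 i k (x - y)"
  have a: "cont_family ?a C" by (simp add: cont_family_def cont_shift l_bound)
  have b: "cont_family ?b C" by (simp add: cont_family_def cont_shift l_bound continuous_on_minus)
  have "continuous_on UNIV (\<lambda>y. - h * l1 i k (x - y))" for k by (intro continuous_on_mult continuous_on_const cont_shift)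
  then have c: "cont_family ?c (\<bar>h\<bar> * C)"
    by (simp add: cont_family_def abs_mult mult_left_mono l1_bound)
  have ab: "cont_family (\<lambda>k y. ?a k y + ?b k y) (C + C)"
    by (rule cont_family_add[OF a b])
  \<comment> \<open>The Taylor remainder of the kernel is one family of size C h^2; the Lipschitz
    bound of \<open>vec_op\<close> between \<xi> and 0 then gives the quadratic estimate.\<close>
  have abc: "cont_family (\<lambda>k y. ?a k y + ?b k y + ?c k y) (C * h\<^sup>2)"
  proof
    show "continuous_on UNIV (\<lambda>y. ?a k y + ?b k y + ?c k y)" for k
      using cont_family_add[OF ab c] by (simp add: cont_family_def)
    show "norm (?a k y + ?b k y + ?c k y) \<le> C * h\<^sup>2" for k y
      using l_taylor[of i k "x - y" h] by (simp add: algebra_simps)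
  qed
  have "vec_op ix ?b \<xi> f = - vec_op ix (\<lambda>k y. l i k (x - y)) \<xi> f"
    using cont_family.vec_op_compose[of "\<lambda>k y. l i k (x - y)" C uminus ix \<xi> f, OF _ bounded_linear_minus[OF bounded_linear_ident]]
    by (simp add: cont_family_def cont_shift l_bound)
  moreover have "vec_op ix ?c \<xi> f = - h * vec_op ix (\<lambda>k y. l1 i k (x - y)) \<xi> f"
    using cont_family.vec_op_compose[of "\<lambda>k y. l1 i k (x - y)" C "\<lambda>t. - h * t" ix \<xi> f, OF _ bounded_linear_mult_right]
    by (simp add: cont_family_def cont_shift l1_bound)
  ultimately have eq: "apply_bcontfun (blinfun_apply (K \<xi>) f) (x + h) $ i - apply_bcontfun (blinfun_apply (K \<xi>) f) x $ i
      - h *\<^sub>R apply_bcontfun (blinfun_apply (K1 \<xi>) f) x $ i = vec_op ix (\<lambda>k y. ?a k y + ?b k y + ?c k y) \<xi> f"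
    unfolding K_nth K1_nth vec_op_family_add[OF cont_family.cont[OF ab] cont_family.cont[OF c]]
      vec_op_family_add[OF cont_family.cont[OF a] cont_family.cont[OF b]] by simp
  have "vec_op ix (\<lambda>k y. ?a k y + ?b k y + ?c k y) 0 f = 0" by (simp add: vec_op_def)
  then show "norm (apply_bcontfun (blinfun_apply (K \<xi>) f) (x + h) $ i - apply_bcontfun (blinfun_apply (K \<xi>) f) x $ i
      - h *\<^sub>R apply_bcontfun (blinfun_apply (K1 \<xi>) f) x $ i) \<le> (C * norm f * (\<Sum>e\<in>UNIV. \<bar>\<xi> $ e\<bar>)) * h\<^sup>2"
    unfolding eq using cont_family.vec_op_lipschitz[OF abc, of ix \<xi> f 0] by (simp add: mult_ac)
qed

lemma K_tendsto: "(K \<longlongrightarrow> K \<xi>) (at \<xi>)"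
  unfolding K_def by (rule u.Blinfun_vec_op_tendsto)

definition Inv :: "(real^'e) set" where "Inv = {\<xi>. invertible_operator (id_blinfun - K \<xi>)}"

definition \<rho> :: "real^'e \<Rightarrow> 'm bc_space \<Rightarrow>\<^sub>L 'm bc_space" where "\<rho> \<xi> = inverse_operator (id_blinfun - K \<xi>)"

lemma \<rho>_inverse:
  assumes "\<xi> \<in> Inv"
  shows "blinfun_apply (\<rho> \<xi>) (f - blinfun_apply (K \<xi>) f) = f"
    and "blinfun_apply (\<rho> \<xi>) f = f + blinfun_apply (K \<xi>) (blinfun_apply (\<rho> \<xi>) f)"
proof -
  have inv: "is_inverse_operator (id_blinfun - K \<xi>) (\<rho> \<xi>)"
    using assms unfolding Inv_def \<rho>_def by (simp add: is_inverse_inverse_operator)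
  have "blinfun_apply (\<rho> \<xi> o\<^sub>L (id_blinfun - K \<xi>)) f = f" "blinfun_apply ((id_blinfun - K \<xi>) o\<^sub>L \<rho> \<xi>) f = f"
    using inv by (simp_all add: is_inverse_operator_def)
  then show "blinfun_apply (\<rho> \<xi>) (f - blinfun_apply (K \<xi>) f) = f"
    "blinfun_apply (\<rho> \<xi>) f = f + blinfun_apply (K \<xi>) (blinfun_apply (\<rho> \<xi>) f)"
    by (simp_all add: blinfun.diff_left algebra_simps)
qed

text \<open>Resolvent values are recognised by their fixed-point equation; both commutators are
  obtained in this way.\<close>

lemma \<rho>_eqI:
  assumes "\<xi> \<in> Inv" "f = g + blinfun_apply (K \<xi>) f"
  shows "f = blinfun_apply (\<rho> \<xi>) g"
  using \<rho>_inverse(1)[OF assms(1), of f] assms(2) by (metis add_diff_cancel_right')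

lemma Inv_eventually: "\<xi> \<in> Inv \<Longrightarrow> eventually (\<lambda>\<eta>. \<eta> \<in> Inv) (at \<xi>)"
  and \<rho>_tendsto: "\<xi> \<in> Inv \<Longrightarrow> (\<rho> \<longlongrightarrow> \<rho> \<xi>) (at \<xi>)"
proof -
  assume \<xi>: "\<xi> \<in> Inv"
  have lim: "((\<lambda>\<eta>. id_blinfun - K \<eta>) \<longlongrightarrow> id_blinfun - K \<xi>) (at \<xi>)"
    by (intro tendsto_intros K_tendsto)
  have inv: "invertible_operator (id_blinfun - K \<xi>)" using \<xi> by (simp add: Inv_def)
  show "eventually (\<lambda>\<eta>. \<eta> \<in> Inv) (at \<xi>)" "(\<rho> \<longlongrightarrow> \<rho> \<xi>) (at \<xi>)"
    using inverse_operator_tendsto[OF lim inv] by (simp_all add: Inv_def \<rho>_def[abs_def])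
qed

text \<open>The product rule is applied to \<rho>(eta) (Psi(eta) - Psi(xi)), which equals
  \<rho>(eta) G(eta) - f because f = Psi(xi). The sum in the derivative comes from K(eta) f, one
  term of rank one for each end-point.\<close>

lemma \<rho>_has_derivative:
  assumes \<xi>: "\<xi> \<in> Inv" and G: "(G has_derivative G') (at \<xi>)"
  defines "f \<equiv> blinfun_apply (\<rho> \<xi>) (G \<xi>)"
  shows "((\<lambda>\<eta>. blinfun_apply (\<rho> \<eta>) (G \<eta>)) has_derivative
    (\<lambda>h. blinfun_apply (\<rho> \<xi>) (G' h - (\<Sum>e\<in>UNIV. (endpoint_sign ix e * h $ e * apply_bcontfun f (\<xi> $ e) $ fst (ix e)) *\<^sub>R u (fst (ix e)) (\<xi> $ e))))) (at \<xi>)"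
proof -
  let ?\<Psi> = "\<lambda>\<eta>. vec_op ix u \<eta> f + G \<eta>"
  have "(?\<Psi> has_derivative (\<lambda>h. - (\<Sum>e\<in>UNIV. (endpoint_sign ix e * h $ e * apply_bcontfun f (\<xi> $ e) $ fst (ix e)) *\<^sub>R u (fst (ix e)) (\<xi> $ e)) + G' h)) (at \<xi>)"
    by (intro has_derivative_add u.vec_op_has_derivative G)
  from has_derivative_blinfun_diff[OF \<rho>_tendsto[OF \<xi>] this]
  have "((\<lambda>\<eta>. f + blinfun_apply (\<rho> \<eta>) (?\<Psi> \<eta> - ?\<Psi> \<xi>)) has_derivative
    (\<lambda>h. 0 + blinfun_apply (\<rho> \<xi>) (- (\<Sum>e\<in>UNIV. (endpoint_sign ix e * h $ e * apply_bcontfun f (\<xi> $ e) $ fst (ix e)) *\<^sub>R u (fst (ix e)) (\<xi> $ e)) + G' h))) (at \<xi>)"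
    by (intro has_derivative_add has_derivative_const)
  moreover have "f + blinfun_apply (\<rho> \<eta>) (?\<Psi> \<eta> - ?\<Psi> \<xi>) = blinfun_apply (\<rho> \<eta>) (G \<eta>)" if \<eta>: "\<eta> \<in> Inv" for \<eta>
  proof -
    have "f = G \<xi> + vec_op ix u \<xi> f" unfolding f_def using \<rho>_inverse(2)[OF \<xi>, of "G \<xi>"] by (simp add: apply_K)
    then have eq: "?\<Psi> \<eta> - ?\<Psi> \<xi> = G \<eta> - (f - blinfun_apply (K \<eta>) f)" by (simp add: apply_K algebra_simps)
    have "blinfun_apply (\<rho> \<eta>) (?\<Psi> \<eta> - ?\<Psi> \<xi>) = blinfun_apply (\<rho> \<eta>) (G \<eta>) - blinfun_apply (\<rho> \<eta>) (f - blinfun_apply (K \<eta>) f)"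
      unfolding eq by (rule blinfun.diff_right)
    then show ?thesis using \<rho>_inverse(1)[OF \<eta>, of f] by simp
  qed
  ultimately have "((\<lambda>\<eta>. blinfun_apply (\<rho> \<eta>) (G \<eta>)) has_derivative
    (\<lambda>h. 0 + blinfun_apply (\<rho> \<xi>) (- (\<Sum>e\<in>UNIV. (endpoint_sign ix e * h $ e * apply_bcontfun f (\<xi> $ e) $ fst (ix e)) *\<^sub>R u (fst (ix e)) (\<xi> $ e)) + G' h))) (at \<xi>)"
    using Inv_eventually[OF \<xi>] \<xi> by (elim has_derivative_transform_eventually) (auto elim: eventually_mono simp: f_def)
  then show ?thesis by simp
qed

text \<open>Differentiating f = g + K f in x and integrating by parts gives f' = g' + K f' plus
  multiples of the columns of the kernel at the end-points: the commutator of \<rho> with d/dx has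
  finite rank.\<close>

lemma \<rho>_deriv:
  assumes \<xi>: "\<xi> \<in> Inv" and g: "\<And>x i. ((\<lambda>x. apply_bcontfun g x $ i) has_real_derivative apply_bcontfun g' x $ i) (at x)"
  defines "f \<equiv> blinfun_apply (\<rho> \<xi>) g"
  defines "f' \<equiv> g' + blinfun_apply (K1 \<xi>) f"
  shows "((\<lambda>x. apply_bcontfun f x $ i) has_real_derivative apply_bcontfun f' x $ i) (at x)"
    and "f' = blinfun_apply (\<rho> \<xi>) (g' + (\<Sum>e\<in>UNIV. (endpoint_sign ix e * apply_bcontfun f (\<xi> $ e) $ fst (ix e)) *\<^sub>R u (fst (ix e)) (\<xi> $ e)))"
proof -
  have f: "f = g + blinfun_apply (K \<xi>) f" unfolding f_def by (rule \<rho>_inverse(2)[OF \<xi>])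
  show d: "((\<lambda>x. apply_bcontfun f x $ i) has_real_derivative apply_bcontfun f' x $ i) (at x)" for x i
    unfolding f'_def by (subst f) (simp, intro DERIV_add g K_deriv)
  have "vec_op ix (\<lambda>k y. - u1 k y) \<xi> f + vec_op ix u \<xi> f' =
      - (\<Sum>e\<in>UNIV. (endpoint_sign ix e * apply_bcontfun f (\<xi> $ e) $ fst (ix e)) *\<^sub>R u (fst (ix e)) (\<xi> $ e))"
    by (rule vec_op_by_parts[OF ix u.cont_family_axioms _ u_has_vector_derivative d, of D])
      (use u1.cont_family_axioms in \<open>auto simp: cont_family_def intro!: continuous_on_minus\<close>)
  moreover have "vec_op ix (\<lambda>k y. - u1 k y) \<xi> f = - vec_op ix u1 \<xi> f"
    using u1.vec_op_compose[OF bounded_linear_minus[OF bounded_linear_ident], of ix \<xi> f] by simp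
  ultimately have "f' = g' + (\<Sum>e\<in>UNIV. (endpoint_sign ix e * apply_bcontfun f (\<xi> $ e) $ fst (ix e)) *\<^sub>R u (fst (ix e)) (\<xi> $ e)) + blinfun_apply (K \<xi>) f'"
    unfolding apply_K f'_def apply_K1 by (simp add: algebra_simps)
  then show "f' = blinfun_apply (\<rho> \<xi>) (g' + (\<Sum>e\<in>UNIV. (endpoint_sign ix e * apply_bcontfun f (\<xi> $ e) $ fst (ix e)) *\<^sub>R u (fst (ix e)) (\<xi> $ e)))"
    by (rule \<rho>_eqI[OF \<xi>])
qed

end

section \<open>Evaluation at moving points, uniqueness of kernels, limits at end-points\<close>

lemma bounded_linear_axis: "bounded_linear (axis i :: 'b::real_normed_vector \<Rightarrow> 'b ^ 'n::finite)"
proof (rule bounded_linear_intro[where K = 1])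
  fix x :: 'b
  have "norm (axis i x) \<le> (\<Sum>j\<in>UNIV. norm (axis i x $ j))"
    unfolding norm_vec_def by (rule L2_set_le_sum) auto
  also have "\<dots> = (\<Sum>j\<in>UNIV. if j = i then norm x else 0)" by (intro sum.cong) (auto simp: axis_def)
  finally show "norm (axis i x) \<le> norm x * 1" by simp
qed (auto simp: axis_def Finite_Cartesian_Product.vec_eq_iff)

lemma has_derivative_vec:
  fixes F :: "'x::real_normed_vector \<Rightarrow> 'b::real_normed_vector ^ 'n::finite"
  assumes "\<And>i. ((\<lambda>x. F x $ i) has_derivative (\<lambda>h. F' h $ i)) net"
  shows "(F has_derivative F') net"
proof -
  have eq: "(\<Sum>i\<in>UNIV. axis i (y $ i)) = y" for y :: "'b ^ 'n"
    by (simp add: Finite_Cartesian_Product.vec_eq_iff axis_def)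
  have "((\<lambda>x. \<Sum>i\<in>UNIV. axis i (F x $ i)) has_derivative (\<lambda>h. \<Sum>i\<in>UNIV. axis i (F' h $ i))) net"
    by (intro has_derivative_sum bounded_linear.has_derivative[OF bounded_linear_axis] assms)
  then show ?thesis by (simp add: eq)
qed

lemma apply_bcontfun_sum_nth:
  "apply_bcontfun (sum F A) x $ i = (\<Sum>b\<in>A. apply_bcontfun (F b :: 'm::finite bc_space) x $ i)"
  using bounded_linear.linear[OF bounded_linear_eval[of x i]] by (rule linear_sum)

lemma bcontfun_nth_tendsto:
  fixes H :: "'x \<Rightarrow> 'm::finite bc_space"
  assumes H: "(H \<longlongrightarrow> H0) F" and x: "(x \<longlongrightarrow> x0) F"
  shows "((\<lambda>\<eta>. apply_bcontfun (H \<eta>) (x \<eta>) $ i) \<longlongrightarrow> apply_bcontfun H0 x0 $ i) F"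
proof -
  have ev: "\<forall>\<^sub>F \<eta> in F. norm (apply_bcontfun (H \<eta> - H0) (x \<eta>) $ i) \<le> norm (H \<eta> - H0)"
    by (intro always_eventually allI) (simp only: real_norm_def abs_bcontfun_nth_le)
  have "((\<lambda>\<eta>. norm (H \<eta> - H0)) \<longlongrightarrow> norm (H0 - H0)) F" by (intro tendsto_intros H)
  then have "((\<lambda>\<eta>. norm (H \<eta> - H0)) \<longlongrightarrow> 0) F" by simp
  from Lim_null_comparison[OF ev this]
  have 1: "((\<lambda>\<eta>. apply_bcontfun (H \<eta> - H0) (x \<eta>) $ i) \<longlongrightarrow> 0) F" .
  have "isCont (\<lambda>x. apply_bcontfun H0 x $ i) x0"
    using continuous_on_bcontfun_nth[of UNIV H0 i] by (simp add: continuous_on_eq_continuous_at)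
  then have 2: "((\<lambda>\<eta>. apply_bcontfun H0 (x \<eta>) $ i) \<longlongrightarrow> apply_bcontfun H0 x0 $ i) F"
    by (rule isCont_tendsto_compose[OF _ x])
  show ?thesis using tendsto_add[OF 1 2] by simp
qed

lemma continuous_on_bcontfun_nth2:
  fixes H :: "real \<Rightarrow> 'm::finite bc_space"
  assumes "continuous_on UNIV H"
  shows "continuous_on UNIV (\<lambda>(x, y). apply_bcontfun (H y) x $ i)"
proof (unfold continuous_on_def split_beta, intro ballI)
  fix p :: "real \<times> real"
  have "((\<lambda>q. H (snd q)) \<longlongrightarrow> H (snd p)) (at p)"
    using assms by (intro isCont_tendsto_compose[of _ H snd] tendsto_intros) (simp add: continuous_on_eq_continuous_at)
  then show "((\<lambda>q. apply_bcontfun (H (snd q)) (fst q) $ i) \<longlongrightarrow> apply_bcontfun (H (snd p)) (fst p) $ i) (at p)"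
    by (rule bcontfun_nth_tendsto) (intro tendsto_intros)
qed

text \<open>\<open>H\<close> is split into its value at \<xi>, its linear part and a remainder. The
  value is differentiated in x, for the linear part continuity in x suffices, and the remainder is
  small in the supremum norm, hence also at the moving point.\<close>

lemma has_derivative_bcontfun_moving:
  fixes H :: "real^'e::finite \<Rightarrow> 'm::finite bc_space"
  assumes H: "(H has_derivative H') (at \<xi>)"
    and d: "((\<lambda>x. apply_bcontfun (H \<xi>) x $ i) has_real_derivative d) (at (\<xi> $ e))"
  shows "((\<lambda>\<eta>. apply_bcontfun (H \<eta>) (\<eta> $ e) $ i) has_derivative
    (\<lambda>h. apply_bcontfun (H' h) (\<xi> $ e) $ i + h $ e * d)) (at \<xi>)"
proof -
  have lin: "linear H'" using has_derivative_bounded_linear[OF H] by (rule bounded_linear.linear)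
  have expand: "H' h = (\<Sum>b\<in>UNIV. (h $ b) *\<^sub>R H' (axis b 1))" for h
  proof -
    have "H' (\<Sum>b\<in>UNIV. (h $ b) *\<^sub>R axis b 1) = (\<Sum>b\<in>UNIV. (h $ b) *\<^sub>R H' (axis b 1))"
      using lin by (simp add: linear_sum linear_cmul)
    moreover have "(\<Sum>b\<in>UNIV. (h $ b) *\<^sub>R axis b 1) = h"
      using basis_expansion[of h] by (simp add: scalar_mult_eq_scaleR)
    ultimately show ?thesis by simp
  qed
  define rem where "rem \<eta> = H \<eta> - H \<xi> - H' (\<eta> - \<xi>)" for \<eta>
  have A: "((\<lambda>\<eta>. apply_bcontfun (rem \<eta>) (\<eta> $ e) $ i) has_derivative (\<lambda>h. 0)) (at \<xi>)"
    unfolding has_derivative_iff_norm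
  proof (intro conjI)
    have lim: "((\<lambda>y. norm (rem y) / norm (y - \<xi>)) \<longlongrightarrow> 0) (at \<xi>)"
      using H unfolding has_derivative_iff_norm rem_def by simp
    have rem0: "rem \<xi> = 0" using lin by (simp add: rem_def linear_0)
    have ev: "\<forall>\<^sub>F y in at \<xi>. norm (norm (apply_bcontfun (rem y) (y $ e) $ i - apply_bcontfun (rem \<xi>) (\<xi> $ e) $ i - 0) / norm (y - \<xi>))
        \<le> norm (rem y) / norm (y - \<xi>)"
      by (intro always_eventually allI) (simp add: rem0 divide_right_mono abs_bcontfun_nth_le)
    show "((\<lambda>y. norm (apply_bcontfun (rem y) (y $ e) $ i - apply_bcontfun (rem \<xi>) (\<xi> $ e) $ i - 0) / norm (y - \<xi>)) \<longlongrightarrow> 0) (at \<xi>)"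
      by (rule Lim_null_comparison[OF ev lim])
  qed simp
  have coord: "((\<lambda>\<eta>. \<eta> $ b) has_derivative (\<lambda>h. h $ b)) (at \<xi>)" for b
    by (rule bounded_linear.has_derivative[OF bounded_linear_vec_nth has_derivative_ident])
  have B: "((\<lambda>\<eta>. apply_bcontfun (H' (axis b 1)) (\<eta> $ e) $ i * (\<eta> $ b - \<xi> $ b)) has_derivative
      (\<lambda>h. apply_bcontfun (H' (axis b 1)) (\<xi> $ e) $ i * h $ b)) (at \<xi>)" for b
  proof -
    \<comment> \<open>The coefficient is continuous in eta; viewed as a multiple of the identity on
      the reals it fits the product rule for operators.\<close>
    have lim: "((\<lambda>\<eta>. apply_bcontfun (H' (axis b 1)) (\<eta> $ e) $ i *\<^sub>R (id_blinfun :: real \<Rightarrow>\<^sub>L real)) \<longlongrightarrow>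
        apply_bcontfun (H' (axis b 1)) (\<xi> $ e) $ i *\<^sub>R id_blinfun) (at \<xi>)"
      by (intro tendsto_scaleR bcontfun_nth_tendsto tendsto_intros)
    from has_derivative_blinfun_diff[OF lim coord[of b]]
    show ?thesis by (simp add: blinfun.scaleR_left)
  qed
  have Cd: "((\<lambda>\<eta>. apply_bcontfun (H \<xi>) (\<eta> $ e) $ i) has_derivative (\<lambda>h. d * h $ e)) (at \<xi>)"
    using has_derivative_compose[OF coord[of e] d[unfolded has_field_derivative_def]] by simp
  have D: "((\<lambda>\<eta>. apply_bcontfun (rem \<eta>) (\<eta> $ e) $ i + (\<Sum>b\<in>UNIV. apply_bcontfun (H' (axis b 1)) (\<eta> $ e) $ i * (\<eta> $ b - \<xi> $ b))
        + apply_bcontfun (H \<xi>) (\<eta> $ e) $ i) has_derivative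
      (\<lambda>h. 0 + (\<Sum>b\<in>UNIV. apply_bcontfun (H' (axis b 1)) (\<xi> $ e) $ i * h $ b) + d * h $ e)) (at \<xi>)"
    by (intro has_derivative_add has_derivative_sum A B Cd)
  have sum_nth: "apply_bcontfun (H' h) x $ i = (\<Sum>b\<in>UNIV. apply_bcontfun (H' (axis b 1)) x $ i * h $ b)" for h x
    by (subst expand, subst bounded_linear.linear[OF bounded_linear_eval, THEN linear_sum]) (simp add: mult.commute)
  have eq: "apply_bcontfun (rem \<eta>) (\<eta> $ e) $ i + (\<Sum>b\<in>UNIV. apply_bcontfun (H' (axis b 1)) (\<eta> $ e) $ i * (\<eta> $ b - \<xi> $ b))
        + apply_bcontfun (H \<xi>) (\<eta> $ e) $ i = apply_bcontfun (H \<eta>) (\<eta> $ e) $ i" for \<eta>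
    unfolding rem_def using sum_nth[of "\<eta> - \<xi>" "\<eta> $ e"] by simp
  show ?thesis using D unfolding eq sum_nth[symmetric] by (simp add: mult.commute[of d])
qed

text \<open>A tent around \<open>y0\<close> is the test function: it is continuous on the whole
  line, as elements of the function space are, and it is supported where \<open>d\<close> keeps its
  sign.\<close>

lemma continuous_nonzero_integral_test:
  fixes d :: "real \<Rightarrow> real"
  assumes int: "integrable lborel d" and X: "open X" "y0 \<in> X" and c: "continuous_on X d" and nz: "d y0 \<noteq> 0"
  obtains \<epsilon> where "0 < \<epsilon>" "(LBINT y. d y * max 0 (\<epsilon> - \<bar>y - y0\<bar>)) \<noteq> 0"
proof -
  define s where "s = sgn (d y0)"
  have s: "\<bar>s\<bar> = 1" "s * d y0 = \<bar>d y0\<bar>" using nz by (auto simp: s_def abs_sgn sgn_if)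
  have "isCont d y0" using X c continuous_on_eq_continuous_at by blast
  then have "((\<lambda>y. s * d y) \<longlongrightarrow> s * d y0) (at y0)" by (intro tendsto_intros) (simp add: isCont_def)
  moreover have "s * d y0 / 2 < s * d y0" using s nz by simp
  ultimately have "\<forall>\<^sub>F y in at y0. s * d y0 / 2 < s * d y" by (rule order_tendstoD(1))
  then obtain \<epsilon> where \<epsilon>: "0 < \<epsilon>" "\<And>y. y \<noteq> y0 \<Longrightarrow> dist y y0 < \<epsilon> \<Longrightarrow> s * d y0 / 2 < s * d y"
    by (auto simp: eventually_at)
  have lower: "\<bar>d y0\<bar> / 2 \<le> s * d y" if "\<bar>y - y0\<bar> < \<epsilon>" for y
    using \<epsilon>(2)[of y] s that nz by (cases "y = y0") (auto simp: dist_real_def)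
  let ?\<phi> = "\<lambda>y. max 0 (\<epsilon> - \<bar>y - y0\<bar>)"
  have int\<phi>: "integrable lborel (\<lambda>y. s * (d y * ?\<phi> y))"
  proof (rule Bochner_Integration.integrable_bound)
    show "integrable lborel (\<lambda>y. \<epsilon> * d y)" using int by simp
    show "(\<lambda>y. s * (d y * ?\<phi> y)) \<in> borel_measurable lborel" using int by measurable
    show "AE y in lborel. norm (s * (d y * ?\<phi> y)) \<le> norm (\<epsilon> * d y)"
      using \<epsilon>(1) s by (intro AE_I2) (auto simp: abs_mult mult.commute[of _ "\<bar>d _\<bar>"] intro!: mult_left_mono)
  qed
  \<comment> \<open>On the inner half of the tent both factors have at least half the size that they
    have at \<open>y0\<close>.\<close>
  let ?g = "\<lambda>y. (\<bar>d y0\<bar> / 2 * (\<epsilon> / 2)) * indicator {y0 - \<epsilon> / 2..y0 + \<epsilon> / 2} y"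
  have "(LBINT y. ?g y) \<le> (LBINT y. s * (d y * ?\<phi> y))"
  proof (rule integral_mono[OF _ int\<phi>])
    show "integrable lborel ?g"
      by (intro integrable_mult_right integrable_real_indicator) (auto simp: emeasure_lborel_Icc_eq)
    fix y
    show "?g y \<le> s * (d y * ?\<phi> y)"
    proof (cases "\<bar>y - y0\<bar> < \<epsilon>")
      case True
      then have nn: "0 \<le> s * d y" using lower[OF True] by linarith
      show ?thesis
      proof (cases "y \<in> {y0 - \<epsilon> / 2..y0 + \<epsilon> / 2}")
        case True
        then have "\<epsilon> / 2 \<le> ?\<phi> y" "\<bar>y - y0\<bar> < \<epsilon>" using \<epsilon>(1) by (auto simp: abs_if)
        then have "(\<bar>d y0\<bar> / 2) * (\<epsilon> / 2) \<le> (s * d y) * ?\<phi> y"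
          using \<epsilon>(1) nn by (intro mult_mono lower) auto
        then show ?thesis using True by (simp add: mult.assoc)
      qed (use nn in \<open>simp add: mult.assoc[symmetric]\<close>)
    qed (use \<epsilon>(1) in \<open>auto simp: indicator_def abs_if split: if_splits\<close>)
  qed
  moreover have "(LBINT y. ?g y) = \<bar>d y0\<bar> / 2 * (\<epsilon> / 2) * \<epsilon>" using \<epsilon>(1) by simp
  moreover have "\<bar>d y0\<bar> / 2 * (\<epsilon> / 2) * \<epsilon> > 0" using nz \<epsilon>(1) by simp
  ultimately have "(LBINT y. s * (d y * ?\<phi> y)) > 0" by linarith
  then have "(LBINT y. d y * ?\<phi> y) \<noteq> 0" by auto
  then show ?thesis using that \<epsilon>(1) by blast
qed

definition unit_bcontfun :: "(real \<Rightarrow> real) \<Rightarrow> 'm::finite \<Rightarrow> 'm bc_space" where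
  "unit_bcontfun f j = Bcontfun (\<lambda>y. axis j (f y))"

lemma unit_bcontfun_nth:
  assumes "continuous_on UNIV f" "\<And>y. \<bar>f y\<bar> \<le> B"
  shows "apply_bcontfun (unit_bcontfun f j) y $ i = (if i = j then f y else 0)"
proof -
  have B: "0 \<le> B" using assms(2)[of 0] by linarith
  have "apply_bcontfun (unit_bcontfun f j) = (\<lambda>y. axis j (f y))"
    unfolding unit_bcontfun_def
  proof (rule apply_Bcontfun_cart[where B = B])
    show "continuous_on UNIV (\<lambda>x. axis j (f x) $ i)" for i
      using assms(1) by (cases "i = j") (auto simp: axis_def)
    show "\<bar>axis j (f x) $ i\<bar> \<le> B" for x i
      using assms(2) B by (simp add: axis_def)
  qed
  then show ?thesis by (simp add: axis_def)
qed

text \<open>The operator determines its kernel only almost everywhere in y; continuity on the open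
  sets and the value 0 outside remove the ambiguity. The definite description in
  \<open>sine_R\<close> rests on this.\<close>

lemma has_matrix_kernel_unique:
  fixes R R' :: "'m::finite \<Rightarrow> 'm \<Rightarrow> real \<Rightarrow> real \<Rightarrow> real"
  assumes R: "has_matrix_kernel T R" and R': "has_matrix_kernel T R'"
    and X: "\<And>j. open (X j)"
    and c: "\<And>i j x. continuous_on (X j) (R i j x)" "\<And>i j x. continuous_on (X j) (R' i j x)"
    and z: "\<And>i j x y. y \<notin> X j \<Longrightarrow> R i j x y = 0" "\<And>i j x y. y \<notin> X j \<Longrightarrow> R' i j x y = 0"
  shows "R = R'"
proof (intro ext, rule ccontr)
  fix i j x y0
  assume ne: "R i j x y0 \<noteq> R' i j x y0"
  let ?d = "\<lambda>y. R i j x y - R' i j x y"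
  have y0: "y0 \<in> X j" using ne z by metis
  have int: "integrable lborel (R i j x)" "integrable lborel (R' i j x)"
    using R R' by (auto simp: has_matrix_kernel_def)
  have "integrable lborel ?d" using int by simp
  then obtain \<epsilon> where \<epsilon>: "0 < \<epsilon>" "(LBINT y. ?d y * max 0 (\<epsilon> - \<bar>y - y0\<bar>)) \<noteq> 0"
    by (rule continuous_nonzero_integral_test[OF _ X y0]) (use ne c in \<open>auto intro: continuous_on_diff\<close>)
  define \<phi> where "\<phi> y = max 0 (\<epsilon> - \<bar>y - y0\<bar>)" for y
  have c\<phi>: "continuous_on UNIV \<phi>" unfolding \<phi>_def by (intro continuous_intros)
  have b\<phi>: "\<bar>\<phi> y\<bar> \<le> \<epsilon>" for y using \<epsilon>(1) by (auto simp: \<phi>_def)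
  note nth = unit_bcontfun_nth[OF c\<phi> b\<phi>]
  have pick: "(\<Sum>k\<in>UNIV. LBINT y. Q i k x y * apply_bcontfun (unit_bcontfun \<phi> j) y $ k) = (LBINT y. Q i j x y * \<phi> y)"
    for Q :: "'m \<Rightarrow> 'm \<Rightarrow> real \<Rightarrow> real \<Rightarrow> real"
  proof -
    have "(\<Sum>k\<in>UNIV. LBINT y. Q i k x y * apply_bcontfun (unit_bcontfun \<phi> j) y $ k) = (\<Sum>k\<in>UNIV. if k = j then LBINT y. Q i j x y * \<phi> y else 0)"
      by (intro sum.cong) (auto simp: nth)
    then show ?thesis by simp
  qed
  have int\<phi>: "integrable lborel (\<lambda>y. Q y * \<phi> y)" if "integrable lborel Q" for Q :: "real \<Rightarrow> real"
  proof (rule Bochner_Integration.integrable_bound)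
    show "integrable lborel (\<lambda>y. \<epsilon> * Q y)" using that by simp
    show "(\<lambda>y. Q y * \<phi> y) \<in> borel_measurable lborel"
      using that borel_measurable_continuous_onI[OF c\<phi>] by measurable
    show "AE y in lborel. norm (Q y * \<phi> y) \<le> norm (\<epsilon> * Q y)"
    proof (rule AE_I2)
      fix y
      show "norm (Q y * \<phi> y) \<le> norm (\<epsilon> * Q y)"
        using mult_left_mono[OF b\<phi>[of y] abs_ge_zero[of "Q y"]] \<epsilon>(1) by (simp add: abs_mult mult.commute)
    qed
  qed
  have "(LBINT y. R i j x y * \<phi> y) = (LBINT y. R' i j x y * \<phi> y)"
    using R R' pick[of R] pick[of R'] unfolding has_matrix_kernel_def by metis
  then have "(LBINT y. ?d y * \<phi> y) = 0"
    using int\<phi>[OF int(1)] int\<phi>[OF int(2)] by (simp add: left_diff_distrib)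
  with \<epsilon>(2) show False by (simp add: \<phi>_def)
qed

lemma closure_intervals:
  assumes ix: "endpoint_indexing n ix" and ord: "ordered_endpoints ix \<xi>"
  shows "\<xi> $ e \<in> closure (intervals ix \<xi> (fst (ix e)))"
proof -
  have bij: "bij_betw ix UNIV (SIGMA k:UNIV. {1..2 * n k})" using ix by (simp add: endpoint_indexing_def)
  obtain k w where kw: "ix e = (k, w)" by (cases "ix e")
  have "ix e \<in> (SIGMA k:UNIV. {1..2 * n k})" using bij by (auto simp: bij_betw_def)
  then have w: "1 \<le> w" "w \<le> 2 * n k" using kw by auto
  have ex: "\<exists>e'. ix e' = (k, w')" if "1 \<le> w'" "w' \<le> 2 * n k" for w'
  proof -
    have "(k, w') \<in> range ix" using bij that by (simp add: bij_betw_def)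
    then show ?thesis by (metis rangeE)
  qed
  have main: "\<xi> $ e \<in> closure (intervals ix \<xi> k)" if "ix a = (k, v)" "ix b = (k, v + 1)" "odd v" "e = a \<or> e = b" for a b v
  proof -
    have lt: "\<xi> $ a < \<xi> $ b" using ord that unfolding ordered_endpoints_def by auto
    have "{\<xi> $ a <..< \<xi> $ b} \<subseteq> intervals ix \<xi> k" unfolding intervals_def using that by blast
    then have "closure {\<xi> $ a <..< \<xi> $ b} \<subseteq> closure (intervals ix \<xi> k)" by (rule closure_mono)
    then show ?thesis using that lt by (auto simp: closure_greaterThanLessThan)
  qed
  have "\<xi> $ e \<in> closure (intervals ix \<xi> k)"
  proof (cases "odd w")
    case True
    \<comment> \<open>An odd index is a left end; its right partner exists because a block has an
      even number of end-points.\<close>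
    then have "w \<noteq> 2 * n k" by auto
    then obtain b where "ix b = (k, w + 1)" using ex[of "w + 1"] w by auto
    then show ?thesis using main[of e w b] kw True by auto
  next
    case False
    then have "w - 1 + 1 = w" "odd (w - 1)" using w by auto
    have "1 \<le> w - 1" using False w(1) by presburger
    moreover have "w - 1 \<le> 2 * n k" using w by linarith
    ultimately obtain a where "ix a = (k, w - 1)" using ex[of "w - 1"] by blast
    then show ?thesis using main[of a "w - 1" e] kw \<open>w - 1 + 1 = w\<close> \<open>odd (w - 1)\<close> by auto
  qed
  then show ?thesis using kw by simp
qed

text \<open>\<open>Lim\<close> is a definite description, so the filter must be nontrivial: in a
  perfect space every point in the closure of an open set is a limit point of it.\<close>

lemma Lim_within_open_closure:
  fixes F :: "'a::{perfect_space,t2_space} \<Rightarrow> 'b::t2_space"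
  assumes U: "open U" "p \<in> closure U" and eq: "\<And>z. z \<in> U \<Longrightarrow> F z = G z" and G: "isCont G p"
  shows "Lim (at p within U) F = G p"
proof (rule tendsto_Lim)
  have "p islimpt U"
  proof (cases "p \<in> U")
    case True
    then show ?thesis using U by (intro interior_limit_point) (simp add: interior_open)
  next
    case False
    then show ?thesis using U by (simp add: closure_def)
  qed
  then show "at p within U \<noteq> bot" by (simp add: trivial_limit_within)
  have "(G \<longlongrightarrow> G p) (at p within U)" using G by (simp add: isCont_def Lim_at_imp_Lim_at_within)
  then show "(F \<longlongrightarrow> G p) (at p within U)"
    by (rule Lim_transform_eventually) (auto simp: eventually_at_topological eq intro: exI[of _ UNIV])
qed

lemma endpoint_matrix_eq:
  assumes ix: "endpoint_indexing n ix" and ord: "ordered_endpoints ix \<xi>"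
    and G: "\<And>i j. continuous_on UNIV (\<lambda>(x, y). G i j x y)"
    and eq: "\<And>i j x y. x \<in> intervals ix \<xi> i \<Longrightarrow> y \<in> intervals ix \<xi> j \<Longrightarrow> F i j x y = G i j x y"
  shows "endpoint_matrix ix \<xi> F $ e $ e' = G (fst (ix e)) (fst (ix e')) (\<xi> $ e) (\<xi> $ e')"
proof -
  let ?i = "fst (ix e)" and ?j = "fst (ix e')"
  have "Lim (at (\<xi> $ e, \<xi> $ e') within intervals ix \<xi> ?i \<times> intervals ix \<xi> ?j) (\<lambda>(x, y). F ?i ?j x y)
      = (\<lambda>(x, y). G ?i ?j x y) (\<xi> $ e, \<xi> $ e')"
  proof (rule Lim_within_open_closure)
    show "(\<xi> $ e, \<xi> $ e') \<in> closure (intervals ix \<xi> ?i \<times> intervals ix \<xi> ?j)"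
      using closure_intervals[OF ix ord] by (simp add: closure_Times)
    show "isCont (\<lambda>(x, y). G ?i ?j x y) (\<xi> $ e, \<xi> $ e')"
      using G by (simp add: continuous_on_eq_continuous_at)
  qed (auto simp: eq intro!: open_Times open_intervals)
  then show ?thesis by (simp add: endpoint_matrix_def)
qed

lemma cont_family_single:
  fixes f :: "real \<Rightarrow> real"
  assumes "continuous_on UNIV f" "\<And>y. \<bar>f y\<bar> \<le> B"
  shows "cont_family (\<lambda>k y. if k = i then f y else 0) B"
proof
  show "continuous_on UNIV (\<lambda>y. if k = i then f y else 0)" for k using assms by (cases "k = i") auto
  show "norm (if k = i then f y else 0) \<le> B" for k y
    using assms(2)[of y] by auto
qed

section \<open>The resolvent kernel and its derivatives in x, y and the end-points\<close>

context conv_kernel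
begin

abbreviation blk :: "'e \<Rightarrow> 'm" where "blk e \<equiv> fst (ix e)"
abbreviation sg :: "'e \<Rightarrow> real" where "sg e \<equiv> endpoint_sign ix e"

definition kerR :: "real^'e \<Rightarrow> 'm \<Rightarrow> 'm \<Rightarrow> real \<Rightarrow> real \<Rightarrow> real" where
  "kerR \<xi> i j x y = apply_bcontfun (blinfun_apply (\<rho> \<xi>) (u j y)) x $ i"

definition kerRx :: "real^'e \<Rightarrow> 'm \<Rightarrow> 'm \<Rightarrow> real \<Rightarrow> real \<Rightarrow> real" where
  "kerRx \<xi> i j x y = apply_bcontfun (u1 j y + blinfun_apply (K1 \<xi>) (blinfun_apply (\<rho> \<xi>) (u j y))) x $ i"

definition kerRy :: "real^'e \<Rightarrow> 'm \<Rightarrow> 'm \<Rightarrow> real \<Rightarrow> real \<Rightarrow> real" where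
  "kerRy \<xi> i j x y = - apply_bcontfun (blinfun_apply (\<rho> \<xi>) (u1 j y)) x $ i"

lemma u_deriv: "((\<lambda>x. apply_bcontfun (u j y) x $ i) has_real_derivative apply_bcontfun (u1 j y) x $ i) (at x)"
proof -
  have "((\<lambda>x. l i j (x - y)) has_real_derivative l1 i j (x - y) * 1) (at x)"
    by (rule DERIV_chain2[OF DERIV_l]) (auto intro!: derivative_eq_intros)
  then show ?thesis by simp
qed

lemma kerR_deriv_x: "\<xi> \<in> Inv \<Longrightarrow> ((\<lambda>x. kerR \<xi> i j x y) has_real_derivative kerRx \<xi> i j x y) (at x)"
  unfolding kerR_def kerRx_def by (rule \<rho>_deriv(1)[OF _ u_deriv])

lemma kerR_deriv_y: "((\<lambda>y. kerR \<xi> i j x y) has_real_derivative kerRy \<xi> i j x y) (at y)"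
proof -
  have "((\<lambda>y. apply_bcontfun (blinfun_apply (\<rho> \<xi>) (u j y)) x $ i) has_vector_derivative
      apply_bcontfun (blinfun_apply (\<rho> \<xi>) (- u1 j y)) x $ i) (at y)"
    by (rule bounded_linear.has_vector_derivative[OF bounded_linear_eval
          bounded_linear.has_vector_derivative[OF blinfun.bounded_linear_right u_has_vector_derivative]])
  then show ?thesis
    unfolding kerR_def kerRy_def has_real_derivative_iff_has_vector_derivative by (simp add: blinfun.minus_right)
qed

text \<open>The kernel depends on x - y only, so d/dx + d/dy annihilates its columns and only the
  boundary terms of \<open>\<rho>_deriv\<close> remain.\<close>

lemma kerR_sum_deriv:
  assumes "\<xi> \<in> Inv"
  shows "kerRx \<xi> i j x y + kerRy \<xi> i j x y = (\<Sum>b\<in>UNIV. sg b * kerR \<xi> i (blk b) x (\<xi> $ b) * kerR \<xi> (blk b) j (\<xi> $ b) y)"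
proof -
  have "kerRx \<xi> i j x y = apply_bcontfun (blinfun_apply (\<rho> \<xi>) (u1 j y + (\<Sum>e\<in>UNIV. (sg e * kerR \<xi> (blk e) j (\<xi> $ e) y) *\<^sub>R u (blk e) (\<xi> $ e)))) x $ i"
    unfolding kerRx_def kerR_def \<rho>_deriv(2)[OF assms u_deriv] ..
  also have "\<dots> = - kerRy \<xi> i j x y + (\<Sum>b\<in>UNIV. sg b * kerR \<xi> i (blk b) x (\<xi> $ b) * kerR \<xi> (blk b) j (\<xi> $ b) y)"
    by (simp add: kerRy_def kerR_def[of _ i "blk _" x "\<xi> $ _"] blinfun.add_right blinfun.sum_right blinfun.scaleR_right apply_bcontfun_sum_nth mult_ac)
  finally show ?thesis by simp
qed

lemma continuous_rho_u: "continuous_on UNIV (\<lambda>y. blinfun_apply (\<rho> \<xi>) (u j y))"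
  by (rule bounded_linear.continuous_on[OF blinfun.bounded_linear_right continuous_u])

lemma continuous_kerR: "continuous_on UNIV (\<lambda>(x, y). kerR \<xi> i j x y)"
  unfolding kerR_def by (rule continuous_on_bcontfun_nth2[OF continuous_rho_u])

lemma continuous_kerRx: "continuous_on UNIV (\<lambda>(x, y). kerRx \<xi> i j x y)"
  unfolding kerRx_def
  by (rule continuous_on_bcontfun_nth2)
    (intro continuous_on_add continuous_u1 bounded_linear.continuous_on[OF blinfun.bounded_linear_right continuous_rho_u])

lemma continuous_kerRy: "continuous_on UNIV (\<lambda>(x, y). kerRy \<xi> i j x y)"
proof -
  have "continuous_on UNIV (\<lambda>(x, y). apply_bcontfun (blinfun_apply (\<rho> \<xi>) (u1 j y)) x $ i)"
    by (rule continuous_on_bcontfun_nth2[OF bounded_linear.continuous_on[OF blinfun.bounded_linear_right continuous_u1]])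
  then show ?thesis unfolding kerRy_def split_beta by (rule continuous_on_minus)
qed

lemma continuous_kerR_y: "continuous_on S (\<lambda>y. kerR \<xi> i j x y)"
  by (rule DERIV_continuous_on[OF has_field_derivative_at_within[OF kerR_deriv_y]])

lemma rho_eval_vec_op:
  "apply_bcontfun (blinfun_apply (\<rho> \<xi>) (blinfun_apply (K \<eta>) f)) x $ i = vec_op ix (\<lambda>k y. kerR \<xi> i k x y) \<eta> f"
  unfolding apply_K kerR_def
  by (rule u.vec_op_compose[OF bounded_linear_compose[OF bounded_linear_eval blinfun.bounded_linear_right]])

text \<open>The resolvent commutes with \<open>K\<close>, so the columns of the kernel are \<rho>
  applied to the columns of \<open>K\<close>.\<close>

lemma K_rho_kernel:
  assumes \<xi>: "\<xi> \<in> Inv" and ord: "ordered_endpoints ix \<xi>"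
  defines "R \<equiv> \<lambda>i j x y. kerR \<xi> i j x y * indicator (intervals ix \<xi> j) y"
  shows "has_matrix_kernel (K \<xi> o\<^sub>L \<rho> \<xi>) R"
  unfolding has_matrix_kernel_def
proof (intro conjI allI)
  show "integrable lborel (R i j x)" for i j x
    unfolding R_def by (rule integral_intervals(1)[OF ix ord continuous_kerR_y])
  fix f i x
  have "blinfun_apply (K \<xi> o\<^sub>L \<rho> \<xi>) f = blinfun_apply (\<rho> \<xi>) (blinfun_apply (K \<xi>) f)"
    using \<rho>_inverse(1)[OF \<xi>, of f] \<rho>_inverse(2)[OF \<xi>, of f] by (simp add: blinfun.diff_right algebra_simps)
  then have "apply_bcontfun (blinfun_apply (K \<xi> o\<^sub>L \<rho> \<xi>) f) x $ i = vec_op ix (\<lambda>k y. kerR \<xi> i k x y) \<xi> f"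
    by (simp only: rho_eval_vec_op)
  also have "\<dots> = (\<Sum>k\<in>UNIV. LBINT y. apply_bcontfun f y $ k * kerR \<xi> i k x y * indicator (intervals ix \<xi> k) y)"
    by (rule vec_op_real[OF ix ord continuous_kerR_y])
  finally show "apply_bcontfun (blinfun_apply (K \<xi> o\<^sub>L \<rho> \<xi>) f) x $ i = (\<Sum>j\<in>UNIV. LBINT y. R i j x y * apply_bcontfun f y $ j)"
    by (simp add: R_def mult_ac)
qed

lemma the_kernel_eq:
  assumes \<xi>: "\<xi> \<in> Inv" and ord: "ordered_endpoints ix \<xi>"
  shows "(THE R. has_matrix_kernel (K \<xi> o\<^sub>L \<rho> \<xi>) R \<and>
      (\<forall>i j x. continuous_on (intervals ix \<xi> j) (R i j x) \<and> (\<forall>y. y \<notin> intervals ix \<xi> j \<longrightarrow> R i j x y = 0)))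
    = (\<lambda>i j x y. kerR \<xi> i j x y * indicator (intervals ix \<xi> j) y)"
proof (rule the_equality)
  let ?R = "\<lambda>i j x y. kerR \<xi> i j x y * indicator (intervals ix \<xi> j) y"
  have c: "continuous_on (intervals ix \<xi> j) (?R i j x)" for i j x
    by (rule continuous_on_eq[OF continuous_kerR_y]) auto
  then show *: "has_matrix_kernel (K \<xi> o\<^sub>L \<rho> \<xi>) ?R \<and>
      (\<forall>i j x. continuous_on (intervals ix \<xi> j) (?R i j x) \<and> (\<forall>y. y \<notin> intervals ix \<xi> j \<longrightarrow> ?R i j x y = 0))"
    using K_rho_kernel[OF \<xi> ord] by simp
  fix R assume R: "has_matrix_kernel (K \<xi> o\<^sub>L \<rho> \<xi>) R \<and>
      (\<forall>i j x. continuous_on (intervals ix \<xi> j) (R i j x) \<and> (\<forall>y. y \<notin> intervals ix \<xi> j \<longrightarrow> R i j x y = 0))"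
  show "R = ?R"
    by (rule has_matrix_kernel_unique[where X = "intervals ix \<xi>"]) (use R * open_intervals in auto)
qed

lemma K_eq_kernel_operator:
  assumes ord: "ordered_endpoints ix \<xi>"
  shows "kernel_operator (\<lambda>i j x y. l i j (x - y) * indicator (intervals ix \<xi> j) y) = K \<xi>"
proof -
  have "(\<lambda>x. \<chi> i. \<Sum>j\<in>UNIV. LBINT y. l i j (x - y) * indicator (intervals ix \<xi> j) y * apply_bcontfun f y $ j) =
      apply_bcontfun (vec_op ix u \<xi> f)" for f
  proof (intro ext, rule Finite_Cartesian_Product.vec_eq_iff[THEN iffD2], intro allI)
    fix x i
    have "apply_bcontfun (vec_op ix u \<xi> f) x $ i = vec_op ix (\<lambda>k y. l i k (x - y)) \<xi> f"
      using K_nth[of \<xi> f x i] by (simp add: apply_K)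
    also have "\<dots> = (\<Sum>k\<in>UNIV. LBINT y. apply_bcontfun f y $ k * l i k (x - y) * indicator (intervals ix \<xi> k) y)"
      by (rule vec_op_real[OF ix ord cont_shift(3)])
    finally show "(\<chi> i. \<Sum>j\<in>UNIV. LBINT y. l i j (x - y) * indicator (intervals ix \<xi> j) y * apply_bcontfun f y $ j) $ i =
        apply_bcontfun (vec_op ix u \<xi> f) x $ i" by (simp add: mult_ac)
  qed
  then show ?thesis unfolding kernel_operator_def K_def by (simp add: apply_bcontfun_inverse)
qed

text \<open>
  \<open>right\<close> is \<open>\<rho>\<^sub>i\<^sub>j f\<close> (the functions \<open>Q\<close> and \<open>P\<close>), \<open>left\<close> is its mirror image (\<open>Q\<close> and \<open>P\<close> with tilde),
  and \<open>lam\<close> is integration against \<open>f \<chi>\<^sub>X\<^sub>i\<close> in the component \<open>i\<close>.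
\<close>

definition right :: "real^'e \<Rightarrow> (real \<Rightarrow> real) \<Rightarrow> 'm \<Rightarrow> 'm \<Rightarrow> real \<Rightarrow> real" where
  "right \<xi> f i j x = apply_bcontfun (blinfun_apply (\<rho> \<xi>) (unit_bcontfun f j)) x $ i"

definition lam :: "real^'e \<Rightarrow> (real \<Rightarrow> real) \<Rightarrow> 'm \<Rightarrow> 'm bc_space \<Rightarrow> real" where
  "lam \<xi> f i = vec_op ix (\<lambda>k y. if k = i then f y else 0) \<xi>"

definition left :: "real^'e \<Rightarrow> (real \<Rightarrow> real) \<Rightarrow> 'm \<Rightarrow> 'm \<Rightarrow> real \<Rightarrow> real" where
  "left \<xi> f i j y = (if i = j then f y else 0) + lam \<xi> f i (blinfun_apply (\<rho> \<xi>) (u j y))"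

lemma lam_integral:
  assumes ord: "ordered_endpoints ix \<xi>" and f: "continuous_on UNIV f"
  shows "lam \<xi> f i g = (LBINT y. f y * indicator (intervals ix \<xi> i) y * apply_bcontfun g y $ i)"
proof -
  have c: "continuous_on UNIV (\<lambda>y. if k = i then f y else 0)" for k using f by (cases "k = i") auto
  have "lam \<xi> f i g = (\<Sum>k\<in>UNIV. LBINT y. apply_bcontfun g y $ k * (if k = i then f y else 0) * indicator (intervals ix \<xi> k) y)"
    unfolding lam_def by (rule vec_op_real[OF ix ord c])
  also have "\<dots> = (\<Sum>k\<in>UNIV. if k = i then LBINT y. f y * indicator (intervals ix \<xi> i) y * apply_bcontfun g y $ i else 0)"
    by (intro sum.cong) (auto simp: mult_ac)
  finally show ?thesis by simp
qed

lemma right_deriv_x: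
  assumes \<xi>: "\<xi> \<in> Inv" and f: "continuous_on UNIV f" "\<And>x. \<bar>f x\<bar> \<le> B" and f': "continuous_on UNIV f'" "\<And>x. \<bar>f' x\<bar> \<le> B'"
    and d: "\<And>x. (f has_real_derivative f' x) (at x)"
  shows "((\<lambda>x. right \<xi> f i j x) has_real_derivative
    right \<xi> f' i j x + (\<Sum>b\<in>UNIV. kerR \<xi> i (blk b) x (\<xi> $ b) * sg b * right \<xi> f (blk b) j (\<xi> $ b))) (at x)"
proof -
  have d': "((\<lambda>x. apply_bcontfun (unit_bcontfun f j) x $ i) has_real_derivative apply_bcontfun (unit_bcontfun f' j) x $ i) (at x)" for x i
    using d by (simp add: unit_bcontfun_nth[OF f] unit_bcontfun_nth[OF f'])
  have "((\<lambda>x. right \<xi> f i j x) has_real_derivative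
      apply_bcontfun (blinfun_apply (\<rho> \<xi>) (unit_bcontfun f' j + (\<Sum>e\<in>UNIV. (sg e * right \<xi> f (blk e) j (\<xi> $ e)) *\<^sub>R u (blk e) (\<xi> $ e)))) x $ i) (at x)"
    using \<rho>_deriv[OF \<xi> d'] unfolding right_def by simp
  moreover have "apply_bcontfun (blinfun_apply (\<rho> \<xi>) (unit_bcontfun f' j + (\<Sum>e\<in>UNIV. (sg e * right \<xi> f (blk e) j (\<xi> $ e)) *\<^sub>R u (blk e) (\<xi> $ e)))) x $ i
     = right \<xi> f' i j x + (\<Sum>b\<in>UNIV. kerR \<xi> i (blk b) x (\<xi> $ b) * sg b * right \<xi> f (blk b) j (\<xi> $ b))"
    by (simp add: right_def[of _ _ i j x] kerR_def blinfun.add_right blinfun.sum_right blinfun.scaleR_right apply_bcontfun_sum_nth mult_ac)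
  ultimately show ?thesis by simp
qed

lemma right_has_derivative:
  assumes \<xi>: "\<xi> \<in> Inv" and f: "continuous_on UNIV f" "\<And>x. \<bar>f x\<bar> \<le> B" and f': "continuous_on UNIV f'" "\<And>x. \<bar>f' x\<bar> \<le> B'"
    and d: "\<And>x. (f has_real_derivative f' x) (at x)"
  shows "((\<lambda>\<eta>. right \<eta> f i j (\<eta> $ e)) has_derivative
    (\<lambda>h. h $ e * (right \<xi> f' i j (\<xi> $ e) + (\<Sum>b\<in>UNIV. kerR \<xi> i (blk b) (\<xi> $ e) (\<xi> $ b) * sg b * right \<xi> f (blk b) j (\<xi> $ b)))
      - (\<Sum>b\<in>UNIV. kerR \<xi> i (blk b) (\<xi> $ e) (\<xi> $ b) * (sg b * h $ b) * right \<xi> f (blk b) j (\<xi> $ b)))) (at \<xi>)"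
proof -
  note H = \<rho>_has_derivative[OF \<xi> has_derivative_const, of "unit_bcontfun f j"]
  have "((\<lambda>x. apply_bcontfun (blinfun_apply (\<rho> \<xi>) (unit_bcontfun f j)) x $ i) has_real_derivative
      right \<xi> f' i j (\<xi> $ e) + (\<Sum>b\<in>UNIV. kerR \<xi> i (blk b) (\<xi> $ e) (\<xi> $ b) * sg b * right \<xi> f (blk b) j (\<xi> $ b))) (at (\<xi> $ e))"
    using right_deriv_x[OF \<xi> f f' d, of i j "\<xi> $ e"] by (simp add: right_def[abs_def])
  from has_derivative_bcontfun_moving[OF H this]
  have "((\<lambda>\<eta>. right \<eta> f i j (\<eta> $ e)) has_derivative
    (\<lambda>h. apply_bcontfun (blinfun_apply (\<rho> \<xi>) (0 - (\<Sum>b\<in>UNIV. (sg b * h $ b * right \<xi> f (blk b) j (\<xi> $ b)) *\<^sub>R u (blk b) (\<xi> $ b)))) (\<xi> $ e) $ i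
      + h $ e * (right \<xi> f' i j (\<xi> $ e) + (\<Sum>b\<in>UNIV. kerR \<xi> i (blk b) (\<xi> $ e) (\<xi> $ b) * sg b * right \<xi> f (blk b) j (\<xi> $ b))))) (at \<xi>)"
    by (simp add: right_def)
  moreover have "apply_bcontfun (blinfun_apply (\<rho> \<xi>) (0 - (\<Sum>b\<in>UNIV. (sg b * h $ b * right \<xi> f (blk b) j (\<xi> $ b)) *\<^sub>R u (blk b) (\<xi> $ b)))) (\<xi> $ e) $ i
     = - (\<Sum>b\<in>UNIV. kerR \<xi> i (blk b) (\<xi> $ e) (\<xi> $ b) * (sg b * h $ b) * right \<xi> f (blk b) j (\<xi> $ b))" for h
    by (simp add: kerR_def blinfun.minus_right blinfun.sum_right blinfun.scaleR_right apply_bcontfun_sum_nth mult_ac)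
  ultimately show ?thesis by (simp add: algebra_simps)
qed

lemma rho_u_has_derivative:
  assumes \<xi>: "\<xi> \<in> Inv"
  shows "((\<lambda>\<eta>. blinfun_apply (\<rho> \<eta>) (u j (\<eta> $ e'))) has_derivative
    (\<lambda>h. - (h $ e') *\<^sub>R blinfun_apply (\<rho> \<xi>) (u1 j (\<xi> $ e')) - (\<Sum>b\<in>UNIV. (sg b * h $ b * kerR \<xi> (blk b) j (\<xi> $ b) (\<xi> $ e')) *\<^sub>R blinfun_apply (\<rho> \<xi>) (u (blk b) (\<xi> $ b))))) (at \<xi>)"
proof -
  have G: "((\<lambda>\<eta>. u j (\<eta> $ e')) has_derivative (\<lambda>h. (h $ e') *\<^sub>R (- u1 j (\<xi> $ e')))) (at \<xi>)"
    by (rule has_derivative_compose[OF bounded_linear.has_derivative[OF bounded_linear_vec_nth has_derivative_ident]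
          u_has_vector_derivative[unfolded has_vector_derivative_def]])
  show ?thesis
    using \<rho>_has_derivative[OF \<xi> G]
    by (simp add: kerR_def blinfun.minus_right blinfun.diff_right blinfun.sum_right blinfun.scaleR_right)
qed

lemma kerR_has_derivative:
  assumes \<xi>: "\<xi> \<in> Inv"
  shows "((\<lambda>\<eta>. kerR \<eta> i j (\<eta> $ e) (\<eta> $ e')) has_derivative
    (\<lambda>h. - (\<Sum>b\<in>UNIV. kerR \<xi> i (blk b) (\<xi> $ e) (\<xi> $ b) * (sg b * h $ b) * kerR \<xi> (blk b) j (\<xi> $ b) (\<xi> $ e'))
      + h $ e * kerRx \<xi> i j (\<xi> $ e) (\<xi> $ e') + kerRy \<xi> i j (\<xi> $ e) (\<xi> $ e') * h $ e')) (at \<xi>)"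
proof -
  from has_derivative_bcontfun_moving[OF rho_u_has_derivative[OF \<xi>] kerR_deriv_x[OF \<xi>, unfolded kerR_def]]
  have "((\<lambda>\<eta>. kerR \<eta> i j (\<eta> $ e) (\<eta> $ e')) has_derivative
    (\<lambda>h. apply_bcontfun (- (h $ e') *\<^sub>R blinfun_apply (\<rho> \<xi>) (u1 j (\<xi> $ e')) - (\<Sum>b\<in>UNIV. (sg b * h $ b * kerR \<xi> (blk b) j (\<xi> $ b) (\<xi> $ e')) *\<^sub>R blinfun_apply (\<rho> \<xi>) (u (blk b) (\<xi> $ b)))) (\<xi> $ e) $ i
      + h $ e * kerRx \<xi> i j (\<xi> $ e) (\<xi> $ e'))) (at \<xi>)"
    unfolding kerR_def .
  moreover have "apply_bcontfun (- (h $ e') *\<^sub>R blinfun_apply (\<rho> \<xi>) (u1 j (\<xi> $ e')) - (\<Sum>b\<in>UNIV. (sg b * h $ b * kerR \<xi> (blk b) j (\<xi> $ b) (\<xi> $ e')) *\<^sub>R blinfun_apply (\<rho> \<xi>) (u (blk b) (\<xi> $ b)))) (\<xi> $ e) $ i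
     = kerRy \<xi> i j (\<xi> $ e) (\<xi> $ e') * h $ e' - (\<Sum>b\<in>UNIV. kerR \<xi> i (blk b) (\<xi> $ e) (\<xi> $ b) * (sg b * h $ b) * kerR \<xi> (blk b) j (\<xi> $ b) (\<xi> $ e'))" for h
    by (simp add: kerR_def kerRy_def apply_bcontfun_sum_nth mult_ac)
  ultimately show ?thesis by (simp add: algebra_simps)
qed

text \<open>The left side is the derivative of \<open>left\<close> in y, a column of the kernel
  having derivative \<open>- u1\<close>. The commutator of \<rho> with d/dx replaces this column by
  an x-derivative, which integration by parts moves onto \<open>f\<close>.\<close>

lemma left_deriv_y:
  assumes \<xi>: "\<xi> \<in> Inv" and f: "continuous_on UNIV f" "\<And>x. \<bar>f x\<bar> \<le> B" and f': "continuous_on UNIV f'" "\<And>x. \<bar>f' x\<bar> \<le> B'"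
    and d: "\<And>x. (f has_real_derivative f' x) (at x)"
  shows "(if i = j then f' y else 0) - lam \<xi> f i (blinfun_apply (\<rho> \<xi>) (u1 j y)) =
    left \<xi> f' i j y + (\<Sum>b\<in>UNIV. left \<xi> f i (blk b) (\<xi> $ b) * sg b * kerR \<xi> (blk b) j (\<xi> $ b) y)"
proof -
  let ?v = "\<lambda>k y. if k = i then f y else 0" and ?v' = "\<lambda>k y. if k = i then f' y else 0"
  have v: "cont_family ?v B" by (rule cont_family_single[OF f])
  have v': "cont_family ?v' B'" by (rule cont_family_single[OF f'])
  interpret v: cont_family ?v B by (rule v)
  let ?F = "blinfun_apply (\<rho> \<xi>) (u j y)"
  let ?F' = "u1 j y + blinfun_apply (K1 \<xi>) ?F"
  have "vec_op ix ?v' \<xi> ?F + vec_op ix ?v \<xi> ?F' = - (\<Sum>e\<in>UNIV. (sg e * apply_bcontfun ?F (\<xi> $ e) $ blk e) *\<^sub>R ?v (blk e) (\<xi> $ e))"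
    by (rule vec_op_by_parts[OF ix v v' _ \<rho>_deriv(1)[OF \<xi> u_deriv]])
      (use d in \<open>simp add: has_real_derivative_iff_has_vector_derivative\<close>)
  then have 1: "lam \<xi> f' i ?F + lam \<xi> f i ?F' = - (\<Sum>b\<in>UNIV. (if blk b = i then f (\<xi> $ b) else 0) * sg b * kerR \<xi> (blk b) j (\<xi> $ b) y)"
    by (simp add: lam_def kerR_def mult_ac)
  have "?F' = blinfun_apply (\<rho> \<xi>) (u1 j y) + (\<Sum>b\<in>UNIV. (sg b * kerR \<xi> (blk b) j (\<xi> $ b) y) *\<^sub>R blinfun_apply (\<rho> \<xi>) (u (blk b) (\<xi> $ b)))"
    unfolding \<rho>_deriv(2)[OF \<xi> u_deriv] by (simp add: kerR_def blinfun.add_right blinfun.sum_right blinfun.scaleR_right)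
  then have 2: "lam \<xi> f i ?F' = lam \<xi> f i (blinfun_apply (\<rho> \<xi>) (u1 j y)) +
      (\<Sum>b\<in>UNIV. lam \<xi> f i (blinfun_apply (\<rho> \<xi>) (u (blk b) (\<xi> $ b))) * sg b * kerR \<xi> (blk b) j (\<xi> $ b) y)"
    unfolding lam_def using bounded_linear.linear[OF v.bounded_linear_vec_op[of ix \<xi>]]
    by (simp add: linear_add linear_sum linear_cmul mult_ac)
  \<comment> \<open>The first sum is the boundary term of the integration by parts, the second comes
    from the commutator; together they form the values of \<open>left\<close> at the end-points,
    including its delta part.\<close>
  have 3: "(\<Sum>b\<in>UNIV. left \<xi> f i (blk b) (\<xi> $ b) * sg b * kerR \<xi> (blk b) j (\<xi> $ b) y) =
     (\<Sum>b\<in>UNIV. (if blk b = i then f (\<xi> $ b) else 0) * sg b * kerR \<xi> (blk b) j (\<xi> $ b) y)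
     + (\<Sum>b\<in>UNIV. lam \<xi> f i (blinfun_apply (\<rho> \<xi>) (u (blk b) (\<xi> $ b))) * sg b * kerR \<xi> (blk b) j (\<xi> $ b) y)"
    unfolding sum.distrib[symmetric] by (intro sum.cong) (auto simp: left_def algebra_simps)
  show ?thesis unfolding 3 using 1 2 by (simp add: left_def[of \<xi> f'])
qed

lemma left_has_derivative:
  assumes \<xi>: "\<xi> \<in> Inv" and f: "continuous_on UNIV f" "\<And>x. \<bar>f x\<bar> \<le> B" and f': "continuous_on UNIV f'" "\<And>x. \<bar>f' x\<bar> \<le> B'"
    and d: "\<And>x. (f has_real_derivative f' x) (at x)"
  shows "((\<lambda>\<eta>. left \<eta> f i j (\<eta> $ e')) has_derivative
    (\<lambda>h. (left \<xi> f' i j (\<xi> $ e') + (\<Sum>b\<in>UNIV. left \<xi> f i (blk b) (\<xi> $ b) * sg b * kerR \<xi> (blk b) j (\<xi> $ b) (\<xi> $ e'))) * h $ e'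
      - (\<Sum>b\<in>UNIV. left \<xi> f i (blk b) (\<xi> $ b) * (sg b * h $ b) * kerR \<xi> (blk b) j (\<xi> $ b) (\<xi> $ e')))) (at \<xi>)"
proof -
  let ?v = "\<lambda>k y. if k = i then f y else 0"
  interpret v: cont_family ?v B by (rule cont_family_single[OF f])
  let ?H = "\<lambda>\<eta>. blinfun_apply (\<rho> \<eta>) (u j (\<eta> $ e'))"
  let ?H' = "\<lambda>h. - (h $ e') *\<^sub>R blinfun_apply (\<rho> \<xi>) (u1 j (\<xi> $ e')) - (\<Sum>b\<in>UNIV. (sg b * h $ b * kerR \<xi> (blk b) j (\<xi> $ b) (\<xi> $ e')) *\<^sub>R blinfun_apply (\<rho> \<xi>) (u (blk b) (\<xi> $ b)))"
  \<comment> \<open>Functional and vector both move with eta. The functional is norm continuous,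
    which suffices on the difference of the vectors; it is differentiated only on the fixed vector
    at \<xi>.\<close>
  have 1: "((\<lambda>\<eta>. lam \<eta> f i (?H \<eta> - ?H \<xi>)) has_derivative (\<lambda>h. lam \<xi> f i (?H' h))) (at \<xi>)"
    unfolding lam_def using has_derivative_blinfun_diff[OF v.Blinfun_vec_op_tendsto rho_u_has_derivative[OF \<xi>]]
    by (simp add: v.Blinfun_vec_op)
  have 2: "((\<lambda>\<eta>. lam \<eta> f i (?H \<xi>)) has_derivative
      (\<lambda>h. - (\<Sum>b\<in>UNIV. (sg b * h $ b * apply_bcontfun (?H \<xi>) (\<xi> $ b) $ blk b) *\<^sub>R ?v (blk b) (\<xi> $ b)))) (at \<xi>)"
    unfolding lam_def by (rule v.vec_op_has_derivative)
  have 3: "((\<lambda>\<eta>. if i = j then f (\<eta> $ e') else 0) has_derivative (\<lambda>h. (if i = j then f' (\<xi> $ e') else 0) * h $ e')) (at \<xi>)"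
    using has_derivative_compose[OF bounded_linear.has_derivative[OF bounded_linear_vec_nth[of e'] has_derivative_ident]
          d[of "\<xi> $ e'", unfolded has_field_derivative_def]] by simp
  have lin: "linear (lam \<eta> f i)" for \<eta> unfolding lam_def by (rule bounded_linear.linear[OF v.bounded_linear_vec_op])
  have "((\<lambda>\<eta>. (if i = j then f (\<eta> $ e') else 0) + (lam \<eta> f i (?H \<eta> - ?H \<xi>) + lam \<eta> f i (?H \<xi>))) has_derivative
      (\<lambda>h. (if i = j then f' (\<xi> $ e') else 0) * h $ e' + (lam \<xi> f i (?H' h)
        + - (\<Sum>b\<in>UNIV. (sg b * h $ b * apply_bcontfun (?H \<xi>) (\<xi> $ b) $ blk b) *\<^sub>R ?v (blk b) (\<xi> $ b))))) (at \<xi>)"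
    by (intro has_derivative_add 1 2 3)
  moreover have "(if i = j then f (\<eta> $ e') else 0) + (lam \<eta> f i (?H \<eta> - ?H \<xi>) + lam \<eta> f i (?H \<xi>)) = left \<eta> f i j (\<eta> $ e')" for \<eta>
    by (simp add: left_def linear_diff[OF lin])
  moreover have "(if i = j then f' (\<xi> $ e') else 0) * h $ e' + (lam \<xi> f i (?H' h)
        + - (\<Sum>b\<in>UNIV. (sg b * h $ b * apply_bcontfun (?H \<xi>) (\<xi> $ b) $ blk b) *\<^sub>R ?v (blk b) (\<xi> $ b))) =
     (left \<xi> f' i j (\<xi> $ e') + (\<Sum>b\<in>UNIV. left \<xi> f i (blk b) (\<xi> $ b) * sg b * kerR \<xi> (blk b) j (\<xi> $ b) (\<xi> $ e'))) * h $ e'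
      - (\<Sum>b\<in>UNIV. left \<xi> f i (blk b) (\<xi> $ b) * (sg b * h $ b) * kerR \<xi> (blk b) j (\<xi> $ b) (\<xi> $ e'))" for h
  proof -
    have a: "lam \<xi> f i (?H' h) = - (h $ e') * lam \<xi> f i (blinfun_apply (\<rho> \<xi>) (u1 j (\<xi> $ e')))
        - (\<Sum>b\<in>UNIV. (sg b * h $ b * kerR \<xi> (blk b) j (\<xi> $ b) (\<xi> $ e')) * lam \<xi> f i (blinfun_apply (\<rho> \<xi>) (u (blk b) (\<xi> $ b))))"
      by (simp add: linear_diff[OF lin] linear_cmul[OF lin] linear_sum[OF lin] linear_neg[OF lin])
    have b: "(\<Sum>b\<in>UNIV. left \<xi> f i (blk b) (\<xi> $ b) * (sg b * h $ b) * kerR \<xi> (blk b) j (\<xi> $ b) (\<xi> $ e')) =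
      (\<Sum>b\<in>UNIV. (sg b * h $ b * kerR \<xi> (blk b) j (\<xi> $ b) (\<xi> $ e')) * lam \<xi> f i (blinfun_apply (\<rho> \<xi>) (u (blk b) (\<xi> $ b))))
      + (\<Sum>b\<in>UNIV. (sg b * h $ b * apply_bcontfun (?H \<xi>) (\<xi> $ b) $ blk b) *\<^sub>R ?v (blk b) (\<xi> $ b))"
      unfolding sum.distrib[symmetric] by (intro sum.cong) (auto simp: left_def kerR_def algebra_simps)
    show ?thesis
      unfolding a b left_deriv_y[OF \<xi> f f' d, symmetric] by (simp add: algebra_simps)
  qed
  ultimately show ?thesis by simp
qed

lemma right_minus:
  assumes f: "continuous_on UNIV f" "\<And>x. \<bar>f x\<bar> \<le> B"
  shows "right \<xi> (\<lambda>x. - f x) i j x = - right \<xi> f i j x"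
proof -
  have mf: "continuous_on UNIV (\<lambda>x. - f x)" "\<And>x. \<bar>- f x\<bar> \<le> B" using f by (auto intro: continuous_on_minus)
  have "unit_bcontfun (\<lambda>x. - f x) j = - unit_bcontfun f j"
    by (rule bcontfun_eqI, rule Finite_Cartesian_Product.vec_eq_iff[THEN iffD2])
      (simp add: unit_bcontfun_nth[OF f] unit_bcontfun_nth[OF mf])
  then show ?thesis by (simp add: right_def blinfun.minus_right)
qed

lemma left_minus:
  assumes f: "continuous_on UNIV f" "\<And>x. \<bar>f x\<bar> \<le> B"
  shows "left \<xi> (\<lambda>x. - f x) i j y = - left \<xi> f i j y"
proof -
  have "(\<lambda>k y. - (if k = i then f y else 0)) = (\<lambda>k y. if k = i then - f y else 0)" by (simp add: fun_eq_iff)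
  then have "lam \<xi> (\<lambda>x. - f x) i g = - lam \<xi> f i g" for g
    using cont_family.vec_op_compose[OF cont_family_single[OF f] bounded_linear_minus[OF bounded_linear_ident], of ix i \<xi> g]
    by (simp add: lam_def)
  then show ?thesis by (simp add: left_def)
qed

lemma continuous_left:
  assumes f: "continuous_on UNIV f" "\<And>x. \<bar>f x\<bar> \<le> B"
  shows "continuous_on UNIV (left \<xi> f i j)"
proof -
  interpret v: cont_family "\<lambda>k y. if k = i then f y else 0" B by (rule cont_family_single[OF f])
  have "continuous_on UNIV (\<lambda>y. if i = j then f y else 0)" using f by (cases "i = j") auto
  then show ?thesis
    unfolding left_def[abs_def] lam_def
    by (intro continuous_on_add bounded_linear.continuous_on[OF v.bounded_linear_vec_op continuous_rho_u])
qed

end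

section \<open>The commutator with x - 2 \<tau> d/dx\<close>

text \<open>Besides regularity, the equation \<open>ode\<close> is all that the commutator argument
  uses about the sine kernel. It has the same form for all pairs of blocks; for i = j it says that l
  is sin x / x away from 0.\<close>

locale sine_conv_kernel = conv_kernel l l1 C n ix
  for l l1 :: "'m::{finite,linorder} \<Rightarrow> 'm \<Rightarrow> real \<Rightarrow> real" and C :: real
    and n :: "'m \<Rightarrow> nat" and ix :: "'e::finite \<Rightarrow> 'm \<times> nat" +
  fixes \<tau> :: "'m \<Rightarrow> real"
  assumes ode: "2 * (\<tau> i - \<tau> j) * l1 i j x = x * l i j x - exp (\<tau> i - \<tau> j) * sin x"
begin

definition tmul :: "'m bc_space \<Rightarrow> 'm bc_space" where
  "tmul f = Bcontfun (\<lambda>x. \<chi> i. \<tau> i * apply_bcontfun f x $ i)"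

lemma tmul_nth [simp]: "apply_bcontfun (tmul f) x $ i = \<tau> i * apply_bcontfun f x $ i"
proof -
  have "apply_bcontfun (tmul f) = (\<lambda>x. \<chi> i. \<tau> i * apply_bcontfun f x $ i)"
    unfolding tmul_def
  proof (rule apply_Bcontfun_cart[where B = "(\<Sum>i\<in>UNIV. \<bar>\<tau> i\<bar>) * norm f"])
    show "continuous_on UNIV (\<lambda>x. (\<chi> i. \<tau> i * apply_bcontfun f x $ i) $ i)" for i
      by (simp, intro continuous_intros)
    show "\<bar>(\<chi> i. \<tau> i * apply_bcontfun f x $ i) $ i\<bar> \<le> (\<Sum>i\<in>UNIV. \<bar>\<tau> i\<bar>) * norm f" for x i
      by (simp add: abs_mult, intro mult_mono member_le_sum abs_bcontfun_nth_le sum_nonneg) auto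
  qed
  then show ?thesis by simp
qed

text \<open>By the addition theorem the inhomogeneous term exp(\<tau>_i - \<tau>_j) sin(x - y) has
  rank two: these vectors, with g = sin and g = cos, are its factors in i and x.\<close>

definition exp_vec :: "(real \<Rightarrow> real) \<Rightarrow> 'm bc_space" where
  "exp_vec g = (\<Sum>a\<in>UNIV. exp (\<tau> a) *\<^sub>R unit_bcontfun g a)"

lemma exp_vec_nth:
  assumes "continuous_on UNIV g" "\<And>y. \<bar>g y\<bar> \<le> B"
  shows "apply_bcontfun (exp_vec g) x $ i = exp (\<tau> i) * g x"
proof -
  have "apply_bcontfun (exp_vec g) x $ i = (\<Sum>a\<in>UNIV. if a = i then exp (\<tau> i) * g x else 0)"
    unfolding exp_vec_def apply_bcontfun_sum_nth by (intro sum.cong) (auto simp: unit_bcontfun_nth[OF assms])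
  then show ?thesis by simp
qed

lemma sin_cos_vec_nth [simp]:
  "apply_bcontfun (exp_vec sin) x $ i = exp (\<tau> i) * sin x" "apply_bcontfun (exp_vec cos) x $ i = exp (\<tau> i) * cos x"
  by (rule exp_vec_nth[where B = 1]; auto intro!: continuous_intros)+

lemma rho_exp_vec: "apply_bcontfun (blinfun_apply (\<rho> \<xi>) (exp_vec g)) x $ i = (\<Sum>a\<in>UNIV. exp (\<tau> a) * right \<xi> g i a x)"
  by (simp add: exp_vec_def blinfun.sum_right blinfun.scaleR_right apply_bcontfun_sum_nth right_def)

text \<open>Clamping to an interval around 0 that contains every end-point, so that nothing changes
  on the sets X.\<close>

definition cl :: "real^'e \<Rightarrow> real \<Rightarrow> real" where
  "cl \<xi> z = max (- (\<Sum>e\<in>UNIV. \<bar>\<xi> $ e\<bar>)) (min (\<Sum>e\<in>UNIV. \<bar>\<xi> $ e\<bar>) z)"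

lemma cl_intervals:
  assumes "z \<in> intervals ix \<xi> k"
  shows "cl \<xi> z = z"
proof -
  obtain e e' where "\<xi> $ e < z" "z < \<xi> $ e'" using assms unfolding intervals_def by auto
  moreover have "\<bar>\<xi> $ b\<bar> \<le> (\<Sum>e\<in>UNIV. \<bar>\<xi> $ e\<bar>)" for b by (rule member_le_sum) auto
  note this[of e] this[of e']
  ultimately show ?thesis by (auto simp: cl_def)
qed

text \<open>Truncation of multiplication by \<open>z\<close>, harmless inside the intervals.\<close>

definition cmul :: "real^'e \<Rightarrow> 'm bc_space \<Rightarrow> 'm bc_space" where
  "cmul \<xi> f = Bcontfun (\<lambda>z. \<chi> k. cl \<xi> z * apply_bcontfun f z $ k)"

lemma cmul_nth [simp]: "apply_bcontfun (cmul \<xi> f) z $ k = cl \<xi> z * apply_bcontfun f z $ k"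
proof -
  let ?R = "\<Sum>e\<in>UNIV. \<bar>\<xi> $ e\<bar>"
  have R: "0 \<le> ?R" by (simp add: sum_nonneg)
  have "apply_bcontfun (cmul \<xi> f) = (\<lambda>z. \<chi> k. cl \<xi> z * apply_bcontfun f z $ k)"
    unfolding cmul_def
  proof (rule apply_Bcontfun_cart[where B = "?R * norm f"])
    show "continuous_on UNIV (\<lambda>x. (\<chi> k. cl \<xi> x * apply_bcontfun f x $ k) $ i)" for i
      unfolding cl_def by (simp, intro continuous_intros)
    have "\<bar>max (- r) (min r x)\<bar> \<le> r" if "0 \<le> r" for r x :: real
      using that by (auto simp: max_def min_def)
    from this[OF R] have "\<bar>cl \<xi> x\<bar> \<le> ?R" for x by (simp add: cl_def)
    then show "\<bar>(\<chi> k. cl \<xi> x * apply_bcontfun f x $ k) $ i\<bar> \<le> ?R * norm f" for x i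
      using R by (simp add: abs_mult mult_mono abs_bcontfun_nth_le)
  qed
  then show ?thesis by simp
qed

lemma K_integral:
  assumes ord: "ordered_endpoints ix \<xi>"
  shows "apply_bcontfun (blinfun_apply (K \<xi>) f) x $ i = (\<Sum>k\<in>UNIV. LBINT z. apply_bcontfun f z $ k * l i k (x - z) * indicator (intervals ix \<xi> k) z)"
    and "apply_bcontfun (blinfun_apply (K1 \<xi>) f) x $ i = (\<Sum>k\<in>UNIV. LBINT z. apply_bcontfun f z $ k * l1 i k (x - z) * indicator (intervals ix \<xi> k) z)"
  unfolding K_nth K1_nth by (rule vec_op_real[OF ix ord cont_shift(3)] vec_op_real[OF ix ord cont_shift(4)])+

text \<open>Under the integral x l = (x - z) l + z l. The equation of \<open>l\<close> turns the
  first part into derivatives and the sine term of rank two; the second part is \<open>K\<close>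
  after multiplication by z.\<close>

lemma mult_K_nth:
  assumes ord: "ordered_endpoints ix \<xi>"
  shows "x * apply_bcontfun (blinfun_apply (K \<xi>) f) x $ i =
    2 * \<tau> i * apply_bcontfun (blinfun_apply (K1 \<xi>) f) x $ i - 2 * apply_bcontfun (blinfun_apply (K1 \<xi>) (tmul f)) x $ i
    + exp (\<tau> i) * (sin x * (\<Sum>k\<in>UNIV. exp (- \<tau> k) * lam \<xi> cos k f) - cos x * (\<Sum>k\<in>UNIV. exp (- \<tau> k) * lam \<xi> sin k f))
    + apply_bcontfun (blinfun_apply (K \<xi>) (cmul \<xi> f)) x $ i"
proof -
  define I where "I k g = (LBINT z. (apply_bcontfun f z $ k * g z) * indicator (intervals ix \<xi> k) z)" for k g
  have int: "integrable lborel (\<lambda>z. (apply_bcontfun f z $ k * g z) * indicator (intervals ix \<xi> k) z)" if "continuous_on UNIV g" for k g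
    by (rule integral_intervals(1)[OF ix ord]) (intro continuous_intros that)
  have add: "I k (\<lambda>z. g z + h z) = I k g + I k h" if "continuous_on UNIV g" "continuous_on UNIV h" for k g h
    using int[OF that(1), of k] int[OF that(2), of k] unfolding I_def by (simp add: distrib_left distrib_right)
  have cm: "I k (\<lambda>z. c * g z) = c * I k g" for k c g
    unfolding I_def by (simp add: mult.left_commute[of _ c] mult.assoc)
  have cs: "continuous_on UNIV (cos :: real \<Rightarrow> real)" "continuous_on UNIV (sin :: real \<Rightarrow> real)" by (intro continuous_intros)+
  have each: "x * I k (\<lambda>z. l i k (x - z)) = 2 * \<tau> i * I k (\<lambda>z. l1 i k (x - z)) - 2 * (\<tau> k * I k (\<lambda>z. l1 i k (x - z)))
      + exp (\<tau> i) * (sin x * (exp (- \<tau> k) * I k cos) - cos x * (exp (- \<tau> k) * I k sin)) + I k (\<lambda>z. z * l i k (x - z))" for k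
  proof -
    have "x * l i k (x - z) = 2 * (\<tau> i - \<tau> k) * l1 i k (x - z) +
        ((exp (\<tau> i) * exp (- \<tau> k) * sin x) * cos z + ((- (exp (\<tau> i) * exp (- \<tau> k) * cos x)) * sin z + z * l i k (x - z)))" for z
      using ode[of i k "x - z"] by (simp add: sin_diff exp_diff exp_minus algebra_simps divide_inverse)
    then have "I k (\<lambda>z. x * l i k (x - z)) = I k (\<lambda>z. 2 * (\<tau> i - \<tau> k) * l1 i k (x - z) +
        ((exp (\<tau> i) * exp (- \<tau> k) * sin x) * cos z + ((- (exp (\<tau> i) * exp (- \<tau> k) * cos x)) * sin z + z * l i k (x - z))))"
      by presburger
    also have "\<dots> = I k (\<lambda>z. 2 * (\<tau> i - \<tau> k) * l1 i k (x - z)) + (I k (\<lambda>z. (exp (\<tau> i) * exp (- \<tau> k) * sin x) * cos z)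
        + (I k (\<lambda>z. (- (exp (\<tau> i) * exp (- \<tau> k) * cos x)) * sin z) + I k (\<lambda>z. z * l i k (x - z))))"
    proof -
      have c1: "continuous_on UNIV (\<lambda>z. 2 * (\<tau> i - \<tau> k) * l1 i k (x - z))"
        and c2: "continuous_on UNIV (\<lambda>z. (exp (\<tau> i) * exp (- \<tau> k) * sin x) * cos z)"
        and c3: "continuous_on UNIV (\<lambda>z. (- (exp (\<tau> i) * exp (- \<tau> k) * cos x)) * sin z)"
        and c4: "continuous_on UNIV (\<lambda>z. z * l i k (x - z))"
        by (rule continuous_on_mult continuous_on_const continuous_on_id cont_shift cs)+
      show ?thesis
        by (simp only: add[OF c1 continuous_on_add[OF c2 continuous_on_add[OF c3 c4]]] add[OF c2 continuous_on_add[OF c3 c4]] add[OF c3 c4])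
    qed
    finally show ?thesis unfolding cm by (simp add: algebra_simps)
  qed
  have Kf: "apply_bcontfun (blinfun_apply (K \<xi>) f) x $ i = (\<Sum>k\<in>UNIV. I k (\<lambda>z. l i k (x - z)))"
    and K1f: "apply_bcontfun (blinfun_apply (K1 \<xi>) f) x $ i = (\<Sum>k\<in>UNIV. I k (\<lambda>z. l1 i k (x - z)))"
    by (simp_all add: K_integral[OF ord] I_def)
  have "(LBINT z. apply_bcontfun (tmul f) z $ k * l1 i k (x - z) * indicator (intervals ix \<xi> k) z) = \<tau> k * I k (\<lambda>z. l1 i k (x - z))" for k
    by (simp add: I_def mult.assoc)
  then have K1t: "apply_bcontfun (blinfun_apply (K1 \<xi>) (tmul f)) x $ i = (\<Sum>k\<in>UNIV. \<tau> k * I k (\<lambda>z. l1 i k (x - z)))"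
    by (simp add: K_integral[OF ord])
  have "(LBINT z. apply_bcontfun (cmul \<xi> f) z $ k * l i k (x - z) * indicator (intervals ix \<xi> k) z) = I k (\<lambda>z. z * l i k (x - z))" for k
    unfolding I_def by (rule Bochner_Integration.integral_cong[OF refl]) (auto simp: cl_intervals indicator_def)
  then have Kc: "apply_bcontfun (blinfun_apply (K \<xi>) (cmul \<xi> f)) x $ i = (\<Sum>k\<in>UNIV. I k (\<lambda>z. z * l i k (x - z)))"
    by (simp add: K_integral[OF ord])
  have lam: "lam \<xi> cos k f = I k cos" "lam \<xi> sin k f = I k sin" for k
    by (simp_all add: lam_integral[OF ord] cs I_def mult_ac)
  show ?thesis
    unfolding Kf K1f K1t Kc lam
    by (simp add: sum_distrib_left each sum.distrib sum_subtractf right_diff_distrib)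
qed

text \<open>For a column f of the resolvent, x f(x) is not bounded a priori. Multiplying f = u + K f
  by x and using \<open>mult_K_nth\<close> exhibits it as the element \<open>F\<close> of the
  function space. On the intervals \<open>F\<close> agrees with the truncated product, hence F = A +
  K F and F = \<rho> A; the identity is the comparison of components.\<close>

lemma commutator_identity:
  assumes \<xi>: "\<xi> \<in> Inv" and ord: "ordered_endpoints ix \<xi>"
  shows "(x - y) * kerR \<xi> i j x y = 2 * \<tau> i * kerRx \<xi> i j x y + 2 * \<tau> j * kerRy \<xi> i j x y
    - 2 * (\<Sum>b\<in>UNIV. sg b * \<tau> (blk b) * kerR \<xi> i (blk b) x (\<xi> $ b) * kerR \<xi> (blk b) j (\<xi> $ b) y)
    + (\<Sum>k\<in>UNIV. \<Sum>a\<in>UNIV. exp (\<tau> a - \<tau> k) * (left \<xi> cos k j y * right \<xi> sin i a x - left \<xi> sin k j y * right \<xi> cos i a x))"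
proof -
  define f where "f = blinfun_apply (\<rho> \<xi>) (u j y)"
  define f' where "f' = u1 j y + blinfun_apply (K1 \<xi>) f"
  let ?c = "\<Sum>k\<in>UNIV. exp (- \<tau> k) * lam \<xi> cos k f" and ?s = "\<Sum>k\<in>UNIV. exp (- \<tau> k) * lam \<xi> sin k f"
  have f: "f = u j y + blinfun_apply (K \<xi>) f" unfolding f_def by (rule \<rho>_inverse(2)[OF \<xi>])
  define A where "A = y *\<^sub>R u j y + 2 *\<^sub>R tmul f' - (2 * \<tau> j) *\<^sub>R u1 j y - 2 *\<^sub>R blinfun_apply (K1 \<xi>) (tmul f)
    + (exp (- \<tau> j) * cos y + ?c) *\<^sub>R exp_vec sin - (exp (- \<tau> j) * sin y + ?s) *\<^sub>R exp_vec cos"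
  define F where "F = A + blinfun_apply (K \<xi>) (cmul \<xi> f)"
  have F_nth: "apply_bcontfun F x $ i = x * apply_bcontfun f x $ i" for x i
  proof -
    have l: "x * l i j (x - y) = y * l i j (x - y) + 2 * (\<tau> i - \<tau> j) * l1 i j (x - y)
        + exp (\<tau> i) * (sin x * (exp (- \<tau> j) * cos y) - cos x * (exp (- \<tau> j) * sin y))"
      using ode[of i j "x - y"] by (simp add: sin_diff exp_diff exp_minus algebra_simps divide_inverse)
    have "x * apply_bcontfun f x $ i = x * l i j (x - y) + x * apply_bcontfun (blinfun_apply (K \<xi>) f) x $ i"
      by (subst f) (simp add: distrib_left)
    also have "\<dots> = apply_bcontfun F x $ i"
      unfolding l mult_K_nth[OF ord, of x f i] F_def A_def f'_def by (simp add: algebra_simps)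
    finally show ?thesis by simp
  qed
  have "blinfun_apply (K \<xi>) F = blinfun_apply (K \<xi>) (cmul \<xi> f)"
  proof (rule bcontfun_eqI, rule Finite_Cartesian_Product.vec_eq_iff[THEN iffD2], rule allI)
    fix x i
    show "apply_bcontfun (blinfun_apply (K \<xi>) F) x $ i = apply_bcontfun (blinfun_apply (K \<xi>) (cmul \<xi> f)) x $ i"
      unfolding K_integral[OF ord]
      by (intro sum.cong refl Bochner_Integration.integral_cong) (auto simp: F_nth cl_intervals indicator_def)
  qed
  then have F: "F = blinfun_apply (\<rho> \<xi>) A"
    by (intro \<rho>_eqI[OF \<xi>]) (simp add: F_def)
  have df: "((\<lambda>y. apply_bcontfun (tmul f) y $ k) has_real_derivative apply_bcontfun (tmul f') y $ k) (at y)" for k y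
    using DERIV_cmult[OF \<rho>_deriv(1)[OF \<xi> u_deriv]] by (simp add: f_def f'_def)
  have "vec_op ix (\<lambda>k y. - u1 k y) \<xi> (tmul f) + vec_op ix u \<xi> (tmul f') =
      - (\<Sum>e\<in>UNIV. (sg e * apply_bcontfun (tmul f) (\<xi> $ e) $ blk e) *\<^sub>R u (blk e) (\<xi> $ e))"
    by (rule vec_op_by_parts[OF ix u.cont_family_axioms _ u_has_vector_derivative df, of D])
      (use u1.cont_family_axioms in \<open>auto simp: cont_family_def intro!: continuous_on_minus\<close>)
  moreover have "vec_op ix (\<lambda>k y. - u1 k y) \<xi> (tmul f) = - vec_op ix u1 \<xi> (tmul f)"
    using u1.vec_op_compose[OF bounded_linear_minus[OF bounded_linear_ident], of ix \<xi> "tmul f"] by simp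
  ultimately have K1t: "blinfun_apply (K1 \<xi>) (tmul f) = blinfun_apply (K \<xi>) (tmul f') +
      (\<Sum>b\<in>UNIV. (sg b * \<tau> (blk b) * kerR \<xi> (blk b) j (\<xi> $ b) y) *\<^sub>R u (blk b) (\<xi> $ b))"
    by (simp add: apply_K apply_K1 f_def kerR_def mult.assoc algebra_simps)
  have c: "exp (- \<tau> j) * cos y + ?c = (\<Sum>k\<in>UNIV. exp (- \<tau> k) * left \<xi> cos k j y)"
    "exp (- \<tau> j) * sin y + ?s = (\<Sum>k\<in>UNIV. exp (- \<tau> k) * left \<xi> sin k j y)"
  proof -
    have "(\<Sum>k\<in>UNIV. exp (- \<tau> k) * left \<xi> g k j y) = (\<Sum>k\<in>UNIV. if k = j then exp (- \<tau> j) * g y else 0) + (\<Sum>k\<in>UNIV. exp (- \<tau> k) * lam \<xi> g k f)" for g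
      unfolding sum.distrib[symmetric] by (intro sum.cong) (auto simp: left_def f_def algebra_simps)
    then show "exp (- \<tau> j) * cos y + ?c = (\<Sum>k\<in>UNIV. exp (- \<tau> k) * left \<xi> cos k j y)"
      "exp (- \<tau> j) * sin y + ?s = (\<Sum>k\<in>UNIV. exp (- \<tau> k) * left \<xi> sin k j y)" by simp_all
  qed
  \<comment> \<open>After integration by parts the terms with f' combine to 2 (I - K) applied to
    \<open>tmul f'\<close>, and \<rho> undoes I - K.\<close>
  have A: "A = y *\<^sub>R u j y + 2 *\<^sub>R (tmul f' - blinfun_apply (K \<xi>) (tmul f')) - (2 * \<tau> j) *\<^sub>R u1 j y
      - 2 *\<^sub>R (\<Sum>b\<in>UNIV. (sg b * \<tau> (blk b) * kerR \<xi> (blk b) j (\<xi> $ b) y) *\<^sub>R u (blk b) (\<xi> $ b))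
      + (\<Sum>k\<in>UNIV. exp (- \<tau> k) * left \<xi> cos k j y) *\<^sub>R exp_vec sin - (\<Sum>k\<in>UNIV. exp (- \<tau> k) * left \<xi> sin k j y) *\<^sub>R exp_vec cos"
    unfolding A_def K1t c by (simp add: algebra_simps)
  have "F = y *\<^sub>R f + 2 *\<^sub>R tmul f' - (2 * \<tau> j) *\<^sub>R blinfun_apply (\<rho> \<xi>) (u1 j y)
      - 2 *\<^sub>R (\<Sum>b\<in>UNIV. (sg b * \<tau> (blk b) * kerR \<xi> (blk b) j (\<xi> $ b) y) *\<^sub>R blinfun_apply (\<rho> \<xi>) (u (blk b) (\<xi> $ b)))
      + (\<Sum>k\<in>UNIV. exp (- \<tau> k) * left \<xi> cos k j y) *\<^sub>R blinfun_apply (\<rho> \<xi>) (exp_vec sin)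
      - (\<Sum>k\<in>UNIV. exp (- \<tau> k) * left \<xi> sin k j y) *\<^sub>R blinfun_apply (\<rho> \<xi>) (exp_vec cos)"
    unfolding F A by (simp only: blinfun.add_right blinfun.diff_right[of _ _ "_ *\<^sub>R _"] blinfun.sum_right blinfun.scaleR_right \<rho>_inverse(1)[OF \<xi>] f_def)
  then have "apply_bcontfun F x $ i = y * kerR \<xi> i j x y + 2 * (\<tau> i * kerRx \<xi> i j x y) + 2 * \<tau> j * kerRy \<xi> i j x y
      - 2 * (\<Sum>b\<in>UNIV. sg b * \<tau> (blk b) * kerR \<xi> i (blk b) x (\<xi> $ b) * kerR \<xi> (blk b) j (\<xi> $ b) y)
      + (\<Sum>k\<in>UNIV. exp (- \<tau> k) * left \<xi> cos k j y) * (\<Sum>a\<in>UNIV. exp (\<tau> a) * right \<xi> sin i a x)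
      - (\<Sum>k\<in>UNIV. exp (- \<tau> k) * left \<xi> sin k j y) * (\<Sum>a\<in>UNIV. exp (\<tau> a) * right \<xi> cos i a x)"
    by (simp add: apply_bcontfun_sum_nth rho_exp_vec kerRy_def kerRx_def f'_def f_def kerR_def[of \<xi> i] mult_ac)
  moreover have "apply_bcontfun F x $ i = x * kerR \<xi> i j x y" by (simp add: F_nth kerR_def f_def)
  moreover have "(\<Sum>k\<in>UNIV. exp (- \<tau> k) * left \<xi> cos k j y) * (\<Sum>a\<in>UNIV. exp (\<tau> a) * right \<xi> sin i a x)
      - (\<Sum>k\<in>UNIV. exp (- \<tau> k) * left \<xi> sin k j y) * (\<Sum>a\<in>UNIV. exp (\<tau> a) * right \<xi> cos i a x) =
      (\<Sum>k\<in>UNIV. \<Sum>a\<in>UNIV. exp (\<tau> a - \<tau> k) * (left \<xi> cos k j y * right \<xi> sin i a x - left \<xi> sin k j y * right \<xi> cos i a x))"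
    unfolding sum_product sum_subtractf[symmetric]
    by (intro sum.cong refl) (simp add: exp_diff exp_minus algebra_simps divide_inverse)
  ultimately show ?thesis by (simp add: left_diff_distrib)
qed

lemma kerRx_off_block:
  assumes \<xi>: "\<xi> \<in> Inv" and ord: "ordered_endpoints ix \<xi>" and ne: "\<tau> i \<noteq> \<tau> j"
  shows "kerRx \<xi> i j x y = ((x - y) * kerR \<xi> i j x y
    + 2 * (\<Sum>b\<in>UNIV. sg b * (\<tau> (blk b) - \<tau> j) * kerR \<xi> i (blk b) x (\<xi> $ b) * kerR \<xi> (blk b) j (\<xi> $ b) y)
    - (\<Sum>k\<in>UNIV. \<Sum>a\<in>UNIV. exp (\<tau> a - \<tau> k) * (left \<xi> cos k j y * right \<xi> sin i a x - left \<xi> sin k j y * right \<xi> cos i a x)))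
    * (1 / (2 * (\<tau> i - \<tau> j)))"
proof -
  let ?S = "\<Sum>b\<in>UNIV. sg b * kerR \<xi> i (blk b) x (\<xi> $ b) * kerR \<xi> (blk b) j (\<xi> $ b) y"
  let ?T = "\<Sum>b\<in>UNIV. sg b * \<tau> (blk b) * kerR \<xi> i (blk b) x (\<xi> $ b) * kerR \<xi> (blk b) j (\<xi> $ b) y"
  let ?G = "\<Sum>k\<in>UNIV. \<Sum>a\<in>UNIV. exp (\<tau> a - \<tau> k) * (left \<xi> cos k j y * right \<xi> sin i a x - left \<xi> sin k j y * right \<xi> cos i a x)"
  have "(\<Sum>b\<in>UNIV. sg b * (\<tau> (blk b) - \<tau> j) * kerR \<xi> i (blk b) x (\<xi> $ b) * kerR \<xi> (blk b) j (\<xi> $ b) y) = ?T - \<tau> j * ?S"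
    unfolding sum_distrib_left sum_subtractf[symmetric] by (intro sum.cong) (auto simp: algebra_simps)
  moreover have "2 * (\<tau> i - \<tau> j) * kerRx \<xi> i j x y = (x - y) * kerR \<xi> i j x y + 2 * (?T - \<tau> j * ?S) - ?G"
    unfolding commutator_identity[OF \<xi> ord] kerR_sum_deriv[OF \<xi>, symmetric] by (simp add: algebra_simps)
  ultimately show ?thesis using ne by (simp add: field_simps)
qed

text \<open>
  Inside a diagonal block the commutator identity does not contain \<open>kerRx\<close> separately, but by
  \<open>kerR_sum_deriv\<close> it expresses \<open>(x - y) * kerR\<close> by products of functions of \<open>x\<close> and of \<open>y\<close>;
  differentiating in \<open>x\<close> yields \<open>kerRx\<close> in terms of off-block values.
\<close>

lemma kerRx_same_block:
  assumes \<xi>: "\<xi> \<in> Inv" and ord: "ordered_endpoints ix \<xi>"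
  shows "(x - y) * kerRx \<xi> i i x y = - kerR \<xi> i i x y
    + 2 * (\<Sum>b\<in>UNIV. sg b * (\<tau> i - \<tau> (blk b)) * kerRx \<xi> i (blk b) x (\<xi> $ b) * kerR \<xi> (blk b) i (\<xi> $ b) y)
    + (\<Sum>k\<in>UNIV. \<Sum>a\<in>UNIV. exp (\<tau> a - \<tau> k) *
        (left \<xi> cos k i y * (right \<xi> cos i a x + (\<Sum>b\<in>UNIV. kerR \<xi> i (blk b) x (\<xi> $ b) * sg b * right \<xi> sin (blk b) a (\<xi> $ b)))
       - left \<xi> sin k i y * (- right \<xi> sin i a x + (\<Sum>b\<in>UNIV. kerR \<xi> i (blk b) x (\<xi> $ b) * sg b * right \<xi> cos (blk b) a (\<xi> $ b)))))"
    (is "_ = - _ + ?S + ?G")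
proof -
  have c: "continuous_on UNIV (sin :: real \<Rightarrow> real)" "continuous_on UNIV (cos :: real \<Rightarrow> real)"
    "continuous_on UNIV (\<lambda>x::real. - sin x)" by (intro continuous_intros)+
  have neg: "right \<xi> (\<lambda>x. - sin x) i a x = - right \<xi> sin i a x" for i a x
    by (rule right_minus[OF c(1), of 1]) auto
  have sin': "((\<lambda>x. right \<xi> sin i a x) has_real_derivative
      right \<xi> cos i a x + (\<Sum>b\<in>UNIV. kerR \<xi> i (blk b) x (\<xi> $ b) * sg b * right \<xi> sin (blk b) a (\<xi> $ b))) (at x)" for a
    by (rule right_deriv_x[OF \<xi> c(1) _ c(2), of 1 1]) (auto intro: DERIV_sin)
  have cos': "((\<lambda>x. right \<xi> cos i a x) has_real_derivative
      - right \<xi> sin i a x + (\<Sum>b\<in>UNIV. kerR \<xi> i (blk b) x (\<xi> $ b) * sg b * right \<xi> cos (blk b) a (\<xi> $ b))) (at x)" for a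
    unfolding neg[symmetric] by (rule right_deriv_x[OF \<xi> c(2) _ c(3), of 1 1]) (auto intro: DERIV_cos)
  have "(x - y) * kerR \<xi> i i x y = 2 * (\<Sum>b\<in>UNIV. sg b * (\<tau> i - \<tau> (blk b)) * kerR \<xi> i (blk b) x (\<xi> $ b) * kerR \<xi> (blk b) i (\<xi> $ b) y)
     + (\<Sum>k\<in>UNIV. \<Sum>a\<in>UNIV. exp (\<tau> a - \<tau> k) * (left \<xi> cos k i y * right \<xi> sin i a x - left \<xi> sin k i y * right \<xi> cos i a x))" for x
  proof -
    let ?S = "\<Sum>b\<in>UNIV. sg b * kerR \<xi> i (blk b) x (\<xi> $ b) * kerR \<xi> (blk b) i (\<xi> $ b) y"
    let ?T = "\<Sum>b\<in>UNIV. sg b * \<tau> (blk b) * kerR \<xi> i (blk b) x (\<xi> $ b) * kerR \<xi> (blk b) i (\<xi> $ b) y"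
    have "(\<Sum>b\<in>UNIV. sg b * (\<tau> i - \<tau> (blk b)) * kerR \<xi> i (blk b) x (\<xi> $ b) * kerR \<xi> (blk b) i (\<xi> $ b) y) = \<tau> i * ?S - ?T"
      unfolding sum_distrib_left sum_subtractf[symmetric] by (intro sum.cong) (auto simp: algebra_simps)
    then show ?thesis
      unfolding commutator_identity[OF \<xi> ord] kerR_sum_deriv[OF \<xi>, symmetric] by (simp add: algebra_simps)
  qed
  then have eq: "(\<lambda>x. (x - y) * kerR \<xi> i i x y) = (\<lambda>x. 2 * (\<Sum>b\<in>UNIV. sg b * (\<tau> i - \<tau> (blk b)) * kerR \<xi> i (blk b) x (\<xi> $ b) * kerR \<xi> (blk b) i (\<xi> $ b) y)
     + (\<Sum>k\<in>UNIV. \<Sum>a\<in>UNIV. exp (\<tau> a - \<tau> k) * (left \<xi> cos k i y * right \<xi> sin i a x - left \<xi> sin k i y * right \<xi> cos i a x)))"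
    by (rule ext)
  have "((\<lambda>x. (x - y) * kerR \<xi> i i x y) has_real_derivative (1 * kerR \<xi> i i x y + kerRx \<xi> i i x y * (x - y))) (at x)"
    by (intro DERIV_mult kerR_deriv_x[OF \<xi>]) (auto intro!: derivative_eq_intros)
  moreover have "((\<lambda>x. (x - y) * kerR \<xi> i i x y) has_real_derivative ?S + ?G) (at x)"
    unfolding eq
    by (intro DERIV_add DERIV_sum DERIV_cmult DERIV_diff DERIV_cmult_right kerR_deriv_x[OF \<xi>] sin' cos')
  ultimately have "1 * kerR \<xi> i i x y + kerRx \<xi> i i x y * (x - y) = ?S + ?G" by (rule DERIV_unique)
  then show ?thesis by (simp add: algebra_simps)
qed

end

section \<open>Regularity and differential equation of the sine kernel\<close>

lemma abs_cos_diff_le: "\<bar>cos a - cos b\<bar> \<le> \<bar>a - b\<bar>" for a b :: real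
proof -
  have "norm (cos a - cos b) \<le> 1 * norm (a - b)"
  proof (rule differentiable_bound[where S = UNIV and f' = "\<lambda>x t. t * - sin x"])
    show "(cos has_derivative (\<lambda>t. t * - sin x)) (at x within UNIV)" for x :: real
      by (auto intro!: derivative_eq_intros)
    show "onorm (\<lambda>t. t * - sin x) \<le> 1" for x :: real
      by (rule onorm_le) (use mult_left_mono[OF abs_sin_le_one[of x] abs_ge_zero] in \<open>auto simp: abs_mult\<close>)
  qed auto
  then show ?thesis by simp
qed

lemma abs_sin_diff_le: "\<bar>sin a - sin b\<bar> \<le> \<bar>a - b\<bar>" for a b :: real
  using abs_cos_diff_le[of "pi / 2 - a" "pi / 2 - b"] by (simp add: cos_diff abs_minus_commute)

lemma abs_cos_taylor_le: "\<bar>cos (a + h) - cos a + h * sin a\<bar> \<le> h\<^sup>2" for a h :: real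
proof -
  have "norm ((\<lambda>t. cos (a + t) + t * sin a) h - (\<lambda>t. cos (a + t) + t * sin a) 0) \<le> \<bar>h\<bar> * norm (h - 0)"
  proof (rule differentiable_bound[where S = "cball 0 \<bar>h\<bar>" and f' = "\<lambda>x t. t * (sin a - sin (a + x))"])
    show "((\<lambda>t. cos (a + t) + t * sin a) has_derivative (\<lambda>t. t * (sin a - sin (a + x)))) (at x within cball 0 \<bar>h\<bar>)" for x :: real
      by (auto intro!: derivative_eq_intros simp: algebra_simps)
    fix x :: real assume "x \<in> cball 0 \<bar>h\<bar>"
    then have "\<bar>sin a - sin (a + x)\<bar> \<le> \<bar>h\<bar>" using abs_sin_diff_le[of a "a + x"] by simp
    then show "onorm (\<lambda>t::real. t * (sin a - sin (a + x))) \<le> \<bar>h\<bar>"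
      by (intro onorm_le) (auto simp: abs_mult mult.commute[of "\<bar>h\<bar>"] intro!: mult_left_mono)
  qed auto
  then show ?thesis by (simp add: power2_eq_square algebra_simps)
qed

text \<open>The factor 1 + z^2 dominates 1, |z| and z^2, hence the integrands of the function, of
  its derivative and of the second-order remainder; one constant serves for all bounds.\<close>

lemma cos_transform_regular:
  fixes g :: "real \<Rightarrow> real"
  assumes g: "integrable lborel (\<lambda>z. (1 + z\<^sup>2) * g z)"
    and [measurable]: "g \<in> borel_measurable borel"
  defines "C \<equiv> LBINT z. (1 + z\<^sup>2) * \<bar>g z\<bar>"
    and "L \<equiv> \<lambda>x. LBINT z. g z * cos (z * x)" and "L1 \<equiv> \<lambda>x. - (LBINT z. z * g z * sin (z * x))"
  shows "\<bar>L x\<bar> \<le> C" "\<bar>L1 x\<bar> \<le> C" "\<bar>L1 x - L1 y\<bar> \<le> C * \<bar>x - y\<bar>" "\<bar>L (x + h) - L x - h * L1 x\<bar> \<le> C * h\<^sup>2"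
    "integrable lborel (\<lambda>z. g z * cos (z * x))" "integrable lborel (\<lambda>z. z * g z * sin (z * x))"
proof -
  have pos: "0 < 1 + z\<^sup>2" for z :: real by (simp add: add_pos_nonneg)
  have G: "integrable lborel (\<lambda>z. (1 + z\<^sup>2) * \<bar>g z\<bar>)"
    using integrable_abs[OF g] pos by (simp add: abs_mult abs_of_pos)
  have z1: "\<bar>z\<bar> \<le> 1 + z\<^sup>2" for z :: real
  proof -
    have "0 \<le> (\<bar>z\<bar> - 1)\<^sup>2" by simp
    then have "2 * \<bar>z\<bar> \<le> 1 + z\<^sup>2" by (simp add: power2_diff)
    then show ?thesis by simp
  qed
  have dom: "\<bar>c * g z * t\<bar> \<le> (1 + z\<^sup>2) * \<bar>g z\<bar> * K" if "\<bar>c\<bar> * \<bar>t\<bar> \<le> (1 + z\<^sup>2) * K" for c z t K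
    using mult_right_mono[OF that abs_ge_zero[of "g z"]] by (simp add: abs_mult mult_ac)
  have b0: "\<bar>g z * cos (z * x)\<bar> \<le> (1 + z\<^sup>2) * \<bar>g z\<bar>" for z x
  proof -
    have "\<bar>cos (z * x)\<bar> \<le> 1 + z\<^sup>2" by (rule order_trans[OF abs_cos_le_one]) simp
    then show ?thesis using dom[of 1 "cos (z * x)" z 1] by simp
  qed
  have b1: "\<bar>z * g z * sin (z * x)\<bar> \<le> (1 + z\<^sup>2) * \<bar>g z\<bar>" for z x
    using dom[of z "sin (z * x)" z 1] mult_mono[OF z1[of z] abs_sin_le_one[of "z * x"]] pos[of z] by simp
  show i0: "integrable lborel (\<lambda>z. g z * cos (z * x))" for x
  proof (rule Bochner_Integration.integrable_bound[OF G])
    show "AE z in lborel. norm (g z * cos (z * x)) \<le> norm ((1 + z\<^sup>2) * \<bar>g z\<bar>)"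
      unfolding real_norm_def by (intro AE_I2 order_trans[OF b0 abs_ge_self])
  qed measurable
  show i1: "integrable lborel (\<lambda>z. z * g z * sin (z * x))" for x
  proof (rule Bochner_Integration.integrable_bound[OF G])
    show "AE z in lborel. norm (z * g z * sin (z * x)) \<le> norm ((1 + z\<^sup>2) * \<bar>g z\<bar>)"
      unfolding real_norm_def by (intro AE_I2 order_trans[OF b1 abs_ge_self])
  qed measurable
  show "\<bar>L x\<bar> \<le> C" unfolding L_def C_def by (rule abs_integral_le[OF G b0])
  show "\<bar>L1 x\<bar> \<le> C" unfolding L1_def C_def abs_minus_cancel by (rule abs_integral_le[OF G b1])
  have "L1 x - L1 y = (LBINT z. z * g z * (sin (z * y) - sin (z * x)))"
    unfolding L1_def using i1 by (simp add: right_diff_distrib)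
  also have "\<bar>\<dots>\<bar> \<le> (LBINT z. (1 + z\<^sup>2) * \<bar>g z\<bar> * \<bar>x - y\<bar>)"
  proof (rule abs_integral_le)
    fix z
    have "\<bar>z\<bar> * \<bar>sin (z * y) - sin (z * x)\<bar> \<le> \<bar>z\<bar> * (\<bar>z\<bar> * \<bar>x - y\<bar>)"
    proof (rule mult_left_mono)
      have "\<bar>sin (z * y) - sin (z * x)\<bar> \<le> \<bar>z * (y - x)\<bar>"
        using abs_sin_diff_le[of "z * y" "z * x"] by (simp add: right_diff_distrib)
      then show "\<bar>sin (z * y) - sin (z * x)\<bar> \<le> \<bar>z\<bar> * \<bar>x - y\<bar>"
        by (simp add: abs_mult abs_minus_commute)
    qed simp
    also have "\<dots> = z\<^sup>2 * \<bar>x - y\<bar>" by (simp add: power2_eq_square mult.assoc[symmetric])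
    also have "\<dots> \<le> (1 + z\<^sup>2) * \<bar>x - y\<bar>" by (rule mult_right_mono) auto
    finally show "\<bar>z * g z * (sin (z * y) - sin (z * x))\<bar> \<le> (1 + z\<^sup>2) * \<bar>g z\<bar> * \<bar>x - y\<bar>" by (rule dom)
  qed (use G in simp)
  finally show "\<bar>L1 x - L1 y\<bar> \<le> C * \<bar>x - y\<bar>" by (simp add: C_def)
  have "L (x + h) - L x - h * L1 x = (LBINT z. 1 * g z * (cos (z * x + z * h) - cos (z * x) + (z * h) * sin (z * x)))"
  proof -
    have "1 * g z * (cos (z * x + z * h) - cos (z * x) + (z * h) * sin (z * x)) =
        g z * cos (z * (x + h)) - g z * cos (z * x) + h * (z * g z * sin (z * x))" for z
      by (simp add: algebra_simps)
    then show ?thesis unfolding L_def L1_def using i0[of "x + h"] i0[of x] i1[of x] by simp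
  qed
  also have "\<bar>\<dots>\<bar> \<le> (LBINT z. (1 + z\<^sup>2) * \<bar>g z\<bar> * h\<^sup>2)"
  proof (rule abs_integral_le)
    fix z
    have "\<bar>1::real\<bar> * \<bar>cos (z * x + z * h) - cos (z * x) + (z * h) * sin (z * x)\<bar> \<le> (z * h)\<^sup>2"
      using abs_cos_taylor_le[of "z * x" "z * h"] by simp
    also have "\<dots> \<le> (1 + z\<^sup>2) * h\<^sup>2" by (simp add: power_mult_distrib distrib_right)
    finally show "\<bar>1 * g z * (cos (z * x + z * h) - cos (z * x) + (z * h) * sin (z * x))\<bar> \<le> (1 + z\<^sup>2) * \<bar>g z\<bar> * h\<^sup>2" by (rule dom)
  qed (use G in simp)
  also have "\<dots> = C * h\<^sup>2" unfolding C_def by (rule integral_mult_left_zero)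
  finally show "\<bar>L (x + h) - L x - h * L1 x\<bar> \<le> C * h\<^sup>2" .
qed

lemma integrable_inverse_square_Ici: "integrable lborel (\<lambda>z::real. indicator {1..} z * (1 / z\<^sup>2))"
proof (rule integrableI_nonneg)
  have "(\<integral>\<^sup>+z. ennreal (1 / z\<^sup>2) * indicator {1..} z \<partial>lborel) = ennreal (0 - (- 1 / 1))"
  proof (rule nn_integral_FTC_atLeast[where F = "\<lambda>z. - 1 / z"])
    show "((\<lambda>z::real. - 1 / z) has_real_derivative 1 / z\<^sup>2) (at z)" if "1 \<le> z" for z
      using that by (auto intro!: derivative_eq_intros simp: power2_eq_square)
    show "((\<lambda>z::real. - 1 / z) \<longlongrightarrow> 0) at_top"
      by (intro tendsto_divide_0[OF tendsto_const] filterlim_at_top_imp_at_infinity filterlim_ident)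
  qed auto
  moreover have "ennreal (indicator {1..} z * (1 / z\<^sup>2)) = ennreal (1 / z\<^sup>2) * indicator {1..} z" for z :: real
    by (auto simp: indicator_def)
  ultimately show "(\<integral>\<^sup>+z. ennreal (indicator {1..} z * (1 / z\<^sup>2)) \<partial>lborel) < \<infinity>" by simp
qed auto

text \<open>The decay z^-4 is what is needed: with the factor 1 + z^2 it leaves the integrable
  z^-2.\<close>

lemma exp_neg_square_le:
  fixes c z :: real
  assumes "0 < c" "1 \<le> z"
  shows "exp (- (c * z\<^sup>2)) \<le> 2 / (c\<^sup>2 * z ^ 4)"
proof -
  have "(c * z\<^sup>2)\<^sup>2 / 2 \<le> exp (c * z\<^sup>2)"
  proof -
    have "0 \<le> c * z\<^sup>2" using assms by simp
    then show ?thesis using exp_lower_Taylor_quadratic[of "c * z\<^sup>2"] by linarith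
  qed
  then have "(c\<^sup>2 * z ^ 4) / 2 \<le> exp (c * z\<^sup>2)" by (simp add: power_mult_distrib power_mult[symmetric])
  moreover have "0 < c\<^sup>2 * z ^ 4" using assms by simp
  ultimately show ?thesis by (simp add: exp_minus field_simps)
qed

text \<open>Both branches of the kernel become cosine transforms of one signed density on the
  line.\<close>

definition sine_density :: "('m::{finite,linorder} \<Rightarrow> real) \<Rightarrow> 'm \<Rightarrow> 'm \<Rightarrow> real \<Rightarrow> real" where
  "sine_density \<tau> i j z = (if i \<ge> j then indicator {0..1} z else - indicator {1..} z) * exp (z\<^sup>2 * (\<tau> i - \<tau> j))"

lemma measurable_sine_density [measurable]: "sine_density \<tau> i j \<in> borel_measurable borel"
  unfolding sine_density_def by measurable

lemma sine_L_eq: "sine_L \<tau> i j x y = (LBINT z. sine_density \<tau> i j z * cos (z * (x - y)))"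
  unfolding sine_L_def sine_density_def set_lebesgue_integral_def
  by (simp add: mult.assoc)

lemma integrable_sine_density:
  assumes "strict_mono \<tau>"
  shows "integrable lborel (\<lambda>z. (1 + z\<^sup>2) * sine_density \<tau> i j z)"
proof (cases "j \<le> i")
  case True
  have "set_integrable lborel {0..1} (\<lambda>z::real. (1 + z\<^sup>2) * exp (z\<^sup>2 * (\<tau> i - \<tau> j)))"
    by (rule borel_integrable_atLeastAtMost') (intro continuous_intros)
  then show ?thesis using True by (simp add: set_integrable_def sine_density_def mult_ac)
next
  case False
  define c where "c = \<tau> j - \<tau> i"
  have c: "0 < c" using False strict_monoD[OF assms, of i j] by (simp add: c_def)
  show ?thesis
  proof (rule Bochner_Integration.integrable_bound)
    \<comment> \<open>4 = 2 * 2, with one factor from 1 + z^2 <= 2 z^2 and the other from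
      \<open>exp_neg_square_le\<close>.\<close>
    show "integrable lborel (\<lambda>z. (4 / c\<^sup>2) * (indicator {1..} z * (1 / z\<^sup>2)))"
      by (intro integrable_mult_right integrable_inverse_square_Ici)
    show "AE z in lborel. norm ((1 + z\<^sup>2) * sine_density \<tau> i j z) \<le> norm ((4 / c\<^sup>2) * (indicator {1..} z * (1 / z\<^sup>2)))"
    proof (rule AE_I2)
      fix z :: real
      show "norm ((1 + z\<^sup>2) * sine_density \<tau> i j z) \<le> norm ((4 / c\<^sup>2) * (indicator {1..} z * (1 / z\<^sup>2)))"
      proof (cases "1 \<le> z")
        case z: True
        have "1 + z\<^sup>2 \<le> 2 * z\<^sup>2" using z by (simp add: one_le_power)
        then have "(1 + z\<^sup>2) * exp (- (c * z\<^sup>2)) \<le> (2 * z\<^sup>2) * (2 / (c\<^sup>2 * z ^ 4))"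
          using z by (intro mult_mono exp_neg_square_le c) auto
        also have "\<dots> = (4 / c\<^sup>2) * (1 / z\<^sup>2)" using z c by (simp add: field_simps power2_eq_square numeral_eq_Suc)
        finally have "(1 + z\<^sup>2) * exp (- (c * z\<^sup>2)) \<le> (4 / c\<^sup>2) * (1 / z\<^sup>2)" .
        moreover have "z\<^sup>2 * (\<tau> i - \<tau> j) = - (c * z\<^sup>2)" by (simp add: c_def algebra_simps)
        ultimately show ?thesis using z False by (simp add: sine_density_def abs_mult add_nonneg_nonneg)
      qed (use False in \<open>simp add: sine_density_def\<close>)
    qed
  qed measurable
qed

text \<open>The derivative of exp(z^2 t) sin(z x) in z is integrated against the density. On [0, 1]
  the boundary value at 0 vanishes, on the half-line the one at infinity; the minus sign of the
  second branch makes the contribution of z = 1 the same in both, which is why one equation covers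
  all i and j.\<close>

lemma sine_density_ode:
  assumes \<tau>: "strict_mono \<tau>"
  shows "2 * (\<tau> i - \<tau> j) * - (LBINT z. z * sine_density \<tau> i j z * sin (z * x)) =
    x * (LBINT z. sine_density \<tau> i j z * cos (z * x)) - exp (\<tau> i - \<tau> j) * sin x"
proof -
  let ?g = "sine_density \<tau> i j" and ?t = "\<tau> i - \<tau> j"
  let ?G = "\<lambda>z. exp (z\<^sup>2 * ?t) * sin (z * x)"
  let ?G' = "\<lambda>z. 2 * ?t * (z * exp (z\<^sup>2 * ?t) * sin (z * x)) + x * (exp (z\<^sup>2 * ?t) * cos (z * x))"
  have DG: "(?G has_real_derivative ?G' z) (at z)" for z
    by (auto intro!: derivative_eq_intros simp: algebra_simps)
  note i = cos_transform_regular(5,6)[OF integrable_sine_density[OF \<tau>] measurable_sine_density, of i j x]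
  have int: "integrable lborel (\<lambda>z. 2 * ?t * (z * ?g z * sin (z * x)) + x * (?g z * cos (z * x)))"
    using i by simp
  have sum: "(LBINT z. 2 * ?t * (z * ?g z * sin (z * x)) + x * (?g z * cos (z * x))) =
      2 * ?t * (LBINT z. z * ?g z * sin (z * x)) + x * (LBINT z. ?g z * cos (z * x))"
    using i by simp
  have "(LBINT z. 2 * ?t * (z * ?g z * sin (z * x)) + x * (?g z * cos (z * x))) = exp ?t * sin x"
  proof (cases "j \<le> i")
    case True
    have "(LBINT z=ereal 0..ereal 1. ?G' z) = ?G 1 - ?G 0"
    proof (rule interval_integral_FTC_finite[where F = ?G])
      show "continuous_on {min 0 1..max 0 1} ?G'" by (intro continuous_intros)
      show "(?G has_vector_derivative ?G' z) (at z within {min 0 1..max 0 1})" for z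
        using has_vector_derivative_at_within[OF DG[unfolded has_real_derivative_iff_has_vector_derivative]] .
    qed
    then have "(LBINT z:{0..1}. ?G' z) = exp ?t * sin x"
      using interval_integral_Icc[of 0 1 ?G'] by simp
    then show ?thesis using True by (simp add: set_lebesgue_integral_def sine_density_def distrib_left mult_ac)
  next
    case False
    define c where "c = \<tau> j - \<tau> i"
    have c: "0 < c" using False strict_monoD[OF assms, of i j] by (simp add: c_def)
    have eq: "2 * ?t * (z * ?g z * sin (z * x)) + x * (?g z * cos (z * x)) = - (indicator {1..} z *\<^sub>R ?G' z)" for z
      using False by (simp add: sine_density_def algebra_simps)
    \<comment> \<open>The fundamental theorem is applied on the open half-line, the density lives on
      the closed one; they differ by a null set.\<close>
    have AE: "AE z in lborel. indicator {1..} z *\<^sub>R ?G' z = indicator {1<..} z *\<^sub>R ?G' z"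
      using AE_lborel_singleton[of "1::real"] by eventually_elim (auto simp: indicator_def)
    have int1: "integrable lborel (\<lambda>z. indicator {1..} z *\<^sub>R ?G' z)"
      using integrable_minus[OF int[unfolded eq]] by simp
    have int2: "set_integrable lborel {1<..} ?G'"
      unfolding set_integrable_def using int1 AE by (subst integrable_cong_AE[symmetric]) (auto simp: set_integrable_def)
    have lim: "(?G \<longlongrightarrow> 0) at_top"
    proof (rule Lim_null_comparison)
      show "((\<lambda>z. (2 / c\<^sup>2) * inverse z) \<longlongrightarrow> 0) at_top"
        by (rule tendsto_mult_right_zero[OF tendsto_inverse_0_at_top[OF filterlim_ident]])
      show "\<forall>\<^sub>F z in at_top. norm (?G z) \<le> (2 / c\<^sup>2) * inverse z"
      proof (rule eventually_at_top_linorderI[of 1])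
        fix z :: real assume z: "1 \<le> z"
        have t: "z\<^sup>2 * ?t = - (c * z\<^sup>2)" by (simp add: c_def algebra_simps)
        have "norm (?G z) \<le> exp (- (c * z\<^sup>2)) * 1"
          unfolding t norm_mult by (rule mult_mono) auto
        also have "\<dots> \<le> 2 / (c\<^sup>2 * z ^ 4)" using exp_neg_square_le[OF c z] by simp
        also have "\<dots> \<le> 2 / (c\<^sup>2 * z)"
          using z c self_le_power[of z 4] by (intro divide_left_mono mult_left_mono mult_pos_pos) auto
        finally show "norm (?G z) \<le> (2 / c\<^sup>2) * inverse z" by (simp add: divide_inverse mult_ac)
      qed
    qed
    have "(LBINT z=ereal 1..\<infinity>. ?G' z) = 0 - exp ?t * sin x"
    proof (rule interval_integral_FTC_integrable)
      show "(?G has_vector_derivative ?G' z) (at z)" for z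
        using DG by (simp add: has_real_derivative_iff_has_vector_derivative)
      show "isCont ?G' z" for z by (intro continuous_intros)
      show "set_integrable lborel (einterval (ereal 1) \<infinity>) ?G'" using int2 by simp
      have "isCont ?G 1" by (intro continuous_intros)
      then have "(?G \<longlongrightarrow> exp ?t * sin x) (at_right 1)"
        by (simp add: isCont_def Lim_at_imp_Lim_at_within)
      then show "((?G \<circ> real_of_ereal) \<longlongrightarrow> exp ?t * sin x) (at_right (ereal 1))"
        by (simp add: ereal_tendsto_simps1)
      show "((?G \<circ> real_of_ereal) \<longlongrightarrow> 0) (at_left \<infinity>)"
        using lim by (simp add: ereal_tendsto_simps1)
    qed simp
    then have "(LBINT z:{1<..}. ?G' z) = - (exp ?t * sin x)" by (simp add: interval_integral_to_infinity_eq)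
    moreover have "(LBINT z. indicator {1..} z *\<^sub>R ?G' z) = (LBINT z:{1<..}. ?G' z)"
      unfolding set_lebesgue_integral_def by (rule integral_cong_AE[OF _ _ AE]) auto
    ultimately show ?thesis unfolding eq by simp
  qed
  then show ?thesis unfolding sum by (simp add: algebra_simps)
qed

definition sine_l :: "('m::{finite,linorder} \<Rightarrow> real) \<Rightarrow> 'm \<Rightarrow> 'm \<Rightarrow> real \<Rightarrow> real" where
  "sine_l \<tau> i j x = (LBINT z. sine_density \<tau> i j z * cos (z * x))"

definition sine_l1 :: "('m::{finite,linorder} \<Rightarrow> real) \<Rightarrow> 'm \<Rightarrow> 'm \<Rightarrow> real \<Rightarrow> real" where
  "sine_l1 \<tau> i j x = - (LBINT z. z * sine_density \<tau> i j z * sin (z * x))"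

definition sine_C :: "('m::{finite,linorder} \<Rightarrow> real) \<Rightarrow> real" where
  "sine_C \<tau> = (\<Sum>i\<in>UNIV. \<Sum>j\<in>UNIV. LBINT z. (1 + z\<^sup>2) * \<bar>sine_density \<tau> i j z\<bar>)"

lemma sine_conv_kernelI:
  assumes \<tau>: "strict_mono \<tau>" and ix: "endpoint_indexing n ix"
  shows "sine_conv_kernel (sine_l \<tau>) (sine_l1 \<tau>) (sine_C \<tau>) n ix \<tau>"
proof
  fix i j :: 'a and x y h :: real
  let ?C = "LBINT z. (1 + z\<^sup>2) * \<bar>sine_density \<tau> i j z\<bar>"
  have nn: "0 \<le> (LBINT z. (1 + z\<^sup>2) * \<bar>sine_density \<tau> a b z\<bar>)" for a b
    by (rule Bochner_Integration.integral_nonneg) (simp add: add_nonneg_nonneg)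
  have "?C \<le> (\<Sum>b\<in>UNIV. LBINT z. (1 + z\<^sup>2) * \<bar>sine_density \<tau> i b z\<bar>)"
    by (rule member_le_sum[of j UNIV]) (auto simp: nn)
  also have "\<dots> \<le> sine_C \<tau>"
    unfolding sine_C_def by (rule member_le_sum[of i UNIV]) (auto intro: sum_nonneg nn)
  finally have C: "?C \<le> sine_C \<tau>" .
  note reg = cos_transform_regular[OF integrable_sine_density[OF \<tau>] measurable_sine_density, of i j, folded sine_l_def sine_l1_def]
  show "endpoint_indexing n ix" by (rule ix)
  show "\<bar>sine_l \<tau> i j x\<bar> \<le> sine_C \<tau>" "\<bar>sine_l1 \<tau> i j x\<bar> \<le> sine_C \<tau>"
    using reg(1,2)[of x] C by linarith+
  show "\<bar>sine_l1 \<tau> i j x - sine_l1 \<tau> i j y\<bar> \<le> sine_C \<tau> * \<bar>x - y\<bar>"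
    by (rule order_trans[OF reg(3) mult_right_mono[OF C]]) auto
  show "\<bar>sine_l \<tau> i j (x + h) - sine_l \<tau> i j x - h * sine_l1 \<tau> i j x\<bar> \<le> sine_C \<tau> * h\<^sup>2"
    by (rule order_trans[OF reg(4) mult_right_mono[OF C]]) auto
  show "2 * (\<tau> i - \<tau> j) * sine_l1 \<tau> i j x = x * sine_l \<tau> i j x - exp (\<tau> i - \<tau> j) * sin x"
    unfolding sine_l_def sine_l1_def by (rule sine_density_ode[OF \<tau>])
qed

lemma sine_L_eq_l: "sine_L \<tau> i j x y = sine_l \<tau> i j (x - y)"
  by (simp add: sine_L_eq sine_l_def)

section \<open>The Fredholm determinant as a function of the end-points\<close>

text \<open>Gronwall's argument: the bound makes \<phi>(s)^2 exp(-2 L s) nonincreasing, and this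
  function starts at 0.\<close>

lemma linear_growth_zero:
  fixes \<phi> :: "real \<Rightarrow> real"
  assumes ab: "a < b" and d: "\<And>t. a \<le> t \<Longrightarrow> t < b \<Longrightarrow> (\<phi> has_real_derivative \<phi>' t) (at t)"
    and le: "\<And>t. a \<le> t \<Longrightarrow> t < b \<Longrightarrow> \<bar>\<phi>' t\<bar> \<le> L * \<bar>\<phi> t\<bar>" and z: "\<phi> a = 0"
    and t: "a \<le> t" "t < b"
  shows "\<phi> t = 0"
proof -
  let ?h = "\<lambda>s. (\<phi> s)\<^sup>2 * exp (- (2 * L * s))"
  have "?h t \<le> ?h a"
  proof (rule DERIV_nonpos_imp_nonincreasing[OF t(1)])
    fix s assume s: "a \<le> s" "s \<le> t"
    then have s': "a \<le> s" "s < b" using t by auto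
    have "(?h has_real_derivative (2 * (\<phi> s * \<phi>' s) - 2 * L * (\<phi> s)\<^sup>2) * exp (- (2 * L * s))) (at s)"
      using d[OF s'] by (auto intro!: derivative_eq_intros simp: algebra_simps power2_eq_square)
    moreover have "\<phi> s * \<phi>' s \<le> L * (\<phi> s)\<^sup>2"
    proof -
      have "\<phi> s * \<phi>' s \<le> \<bar>\<phi> s\<bar> * \<bar>\<phi>' s\<bar>" by (metis abs_ge_self abs_mult)
      also have "\<dots> \<le> \<bar>\<phi> s\<bar> * (L * \<bar>\<phi> s\<bar>)" by (rule mult_left_mono[OF le[OF s']]) auto
      finally show ?thesis by (simp add: power2_eq_square mult_ac)
    qed
    then have "(2 * (\<phi> s * \<phi>' s) - 2 * L * (\<phi> s)\<^sup>2) * exp (- (2 * L * s)) \<le> 0"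
      by (intro mult_nonpos_nonneg) auto
    ultimately show "\<exists>y. (?h has_real_derivative y) (at s) \<and> y \<le> 0" by blast
  qed
  then have "(\<phi> t)\<^sup>2 * exp (- (2 * L * t)) \<le> 0" using z by simp
  then show ?thesis by (simp add: mult_le_0_iff)
qed

lemma integral_count_space_pair:
  fixes f :: "'m::finite \<times> real \<Rightarrow> real"
  assumes "\<And>k. integrable lborel (\<lambda>y. f (k, y))"
  shows "integrable (count_space UNIV \<Otimes>\<^sub>M lborel) f"
    and "(\<integral>z. f z \<partial>(count_space UNIV \<Otimes>\<^sub>M lborel)) = (\<Sum>k\<in>UNIV. LBINT y. f (k, y))"
proof -
  interpret C: sigma_finite_measure "count_space (UNIV :: 'm set)" by (rule sigma_finite_measure_count_space_finite) simp
  interpret P: pair_sigma_finite "count_space (UNIV :: 'm set)" lborel ..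
  have meas: "f \<in> borel_measurable (count_space UNIV \<Otimes>\<^sub>M lborel)"
    by (rule measurable_pair_measure_countable1) (use assms in auto)
  show int: "integrable (count_space UNIV \<Otimes>\<^sub>M lborel) f"
    by (rule P.Fubini_integrable[OF meas]) (use assms in \<open>auto intro!: integrable_count_space\<close>)
  show "(\<integral>z. f z \<partial>(count_space UNIV \<Otimes>\<^sub>M lborel)) = (\<Sum>k\<in>UNIV. LBINT y. f (k, y))"
    using P.integral_fst'[OF int] by (simp add: lebesgue_integral_count_space_finite)
qed

lemma integrable_bounded_times:
  fixes f g :: "real \<Rightarrow> real"
  assumes f: "integrable lborel f" and g: "g \<in> borel_measurable borel" "\<And>y. \<bar>g y\<bar> \<le> B"
  shows "integrable lborel (\<lambda>y. f y * g y)"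
proof (rule Bochner_Integration.integrable_bound)
  show "integrable lborel (\<lambda>y. B * f y)" using f by simp
  show "(\<lambda>y. f y * g y) \<in> borel_measurable lborel" using f g by measurable
  show "AE y in lborel. norm (f y * g y) \<le> norm (B * f y)"
  proof (rule AE_I2)
    fix y
    have "0 \<le> B" using g(2)[of y] by linarith
    then show "norm (f y * g y) \<le> norm (B * f y)"
      using mult_left_mono[OF g(2)[of y] abs_ge_zero[of "f y"]] by (simp add: abs_mult mult.commute)
  qed
qed

text \<open>Writing a function of two discrete indices as a finite sum with indicators makes joint
  measurability provable term by term.\<close>

lemma sum_indicator_pick:
  fixes t :: "'m::finite \<Rightarrow> 'm \<Rightarrow> real"
  shows "(\<Sum>i\<in>UNIV. \<Sum>j\<in>UNIV. indicator {i} a * indicator {j} b * t i j) = t a b"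
proof -
  have "indicator {i} a * indicator {j} b * t i j = (if j = b then (if i = a then t a b else 0) else 0)" for i j
    by (auto simp: indicator_def)
  then show ?thesis by simp
qed

context conv_kernel
begin

definition fk :: "'m \<times> real \<Rightarrow> 'm \<times> real \<Rightarrow> real" where
  "fk z w = l (fst z) (fst w) (snd z - snd w)"

lemma fk_pair: "fk (i, x) (j, y) = l i j (x - y)"
  by (simp add: fk_def)

definition wt :: "real^'e \<Rightarrow> 'm \<times> real \<Rightarrow> real" where
  "wt \<xi> z = indicator (intervals ix \<xi> (fst z)) (snd z)"

sublocale F: bounded_kernel "count_space (UNIV :: 'm set) \<Otimes>\<^sub>M lborel" fk C
proof -
  interpret C: sigma_finite_measure "count_space (UNIV :: 'm set)" by (rule sigma_finite_measure_count_space_finite) simp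
  interpret P: pair_sigma_finite "count_space (UNIV :: 'm set)" "lborel :: real measure" ..
  show "bounded_kernel (count_space (UNIV :: 'm set) \<Otimes>\<^sub>M lborel) fk C"
  proof
    show "space (count_space (UNIV :: 'm set) \<Otimes>\<^sub>M lborel) = (UNIV :: ('m \<times> real) set)"
      by (simp add: space_pair_measure)
    have [measurable]: "l i j \<in> borel_measurable borel" for i j
      by (rule borel_measurable_continuous_onI[OF continuous_l])
    have "case_prod fk = (\<lambda>p. \<Sum>i\<in>UNIV. \<Sum>j\<in>UNIV. indicator {i} (fst (fst p)) * indicator {j} (fst (snd p)) * l i j (snd (fst p) - snd (snd p)))"
      by (simp only: fun_eq_iff split_beta fk_def sum_indicator_pick) simp
    moreover have "\<dots> \<in> borel_measurable ((count_space (UNIV :: 'm set) \<Otimes>\<^sub>M lborel) \<Otimes>\<^sub>M (count_space (UNIV :: 'm set) \<Otimes>\<^sub>M lborel))"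
      by measurable
    ultimately show "case_prod fk \<in> borel_measurable ((count_space (UNIV :: 'm set) \<Otimes>\<^sub>M lborel) \<Otimes>\<^sub>M (count_space (UNIV :: 'm set) \<Otimes>\<^sub>M lborel))"
      by simp
  qed (simp add: fk_def l_bound)
qed

lemma integrable_indicator_intervals: "integrable lborel (indicator (intervals ix \<xi> k) :: real \<Rightarrow> real)"
  if "ordered_endpoints ix \<xi>"
  using integral_intervals(1)[OF ix that continuous_on_const[of UNIV 1], of k] by simp

lemma integrable_wt: "ordered_endpoints ix \<xi> \<Longrightarrow> integrable (count_space UNIV \<Otimes>\<^sub>M lborel) (wt \<xi>)"
  by (rule integral_count_space_pair(1)) (simp add: wt_def integrable_indicator_intervals)

lemma fredholm_det_eq_series:
  assumes ord: "ordered_endpoints ix \<xi>"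
  shows "fredholm_det (\<lambda>i j x y. l i j (x - y) * indicator (intervals ix \<xi> j) y) = F.fredholm_series (wt \<xi>)"
  unfolding fredholm_det_def F.fredholm_series_eq_det[OF integrable_wt[OF ord]] by (simp add: fk_def wt_def)

lemma measurable_first_minor_snd:
  assumes "ordered_endpoints ix \<xi>"
  shows "(\<lambda>y. F.fredholm_first_minor (\<lambda>z. c * wt \<xi> z) (k, y) q) \<in> borel_measurable borel"
proof -
  have w: "(\<lambda>z. c * wt \<xi> z) \<in> borel_measurable (count_space UNIV \<Otimes>\<^sub>M lborel)"
    using integrable_wt[OF assms] by auto
  have "(\<lambda>y. F.fredholm_first_minor (\<lambda>z. c * wt \<xi> z) (k, y) q) \<in> borel_measurable lborel"
    by (rule F.measurable_fredholm_first_minor[OF w]) (auto simp: F.space_UNIV)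
  then show ?thesis by simp
qed

text \<open>By \<open>fredholm_identity\<close> the column of the first minor at (j, y) solves (I -
  c K) G = d u, with d the determinant. Invertibility concerns the space of bounded continuous
  functions, so continuity of this column must be shown first; it is inherited from the Lipschitz
  kernel.\<close>

lemma first_minor_resolvent:
  assumes ord: "ordered_endpoints ix \<xi>" and inv: "invertible_operator (id_blinfun - c *\<^sub>R K \<xi>)"
  shows "F.fredholm_first_minor (\<lambda>z. c * wt \<xi> z) (i, x) (j, y) = F.fredholm_series (\<lambda>z. c * wt \<xi> z) *
    apply_bcontfun (blinfun_apply (inverse_operator (id_blinfun - c *\<^sub>R K \<xi>)) (u j y)) x $ i"
proof -
  let ?w = "\<lambda>z. c * wt \<xi> z" and ?d = "F.fredholm_series (\<lambda>z. c * wt \<xi> z)"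
  have w: "integrable (count_space UNIV \<Otimes>\<^sub>M lborel) ?w" using integrable_wt[OF ord] by simp
  obtain B where B: "\<And>p q. \<bar>F.fredholm_first_minor ?w p q\<bar> \<le> B"
    using F.fredholm_first_minor_bounded[OF w] by blast
  define Dm where "Dm k z = F.fredholm_first_minor ?w (k, z) (j, y)" for k z
  have Dm_bound: "\<bar>Dm k z\<bar> \<le> B" for k z by (simp add: Dm_def B)
  have Dm_meas: "Dm k \<in> borel_measurable borel" for k
    unfolding Dm_def[abs_def] by (rule measurable_first_minor_snd[OF ord])
  have int: "integrable lborel (\<lambda>z. indicator (intervals ix \<xi> k) z * Dm k z)" for k
    by (rule integrable_bounded_times[OF integrable_indicator_intervals[OF ord] Dm_meas Dm_bound])
  have intl: "integrable lborel (\<lambda>z. indicator (intervals ix \<xi> k) z * Dm k z * l i k (x - z))" for i k x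
    by (rule integrable_bounded_times[OF int borel_measurable_continuous_onI[OF cont_shift(3)] l_bound])
  let ?J = "\<lambda>i k x. LBINT z. indicator (intervals ix \<xi> k) z * Dm k z * l i k (x - z)"
  have identity: "Dm i x = ?d * l i j (x - y) + c * (\<Sum>k\<in>UNIV. ?J i k x)" for i x
  proof -
    have "Dm i x = ?d * fk (i, x) (j, y) + (\<integral>z. fk (i, x) z * ?w z * F.fredholm_first_minor ?w z (j, y) \<partial>(count_space UNIV \<Otimes>\<^sub>M lborel))"
      unfolding Dm_def by (rule F.fredholm_identity[OF w])
    also have "(\<integral>z. fk (i, x) z * ?w z * F.fredholm_first_minor ?w z (j, y) \<partial>(count_space UNIV \<Otimes>\<^sub>M lborel)) =
        (\<Sum>k\<in>UNIV. LBINT z. c * (indicator (intervals ix \<xi> k) z * Dm k z * l i k (x - z)))"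
      using integral_count_space_pair(2)[of "\<lambda>z. fk (i, x) z * ?w z * F.fredholm_first_minor ?w z (j, y)"] intl
      by (simp add: fk_pair wt_def Dm_def mult_ac)
    finally show ?thesis by (simp add: fk_pair sum_distrib_left)
  qed
  have J_lip: "\<bar>?J i k x - ?J i k x'\<bar> \<le> C * (LBINT z. \<bar>indicator (intervals ix \<xi> k) z * Dm k z\<bar>) * \<bar>x - x'\<bar>" for i k x x'
  proof -
    have "?J i k x - ?J i k x' = (LBINT z. indicator (intervals ix \<xi> k) z * Dm k z * (l i k (x - z) - l i k (x' - z)))"
      using intl by (simp add: right_diff_distrib)
    also have "\<bar>\<dots>\<bar> \<le> (LBINT z. \<bar>indicator (intervals ix \<xi> k) z * Dm k z\<bar> * (C * \<bar>x - x'\<bar>))"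
    proof (rule abs_integral_le)
      fix z
      show "\<bar>indicator (intervals ix \<xi> k) z * Dm k z * (l i k (x - z) - l i k (x' - z))\<bar> \<le>
          \<bar>indicator (intervals ix \<xi> k) z * Dm k z\<bar> * (C * \<bar>x - x'\<bar>)"
        unfolding abs_mult[of "indicator (intervals ix \<xi> k) z * Dm k z"]
        using l_lipschitz[of i k "x - z" "x' - z"] by (intro mult_left_mono) auto
    qed (use int in auto)
    finally show ?thesis by (simp add: mult_ac)
  qed
  have Dm_cont: "continuous_on UNIV (Dm i)" for i
  proof -
    have "continuous_on UNIV (?J i k)" for k
      by (rule lipschitz_on_continuous_on[of "C * (LBINT z. \<bar>indicator (intervals ix \<xi> k) z * Dm k z\<bar>)"], rule lipschitz_onI)
        (use J_lip C_nonneg in \<open>auto simp: dist_real_def\<close>)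
    then have "continuous_on UNIV (\<lambda>x. ?d * l i j (x - y) + c * (\<Sum>k\<in>UNIV. ?J i k x))"
      by (intro continuous_on_add continuous_on_mult continuous_on_const continuous_on_sum cont_shift)
    then show ?thesis by (rule continuous_on_eq) (rule identity[symmetric])
  qed
  define G where "G = Bcontfun (\<lambda>x. \<chi> i. Dm i x)"
  have G: "apply_bcontfun G x $ i = Dm i x" for x i
    unfolding G_def by (subst apply_Bcontfun_cart[where B = B]) (use Dm_cont Dm_bound in auto)
  have Keval: "apply_bcontfun (blinfun_apply (K \<xi>) G) x $ i = (\<Sum>k\<in>UNIV. ?J i k x)" for x i
    unfolding K_nth by (subst vec_op_real[OF ix ord cont_shift(3)]) (simp add: G mult_ac)
  have eq: "blinfun_apply (id_blinfun - c *\<^sub>R K \<xi>) G = ?d *\<^sub>R u j y"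
  proof (rule bcontfun_eqI, rule Finite_Cartesian_Product.vec_eq_iff[THEN iffD2], intro allI)
    fix x i
    show "apply_bcontfun (blinfun_apply (id_blinfun - c *\<^sub>R K \<xi>) G) x $ i = apply_bcontfun (?d *\<^sub>R u j y) x $ i"
      using identity[of i x] by (simp add: blinfun.diff_left blinfun.scaleR_left G Keval)
  qed
  have "is_inverse_operator (id_blinfun - c *\<^sub>R K \<xi>) (inverse_operator (id_blinfun - c *\<^sub>R K \<xi>))"
    by (rule is_inverse_inverse_operator[OF inv])
  then have "blinfun_apply (inverse_operator (id_blinfun - c *\<^sub>R K \<xi>) o\<^sub>L (id_blinfun - c *\<^sub>R K \<xi>)) G = G"
    by (simp add: is_inverse_operator_def)
  then have "G = ?d *\<^sub>R blinfun_apply (inverse_operator (id_blinfun - c *\<^sub>R K \<xi>)) (u j y)"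
    using eq by (simp add: blinfun.scaleR_right)
  then have "apply_bcontfun G x $ i = ?d * apply_bcontfun (blinfun_apply (inverse_operator (id_blinfun - c *\<^sub>R K \<xi>)) (u j y)) x $ i"
    by simp
  then show ?thesis by (simp add: G Dm_def)
qed

lemma first_minor_kerR:
  assumes "ordered_endpoints ix \<xi>" "\<xi> \<in> Inv"
  shows "F.fredholm_first_minor (wt \<xi>) (i, x) (j, y) = F.fredholm_series (wt \<xi>) * kerR \<xi> i j x y"
  using first_minor_resolvent[of \<xi> 1 i x j y] assms by (simp add: Inv_def kerR_def \<rho>_def)

lemma fredholm_series_scaled_deriv:
  assumes ord: "ordered_endpoints ix \<xi>"
  shows "((\<lambda>c. F.fredholm_series (\<lambda>z. c * wt \<xi> z)) has_real_derivative
    - (\<integral>z. wt \<xi> z * F.fredholm_first_minor (\<lambda>z. c * wt \<xi> z) z z \<partial>(count_space UNIV \<Otimes>\<^sub>M lborel))) (at c)"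
proof -
  let ?M = "count_space (UNIV :: 'm set) \<Otimes>\<^sub>M (lborel :: real measure)"
  let ?W = "\<integral>z. \<bar>wt \<xi> z\<bar> \<partial>?M" and ?D = "\<integral>z. wt \<xi> z * F.fredholm_first_minor (\<lambda>z. c * wt \<xi> z) z z \<partial>?M"
  have w: "integrable ?M (wt \<xi>)" by (rule integrable_wt[OF ord])
  have W: "0 \<le> ?W" by simp
  \<comment> \<open>A bound for the L1 norms of the weights c w and h w together, for all |h| <=
    1.\<close>
  define Q where "Q = 1 + (\<bar>c\<bar> + 1) * ?W"
  have Q: "1 \<le> Q" using W by (simp add: Q_def)
  obtain A where A: "0 \<le> A"
    "\<And>w v. integrable ?M w \<Longrightarrow> integrable ?M v \<Longrightarrow> (\<integral>z. \<bar>w z\<bar> \<partial>?M) + (\<integral>z. \<bar>v z\<bar> \<partial>?M) \<le> Q \<Longrightarrow>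
      \<bar>F.fredholm_series (\<lambda>z. w z + v z) - F.fredholm_series w + (\<integral>t. v t * F.fredholm_first_minor w t t \<partial>?M)\<bar>
        \<le> A * (\<integral>z. \<bar>v z\<bar> \<partial>?M)\<^sup>2"
    using F.fredholm_series_add[OF Q] by blast
  have bound: "\<bar>F.fredholm_series (\<lambda>z. (c + h) * wt \<xi> z) - F.fredholm_series (\<lambda>z. c * wt \<xi> z) - h * (- ?D)\<bar> \<le> (A * ?W\<^sup>2) * h\<^sup>2"
    if h: "\<bar>h\<bar> \<le> 1" for h
  proof -
    have "(\<integral>z. \<bar>c * wt \<xi> z\<bar> \<partial>?M) + (\<integral>z. \<bar>h * wt \<xi> z\<bar> \<partial>?M) = (\<bar>c\<bar> + \<bar>h\<bar>) * ?W"
      by (simp add: abs_mult distrib_right)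
    also have "\<dots> \<le> (\<bar>c\<bar> + 1) * ?W" using h W by (intro mult_right_mono) auto
    also have "\<dots> \<le> Q" by (simp add: Q_def)
    finally have "(\<integral>z. \<bar>c * wt \<xi> z\<bar> \<partial>?M) + (\<integral>z. \<bar>h * wt \<xi> z\<bar> \<partial>?M) \<le> Q" .
    from A(2)[OF _ _ this] w
    have "\<bar>F.fredholm_series (\<lambda>z. c * wt \<xi> z + h * wt \<xi> z) - F.fredholm_series (\<lambda>z. c * wt \<xi> z)
        + (\<integral>t. h * wt \<xi> t * F.fredholm_first_minor (\<lambda>z. c * wt \<xi> z) t t \<partial>?M)\<bar> \<le> A * (\<integral>z. \<bar>h * wt \<xi> z\<bar> \<partial>?M)\<^sup>2"
      by simp
    then show ?thesis by (simp add: distrib_right mult.assoc abs_mult power_mult_distrib mult_ac)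
  qed
  have lim: "((\<lambda>h. (A * ?W\<^sup>2) * \<bar>h\<bar>) \<longlongrightarrow> (A * ?W\<^sup>2) * \<bar>0\<bar>) (at 0)" by (intro tendsto_intros)
  have "((\<lambda>h. (F.fredholm_series (\<lambda>z. (c + h) * wt \<xi> z) - F.fredholm_series (\<lambda>z. c * wt \<xi> z)) / h - (- ?D)) \<longlongrightarrow> 0) (at 0)"
  proof (rule Lim_null_comparison)
    show "((\<lambda>h. (A * ?W\<^sup>2) * \<bar>h\<bar>) \<longlongrightarrow> 0) (at 0)" using lim by simp
    have "\<forall>\<^sub>F h in at 0. h \<noteq> 0 \<and> \<bar>h\<bar> \<le> (1::real)"
      unfolding eventually_at by (intro exI[of _ 1]) auto
    then show "\<forall>\<^sub>F h in at 0. norm ((F.fredholm_series (\<lambda>z. (c + h) * wt \<xi> z) - F.fredholm_series (\<lambda>z. c * wt \<xi> z)) / h - (- ?D)) \<le> (A * ?W\<^sup>2) * \<bar>h\<bar>"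
    proof eventually_elim
      case (elim h)
      let ?N = "F.fredholm_series (\<lambda>z. (c + h) * wt \<xi> z) - F.fredholm_series (\<lambda>z. c * wt \<xi> z)"
      have "?N / h - (- ?D) = (?N - h * (- ?D)) / h" using elim by (simp add: field_simps)
      then have "norm (?N / h - (- ?D)) = \<bar>?N - h * (- ?D)\<bar> / \<bar>h\<bar>" by simp
      also have "\<dots> \<le> ((A * ?W\<^sup>2) * h\<^sup>2) / \<bar>h\<bar>"
        using bound[of h] elim by (intro divide_right_mono) auto
      also have "\<dots> = ((A * ?W\<^sup>2) * (\<bar>h\<bar> * \<bar>h\<bar>)) / \<bar>h\<bar>" by (simp add: power2_eq_square)
      also have "\<dots> = (A * ?W\<^sup>2) * (\<bar>h\<bar> * \<bar>h\<bar> / \<bar>h\<bar>)" by (rule times_divide_eq_right[symmetric])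
      also have "\<bar>h\<bar> * \<bar>h\<bar> / \<bar>h\<bar> = \<bar>h\<bar>" using elim by (subst nonzero_mult_div_cancel_right) auto
      finally show ?case .
    qed
  qed
  then have "((\<lambda>h. (F.fredholm_series (\<lambda>z. (c + h) * wt \<xi> z) - F.fredholm_series (\<lambda>z. c * wt \<xi> z)) / h) \<longlongrightarrow> - ?D) (at 0)"
    by (rule LIM_zero_cancel)
  then show ?thesis by (simp add: DERIV_def)
qed

text \<open>
  Along \<open>c\<close> the determinant of \<open>I - c K\<close> satisfies a linear differential equation wherever
  \<open>I - c K\<close> is invertible, so a zero at \<open>c = 1\<close> would spread to an interval.
\<close>

lemma fredholm_series_nonzero:
  assumes ord: "ordered_endpoints ix \<xi>" and \<xi>: "\<xi> \<in> Inv"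
  shows "F.fredholm_series (wt \<xi>) \<noteq> 0"
proof
  assume zero: "F.fredholm_series (wt \<xi>) = 0"
  let ?M = "count_space (UNIV :: 'm set) \<Otimes>\<^sub>M (lborel :: real measure)"
  let ?T = "\<lambda>c. id_blinfun - c *\<^sub>R K \<xi>"
  have w: "integrable ?M (wt \<xi>)" by (rule integrable_wt[OF ord])
  let ?W = "\<integral>z. \<bar>wt \<xi> z\<bar> \<partial>?M"
  have lim: "(?T \<longlongrightarrow> ?T 1) (at 1)" by (intro tendsto_intros)
  have inv1: "invertible_operator (?T 1)" using \<xi> by (simp add: Inv_def)
  let ?S = "\<lambda>c. inverse_operator (?T c)"
  have "((\<lambda>c. norm (?S c)) \<longlongrightarrow> norm (?S 1)) (at 1)"
    by (intro tendsto_norm inverse_operator_tendsto(2)[OF lim inv1])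
  then have "\<forall>\<^sub>F c in at 1. norm (?S c) < norm (?S 1) + 1" by (rule order_tendstoD) simp
  with inverse_operator_tendsto(1)[OF lim inv1]
  have "\<forall>\<^sub>F c in at 1. invertible_operator (?T c) \<and> norm (?S c) < norm (?S 1) + 1" by (rule eventually_conj)
  then obtain \<epsilon> where \<epsilon>: "0 < \<epsilon>" "\<And>c. c \<noteq> 1 \<Longrightarrow> dist c 1 < \<epsilon> \<Longrightarrow> invertible_operator (?T c) \<and> norm (?S c) < norm (?S 1) + 1"
    by (auto simp: eventually_at)
  have near: "invertible_operator (?T c) \<and> norm (?S c) \<le> norm (?S 1) + 1" if "1 \<le> c" "c < 1 + \<epsilon>" for c
    using \<epsilon>(2)[of c] inv1 that by (cases "c = 1") (auto simp: dist_real_def)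
  \<comment> \<open>The total length of the intervals times a bound for the resolvent kernel near c
    = 1, \<open>D\<close> bounding the norms of the columns.\<close>
  define L where "L = ?W * ((norm (?S 1) + 1) * D)"
  let ?\<phi> = "\<lambda>c. F.fredholm_series (\<lambda>z. c * wt \<xi> z)"
  let ?\<phi>' = "\<lambda>c. - (\<integral>z. wt \<xi> z * F.fredholm_first_minor (\<lambda>z. c * wt \<xi> z) z z \<partial>?M)"
  have growth: "\<bar>?\<phi>' c\<bar> \<le> L * \<bar>?\<phi> c\<bar>" if c: "1 \<le> c" "c < 1 + \<epsilon>" for c
  proof -
    have R: "\<bar>apply_bcontfun (blinfun_apply (?S c) (u j y)) x $ i\<bar> \<le> (norm (?S 1) + 1) * D" for i j x y
    proof -
      have "\<bar>apply_bcontfun (blinfun_apply (?S c) (u j y)) x $ i\<bar> \<le> norm (blinfun_apply (?S c) (u j y))"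
        by (rule abs_bcontfun_nth_le)
      also have "\<dots> \<le> norm (?S c) * norm (u j y)" by (rule norm_blinfun)
      also have "\<dots> \<le> (norm (?S 1) + 1) * D"
        using near[OF c] u.bound[of j y] by (intro mult_mono) (auto intro: add_nonneg_nonneg)
      finally show ?thesis .
    qed
    have Dz: "\<bar>F.fredholm_first_minor (\<lambda>z. c * wt \<xi> z) z z\<bar> \<le> \<bar>?\<phi> c\<bar> * ((norm (?S 1) + 1) * D)" for z
    proof (cases z)
      case (Pair i x)
      then show ?thesis
        using first_minor_resolvent[OF ord, of c i x i x] near[OF c] mult_left_mono[OF R[of i x x i] abs_ge_zero[of "?\<phi> c"]]
        by (simp add: abs_mult)
    qed
    have "\<bar>\<integral>z. wt \<xi> z * F.fredholm_first_minor (\<lambda>z. c * wt \<xi> z) z z \<partial>?M\<bar> \<le> (\<integral>z. \<bar>wt \<xi> z\<bar> * (\<bar>?\<phi> c\<bar> * ((norm (?S 1) + 1) * D)) \<partial>?M)"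
      by (rule abs_integral_le) (use w Dz in \<open>auto simp: abs_mult intro!: mult_left_mono\<close>)
    then show ?thesis by (simp add: L_def mult_ac)
  qed
  have z1: "?\<phi> 1 = 0" using zero by simp
  have vanish: "?\<phi> c = 0" if "1 \<le> c" "c < 1 + \<epsilon>" for c
    by (rule linear_growth_zero[of 1 "1 + \<epsilon>" ?\<phi> ?\<phi>' L, OF _ fredholm_series_scaled_deriv[OF ord] growth z1 that]) (use \<epsilon>(1) in auto)
  show False
    by (rule F.fredholm_series_not_zero_on_interval[OF w, of 1 "1 + \<epsilon>"]) (use \<epsilon>(1) vanish in auto)
qed

text \<open>Half-lines separate the end-points, so that the L1 distance of two configurations can be
  bounded end-point by end-point.\<close>

lemma indicator_intervals_AE:
  assumes ord: "ordered_endpoints ix \<xi>"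
  shows "AE y in lborel. indicator (intervals ix \<xi> k) y = (\<Sum>e | blk e = k. sg e * indicator {\<xi> $ e<..} y :: real)"
proof -
  have bij: "bij_betw ix UNIV (SIGMA k:UNIV. {1..2 * n k})" using ix by (simp add: endpoint_indexing_def)
  have inj: "inj ix" using bij by (simp add: bij_betw_def)
  have ix_inv: "ix (the_inv ix (k, w)) = (k, w)" if "w \<in> {1..2 * n k}" for w
    by (rule f_the_inv_into_f[OF inj]) (use bij that in \<open>auto simp: bij_betw_def\<close>)
  define a where "a w = \<xi> $ the_inv ix (k, w)" for w
  have less: "a w < a w'" if "w < w'" "1 \<le> w" "w' \<le> 2 * n k" for w w'
    using ord that ix_inv[of w] ix_inv[of w'] unfolding ordered_endpoints_def a_def by auto
  \<comment> \<open>The exclusion matters at right ends, where the open interval and the difference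
    of half-lines disagree. Index 0 belongs to no end-point and excludes one further point.\<close>
  have "AE y in lborel. \<forall>w\<in>{..2 * n k}. y \<noteq> a w"
    by (rule AE_finite_allI) (auto intro: AE_lborel_singleton)
  then show ?thesis
  proof eventually_elim
    case (elim y)
    define I where "I t = {a (2 * t + 1) <..< a (2 * t + 2)}" for t
    have disj: "disjoint_family_on I {..<n k}"
    proof (unfold disjoint_family_on_def, intro ballI impI)
      have "I s \<inter> I t = {}" if "s < t" "t < n k" for s t
      proof -
        have "a (2 * s + 2) \<le> a (2 * t + 1)"
          using less[of "2 * s + 2" "2 * t + 1"] that by (cases "2 * s + 2 = 2 * t + 1") auto
        then show ?thesis by (auto simp: I_def)
      qed
      then show "I s \<inter> I t = {}" if "s \<in> {..<n k}" "t \<in> {..<n k}" "s \<noteq> t" for s t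
        using that by (metis Int_commute lessThan_iff linorder_neqE_nat)
    qed
    have "indicator (intervals ix \<xi> k) y = (\<Sum>t<n k. indicator (I t) y :: real)"
      unfolding intervals_eq[OF ix] a_def[symmetric] I_def[symmetric] using disj by (simp add: indicator_UN_disjoint)
    also have "\<dots> = (\<Sum>t<n k. indicator {a (2 * t + 1)<..} y - indicator {a (2 * t + 2)<..} y)"
    proof (rule sum.cong[OF refl])
      fix t assume t: "t \<in> {..<n k}"
      have "a (2 * t + 1) < a (2 * t + 2)" using less[of "2 * t + 1" "2 * t + 2"] t by auto
      moreover have "y \<noteq> a (2 * t + 2)" using elim t by auto
      ultimately show "indicator (I t) y = (indicator {a (2 * t + 1)<..} y - indicator {a (2 * t + 2)<..} y :: real)"
        by (auto simp: I_def indicator_def)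
    qed
    also have "\<dots> = (\<Sum>e | blk e = k. sg e * indicator {\<xi> $ e<..} y)"
      using sum_block[OF ix, where k = k and F = "\<lambda>e. indicator {\<xi> $ e<..} y :: real"] by (simp add: a_def)
    finally show ?case .
  qed
qed

lemma integral_abs_indicator_Ioi_diff:
  "integrable lborel (\<lambda>y. \<bar>indicator {a<..} y - indicator {b<..} y\<bar> :: real)"
  "(LBINT y. \<bar>indicator {a<..} y - indicator {b<..} y\<bar>) = \<bar>a - b\<bar>" for a b :: real
proof -
  have *: "\<bar>indicator {a<..} y - indicator {b<..} y\<bar> = (indicator {min a b<..max a b} y :: real)" for y
    by (auto simp: indicator_def)
  show "integrable lborel (\<lambda>y. \<bar>indicator {a<..} y - indicator {b<..} y\<bar> :: real)"
    unfolding * by (intro integrable_real_indicator) (auto simp: min_def max_def)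
  show "(LBINT y. \<bar>indicator {a<..} y - indicator {b<..} y\<bar>) = \<bar>a - b\<bar>"
    unfolding * by (simp add: abs_if)
qed

lemma integral_abs_wt_diff:
  assumes ord: "ordered_endpoints ix \<xi>" "ordered_endpoints ix \<eta>"
  shows "(\<integral>z. \<bar>wt \<eta> z - wt \<xi> z\<bar> \<partial>(count_space UNIV \<Otimes>\<^sub>M lborel)) \<le> (\<Sum>e\<in>UNIV. \<bar>\<eta> $ e - \<xi> $ e\<bar>)"
proof -
  have int: "integrable lborel (\<lambda>y. \<bar>wt \<eta> (k, y) - wt \<xi> (k, y)\<bar>)" for k
    using integrable_indicator_intervals[OF ord(1), of k] integrable_indicator_intervals[OF ord(2), of k] by (simp add: wt_def)
  have "(\<integral>z. \<bar>wt \<eta> z - wt \<xi> z\<bar> \<partial>(count_space UNIV \<Otimes>\<^sub>M lborel)) = (\<Sum>k\<in>UNIV. LBINT y. \<bar>wt \<eta> (k, y) - wt \<xi> (k, y)\<bar>)"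
    by (rule integral_count_space_pair(2)[OF int])
  also have "\<dots> \<le> (\<Sum>k\<in>UNIV. \<Sum>e | blk e = k. \<bar>\<eta> $ e - \<xi> $ e\<bar>)"
  proof (rule sum_mono)
    fix k
    let ?g = "\<lambda>y. \<Sum>e | blk e = k. \<bar>indicator {\<eta> $ e<..} y - indicator {\<xi> $ e<..} y\<bar> :: real"
    have "(LBINT y. \<bar>wt \<eta> (k, y) - wt \<xi> (k, y)\<bar>) \<le> (LBINT y. ?g y)"
    proof (rule integral_mono_AE[OF int])
      show "integrable lborel ?g" by (intro Bochner_Integration.integrable_sum integral_abs_indicator_Ioi_diff)
      show "AE y in lborel. \<bar>wt \<eta> (k, y) - wt \<xi> (k, y)\<bar> \<le> ?g y"
        using indicator_intervals_AE[OF ord(1), of k] indicator_intervals_AE[OF ord(2), of k]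
      proof eventually_elim
        case (elim y)
        have "wt \<eta> (k, y) - wt \<xi> (k, y) = (\<Sum>e | blk e = k. sg e * (indicator {\<eta> $ e<..} y - indicator {\<xi> $ e<..} y))"
          using elim by (simp add: wt_def right_diff_distrib sum_subtractf)
        also have "\<bar>\<dots>\<bar> \<le> (\<Sum>e | blk e = k. \<bar>sg e * (indicator {\<eta> $ e<..} y - indicator {\<xi> $ e<..} y)\<bar>)" by (rule sum_abs)
        finally show ?case by (simp add: abs_mult)
      qed
    qed
    also have "\<dots> = (\<Sum>e | blk e = k. \<bar>\<eta> $ e - \<xi> $ e\<bar>)"
      by (simp add: Bochner_Integration.integral_sum integral_abs_indicator_Ioi_diff)
    finally show "(LBINT y. \<bar>wt \<eta> (k, y) - wt \<xi> (k, y)\<bar>) \<le> (\<Sum>e | blk e = k. \<bar>\<eta> $ e - \<xi> $ e\<bar>)" .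
  qed
  also have "\<dots> = (\<Sum>e\<in>UNIV. \<bar>\<eta> $ e - \<xi> $ e\<bar>)" by (rule sum_by_blocks[symmetric])
  finally show ?thesis .
qed

lemma ordered_eventually:
  assumes "ordered_endpoints ix \<xi>"
  shows "\<forall>\<^sub>F \<eta> in at \<xi>. ordered_endpoints ix \<eta>"
proof -
  have "\<forall>\<^sub>F \<eta> in at \<xi>. blk e = blk e' \<and> snd (ix e) < snd (ix e') \<longrightarrow> \<eta> $ e < \<eta> $ e'" for e e'
  proof (cases "blk e = blk e' \<and> snd (ix e) < snd (ix e')")
    case True
    then have "\<xi> $ e < \<xi> $ e'" using assms by (simp add: ordered_endpoints_def)
    then have "0 < \<xi> $ e' - \<xi> $ e" by simp
    moreover have "((\<lambda>\<eta>. \<eta> $ e' - \<eta> $ e) \<longlongrightarrow> \<xi> $ e' - \<xi> $ e) (at \<xi>)" by (intro tendsto_intros)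
    ultimately have "\<forall>\<^sub>F \<eta> in at \<xi>. 0 < \<eta> $ e' - \<eta> $ e" by (rule order_tendstoD(1)[rotated])
    then show ?thesis by eventually_elim simp
  next
    case False
    then show ?thesis by (intro always_eventually allI) blast
  qed
  then show ?thesis unfolding ordered_endpoints_def by (simp add: eventually_all_finite)
qed

text \<open>The first minor is the determinant times \<open>kerR\<close>, so the term of first order
  is an integral of the diagonal of \<open>kerR\<close>, differentiable in the end-points. By
  \<open>integral_abs_wt_diff\<close> the remainder, quadratic in L1, is quadratic in the
  displacement.\<close>

lemma fredholm_series_has_derivative:
  assumes ord: "ordered_endpoints ix \<xi>" and \<xi>: "\<xi> \<in> Inv"
  shows "((\<lambda>\<eta>. F.fredholm_series (wt \<eta>)) has_derivative
    (\<lambda>h. F.fredholm_series (wt \<xi>) * (\<Sum>e\<in>UNIV. sg e * h $ e * kerR \<xi> (blk e) (blk e) (\<xi> $ e) (\<xi> $ e)))) (at \<xi>)"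
proof -
  let ?M = "count_space (UNIV :: 'm set) \<Otimes>\<^sub>M (lborel :: real measure)"
  let ?d = "\<lambda>\<eta>. F.fredholm_series (wt \<eta>)"
  define g where "g k y = kerR \<xi> k k y y" for k y
  have g: "continuous_on UNIV (g k)" for k
    unfolding g_def using continuous_on_compose2[OF continuous_kerR[of \<xi> k k], of UNIV "\<lambda>y. (y, y)"]
    by (simp add: continuous_on_Pair continuous_on_id)
  \<comment> \<open>Up to sign, the integral of the diagonal resolvent kernel against the difference
    of the two weights.\<close>
  let ?P = "\<lambda>\<eta>. \<Sum>e\<in>UNIV. sg e * (antideriv (g (blk e)) (\<eta> $ e) - antideriv (g (blk e)) (\<xi> $ e))"
  define Q where "Q = 1 + (\<integral>z. \<bar>wt \<xi> z\<bar> \<partial>?M)"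
  have Q: "1 \<le> Q" by (simp add: Q_def)
  obtain A where A: "0 \<le> A"
    "\<And>w v. integrable ?M w \<Longrightarrow> integrable ?M v \<Longrightarrow> (\<integral>z. \<bar>w z\<bar> \<partial>?M) + (\<integral>z. \<bar>v z\<bar> \<partial>?M) \<le> Q \<Longrightarrow>
      \<bar>F.fredholm_series (\<lambda>z. w z + v z) - F.fredholm_series w + (\<integral>t. v t * F.fredholm_first_minor w t t \<partial>?M)\<bar>
        \<le> A * (\<integral>z. \<bar>v z\<bar> \<partial>?M)\<^sup>2"
    using F.fredholm_series_add[OF Q] by blast
  let ?N = "\<lambda>\<eta>. \<Sum>e\<in>UNIV. \<bar>\<eta> $ e - \<xi> $ e\<bar>"
  have bound: "\<bar>?d \<eta> - ?d \<xi> - ?d \<xi> * ?P \<eta>\<bar> \<le> A * (?N \<eta>)\<^sup>2" if \<eta>: "ordered_endpoints ix \<eta>" "?N \<eta> \<le> 1" for \<eta>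
  proof -
    let ?v = "\<lambda>z. wt \<eta> z - wt \<xi> z"
    have v: "integrable ?M ?v" using integrable_wt[OF ord] integrable_wt[OF \<eta>(1)] by simp
    have vN: "(\<integral>z. \<bar>?v z\<bar> \<partial>?M) \<le> ?N \<eta>" by (rule integral_abs_wt_diff[OF ord \<eta>(1)])
    have vi: "integrable lborel (\<lambda>y. ?v (k, y) * F.fredholm_first_minor (wt \<xi>) (k, y) (k, y))"
      "(LBINT y. ?v (k, y) * F.fredholm_first_minor (wt \<xi>) (k, y) (k, y)) =
        ?d \<xi> * - (\<Sum>e | blk e = k. sg e * (antideriv (g k) (\<eta> $ e) - antideriv (g k) (\<xi> $ e)))" for k
    proof -
      have eq: "?v (k, y) * F.fredholm_first_minor (wt \<xi>) (k, y) (k, y) =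
          ?d \<xi> * (g k y * indicator (intervals ix \<eta> k) y - g k y * indicator (intervals ix \<xi> k) y)" for y
        by (simp add: first_minor_kerR[OF ord \<xi>] wt_def g_def algebra_simps)
      note i = integral_intervals[OF ix ord g[of k], of k] integral_intervals[OF ix \<eta>(1) g[of k], of k]
      show "integrable lborel (\<lambda>y. ?v (k, y) * F.fredholm_first_minor (wt \<xi>) (k, y) (k, y))"
        unfolding eq using i by (intro integrable_mult_right Bochner_Integration.integrable_diff)
      show "(LBINT y. ?v (k, y) * F.fredholm_first_minor (wt \<xi>) (k, y) (k, y)) =
        ?d \<xi> * - (\<Sum>e | blk e = k. sg e * (antideriv (g k) (\<eta> $ e) - antideriv (g k) (\<xi> $ e)))"
        unfolding eq using i by (simp add: right_diff_distrib sum_subtractf)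
    qed
    have "(\<integral>t. ?v t * F.fredholm_first_minor (wt \<xi>) t t \<partial>?M) =
        (\<Sum>k\<in>UNIV. LBINT y. ?v (k, y) * F.fredholm_first_minor (wt \<xi>) (k, y) (k, y))"
      by (rule integral_count_space_pair(2)[OF vi(1)])
    also have "\<dots> = - (?d \<xi> * (\<Sum>k\<in>UNIV. \<Sum>e | blk e = k. sg e * (antideriv (g k) (\<eta> $ e) - antideriv (g k) (\<xi> $ e))))"
      unfolding vi(2) by (simp add: sum_distrib_left sum_negf)
    also have "(\<Sum>k\<in>UNIV. \<Sum>e | blk e = k. sg e * (antideriv (g k) (\<eta> $ e) - antideriv (g k) (\<xi> $ e))) = ?P \<eta>"
      by (subst sum_by_blocks[of _ ix]) (auto intro!: sum.cong)
    finally have minor: "(\<integral>t. ?v t * F.fredholm_first_minor (wt \<xi>) t t \<partial>?M) = - (?d \<xi> * ?P \<eta>)" .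
    have "\<bar>F.fredholm_series (\<lambda>z. wt \<xi> z + ?v z) - ?d \<xi> + (\<integral>t. ?v t * F.fredholm_first_minor (wt \<xi>) t t \<partial>?M)\<bar>
        \<le> A * (\<integral>z. \<bar>?v z\<bar> \<partial>?M)\<^sup>2"
      by (rule A(2)[OF integrable_wt[OF ord] v]) (use vN \<eta>(2) in \<open>simp add: Q_def\<close>)
    also have "\<dots> \<le> A * (?N \<eta>)\<^sup>2" using A(1) vN by (intro mult_left_mono power_mono) auto
    finally show ?thesis unfolding minor by simp
  qed
  have rem: "((\<lambda>\<eta>. ?d \<eta> - ?d \<xi> - ?d \<xi> * ?P \<eta>) has_derivative (\<lambda>h. 0)) (at \<xi>)"
    unfolding has_derivative_iff_norm
  proof (intro conjI)
    let ?c = "real CARD('e)"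
    have N: "?N \<eta> \<le> ?c * norm (\<eta> - \<xi>)" for \<eta>
    proof -
      have "?N \<eta> \<le> (\<Sum>e\<in>(UNIV :: 'e set). norm (\<eta> - \<xi>))"
        by (rule sum_mono) (use component_le_norm_cart[of "\<eta> - \<xi>"] in simp)
      then show ?thesis by simp
    qed
    have limN: "((\<lambda>\<eta>. ?N \<eta>) \<longlongrightarrow> (\<Sum>e\<in>UNIV. \<bar>\<xi> $ e - \<xi> $ e\<bar>)) (at \<xi>)" by (intro tendsto_intros)
    then have N0: "((\<lambda>\<eta>. ?N \<eta>) \<longlongrightarrow> 0) (at \<xi>)" by simp
    then have "\<forall>\<^sub>F \<eta> in at \<xi>. ?N \<eta> < 1" by (rule order_tendstoD) simp
    with ordered_eventually[OF ord] have ev: "\<forall>\<^sub>F \<eta> in at \<xi>. norm (norm ((?d \<eta> - ?d \<xi> - ?d \<xi> * ?P \<eta>) - (?d \<xi> - ?d \<xi> - ?d \<xi> * ?P \<xi>) - 0) / norm (\<eta> - \<xi>)) \<le> A * ?c * ?N \<eta>"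
    proof eventually_elim
      case (elim \<eta>)
      have nn: "0 \<le> ?N \<eta>" by (simp add: sum_nonneg)
      have "\<bar>?d \<eta> - ?d \<xi> - ?d \<xi> * ?P \<eta>\<bar> \<le> A * (?N \<eta>)\<^sup>2" using elim by (intro bound) auto
      also have "\<dots> \<le> A * (?N \<eta> * (?c * norm (\<eta> - \<xi>)))"
        unfolding power2_eq_square using A(1) N nn by (intro mult_left_mono) auto
      finally have "\<bar>?d \<eta> - ?d \<xi> - ?d \<xi> * ?P \<eta>\<bar> \<le> (A * ?c * ?N \<eta>) * norm (\<eta> - \<xi>)" by (simp add: mult_ac)
      then have "\<bar>?d \<eta> - ?d \<xi> - ?d \<xi> * ?P \<eta>\<bar> / norm (\<eta> - \<xi>) \<le> A * ?c * ?N \<eta>"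
        using A(1) nn by (cases "\<eta> = \<xi>") (auto simp: divide_le_eq)
      then show ?case by simp
    qed
    have "((\<lambda>\<eta>. A * ?c * ?N \<eta>) \<longlongrightarrow> 0) (at \<xi>)" by (rule tendsto_mult_right_zero[OF N0])
    from Lim_null_comparison[OF ev this]
    show "((\<lambda>y. norm ((?d y - ?d \<xi> - ?d \<xi> * ?P y) - (?d \<xi> - ?d \<xi> - ?d \<xi> * ?P \<xi>) - 0) / norm (y - \<xi>)) \<longlongrightarrow> 0) (at \<xi>)" .
  qed simp
  have coord: "((\<lambda>\<eta>. \<eta> $ b) has_derivative (\<lambda>h. h $ b)) (at \<xi>)" for b
    by (rule bounded_linear.has_derivative[OF bounded_linear_vec_nth has_derivative_ident])
  have "((\<lambda>\<eta>. antideriv (g (blk e)) (\<eta> $ e)) has_derivative (\<lambda>h. h $ e * g (blk e) (\<xi> $ e))) (at \<xi>)" for e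
    using has_derivative_compose[OF coord[of e] antideriv_has_vector_derivative[OF g, unfolded has_vector_derivative_def]]
    by simp
  then have P: "(?P has_derivative (\<lambda>h. \<Sum>e\<in>UNIV. sg e * (h $ e * g (blk e) (\<xi> $ e) - 0))) (at \<xi>)"
    by (intro has_derivative_sum has_derivative_mult_right has_derivative_diff has_derivative_const)
  have "((\<lambda>\<eta>. (?d \<eta> - ?d \<xi> - ?d \<xi> * ?P \<eta>) + ?d \<xi> + ?d \<xi> * ?P \<eta>) has_derivative
      (\<lambda>h. 0 + 0 + ?d \<xi> * (\<Sum>e\<in>UNIV. sg e * (h $ e * g (blk e) (\<xi> $ e) - 0)))) (at \<xi>)"
    by (intro has_derivative_add rem has_derivative_const has_derivative_mult_right P)
  then show ?thesis by (simp add: g_def mult.assoc)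
qed

end

section \<open>Matrix form of the equations\<close>

lemma diag_mat_mult_nth: "(diag_mat v ** A) $ a $ b = v $ a * A $ a $ b"
proof -
  have "(diag_mat v ** A) $ a $ b = (\<Sum>k\<in>UNIV. if k = a then v $ a * A $ a $ b else 0)"
    by (subst matrix_matrix_mult_def, simp only: vec_lambda_beta, rule sum.cong) (auto simp: diag_mat_def)
  then show ?thesis by simp
qed

lemma mult_diag_mat_nth: "(A ** diag_mat v) $ a $ b = A $ a $ b * v $ b"
proof -
  have "(A ** diag_mat v) $ a $ b = (\<Sum>k\<in>UNIV. if k = b then A $ a $ b * v $ b else 0)"
    by (subst matrix_matrix_mult_def, simp only: vec_lambda_beta, rule sum.cong) (auto simp: diag_mat_def)
  then show ?thesis by simp
qed

lemma signed_diff_eq: "signed_diff ix h = diag_mat (\<chi> e. endpoint_sign ix e * h $ e)"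
  by (simp add: Finite_Cartesian_Product.vec_eq_iff signed_diff_def sign_mat_def diag_mat_mult_nth)
    (simp add: diag_mat_def)

lemma mult_diag_mult_nth: "(A ** diag_mat v ** B) $ a $ b = (\<Sum>c\<in>UNIV. A $ a $ c * v $ c * B $ c $ b)"
  by (subst matrix_matrix_mult_def) (simp add: mult_diag_mat_nth)

lemma dr_rhs_nth:
  "dr_rhs ix M A B h $ e $ e' = - (\<Sum>b\<in>UNIV. M $ e $ b * (endpoint_sign ix b * h $ b) * M $ b $ e')
    + h $ e * A $ e $ e' + B $ e $ e' * h $ e'"
  by (simp add: dr_rhs_def signed_diff_eq mult_diag_mult_nth diag_mat_mult_nth mult_diag_mat_nth)

text \<open>At a diagonal position both increments are the same h_e, so only the sum of the two
  matrices enters.\<close>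

lemma dr_rhs_cong:
  assumes diag: "\<And>e. (A + B) $ e $ e = (A' + B') $ e $ e"
    and off: "\<And>e e'. e \<noteq> e' \<Longrightarrow> A $ e $ e' = A' $ e $ e' \<and> B $ e $ e' = B' $ e $ e'"
  shows "dr_rhs ix M A B = dr_rhs ix M A' B'"
proof (rule ext, unfold Finite_Cartesian_Product.vec_eq_iff, intro allI)
  fix h e e'
  have "h $ e * A $ e $ e' + B $ e $ e' * h $ e' = h $ e * A' $ e $ e' + B' $ e $ e' * h $ e'"
  proof (cases "e = e'")
    case True
    then show ?thesis using arg_cong[OF diag[of e], of "\<lambda>x. h $ e * x"] by (simp add: algebra_simps)
  qed (use off in simp)
  then show "dr_rhs ix M A B h $ e $ e' = dr_rhs ix M A' B' h $ e $ e'" by (simp add: dr_rhs_nth)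
qed

lemma real_polynomial_function_sine_vars:
  fixes e e' :: "'e::finite" and j :: "'m::finite"
  shows "real_polynomial_function (\<lambda>v::('m, 'e) sine_vars. fst v $ e $ e')"
    "real_polynomial_function (\<lambda>v::('m, 'e) sine_vars. fst (snd v) $ e $ j)"
    "real_polynomial_function (\<lambda>v::('m, 'e) sine_vars. fst (snd (snd v)) $ j $ e)"
    "real_polynomial_function (\<lambda>v::('m, 'e) sine_vars. fst (snd (snd (snd v))) $ e $ j)"
    "real_polynomial_function (\<lambda>v::('m, 'e) sine_vars. fst (snd (snd (snd (snd v)))) $ j $ e)"
    "real_polynomial_function (\<lambda>v::('m, 'e) sine_vars. snd (snd (snd (snd (snd v)))) $ e)"
  by (intro real_polynomial_function.intros(1) bounded_linear_compose[OF bounded_linear_vec_nth]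
      bounded_linear_fst_comp bounded_linear_snd_comp bounded_linear_ident)+

lemma rational_on_polynomial: "real_polynomial_function N \<Longrightarrow> rational_on V N"
  unfolding rational_on_def by (rule exI[of _ N], rule exI[of _ "\<lambda>_. 1"]) auto

section \<open>The sine kernel: identification of the defined quantities and the differential
  equations\<close>

locale sine_setting =
  fixes \<tau> :: "'m::{finite,linorder} \<Rightarrow> real" and n :: "'m \<Rightarrow> nat" and ix :: "'e::finite \<Rightarrow> 'm \<times> nat"
  assumes \<tau>: "strict_mono \<tau>" and ix: "endpoint_indexing n ix"
begin

sublocale sine_conv_kernel "sine_l \<tau>" "sine_l1 \<tau>" "sine_C \<tau>" n ix \<tau>
  by (rule sine_conv_kernelI[OF \<tau> ix])

abbreviation "S \<equiv> admissible \<tau> ix"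

lemma sine_K_eq: "sine_K \<tau> (intervals ix \<xi>) = (\<lambda>i j x y. sine_l \<tau> i j (x - y) * indicator (intervals ix \<xi> j) y)"
  by (simp add: fun_eq_iff sine_K_def sine_L_eq_l)

lemma sine_op_eq: "ordered_endpoints ix \<xi> \<Longrightarrow> sine_op \<tau> (intervals ix \<xi>) = K \<xi>"
  by (simp add: sine_op_def sine_K_eq K_eq_kernel_operator)

lemma sine_rho_eq: "ordered_endpoints ix \<xi> \<Longrightarrow> sine_rho \<tau> (intervals ix \<xi>) = \<rho> \<xi>"
  by (simp add: sine_rho_def sine_op_eq \<rho>_def)

lemma sine_det_eq: "ordered_endpoints ix \<xi> \<Longrightarrow> sine_det \<tau> ix \<xi> = F.fredholm_series (wt \<xi>)"
  by (simp add: sine_det_def sine_K_eq fredholm_det_eq_series)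

lemma admissible_iff: "\<xi> \<in> S \<longleftrightarrow> ordered_endpoints ix \<xi> \<and> \<xi> \<in> Inv"
  by (auto simp: admissible_def Inv_def sine_op_eq)

lemma admissible_eventually: "\<xi> \<in> S \<Longrightarrow> \<forall>\<^sub>F \<eta> in at \<xi>. \<eta> \<in> S"
  unfolding admissible_iff by (intro eventually_conj ordered_eventually Inv_eventually) auto

lemma sine_R_eq:
  assumes "\<xi> \<in> S"
  shows "sine_R \<tau> (intervals ix \<xi>) = (\<lambda>i j x y. kerR \<xi> i j x y * indicator (intervals ix \<xi> j) y)"
  using assms unfolding admissible_iff sine_R_def by (simp only: sine_op_eq sine_rho_eq the_kernel_eq)

lemma mat_r_nth:
  assumes \<xi>: "\<xi> \<in> S"
  shows "mat_r \<tau> ix \<xi> $ e $ e' = kerR \<xi> (blk e) (blk e') (\<xi> $ e) (\<xi> $ e')"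
  unfolding mat_r_def
  by (rule endpoint_matrix_eq[OF ix]) (use \<xi> in \<open>auto simp: admissible_iff sine_R_eq[OF \<xi>] continuous_kerR\<close>)

lemma mat_rx_nth:
  assumes \<xi>: "\<xi> \<in> S"
  shows "mat_rx \<tau> ix \<xi> $ e $ e' = kerRx \<xi> (blk e) (blk e') (\<xi> $ e) (\<xi> $ e')"
  unfolding mat_rx_def
proof (rule endpoint_matrix_eq[OF ix])
  have Inv: "\<xi> \<in> Inv" using \<xi> by (simp add: admissible_iff)
  fix i j x y
  assume "y \<in> intervals ix \<xi> j"
  then show "deriv (\<lambda>t. sine_R \<tau> (intervals ix \<xi>) i j t y) x = kerRx \<xi> i j x y"
    using kerR_deriv_x[OF Inv, of i j y x] by (simp add: sine_R_eq[OF \<xi>] DERIV_imp_deriv)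
qed (use \<xi> in \<open>auto simp: admissible_iff continuous_kerRx\<close>)

lemma mat_ry_nth:
  assumes \<xi>: "\<xi> \<in> S"
  shows "mat_ry \<tau> ix \<xi> $ e $ e' = kerRy \<xi> (blk e) (blk e') (\<xi> $ e) (\<xi> $ e')"
  unfolding mat_ry_def
proof (rule endpoint_matrix_eq[OF ix])
  fix i j x y
  assume y: "y \<in> intervals ix \<xi> j"
  \<comment> \<open>Inside the open set X_j the indicator is locally constant and does not affect
    the derivative.\<close>
  have "((\<lambda>t. kerR \<xi> i j x t * indicator (intervals ix \<xi> j) t) has_real_derivative kerRy \<xi> i j x y) (at y)"
    by (rule has_field_derivative_transform_within_open[OF kerR_deriv_y open_intervals y]) simp
  then show "deriv (\<lambda>t. sine_R \<tau> (intervals ix \<xi>) i j x t) y = kerRy \<xi> i j x y"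
    by (simp add: sine_R_eq[OF \<xi>] DERIV_imp_deriv)
qed (use \<xi> in \<open>auto simp: admissible_iff continuous_kerRy\<close>)

lemma mat_right_nth:
  assumes "\<xi> \<in> S"
  shows "mat_right f \<tau> ix \<xi> $ e $ j = right \<xi> f (blk e) j (\<xi> $ e)"
  using assms by (simp add: mat_right_def operator_entry_def right_def unit_bcontfun_def sine_rho_eq admissible_iff)

lemma mat_left_nth:
  assumes \<xi>: "\<xi> \<in> S" and f: "continuous_on UNIV f" "\<And>x. \<bar>f x\<bar> \<le> B"
  shows "mat_left f \<tau> ix \<xi> $ i $ e = left \<xi> f i (blk e) (\<xi> $ e)"
proof -
  have ord: "ordered_endpoints ix \<xi>" using \<xi> by (simp add: admissible_iff)
  have "Lim (at (\<xi> $ e) within intervals ix \<xi> (blk e)) (rho_left \<tau> (intervals ix \<xi>) f i (blk e)) =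
      left \<xi> f i (blk e) (\<xi> $ e)"
  proof (rule Lim_within_open_closure[OF open_intervals closure_intervals[OF ix ord]])
    show "isCont (left \<xi> f i (blk e)) (\<xi> $ e)"
      using continuous_left[OF f] by (simp add: continuous_on_eq_continuous_at)
    fix z assume "z \<in> intervals ix \<xi> (blk e)"
    then show "rho_left \<tau> (intervals ix \<xi>) f i (blk e) z = left \<xi> f i (blk e) z"
      by (simp add: rho_left_def left_def lam_integral[OF ord f(1)] sine_R_eq[OF \<xi>] kerR_def)
  qed
  then show ?thesis by (simp add: mat_left_def)
qed

text \<open>The end-point matrices are identified with smooth expressions on the admissible set,
  which is a neighbourhood of each of its points.\<close>

lemma has_derivative_admissible:
  assumes \<xi>: "\<xi> \<in> S" and f: "(f has_derivative f') (at \<xi>)" and eq: "\<And>\<eta>. \<eta> \<in> S \<Longrightarrow> g \<eta> = f \<eta>"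
  shows "(g has_derivative f') (at \<xi>)"
  by (rule has_derivative_transform_eventually[OF f])
    (use admissible_eventually[OF \<xi>] \<xi> eq in \<open>auto elim: eventually_mono\<close>)

lemma mat_r_has_derivative:
  assumes \<xi>: "\<xi> \<in> S"
  shows "(mat_r \<tau> ix has_derivative dr_rhs ix (mat_r \<tau> ix \<xi>) (mat_rx \<tau> ix \<xi>) (mat_ry \<tau> ix \<xi>)) (at \<xi>)"
proof (intro has_derivative_vec)
  have Inv: "\<xi> \<in> Inv" using \<xi> by (simp add: admissible_iff)
  fix e e'
  show "((\<lambda>\<eta>. mat_r \<tau> ix \<eta> $ e $ e') has_derivative
    (\<lambda>h. dr_rhs ix (mat_r \<tau> ix \<xi>) (mat_rx \<tau> ix \<xi>) (mat_ry \<tau> ix \<xi>) h $ e $ e')) (at \<xi>)"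
    unfolding dr_rhs_nth mat_r_nth[OF \<xi>] mat_rx_nth[OF \<xi>] mat_ry_nth[OF \<xi>]
    by (rule has_derivative_admissible[OF \<xi> kerR_has_derivative[OF Inv]]) (rule mat_r_nth)
qed

lemma mat_right_has_derivative:
  assumes \<xi>: "\<xi> \<in> S" and f: "continuous_on UNIV f" "\<And>x. \<bar>f x\<bar> \<le> B" and f': "continuous_on UNIV f'" "\<And>x. \<bar>f' x\<bar> \<le> B'"
    and d: "\<And>x. (f has_real_derivative f' x) (at x)"
  shows "(mat_right f \<tau> ix has_derivative
    (\<lambda>h. diag_mat h ** (mat_right f' \<tau> ix \<xi> + mat_r \<tau> ix \<xi> ** sign_mat ix ** mat_right f \<tau> ix \<xi>)
      - mat_r \<tau> ix \<xi> ** signed_diff ix h ** mat_right f \<tau> ix \<xi>)) (at \<xi>)"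
proof (intro has_derivative_vec)
  have Inv: "\<xi> \<in> Inv" using \<xi> by (simp add: admissible_iff)
  fix e j
  show "((\<lambda>\<eta>. mat_right f \<tau> ix \<eta> $ e $ j) has_derivative
    (\<lambda>h. (diag_mat h ** (mat_right f' \<tau> ix \<xi> + mat_r \<tau> ix \<xi> ** sign_mat ix ** mat_right f \<tau> ix \<xi>)
      - mat_r \<tau> ix \<xi> ** signed_diff ix h ** mat_right f \<tau> ix \<xi>) $ e $ j)) (at \<xi>)"
    using has_derivative_admissible[OF \<xi> right_has_derivative[OF Inv f f' d, of "blk e" j e], of "\<lambda>\<eta>. mat_right f \<tau> ix \<eta> $ e $ j"]
    by (simp add: mat_right_nth mat_r_nth[OF \<xi>] \<xi> sign_mat_def signed_diff_eq diag_mat_mult_nth mult_diag_mult_nth)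
qed

lemma mat_left_has_derivative:
  assumes \<xi>: "\<xi> \<in> S" and f: "continuous_on UNIV f" "\<And>x. \<bar>f x\<bar> \<le> B" and f': "continuous_on UNIV f'" "\<And>x. \<bar>f' x\<bar> \<le> B'"
    and d: "\<And>x. (f has_real_derivative f' x) (at x)"
  shows "(mat_left f \<tau> ix has_derivative
    (\<lambda>h. (mat_left f' \<tau> ix \<xi> + mat_left f \<tau> ix \<xi> ** sign_mat ix ** mat_r \<tau> ix \<xi>) ** diag_mat h
      - mat_left f \<tau> ix \<xi> ** signed_diff ix h ** mat_r \<tau> ix \<xi>)) (at \<xi>)"
proof (intro has_derivative_vec)
  have Inv: "\<xi> \<in> Inv" using \<xi> by (simp add: admissible_iff)
  fix i e
  show "((\<lambda>\<eta>. mat_left f \<tau> ix \<eta> $ i $ e) has_derivative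
    (\<lambda>h. ((mat_left f' \<tau> ix \<xi> + mat_left f \<tau> ix \<xi> ** sign_mat ix ** mat_r \<tau> ix \<xi>) ** diag_mat h
      - mat_left f \<tau> ix \<xi> ** signed_diff ix h ** mat_r \<tau> ix \<xi>) $ i $ e)) (at \<xi>)"
    using has_derivative_admissible[OF \<xi> left_has_derivative[OF Inv f f' d, of i "blk e" e], of "\<lambda>\<eta>. mat_left f \<tau> ix \<eta> $ i $ e"]
    by (simp add: mat_left_nth[OF _ f] mat_left_nth[OF \<xi> f'] mat_r_nth[OF \<xi>] \<xi> sign_mat_def signed_diff_eq mult_diag_mat_nth mult_diag_mult_nth)
qed

lemma sin_cos_bounded:
  "continuous_on UNIV (sin :: real \<Rightarrow> real)" "\<And>x::real. \<bar>sin x\<bar> \<le> 1"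
  "continuous_on UNIV (cos :: real \<Rightarrow> real)" "\<And>x::real. \<bar>cos x\<bar> \<le> 1"
  "continuous_on UNIV (\<lambda>x::real. - sin x)" "\<And>x::real. \<bar>- sin x\<bar> \<le> 1"
  by (auto intro!: continuous_intros)

lemma mat_minus_sin:
  assumes \<xi>: "\<xi> \<in> S"
  shows "mat_right (\<lambda>x. - sin x) \<tau> ix \<xi> = - mat_q \<tau> ix \<xi>" "mat_left (\<lambda>x. - sin x) \<tau> ix \<xi> = - mat_qt \<tau> ix \<xi>"
  by (simp_all add: Finite_Cartesian_Product.vec_eq_iff mat_right_nth[OF \<xi>] mat_left_nth[OF \<xi> sin_cos_bounded(1,2)]
      mat_left_nth[OF \<xi> sin_cos_bounded(5,6)] right_minus[OF sin_cos_bounded(1,2)] left_minus[OF sin_cos_bounded(1,2)])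

lemma sine_det_nonzero: "\<xi> \<in> S \<Longrightarrow> sine_det \<tau> ix \<xi> \<noteq> 0"
  using fredholm_series_nonzero by (simp add: admissible_iff sine_det_eq)

lemma sine_det_has_derivative:
  assumes \<xi>: "\<xi> \<in> S"
  shows "(sine_det \<tau> ix has_derivative (\<lambda>h. sine_det \<tau> ix \<xi> * (\<Sum>e\<in>UNIV. sg e * mat_r \<tau> ix \<xi> $ e $ e * h $ e))) (at \<xi>)"
proof -
  have o: "ordered_endpoints ix \<xi>" "\<xi> \<in> Inv" using \<xi> by (auto simp: admissible_iff)
  show ?thesis
    by (rule has_derivative_admissible[OF \<xi>, where f = "\<lambda>\<eta>. F.fredholm_series (wt \<eta>)"])
      (use fredholm_series_has_derivative[OF o] in \<open>simp_all add: admissible_iff sine_det_eq o(1) mat_r_nth[OF \<xi>] mult_ac\<close>)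
qed

lemma ln_sine_det_deriv:
  assumes \<xi>: "\<xi> \<in> S"
  shows "((\<lambda>t. ln \<bar>sine_det \<tau> ix (\<xi> + t *\<^sub>R axis e 1)\<bar>) has_real_derivative sg e * mat_r \<tau> ix \<xi> $ e $ e) (at 0)"
proof -
  let ?g = "\<lambda>t. sine_det \<tau> ix (\<xi> + t *\<^sub>R axis e 1)"
  have nz: "sine_det \<tau> ix \<xi> \<noteq> 0" by (rule sine_det_nonzero[OF \<xi>])
  have line: "((\<lambda>t. \<xi> + t *\<^sub>R axis e 1) has_derivative (\<lambda>t. t *\<^sub>R axis e 1)) (at 0)"
    by (auto intro!: derivative_eq_intros)
  have "(sine_det \<tau> ix has_derivative (\<lambda>h. sine_det \<tau> ix \<xi> * (\<Sum>e\<in>UNIV. sg e * mat_r \<tau> ix \<xi> $ e $ e * h $ e))) (at (\<xi> + 0 *\<^sub>R axis e 1))"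
    using sine_det_has_derivative[OF \<xi>] by simp
  from has_derivative_compose[OF line this]
  have "(?g has_derivative (\<lambda>t. sine_det \<tau> ix \<xi> * (\<Sum>b\<in>UNIV. sg b * mat_r \<tau> ix \<xi> $ b $ b * (t *\<^sub>R axis e 1) $ b))) (at 0)" .
  moreover have "(\<Sum>b\<in>UNIV. sg b * mat_r \<tau> ix \<xi> $ b $ b * (t *\<^sub>R axis e 1) $ b) = sg e * mat_r \<tau> ix \<xi> $ e $ e * t" for t
  proof -
    have "(\<Sum>b\<in>UNIV. sg b * mat_r \<tau> ix \<xi> $ b $ b * (t *\<^sub>R axis e 1) $ b) = (\<Sum>b\<in>UNIV. if b = e then sg e * mat_r \<tau> ix \<xi> $ e $ e * t else 0)"
      by (intro sum.cong) (auto simp: axis_def)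
    then show ?thesis by simp
  qed
  ultimately have g: "(?g has_real_derivative sine_det \<tau> ix \<xi> * (sg e * mat_r \<tau> ix \<xi> $ e $ e)) (at 0)"
    by (simp add: has_field_derivative_def mult.assoc[symmetric])
  \<comment> \<open>The logarithm of the absolute value is written as half the logarithm of the
    square, which treats both signs of the determinant at once.\<close>
  have "((\<lambda>t. (?g t)\<^sup>2) has_real_derivative 2 * (?g 0) * (sine_det \<tau> ix \<xi> * (sg e * mat_r \<tau> ix \<xi> $ e $ e))) (at 0)"
    using DERIV_power[OF g, of 2] by (simp add: mult_ac)
  from DERIV_chain2[OF DERIV_ln this]
  have "((\<lambda>t. ln ((?g t)\<^sup>2)) has_real_derivative
      inverse ((?g 0)\<^sup>2) * (2 * (?g 0) * (sine_det \<tau> ix \<xi> * (sg e * mat_r \<tau> ix \<xi> $ e $ e)))) (at 0)"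
    using nz by simp
  from DERIV_cdivide[OF this, of 2]
  have "((\<lambda>t. ln ((?g t)\<^sup>2) / 2) has_real_derivative sg e * mat_r \<tau> ix \<xi> $ e $ e) (at 0)"
    using nz by (simp add: power2_eq_square mult.assoc[symmetric])
  moreover have "ln (x\<^sup>2) / 2 = ln \<bar>x\<bar>" for x :: real
    using ln_realpow[of "\<bar>x\<bar>" 2] by (cases "x = 0") auto
  ultimately show ?thesis by simp
qed

text \<open>Integrating factor: the determinant times exp(-f) has derivative 0 on a connected open
  set.\<close>

lemma sine_det_determined:
  assumes C: "open C" "connected C" "C \<subseteq> S"
    and f: "\<And>\<xi>. \<xi> \<in> C \<Longrightarrow> (f has_derivative (\<lambda>h. \<Sum>e\<in>UNIV. sg e * mat_r \<tau> ix \<xi> $ e $ e * h $ e)) (at \<xi>)"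
    and \<xi>: "\<xi> \<in> C" "\<eta> \<in> C"
  shows "sine_det \<tau> ix \<eta> = sine_det \<tau> ix \<xi> * exp (f \<eta> - f \<xi>)"
proof -
  let ?g = "\<lambda>\<eta>. sine_det \<tau> ix \<eta> * exp (- f \<eta>)"
  have "(?g has_derivative (\<lambda>h. 0)) (at z)" if "z \<in> C" for z
  proof -
    have zS: "z \<in> S" using that C by auto
    show ?thesis
      by (auto intro!: derivative_eq_intros sine_det_has_derivative[OF zS] f[OF that] simp: algebra_simps)
  qed
  then have "?g \<eta> = ?g \<xi>"
    using has_derivative_zero_unique_connected[OF C(1,2) _ \<xi>(2,1), of ?g] by simp
  then show ?thesis by (simp add: exp_minus exp_diff field_simps)
qed

section \<open>Algebraic expressions for the entries of r_x and r_y\<close>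

text \<open>
  Right-hand sides of \<open>kerR_sum_deriv\<close>, \<open>kerRx_off_block\<close> and \<open>kerRx_same_block\<close> at end-points, as
  polynomials in the variables. In \<open>same_rx\<close> the coefficient of \<open>off_rx v e b\<close> vanishes if \<open>b\<close> lies in
  the block of \<open>e\<close>, where \<open>off_rx\<close> has the junk value \<open>0\<close>.
\<close>

definition sd :: "('m, 'e) sine_vars \<Rightarrow> 'e \<Rightarrow> 'e \<Rightarrow> real" where
  "sd v e e' = (\<Sum>b\<in>UNIV. sg b * fst v $ e $ b * fst v $ b $ e')"

definition off_rx :: "('m, 'e) sine_vars \<Rightarrow> 'e \<Rightarrow> 'e \<Rightarrow> real" where
  "off_rx v e e' = (case v of (r, q, qt, p, pt, x) \<Rightarrow>
    ((x $ e - x $ e') * r $ e $ e'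
      + 2 * (\<Sum>b\<in>UNIV. sg b * (\<tau> (blk b) - \<tau> (blk e')) * r $ e $ b * r $ b $ e')
      - (\<Sum>k\<in>UNIV. \<Sum>a\<in>UNIV. exp (\<tau> a - \<tau> k) * (pt $ k $ e' * q $ e $ a - qt $ k $ e' * p $ e $ a)))
    * (1 / (2 * (\<tau> (blk e) - \<tau> (blk e')))))"

definition same_rx :: "('m, 'e) sine_vars \<Rightarrow> 'e \<Rightarrow> 'e \<Rightarrow> real" where
  "same_rx v e e' = (case v of (r, q, qt, p, pt, x) \<Rightarrow>
    - r $ e $ e'
    + 2 * (\<Sum>b\<in>UNIV. sg b * (\<tau> (blk e) - \<tau> (blk b)) * off_rx v e b * r $ b $ e')
    + (\<Sum>k\<in>UNIV. \<Sum>a\<in>UNIV. exp (\<tau> a - \<tau> k) *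
        (pt $ k $ e' * (p $ e $ a + (\<Sum>b\<in>UNIV. r $ e $ b * sg b * q $ b $ a))
       - qt $ k $ e' * (- q $ e $ a + (\<Sum>b\<in>UNIV. r $ e $ b * sg b * p $ b $ a)))))"

text \<open>On the diagonal only the sum of r_x and r_y is prescribed; \<open>alg_rx\<close> takes
  all of it, and \<open>alg_ry\<close> is 0 there.\<close>

definition alg_rx :: "('m, 'e) sine_vars \<Rightarrow> real^'e^'e" where
  "alg_rx v = (\<chi> e e'. if e = e' then sd v e e'
    else if blk e \<noteq> blk e' then off_rx v e e'
    else same_rx v e e' / (snd (snd (snd (snd (snd v)))) $ e - snd (snd (snd (snd (snd v)))) $ e'))"

definition alg_ry :: "('m, 'e) sine_vars \<Rightarrow> real^'e^'e" where
  "alg_ry v = (\<chi> e e'. if e = e' then 0 else sd v e e' - alg_rx v $ e $ e')"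

lemmas polynomial_intros = real_polynomial_function_sine_vars real_polynomial_function.intros(2-4) real_polynomial_function_sum real_polynomial_function_diff real_polynomial_function_minus

lemma polynomial_sd: "real_polynomial_function (\<lambda>v. sd v e e')"
  unfolding sd_def by (intro polynomial_intros) auto

lemma polynomial_off_rx: "real_polynomial_function (\<lambda>v. off_rx v e e')"
  unfolding off_rx_def split_beta by (intro polynomial_intros) auto

lemma polynomial_same_rx: "real_polynomial_function (\<lambda>v. same_rx v e e')"
  unfolding same_rx_def split_beta by (intro polynomial_intros polynomial_off_rx) auto

lemma endpoints_distinct:
  assumes ord: "ordered_endpoints ix \<xi>" and ne: "e \<noteq> e'" and blk: "blk e = blk e'"
  shows "\<xi> $ e \<noteq> \<xi> $ e'"
proof -
  have "inj ix" using ix by (simp add: endpoint_indexing_def bij_betw_def)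
  then have "snd (ix e) \<noteq> snd (ix e')" using ne blk by (metis injD prod_eqI)
  then consider "snd (ix e) < snd (ix e')" | "snd (ix e') < snd (ix e)" by linarith
  then show ?thesis
  proof cases
    case 1
    then have "\<xi> $ e < \<xi> $ e'" using ord blk by (simp add: ordered_endpoints_def)
    then show ?thesis by simp
  next
    case 2
    then have "\<xi> $ e' < \<xi> $ e" using ord blk by (simp add: ordered_endpoints_def)
    then show ?thesis by simp
  qed
qed

lemma rational_alg:
  shows "rational_on (sine_data \<tau> ix ` S) (\<lambda>v. alg_rx v $ e $ e')" (is ?A)
    and "rational_on (sine_data \<tau> ix ` S) (\<lambda>v. alg_ry v $ e $ e')" (is ?B)
proof -
  note [intro!] = polynomial_sd polynomial_off_rx polynomial_same_rx
  consider "e = e'" | "e \<noteq> e'" "blk e \<noteq> blk e'" | "e \<noteq> e'" "blk e = blk e'" by blast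
  then have "?A \<and> ?B"
  proof cases
    case 1
    then show ?thesis by (auto simp: alg_rx_def alg_ry_def intro!: rational_on_polynomial)
  next
    case 2
    then show ?thesis
      by (auto simp: alg_rx_def alg_ry_def intro!: rational_on_polynomial real_polynomial_function_diff)
  next
    case 3
    \<comment> \<open>Inside a block the denominator is the difference of two end-points, nonzero on
      all of \<open>S\<close> by their order.\<close>
    let ?D = "\<lambda>v::('m, 'e) sine_vars. snd (snd (snd (snd (snd v)))) $ e - snd (snd (snd (snd (snd v)))) $ e'"
    have D: "real_polynomial_function ?D" by (intro polynomial_intros)
    have D0: "?D v \<noteq> 0" if "v \<in> sine_data \<tau> ix ` S" for v
      using that endpoints_distinct[OF _ 3] by (auto simp: sine_data_def admissible_iff)
    \<comment> \<open>A point where the denominator is nonzero: the end-point coordinates form a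
      unit vector, all other variables are 0.\<close>
    have "?D (0, 0, 0, 0, 0, axis e 1) \<noteq> 0" using 3 by (simp add: axis_def)
    then have D1: "\<exists>v. ?D v \<noteq> 0" by blast
    have A: ?A unfolding rational_on_def
      by (rule exI[of _ "\<lambda>v. same_rx v e e'"], rule exI[of _ ?D]) (use 3 D D0 D1 in \<open>auto simp: alg_rx_def\<close>)
    have "real_polynomial_function (\<lambda>v. sd v e e' * ?D v - same_rx v e e')"
      by (intro real_polynomial_function_diff real_polynomial_function.intros(4) polynomial_sd D polynomial_same_rx)
    moreover have "alg_ry v $ e $ e' = (sd v e e' * ?D v - same_rx v e e') / ?D v" if "?D v \<noteq> 0" for v
      using that 3 by (simp add: alg_rx_def alg_ry_def field_simps)
    ultimately have ?B unfolding rational_on_def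
      by (intro exI[of _ "\<lambda>v. sd v e e' * ?D v - same_rx v e e'"] exI[of _ ?D]) (use D D0 D1 in auto)
    with A show ?thesis ..
  qed
  then show ?A ?B by auto
qed

lemma \<tau>_blk: "\<tau> i = \<tau> j \<longleftrightarrow> i = j"
  using strict_mono_eq[OF \<tau>] .

lemma off_rx_eq:
  assumes \<xi>: "\<xi> \<in> S" and ne: "blk e \<noteq> blk e'"
  shows "off_rx (sine_data \<tau> ix \<xi>) e e' = mat_rx \<tau> ix \<xi> $ e $ e'"
proof -
  have o: "ordered_endpoints ix \<xi>" "\<xi> \<in> Inv" using \<xi> by (auto simp: admissible_iff)
  have ne: "\<tau> (blk e) \<noteq> \<tau> (blk e')" using ne by (simp add: \<tau>_blk)
  show ?thesis
    unfolding mat_rx_nth[OF \<xi>] kerRx_off_block[OF o(2,1) ne]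
    by (simp add: off_rx_def sine_data_def mat_r_nth[OF \<xi>] mat_right_nth[OF \<xi>]
        mat_left_nth[OF \<xi> sin_cos_bounded(1,2)] mat_left_nth[OF \<xi> sin_cos_bounded(3,4)])
qed

lemma same_rx_eq:
  assumes \<xi>: "\<xi> \<in> S" and blk: "blk e = blk e'"
  shows "same_rx (sine_data \<tau> ix \<xi>) e e' = (\<xi> $ e - \<xi> $ e') * mat_rx \<tau> ix \<xi> $ e $ e'"
proof -
  have o: "ordered_endpoints ix \<xi>" "\<xi> \<in> Inv" using \<xi> by (auto simp: admissible_iff)
  have "(\<Sum>b\<in>UNIV. sg b * (\<tau> (blk e) - \<tau> (blk b)) * off_rx (sine_data \<tau> ix \<xi>) e b * mat_r \<tau> ix \<xi> $ b $ e') =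
      (\<Sum>b\<in>UNIV. sg b * (\<tau> (blk e) - \<tau> (blk b)) * mat_rx \<tau> ix \<xi> $ e $ b * mat_r \<tau> ix \<xi> $ b $ e')"
  proof (rule sum.cong[OF refl])
    fix b
    show "sg b * (\<tau> (blk e) - \<tau> (blk b)) * off_rx (sine_data \<tau> ix \<xi>) e b * mat_r \<tau> ix \<xi> $ b $ e' =
      sg b * (\<tau> (blk e) - \<tau> (blk b)) * mat_rx \<tau> ix \<xi> $ e $ b * mat_r \<tau> ix \<xi> $ b $ e'"
      by (cases "blk e = blk b") (simp_all add: off_rx_eq[OF \<xi>])
  qed
  then show ?thesis
    using kerRx_same_block[OF o(2,1), of "\<xi> $ e" "\<xi> $ e'" "blk e"]
    by (simp add: same_rx_def sine_data_def mat_r_nth[OF \<xi>] mat_rx_nth[OF \<xi>] mat_right_nth[OF \<xi>] blk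
        mat_left_nth[OF \<xi> sin_cos_bounded(1,2)] mat_left_nth[OF \<xi> sin_cos_bounded(3,4)])
qed

lemma sd_eq:
  assumes \<xi>: "\<xi> \<in> S"
  shows "sd (sine_data \<tau> ix \<xi>) e e' = mat_rx \<tau> ix \<xi> $ e $ e' + mat_ry \<tau> ix \<xi> $ e $ e'"
  using kerR_sum_deriv[of \<xi> "blk e" "blk e'" "\<xi> $ e" "\<xi> $ e'"] \<xi>
  by (simp add: sd_def sine_data_def mat_r_nth[OF \<xi>] mat_rx_nth[OF \<xi>] mat_ry_nth[OF \<xi>] admissible_iff)

lemma alg_eq:
  assumes \<xi>: "\<xi> \<in> S"
  shows "e \<noteq> e' \<Longrightarrow> alg_rx (sine_data \<tau> ix \<xi>) $ e $ e' = mat_rx \<tau> ix \<xi> $ e $ e'"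
    and "e \<noteq> e' \<Longrightarrow> alg_ry (sine_data \<tau> ix \<xi>) $ e $ e' = mat_ry \<tau> ix \<xi> $ e $ e'"
    and "(alg_rx (sine_data \<tau> ix \<xi>) + alg_ry (sine_data \<tau> ix \<xi>)) $ e $ e = (mat_rx \<tau> ix \<xi> + mat_ry \<tau> ix \<xi>) $ e $ e"
proof -
  show x: "alg_rx (sine_data \<tau> ix \<xi>) $ e $ e' = mat_rx \<tau> ix \<xi> $ e $ e'" if "e \<noteq> e'"
  proof (cases "blk e = blk e'")
    case True
    have "\<xi> $ e - \<xi> $ e' \<noteq> 0" using endpoints_distinct[OF _ that True] \<xi> by (simp add: admissible_iff)
    moreover have "snd (snd (snd (snd (snd (sine_data \<tau> ix \<xi>))))) = \<xi>" by (simp add: sine_data_def)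
    ultimately show ?thesis using that True by (simp add: alg_rx_def same_rx_eq[OF \<xi> True])
  qed (use that in \<open>simp add: alg_rx_def off_rx_eq[OF \<xi>]\<close>)
  show "alg_ry (sine_data \<tau> ix \<xi>) $ e $ e' = mat_ry \<tau> ix \<xi> $ e $ e'" if "e \<noteq> e'"
    using x[OF that] that by (simp add: alg_ry_def sd_eq[OF \<xi>])
  show "(alg_rx (sine_data \<tau> ix \<xi>) + alg_ry (sine_data \<tau> ix \<xi>)) $ e $ e = (mat_rx \<tau> ix \<xi> + mat_ry \<tau> ix \<xi>) $ e $ e"
    by (simp add: alg_rx_def alg_ry_def sd_eq[OF \<xi>])
qed

end

theorem mainTheorem3:
  fixes \<tau> :: "'m::{finite,linorder} \<Rightarrow> real"
    and n :: "'m \<Rightarrow> nat"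
    and ix :: "'e::finite \<Rightarrow> 'm \<times> nat"
  assumes tau: "strict_mono \<tau>"
    and ix: "endpoint_indexing n ix"
  defines "S \<equiv> admissible \<tau> ix"
    and "r \<equiv> mat_r \<tau> ix" and "rx \<equiv> mat_rx \<tau> ix" and "ry \<equiv> mat_ry \<tau> ix"
    and "q \<equiv> mat_q \<tau> ix" and "qt \<equiv> mat_qt \<tau> ix"
    and "p \<equiv> mat_p \<tau> ix" and "pt \<equiv> mat_pt \<tau> ix"
    and "s \<equiv> sign_mat ix" and "dxi \<equiv> signed_diff ix" and "dhat \<equiv> diag_mat"
    and "vars \<equiv> sine_data \<tau> ix"
  shows
    \<comment> \<open>logarithmic derivatives; \<open>ln \<bar>det\<bar>\<close> because the real number \<open>det\<close> may be negative\<close>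
    "(\<forall>\<xi>\<in>S. sine_det \<tau> ix \<xi> \<noteq> 0 \<and>
        (\<forall>e. ((\<lambda>t. ln \<bar>sine_det \<tau> ix (\<xi> + t *\<^sub>R axis e 1)\<bar>) has_real_derivative
               (-1) ^ (snd (ix e) + 1) * r \<xi> $ e $ e) (at 0)))
     \<and> (\<forall>\<xi>\<in>S.
         (r has_derivative dr_rhs ix (r \<xi>) (rx \<xi>) (ry \<xi>)) (at \<xi>) \<and>
         (q has_derivative
           (\<lambda>h. dhat h ** (p \<xi> + r \<xi> ** s ** q \<xi>) - r \<xi> ** dxi h ** q \<xi>)) (at \<xi>) \<and>
         (qt has_derivative
           (\<lambda>h. (pt \<xi> + qt \<xi> ** s ** r \<xi>) ** dhat h - qt \<xi> ** dxi h ** r \<xi>)) (at \<xi>) \<and>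
         (p has_derivative
           (\<lambda>h. dhat h ** (- q \<xi> + r \<xi> ** s ** p \<xi>) - r \<xi> ** dxi h ** p \<xi>)) (at \<xi>) \<and>
         (pt has_derivative
           (\<lambda>h. (- qt \<xi> + pt \<xi> ** s ** r \<xi>) ** dhat h - pt \<xi> ** dxi h ** r \<xi>)) (at \<xi>))
     \<comment> \<open>only these entries of \<open>r\<^sub>x\<close> and \<open>r\<^sub>y\<close> matter\<close>
     \<and> (\<forall>M A B A' B'.
         (\<forall>e. (A + B) $ e $ e = (A' + B') $ e $ e) \<and>
         (\<forall>e e'. e \<noteq> e' \<longrightarrow> A $ e $ e' = A' $ e $ e' \<and> B $ e $ e' = B' $ e $ e') \<longrightarrow>
         dr_rhs ix M A B = dr_rhs ix M A' B')
     \<and> (\<forall>e. algebraic_in vars S (\<lambda>\<xi>. (rx \<xi> + ry \<xi>) $ e $ e))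
     \<and> (\<forall>e e'. e \<noteq> e' \<longrightarrow>
         algebraic_in vars S (\<lambda>\<xi>. rx \<xi> $ e $ e') \<and> algebraic_in vars S (\<lambda>\<xi>. ry \<xi> $ e $ e'))
     \<comment> \<open>closed system\<close>
     \<and> (\<exists>A B. (\<forall>e e'. rational_on (vars ` S) (\<lambda>v. A v $ e $ e') \<and>
                     rational_on (vars ` S) (\<lambda>v. B v $ e $ e')) \<and>
              (\<forall>\<xi>\<in>S. (r has_derivative dr_rhs ix (r \<xi>) (A (vars \<xi>)) (B (vars \<xi>))) (at \<xi>)))
     \<comment> \<open>\<open>r\<close> determines the determinant up to a constant factor\<close>
     \<and> (\<forall>C f. open C \<and> connected C \<and> C \<subseteq> S \<and>
           (\<forall>\<xi>\<in>C. (f has_derivative (\<lambda>h. \<Sum>e\<in>UNIV. (-1) ^ (snd (ix e) + 1) * r \<xi> $ e $ e * h $ e))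
                      (at \<xi>)) \<longrightarrow>
           (\<forall>\<xi>\<in>C. \<forall>\<eta>\<in>C. sine_det \<tau> ix \<eta> = sine_det \<tau> ix \<xi> * exp (f \<eta> - f \<xi>)))"
proof -
  interpret sine_setting \<tau> n ix by unfold_locales (rule tau ix)+
  have sg: "(-1) ^ (snd (ix e) + 1) = endpoint_sign ix e" for e by (simp add: endpoint_sign_def)
  note defs = S_def r_def rx_def ry_def q_def qt_def p_def pt_def s_def dxi_def dhat_def vars_def
  \<comment> \<open>One lemma serves both equations: sin' = cos puts \<open>p\<close> into the
    equation of \<open>q\<close>, and cos' = - sin puts \<open>- q\<close> into that of
    \<open>p\<close>.\<close>
  have right: "(q has_derivative (\<lambda>h. dhat h ** (p \<xi> + r \<xi> ** s ** q \<xi>) - r \<xi> ** dxi h ** q \<xi>)) (at \<xi>)"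
    "(p has_derivative (\<lambda>h. dhat h ** (- q \<xi> + r \<xi> ** s ** p \<xi>) - r \<xi> ** dxi h ** p \<xi>)) (at \<xi>)"
    if "\<xi> \<in> S" for \<xi>
    using that unfolding defs
    by (rule mat_right_has_derivative[OF _ sin_cos_bounded(1-4) DERIV_sin],
        subst mat_minus_sin(1)[symmetric, OF that[unfolded S_def]], rule mat_right_has_derivative[OF _ sin_cos_bounded(3-6) DERIV_cos])
  have left: "(qt has_derivative (\<lambda>h. (pt \<xi> + qt \<xi> ** s ** r \<xi>) ** dhat h - qt \<xi> ** dxi h ** r \<xi>)) (at \<xi>)"
    "(pt has_derivative (\<lambda>h. (- qt \<xi> + pt \<xi> ** s ** r \<xi>) ** dhat h - pt \<xi> ** dxi h ** r \<xi>)) (at \<xi>)"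
    if "\<xi> \<in> S" for \<xi>
    using that unfolding defs
    by (rule mat_left_has_derivative[OF _ sin_cos_bounded(1-4) DERIV_sin],
        subst mat_minus_sin(2)[symmetric, OF that[unfolded S_def]], rule mat_left_has_derivative[OF _ sin_cos_bounded(3-6) DERIV_cos])
  have alg: "algebraic_in vars S (\<lambda>\<xi>. (rx \<xi> + ry \<xi>) $ e $ e)"
    "e \<noteq> e' \<Longrightarrow> algebraic_in vars S (\<lambda>\<xi>. rx \<xi> $ e $ e')" "e \<noteq> e' \<Longrightarrow> algebraic_in vars S (\<lambda>\<xi>. ry \<xi> $ e $ e')" for e e'
    unfolding defs algebraic_in_def
    using rational_alg rational_on_polynomial[OF polynomial_sd]
    by (intro exI[of _ "\<lambda>v. sd v e e"] exI[of _ "\<lambda>v. alg_rx v $ e $ e'"] exI[of _ "\<lambda>v. alg_ry v $ e $ e'"]; simp add: alg_eq sd_eq)+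
  have closed: "(r has_derivative dr_rhs ix (r \<xi>) (alg_rx (vars \<xi>)) (alg_ry (vars \<xi>))) (at \<xi>)" if "\<xi> \<in> S" for \<xi>
  proof -
    \<comment> \<open>On the diagonal the algebraic matrices agree with r_x and r_y only in their
      sum, which is all that the right-hand side sees.\<close>
    have "dr_rhs ix (r \<xi>) (alg_rx (vars \<xi>)) (alg_ry (vars \<xi>)) = dr_rhs ix (r \<xi>) (rx \<xi>) (ry \<xi>)"
      using that unfolding defs by (intro dr_rhs_cong conjI alg_eq)
    then show ?thesis using mat_r_has_derivative that unfolding defs by simp
  qed
  show ?thesis
    unfolding sg
  proof (intro conjI ballI allI impI)
    fix \<xi> e assume "\<xi> \<in> S"
    then have \<xi>: "\<xi> \<in> admissible \<tau> ix" by (simp add: S_def)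
    show "sine_det \<tau> ix \<xi> \<noteq> 0" by (rule sine_det_nonzero[OF \<xi>])
    show "((\<lambda>t. ln \<bar>sine_det \<tau> ix (\<xi> + t *\<^sub>R axis e 1)\<bar>) has_real_derivative endpoint_sign ix e * r \<xi> $ e $ e) (at 0)"
      unfolding r_def by (rule ln_sine_det_deriv[OF \<xi>])
    show "(r has_derivative dr_rhs ix (r \<xi>) (rx \<xi>) (ry \<xi>)) (at \<xi>)"
      unfolding defs by (rule mat_r_has_derivative[OF \<xi>])
  next
    show "\<exists>A B. (\<forall>e e'. rational_on (vars ` S) (\<lambda>v. A v $ e $ e') \<and> rational_on (vars ` S) (\<lambda>v. B v $ e $ e')) \<and>
        (\<forall>\<xi>\<in>S. (r has_derivative dr_rhs ix (r \<xi>) (A (vars \<xi>)) (B (vars \<xi>))) (at \<xi>))"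
      using rational_alg closed unfolding S_def vars_def by blast
  next
    fix C f \<xi> \<eta>
    assume C: "open C \<and> connected C \<and> C \<subseteq> S \<and>
      (\<forall>\<xi>\<in>C. (f has_derivative (\<lambda>h. \<Sum>e\<in>UNIV. endpoint_sign ix e * r \<xi> $ e $ e * h $ e)) (at \<xi>))"
    assume "\<xi> \<in> C" "\<eta> \<in> C"
    then show "sine_det \<tau> ix \<eta> = sine_det \<tau> ix \<xi> * exp (f \<eta> - f \<xi>)"
      by (intro sine_det_determined[of C f]) (use C in \<open>auto simp: S_def r_def\<close>)
  qed ((rule right left alg; assumption) | (rule dr_rhs_cong; blast))+
qed

end
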